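(* Let $a:\mathbb R^d\to\mathbb R$ satisfy $a\in L^1(\mathbb R^d)$, $a\ge 0$, $\hat a\in L^2(\mathbb T^d)$, $\int_{\mathbb R^d}a(z)\,dz=a_1>0$ and $\int_{\mathbb R^d}|z|^2a(z)\,dz<\infty$. Let $\mu:\mathbb R^d\times\mathbb R^d\to\mathbb R$ be measurable, $\mathbb Z^d$-periodic in each of its two variables, and satisfy $0<\alpha_1\le\mu(x,y)\le\alpha_2<\infty$ for some constants $\alpha_1,\alpha_2$. Then there exist a vector $b\in\mathbb R^d$ and a positive definite constant matrix $\Theta=(\Theta^{ij})$ such that for every $\varphi\in L^2(\mathbb R^d)$ the following holds. For $\varepsilon>0$ let $u^\varepsilon(x,t)$ be the solution of $$\frac{\partial u^\varepsilon}{\partial t}=L^\varepsilon u^\varepsilon,\qquad u^\varepsilon(x,0)=\varphi(x),$$ and let $u^0(x,t)$ be the solution of $$\frac{\partial u^0}{\partial t}=\Theta\cdot\nabla\nabla u^0,\qquad u^0(x,0)=\varphi(x).$$ Then for any $T>0$ $$\Big\|u^\varepsilon\Big(x+\frac b\varepsilon t,\,t\Big)-u^0(x,t)\Big\|_{L^\infty((0,T),\,L^2(\mathbb R^d))}\to0\quad\text{as }\varepsilon\to0 .$$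
   Context: $\mathbb T^d=\mathbb R^d/\mathbb Z^d$; $\mathbb Z^d$-periodic functions on $\mathbb R^d$ are identified with functions on $\mathbb T^d$. For a non-negative function $a\in L^1(\mathbb R^d)$, $\hat a$ denotes its periodization $\hat a(\eta)=\sum_{k\in\mathbb Z^d}a(\eta+k)$, $\eta\in\mathbb T^d$. For $\varepsilon>0$, a non-negative function $a\in L^1(\mathbb R^d)$ and a measurable function $\mu$ on $\mathbb R^d\times\mathbb R^d$, $\mathbb Z^d$-periodic in each variable and bounded between two positive constants, the (bounded, not necessarily symmetric) operator $L^\varepsilon$ in $L^2(\mathbb R^d)$ is $$(L^\varepsilon u)(x)=\frac1{\varepsilon^{d+2}}\int_{\mathbb R^d}a\Big(\frac{x-y}\varepsilon\Big)\mu\Big(\frac x\varepsilon,\frac y\varepsilon\Big)\big(u(y)-u(x)\big)\,dy .$$ $\Theta\cdot\nabla\nabla u=\sum_{i,j}\Theta^{ij}\partial_{x^i}\partial_{x^j}u$. A real matrix $\Theta$ (not necessarily symmetric) is called positive definite if $\Theta r\cdot r>0$ for all $r\in\mathbb R^d\setminus\{0\}$. *)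

theory Defs
  imports "HOL-Analysis.Analysis" "HOL-Probability.Essential_Supremum"
begin

definition integer_lattice :: "(real ^ 'n) set" where
  "integer_lattice = {k. \<forall>i. k $ i \<in> \<int>}"

text \<open>The torus is represented by its half-open fundamental cell, with Lebesgue measure.\<close>

definition unit_cell :: "(real ^ 'n) set" where
  "unit_cell = {x. \<forall>i. 0 \<le> x $ i \<and> x $ i < 1}"

text \<open>For a nonnegative function the periodization is taken in the extended reals, because for
  an integrable function the series need only converge almost everywhere.\<close>

definition periodization :: "(real ^ 'n \<Rightarrow> real) \<Rightarrow> real ^ 'n \<Rightarrow> ennreal" where
  "periodization a \<eta> = (\<Sum>\<^sub>\<infinity>k\<in>integer_lattice. ennreal (a (\<eta> + k)))"

text \<open>Elements of $L^2$ are represented by functions; equality in $L^2$ is equality almost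
  everywhere. The value of \<open>L2_norm\<close> is meaningful only for functions in \<open>L2_space\<close>.\<close>

definition L2_space :: "(real ^ 'n \<Rightarrow> real) set" where
  "L2_space = {f. f \<in> borel_measurable lebesgue \<and> integrable lebesgue (\<lambda>x. (f x)\<^sup>2)}"

definition L2_norm :: "(real ^ 'n \<Rightarrow> real) \<Rightarrow> real" where
  "L2_norm f = sqrt (LINT x|lebesgue. (f x)\<^sup>2)"

definition Linf_L2_norm :: "real \<Rightarrow> (real \<Rightarrow> real ^ 'n \<Rightarrow> real) \<Rightarrow> ereal" where
  "Linf_L2_norm T w =
     esssup (restrict_space lebesgue {0<..<T}) (\<lambda>t. ereal (L2_norm (w t)))"

definition partial_deriv :: "'n \<Rightarrow> (real ^ 'n \<Rightarrow> real) \<Rightarrow> real ^ 'n \<Rightarrow> real" where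
  "partial_deriv i f x = frechet_derivative f (at x) (axis i 1)"

fun continuously_differentiable :: "nat \<Rightarrow> (real ^ 'n \<Rightarrow> real) \<Rightarrow> bool" where
  "continuously_differentiable 0 f = continuous_on UNIV f"
| "continuously_differentiable (Suc k) f =
     ((\<forall>x. f differentiable (at x)) \<and> (\<forall>i. continuously_differentiable k (partial_deriv i f)))"

definition test_function :: "(real ^ 'n \<Rightarrow> real) \<Rightarrow> bool" where
  "test_function \<psi> \<longleftrightarrow>
     (\<forall>k. continuously_differentiable k \<psi>) \<and> compact (closure {x. \<psi> x \<noteq> 0})"

definition weak_partial_deriv ::
  "'n \<Rightarrow> (real ^ 'n \<Rightarrow> real) \<Rightarrow> (real ^ 'n \<Rightarrow> real) \<Rightarrow> bool" where
  "weak_partial_deriv i f g \<longleftrightarrow>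
     (\<forall>\<psi>. test_function \<psi> \<longrightarrow>
        (LINT x|lebesgue. f x * partial_deriv i \<psi> x) = - (LINT x|lebesgue. g x * \<psi> x))"

definition has_L2_derivative ::
  "(real \<Rightarrow> real ^ 'n \<Rightarrow> real) \<Rightarrow> (real ^ 'n \<Rightarrow> real) \<Rightarrow> real \<Rightarrow> bool" where
  "has_L2_derivative u v t \<longleftrightarrow> v \<in> L2_space \<and>
     ((\<lambda>s. L2_norm (\<lambda>x. (u s x - u t x) / (s - t) - v x)) \<longlongrightarrow> 0) (at t)"

text \<open>A possibly unbounded operator on $L^2$ is given by its graph \<open>A\<close>. The solution of
  $u' = A u$, $u(0) = \varphi$ is the classical one: it lies in $C([0,\infty), L^2)$, and for every
  $t > 0$ it is differentiable in $L^2$ and lies in the domain of \<open>A\<close>. Only the values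
  \<open>u t\<close> with \<open>t \<ge> 0\<close> matter.\<close>

definition solves_cauchy_problem ::
  "((real ^ 'n \<Rightarrow> real) \<Rightarrow> (real ^ 'n \<Rightarrow> real) \<Rightarrow> bool) \<Rightarrow> (real ^ 'n \<Rightarrow> real)
     \<Rightarrow> (real \<Rightarrow> real ^ 'n \<Rightarrow> real) \<Rightarrow> bool" where
  "solves_cauchy_problem A \<phi> u \<longleftrightarrow>
     (\<forall>t\<ge>0. u t \<in> L2_space) \<and>
     (\<forall>t\<ge>0. ((\<lambda>s. L2_norm (\<lambda>x. u s x - u t x)) \<longlongrightarrow> 0) (at t within {0..})) \<and>
     (AE x in lebesgue. u 0 x = \<phi> x) \<and>
     (\<forall>t>0. \<exists>v. A (u t) v \<and> has_L2_derivative u v t)"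

definition nonlocal_operator ::
  "(real ^ 'n \<Rightarrow> real) \<Rightarrow> (real ^ 'n \<Rightarrow> real ^ 'n \<Rightarrow> real) \<Rightarrow> real
     \<Rightarrow> (real ^ 'n \<Rightarrow> real) \<Rightarrow> real ^ 'n \<Rightarrow> real" where
  "nonlocal_operator a \<mu> \<epsilon> u x =
     1 / \<epsilon> ^ (CARD('n) + 2) *
     (LINT y|lebesgue. a ((x - y) /\<^sub>R \<epsilon>) * \<mu> (x /\<^sub>R \<epsilon>) (y /\<^sub>R \<epsilon>) * (u y - u x))"

definition positive_definite :: "real ^ 'n ^ 'n \<Rightarrow> bool" where
  "positive_definite \<Theta> \<longleftrightarrow> (\<forall>r. r \<noteq> 0 \<longrightarrow> (\<Theta> *v r) \<bullet> r > 0)"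

text \<open>The graph of $u \mapsto \Theta\cdot\nabla\nabla u$ with domain $H^2$: the functions \<open>G j\<close> are the
  weak first partial derivatives of \<open>f\<close>, and \<open>D i j\<close> is the weak derivative of \<open>G j\<close> in direction
  \<open>i\<close>.\<close>

definition diffusion_graph ::
  "real ^ 'n ^ 'n \<Rightarrow> (real ^ 'n \<Rightarrow> real) \<Rightarrow> (real ^ 'n \<Rightarrow> real) \<Rightarrow> bool" where
  "diffusion_graph \<Theta> f g \<longleftrightarrow> f \<in> L2_space \<and>
     (\<exists>G D. (\<forall>j. G j \<in> L2_space \<and> weak_partial_deriv j f (G j)) \<and>
            (\<forall>i j. D i j \<in> L2_space \<and> weak_partial_deriv i (G j) (D i j)) \<and>
            g = (\<lambda>x. \<Sum>i\<in>UNIV. \<Sum>j\<in>UNIV. \<Theta> $ i $ j * D i j x))"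

end

theory Submission
  imports Defs "HOL-Computational_Algebra.Polynomial"
begin

text \<open>The jump chain on the torus with kernel proportional to \<open>a (x - y) * \<mu> x y\<close> satisfies a
  minorization condition, because the convolution of \<open>a\<close> with itself is bounded below near some point.
  Hence it contracts oscillations geometrically; this yields an invariant density bounded above and
  below, and it solves the cell problems for the two correctors, whose solvability conditions
  determine the drift \<open>b\<close> and the matrix \<open>\<Theta>\<close>.

  In the $L^2$ norm weighted by the invariant density the operator $L^\varepsilon$ is dissipative. The
  limit solution is only square integrable, so the two-scale expansion is applied to its spatial
  mollification: every derivative then falls on the mollifier, and the residual of the expansion in
  the moving frame is a bounded operator on $L^2$ whose norm tends to 0 with \<open>\<epsilon>\<close>. The energy estimate bounds
  the difference between the solution and the expansion, and the mollification error is small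
  uniformly for $t \in [0,T]$ because the limit solution is a continuous path in $L^2$.\<close>

text \<open>The correctors and the density \<open>p0\<close> multiply functions that are merely in
  L2, so they must be bounded, not just square integrable over a cell. Hence they are built inside
  the class \<open>BP\<close> of bounded periodic functions, as uniform limits, and the chain is
  controlled through oscillations rather than by spectral theory. The weight answers the lack of
  symmetry: unweighted, the quadratic form of the operator need not have a sign; weighted by the
  stationary density, gains and losses of the square balance on the whole space. Only second moments
  of \<open>a\<close> are available, so a third-order Taylor bound need not be integrable against
  \<open>a\<close>. It is combined with a quadratic bound and passed to the limit by dominated
  convergence, which makes the residual vanish without a rate. The displacement t/\<epsilon> of the
  moving frame is unbounded as \<epsilon> tends to 0, so all residual bounds are uniform in the
  displacement. The analysis is done for Borel data that satisfy the hypotheses at every point;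
  Lebesgue measurable data and solutions are replaced by such representatives at the end.\<close>

section \<open>Affine changes of variables in Lebesgue measure\<close>

lemma nn_integral_translate:
  fixes f :: "'a::euclidean_space \<Rightarrow> ennreal"
  assumes [measurable]: "f \<in> borel_measurable borel"
  shows "(\<integral>\<^sup>+x. f (x + c) \<partial>lborel) = (\<integral>\<^sup>+x. f x \<partial>lborel)"
    and "(\<integral>\<^sup>+x. f (c + x) \<partial>lborel) = (\<integral>\<^sup>+x. f x \<partial>lborel)"
    and "(\<integral>\<^sup>+x. f (x - c) \<partial>lborel) = (\<integral>\<^sup>+x. f x \<partial>lborel)"
proof -
  have *: "(\<integral>\<^sup>+x. f (c + x) \<partial>lborel) = (\<integral>\<^sup>+x. f x \<partial>lborel)" for c
    by (subst (2) lborel_distr_plus[of c, symmetric]) (simp add: nn_integral_distr)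
  from *[of c] show "(\<integral>\<^sup>+x. f (c + x) \<partial>lborel) = (\<integral>\<^sup>+x. f x \<partial>lborel)"
    and "(\<integral>\<^sup>+x. f (x + c) \<partial>lborel) = (\<integral>\<^sup>+x. f x \<partial>lborel)"
    by (simp_all add: add.commute)
  from *[of "-c"] show "(\<integral>\<^sup>+x. f (x - c) \<partial>lborel) = (\<integral>\<^sup>+x. f x \<partial>lborel)"
    by (simp add: add.commute)
qed

lemma nn_integral_scale:
  fixes f :: "'a::euclidean_space \<Rightarrow> ennreal"
  assumes [measurable]: "f \<in> borel_measurable borel" and c: "c \<noteq> 0"
  shows "(\<integral>\<^sup>+x. f x \<partial>lborel) = ennreal (\<bar>c\<bar> ^ DIM('a)) * (\<integral>\<^sup>+x. f (t + c *\<^sub>R x) \<partial>lborel)"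
  by (subst lborel_affine[OF c, of t])
     (simp add: nn_integral_density nn_integral_distr nn_integral_cmult)

lemma nn_integral_reflect:
  fixes f :: "'a::euclidean_space \<Rightarrow> ennreal"
  assumes [measurable]: "f \<in> borel_measurable borel"
  shows "(\<integral>\<^sup>+x. f (c - x) \<partial>lborel) = (\<integral>\<^sup>+x. f x \<partial>lborel)"
  using nn_integral_scale[of f "-1" c] by simp

lemma lborel_integral_affine:
  fixes f :: "'a::euclidean_space \<Rightarrow> real"
  assumes f[measurable]: "f \<in> borel_measurable borel" and c: "c \<noteq> 0"
  shows "(LINT x|lborel. f x) = \<bar>c\<bar> ^ DIM('a) * (LINT x|lborel. f (t + c *\<^sub>R x))"
  by (subst lborel_affine[OF c, of t]) (simp add: integral_density integral_distr)

lemma lborel_integrable_affine: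
  fixes f :: "'a::euclidean_space \<Rightarrow> real"
  assumes f: "integrable lborel f" and c: "c \<noteq> 0"
  shows "integrable lborel (\<lambda>x. f (t + c *\<^sub>R x))"
proof -
  have [measurable]: "f \<in> borel_measurable borel" using f by auto
  have "(\<integral>\<^sup>+x. norm (f x) \<partial>lborel) < \<infinity>" using f by (simp add: integrable_iff_bounded)
  then show ?thesis using c
    by (subst (asm) nn_integral_scale[OF _ c, of _ t])
       (auto simp: integrable_iff_bounded ennreal_mult_less_top)
qed

lemma lborel_integrable_shift:
  fixes f :: "'a::euclidean_space \<Rightarrow> real"
  assumes "integrable lborel f"
  shows "integrable lborel (\<lambda>x. f (x - c))" "integrable lborel (\<lambda>x. f (c - x))" "integrable lborel (\<lambda>x. f (x + c))"
  using lborel_integrable_affine[OF assms, of 1 "-c"] lborel_integrable_affine[OF assms, of 1 "c"]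
    lborel_integrable_affine[OF assms, of "-1" c] by (simp_all add: algebra_simps)

lemma lborel_integral_shift:
  fixes f :: "'a::euclidean_space \<Rightarrow> real"
  assumes "f \<in> borel_measurable borel"
  shows "(LINT x|lborel. f (x - c)) = (LINT x|lborel. f x)" "(LINT x|lborel. f (c - x)) = (LINT x|lborel. f x)"
   "(LINT x|lborel. f (x + c)) = (LINT x|lborel. f x)"
  using lborel_integral_affine[OF assms, of 1 "-c"] lborel_integral_affine[OF assms, of 1 c] lborel_integral_affine[OF assms, of "-1" c]
  by (simp_all add: algebra_simps)

lemma AE_lborel_affine:
  fixes P :: "'a::euclidean_space \<Rightarrow> bool"
  assumes "AE x in lborel. P x" and c: "c \<noteq> 0"
  shows "AE x in lborel. P (t + c *\<^sub>R x)"
proof -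
  obtain N where N: "\<And>x. x \<in> space lborel - N \<Longrightarrow> P x" "N \<in> null_sets lborel"
    using AE_E3[OF assms(1)] by blast
  have [measurable]: "N \<in> sets borel" using N by auto
  have "(\<integral>\<^sup>+x. indicator N x \<partial>lborel) = 0" using N by (simp add: null_setsD1)
  then have "(\<integral>\<^sup>+x. indicator N (t + c *\<^sub>R x) \<partial>lborel) = 0" using c
    by (subst (asm) nn_integral_scale[OF _ c, of _ t]) auto
  then have "AE x in lborel. indicator N (t + c *\<^sub>R x) = (0::ennreal)"
    by (subst (asm) nn_integral_0_iff_AE) auto
  then show ?thesis by eventually_elim (use N(1) in \<open>auto split: split_indicator_asm\<close>)
qed

subsection \<open>Square integrable Borel functions\<close>

definition bL2 :: "('a::euclidean_space \<Rightarrow> real) set" where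
  "bL2 = {f. f \<in> borel_measurable borel \<and> integrable lborel (\<lambda>x. (f x)\<^sup>2)}"

definition nL2 :: "('a::euclidean_space \<Rightarrow> real) \<Rightarrow> real" where
  "nL2 f = sqrt (LINT x|lborel. (f x)\<^sup>2)"

lemma bL2_measurable: "f \<in> bL2 \<Longrightarrow> f \<in> borel_measurable borel"
  by (simp add: bL2_def)

lemma bL2_integrable: "f \<in> bL2 \<Longrightarrow> integrable lborel (\<lambda>x. (f x)\<^sup>2)"
  by (simp add: bL2_def)

lemma nL2_nonneg [simp]: "nL2 f \<ge> 0"
  by (simp add: nL2_def)

lemma nL2_sq: "(nL2 f)\<^sup>2 = (LINT x|lborel. (f x)\<^sup>2)"
  by (simp add: nL2_def)

lemma nn_integral_nL2:
  assumes "f \<in> bL2" shows "(\<integral>\<^sup>+x. ennreal ((f x)\<^sup>2) \<partial>lborel) = ennreal ((nL2 f)\<^sup>2)"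
  using bL2_integrable[OF assms] by (simp add: nL2_sq nn_integral_eq_integral)

lemma bL2_I:
  assumes [measurable]: "f \<in> borel_measurable borel"
    and le: "(\<integral>\<^sup>+x. ennreal ((f x)\<^sup>2) \<partial>lborel) \<le> ennreal (C\<^sup>2)" and "C \<ge> 0"
  shows "f \<in> bL2" "nL2 f \<le> C"
proof -
  have i: "integrable lborel (\<lambda>x. (f x)\<^sup>2)"
    using le by (auto simp: integrable_iff_bounded intro: le_less_trans)
  then show "f \<in> bL2" by (simp add: bL2_def)
  have "(nL2 f)\<^sup>2 \<le> C\<^sup>2" using le by (simp add: nn_integral_nL2[OF \<open>f \<in> bL2\<close>])
  then show "nL2 f \<le> C" using \<open>C \<ge> 0\<close> by (rule power2_le_imp_le)
qed

lemma bL2_mult_integrable: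
  assumes f: "f \<in> bL2" and g: "g \<in> bL2" shows "integrable lborel (\<lambda>x. f x * g x)"
proof (rule Bochner_Integration.integrable_bound)
  show "integrable lborel (\<lambda>x. (f x)\<^sup>2 + (g x)\<^sup>2)"
    using f g by (intro Bochner_Integration.integrable_add bL2_integrable)
  show "(\<lambda>x. f x * g x) \<in> borel_measurable lborel" using bL2_measurable[OF f] bL2_measurable[OF g] by simp
  have "\<bar>a * b\<bar> \<le> a\<^sup>2 + b\<^sup>2" for a b :: real
  proof -
    have "2 * (\<bar>a\<bar> * \<bar>b\<bar>) \<le> a\<^sup>2 + b\<^sup>2" using sum_squares_bound[of "\<bar>a\<bar>" "\<bar>b\<bar>"] by (simp add: mult.assoc)
    moreover have "0 \<le> \<bar>a\<bar> * \<bar>b\<bar>" by simp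
    ultimately show ?thesis unfolding abs_mult by linarith
  qed
  then show "AE x in lborel. norm (f x * g x) \<le> norm ((f x)\<^sup>2 + (g x)\<^sup>2)" by (simp add: abs_le_iff)
qed

lemma bL2_add: assumes f: "f \<in> bL2" and g: "g \<in> bL2" shows "(\<lambda>x. f x + g x) \<in> bL2"
proof -
  have "integrable lborel (\<lambda>x. (f x)\<^sup>2 + (g x)\<^sup>2 + 2 * (f x * g x))"
    using f g by (intro Bochner_Integration.integrable_add bL2_integrable integrable_mult_right bL2_mult_integrable)
  then have "integrable lborel (\<lambda>x. (f x + g x)\<^sup>2)"
    by (simp add: power2_sum algebra_simps)
  then show ?thesis using bL2_measurable[OF f] bL2_measurable[OF g] by (simp add: bL2_def)
qed

lemma bL2_bounded_mult:
  assumes f: "f \<in> bL2" and g[measurable]: "g \<in> borel_measurable borel" and C: "\<And>x. \<bar>g x\<bar> \<le> C"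
  shows "(\<lambda>x. g x * f x) \<in> bL2" "nL2 (\<lambda>x. g x * f x) \<le> C * nL2 f"
proof -
  have [measurable]: "f \<in> borel_measurable borel" using f by (rule bL2_measurable)
  have C0: "C \<ge> 0" using C[of undefined] by linarith
  have le: "(g x * f x)\<^sup>2 \<le> C\<^sup>2 * (f x)\<^sup>2" for x
    using C[of x] by (auto simp: power_mult_distrib intro!: mult_right_mono abs_le_square_iff[THEN iffD1])
  have "(\<integral>\<^sup>+x. ennreal ((g x * f x)\<^sup>2) \<partial>lborel) \<le> (\<integral>\<^sup>+x. ennreal (C\<^sup>2) * ennreal ((f x)\<^sup>2) \<partial>lborel)"
    using le by (intro nn_integral_mono) (simp add: ennreal_mult[symmetric])
  also have "\<dots> = ennreal ((C * nL2 f)\<^sup>2)"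
    by (simp add: nn_integral_cmult nn_integral_nL2[OF f] power_mult_distrib ennreal_mult)
  finally show "(\<lambda>x. g x * f x) \<in> bL2" "nL2 (\<lambda>x. g x * f x) \<le> C * nL2 f"
    using C0 by (intro bL2_I[where C="C * nL2 f"]; simp)+
qed

lemma bL2_scale: "f \<in> bL2 \<Longrightarrow> (\<lambda>x. c * f x) \<in> bL2"
  by (rule bL2_bounded_mult[where C="\<bar>c\<bar>"]) auto

lemma nL2_scale: "nL2 (\<lambda>x. c * f x) = \<bar>c\<bar> * nL2 f"
  by (simp add: nL2_def power_mult_distrib real_sqrt_mult)

lemma bL2_diff: "f \<in> bL2 \<Longrightarrow> g \<in> bL2 \<Longrightarrow> (\<lambda>x. f x - g x) \<in> bL2"
  using bL2_add[of f "\<lambda>x. (-1) * g x"] bL2_scale[of g "-1"] by simp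

lemma bL2_zero: "(\<lambda>x. 0) \<in> bL2" by (simp add: bL2_def)

lemma bL2_sum: "(\<And>i. i \<in> I \<Longrightarrow> f i \<in> bL2) \<Longrightarrow> (\<lambda>x. \<Sum>i\<in>I. f i x) \<in> bL2"
  by (induction I rule: infinite_finite_induct) (auto intro: bL2_add bL2_zero)

lemma nL2_cauchy_schwarz:
  assumes f: "f \<in> bL2" and g: "g \<in> bL2"
  shows "\<bar>LINT x|lborel. f x * g x\<bar> \<le> nL2 f * nL2 g"
proof -
  have [measurable]: "f \<in> borel_measurable borel" "g \<in> borel_measurable borel" using f g by (auto intro: bL2_measurable)
  have i: "integrable lborel (\<lambda>x. \<bar>f x * g x\<bar>)"
    using bL2_mult_integrable[OF f g] by (rule integrable_abs)
  let ?I = "LINT x|lborel. \<bar>f x * g x\<bar>"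
  have "(\<integral>\<^sup>+x. ennreal \<bar>f x\<bar> * ennreal \<bar>g x\<bar> \<partial>lborel)\<^sup>2
      \<le> (\<integral>\<^sup>+x. (ennreal \<bar>f x\<bar>)\<^sup>2 \<partial>lborel) * (\<integral>\<^sup>+x. (ennreal \<bar>g x\<bar>)\<^sup>2 \<partial>lborel)"
    by (rule Cauchy_Schwarz_nn_integral) auto
  also have "\<dots> = ennreal ((nL2 f * nL2 g)\<^sup>2)"
    by (simp add: ennreal_power nn_integral_nL2 f g power_mult_distrib ennreal_mult)
  also have "(\<integral>\<^sup>+x. ennreal \<bar>f x\<bar> * ennreal \<bar>g x\<bar> \<partial>lborel) = ennreal ?I"
    using i by (simp add: ennreal_mult[symmetric] abs_mult[symmetric] nn_integral_eq_integral)
  finally have "?I\<^sup>2 \<le> (nL2 f * nL2 g)\<^sup>2" by (simp add: ennreal_power)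
  then have "?I \<le> nL2 f * nL2 g" by (rule power2_le_imp_le) simp
  then show ?thesis using integral_abs_bound[of lborel "\<lambda>x. f x * g x"] by linarith
qed

lemma nL2_triangle:
  assumes f: "f \<in> bL2" and g: "g \<in> bL2"
  shows "nL2 (\<lambda>x. f x + g x) \<le> nL2 f + nL2 g"
proof -
  have "(nL2 (\<lambda>x. f x + g x))\<^sup>2 = (LINT x|lborel. (f x)\<^sup>2 + (g x)\<^sup>2 + 2 * (f x * g x))"
    by (simp add: nL2_sq power2_sum algebra_simps)
  also have "\<dots> = (nL2 f)\<^sup>2 + (nL2 g)\<^sup>2 + 2 * (LINT x|lborel. f x * g x)"
    using f g by (simp add: nL2_sq bL2_integrable bL2_mult_integrable)
  also have "\<dots> \<le> (nL2 f + nL2 g)\<^sup>2"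
    using nL2_cauchy_schwarz[OF f g] by (simp add: power2_sum algebra_simps)
  finally show ?thesis by (rule power2_le_imp_le) simp
qed

lemma nL2_diff_commute: "nL2 (\<lambda>x. f x - g x) = nL2 (\<lambda>x. g x - f x)"
  using nL2_scale[of "-1" "\<lambda>x. f x - g x"] by simp

lemma nL2_triangle_diff:
  assumes "f \<in> bL2" "g \<in> bL2" "h \<in> bL2"
  shows "nL2 (\<lambda>x. f x - h x) \<le> nL2 (\<lambda>x. f x - g x) + nL2 (\<lambda>x. g x - h x)"
  using nL2_triangle[OF bL2_diff[OF assms(1,2)] bL2_diff[OF assms(2,3)]] by simp

lemma nL2_diff_le: assumes "f \<in> bL2" "g \<in> bL2" shows "\<bar>nL2 f - nL2 g\<bar> \<le> nL2 (\<lambda>x. f x - g x)"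
  using nL2_triangle[OF bL2_diff[OF assms] assms(2)] nL2_triangle[OF bL2_diff[OF assms(2,1)] assms(1)]
    nL2_diff_commute[of f g] by simp

lemma bL2_shift: assumes f: "f \<in> bL2"
  shows "(\<lambda>x. f (x - h)) \<in> bL2" "nL2 (\<lambda>x. f (x - h)) = nL2 f"
    "(\<lambda>x. f (x + h)) \<in> bL2" "nL2 (\<lambda>x. f (x + h)) = nL2 f"
proof -
  have [measurable]: "f \<in> borel_measurable borel" using f by (rule bL2_measurable)
  show "(\<lambda>x. f (x - h)) \<in> bL2" "(\<lambda>x. f (x + h)) \<in> bL2"
    using lborel_integrable_shift[OF bL2_integrable[OF f], of h] by (auto simp: bL2_def)
  show "nL2 (\<lambda>x. f (x - h)) = nL2 f"  "nL2 (\<lambda>x. f (x + h)) = nL2 f"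
    using lborel_integral_shift[of "\<lambda>x. (f x)\<^sup>2"] by (simp_all add: nL2_def)
qed

subsection \<open>Continuity of translations\<close>

text \<open>Outer regularity applied to the complement of A gives an open U around it; the
  complement of U is closed, lies in A and becomes compact after intersection with a large ball.
  Finite measure of A is what allows continuity from above as the radius grows.\<close>

lemma borel_inner_compact:
  fixes A :: "'a::euclidean_space set"
  assumes A: "A \<in> sets borel" and fin: "emeasure lborel A < \<infinity>" and e: "e > (0::real)"
  obtains K where "compact K" "K \<subseteq> A" "emeasure lborel (A - K) < ennreal e"
proof -
  obtain U where U: "open U" "- A \<subseteq> U" "emeasure lborel (U - - A) < ennreal e"
    using outer_regular_lborel[of "-A" e] A e by (auto simp: Compl_eq_Diff_UNIV)
  define C where "C n = A - (- U \<inter> cball 0 (real n))" for n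
  have [measurable]: "A \<in> sets borel" "U \<in> sets borel" using A U by auto
  have inter: "(\<Inter>n. C n) = U - - A"
  proof -
    have "\<exists>n. norm x \<le> real n" for x :: 'a by (rule real_arch_simple)
    then show ?thesis by (fastforce simp: C_def)
  qed
  have fC: "emeasure lborel (C n) \<noteq> \<infinity>" for n
    using fin by (metis C_def Diff_subset A emeasure_mono infinity_ennreal_def leD sets_lborel top.not_eq_extremum)
  have "(\<lambda>n. emeasure lborel (C n)) \<longlonglongrightarrow> emeasure lborel (\<Inter>n. C n)"
    by (intro Lim_emeasure_decseq fC) (auto simp: C_def decseq_def)
  then have "(\<lambda>n. emeasure lborel (C n)) \<longlonglongrightarrow> emeasure lborel (U - - A)" by (simp add: inter)
  from order_tendstoD(2)[OF this U(3)] obtain n where n: "emeasure lborel (C n) < ennreal e"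
    by (auto simp: eventually_sequentially)
  show thesis
  proof (rule that)
    show "compact (- U \<inter> cball 0 (real n))" using U(1) by (intro closed_Int_compact) auto
    show "- U \<inter> cball 0 (real n) \<subseteq> A" using U(2) by auto
  qed (use n in \<open>simp add: C_def\<close>)
qed

lemma ennreal_tendsto_0_le:
  fixes f g :: "'a \<Rightarrow> ennreal"
  assumes "(g \<longlongrightarrow> 0) F" "\<And>x. f x \<le> g x"
  shows "(f \<longlongrightarrow> 0) F"
  using assms by (intro tendsto_sandwich[OF _ _ tendsto_const assms(1)]) auto

text \<open>The functions with this property include the indicators of sets of finite measure and
  are closed under sums and dominated limits, which is the induction principle for integrable
  functions. For an indicator, A is squeezed between a compact K and an open U: a shift smaller than
  the distance from K to the outside of U alters the indicator only on \<open>U - K\<close> and its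
  translate.\<close>

lemma L1_translation_continuous:
  fixes f :: "'a::euclidean_space \<Rightarrow> real"
  assumes "integrable lborel f"
  shows "((\<lambda>h. \<integral>\<^sup>+x. ennreal \<bar>f (x - h) - f x\<bar> \<partial>lborel) \<longlongrightarrow> 0) (at 0)"
  using assms
proof (induction rule: integrable_induct)
  case (base A c)
  have [measurable]: "A \<in> sets borel" using base by simp
  show ?case
  proof (cases "A = {}")
    case False
    show ?thesis
    proof (rule tendsto_zero_ennreal)
      fix e :: real assume e: "e > 0"
      \<comment> \<open>The final bound is 4 |c| d; the summand 1 keeps the choice meaningful for c
        = 0 and makes the inequality strict.\<close>
      define d where "d = e / (4 * (\<bar>c\<bar> + 1))"
      have d: "d > 0" using e by (simp add: d_def)
      obtain U where U: "open U" "A \<subseteq> U" "emeasure lborel (U - A) < ennreal d"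
        using outer_regular_lborel[OF _ d, of A] by auto
      obtain K where K: "compact K" "K \<subseteq> A" "emeasure lborel (A - K) < ennreal d"
        using borel_inner_compact[OF _ _ d, of A] base by auto
      have [measurable]: "U \<in> sets borel" "K \<in> sets borel" using U K by (auto intro: borel_compact)
      obtain r where r: "r > 0" "\<And>x y. x \<in> K \<Longrightarrow> dist x y < r \<Longrightarrow> y \<in> U"
      proof (cases "K = {}")
        case False
        obtain r where "r > 0" "{x. infdist x K \<le> r} \<subseteq> U"
          using compact_in_open_separated[OF False K(1) U(1)] K U by blast
        then show thesis
          by (intro that[of r]) (auto simp: dist_commute infdist_def False intro!: cINF_lower2 dest!: subsetD)
      qed (use that[of 1] in auto)
      have "(\<integral>\<^sup>+x. ennreal \<bar>indicator A (x - h) *\<^sub>R c - indicator A x *\<^sub>R c\<bar> \<partial>lborel) < ennreal e"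
        if h: "norm h < r" for h
      proof -
        define I where "I x = (indicator (U - A) x + indicator (A - K) x :: ennreal)" for x
        have [measurable]: "I \<in> borel_measurable borel" by (simp add: I_def[abs_def])
        have I: "(\<integral>\<^sup>+x. I x \<partial>lborel) < ennreal (2 * d)"
        proof -
          have "(\<integral>\<^sup>+x. I x \<partial>lborel) = emeasure lborel (U - A) + emeasure lborel (A - K)"
            by (simp add: I_def nn_integral_add)
          also have "\<dots> < ennreal d + ennreal d"
            using U(3) K(3) by (rule add_strict_mono)
          finally show ?thesis using d by (simp flip: ennreal_plus)
        qed
        have "ennreal \<bar>indicator A (x - h) *\<^sub>R c - indicator A x *\<^sub>R c\<bar> \<le> ennreal \<bar>c\<bar> * (I (x - h) + I x)" for x
        proof -
          have "x - h \<in> K \<Longrightarrow> x \<in> U" "x \<in> K \<Longrightarrow> x - h \<in> U"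
            using r(2)[of "x - h" x] r(2)[of x "x - h"] h by (auto simp: dist_norm norm_minus_commute)
          then show ?thesis
            using U(2) K(2) by (auto simp: I_def indicator_def distrib_left intro: add_increasing add_increasing2)
        qed
        then have "(\<integral>\<^sup>+x. ennreal \<bar>indicator A (x - h) *\<^sub>R c - indicator A x *\<^sub>R c\<bar> \<partial>lborel)
          \<le> (\<integral>\<^sup>+x. ennreal \<bar>c\<bar> * (I (x - h) + I x) \<partial>lborel)" by (rule nn_integral_mono)
        also have "\<dots> = ennreal \<bar>c\<bar> * (2 * (\<integral>\<^sup>+x. I x \<partial>lborel))"
          using nn_integral_translate(3)[of I h] by (simp add: nn_integral_cmult nn_integral_add mult_2)
        also have "\<dots> \<le> ennreal \<bar>c\<bar> * (2 * ennreal (2 * d))" using I by (intro mult_left_mono) auto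
        also have "\<dots> = ennreal (\<bar>c\<bar> * (2 * (2 * d)))"
          by (metis abs_ge_zero ennreal_mult' ennreal_numeral zero_le_numeral)
        also have "\<dots> < ennreal e"
        proof (rule ennreal_lessI[OF e])
          have "\<bar>c\<bar> * (2 * (2 * d)) < (\<bar>c\<bar> + 1) * (4 * d)" using d by (simp add: algebra_simps)
          also have "\<dots> = e" by (simp add: d_def field_simps)
          finally show "\<bar>c\<bar> * (2 * (2 * d)) < e" .
        qed
        finally show ?thesis .
      qed
      then show "\<forall>\<^sub>F h in at 0. (\<integral>\<^sup>+x. ennreal \<bar>indicator A (x - h) *\<^sub>R c - indicator A x *\<^sub>R c\<bar> \<partial>lborel) < ennreal e"
        using r(1) by (auto simp: eventually_at dist_norm)
    qed
  qed simp
next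
  case (add f g)
  have [measurable]: "f \<in> borel_measurable borel" "g \<in> borel_measurable borel" using add by auto
  have "(\<integral>\<^sup>+x. ennreal \<bar>f (x - h) + g (x - h) - (f x + g x)\<bar> \<partial>lborel)
    \<le> (\<integral>\<^sup>+x. ennreal \<bar>f (x - h) - f x\<bar> \<partial>lborel) + (\<integral>\<^sup>+x. ennreal \<bar>g (x - h) - g x\<bar> \<partial>lborel)" for h
    by (subst nn_integral_add[symmetric]) (auto intro!: nn_integral_mono simp flip: ennreal_plus)
  note le = this
  have "((\<lambda>h. (\<integral>\<^sup>+x. ennreal \<bar>f (x - h) - f x\<bar> \<partial>lborel) + (\<integral>\<^sup>+x. ennreal \<bar>g (x - h) - g x\<bar> \<partial>lborel)) \<longlongrightarrow> 0) (at 0)"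
    using tendsto_add[OF add.IH] by simp
  then show ?case using le by (rule ennreal_tendsto_0_le)
next
  case (lim f s)
  have [measurable]: "f \<in> borel_measurable borel" "\<And>i. s i \<in> borel_measurable borel" using lim.hyps by auto
  have "(\<lambda>i. \<integral>\<^sup>+x. ennreal (norm (f x - s i x)) \<partial>lborel) \<longlonglongrightarrow> 0"
  proof (rule nn_integral_dominated_convergence_norm[where w="\<lambda>x. 2 * norm (f x)"])
    show "(\<integral>\<^sup>+x. ennreal (2 * norm (f x)) \<partial>lborel) < \<infinity>"
      using lim.hyps(4) by (auto simp: integrable_iff_bounded ennreal_mult nn_integral_cmult ennreal_mult_less_top)
  qed (use lim.hyps in auto)
  note sf = this
  show ?case
  proof (rule tendsto_zero_ennreal)
    fix e :: real assume e: "e > 0"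
    from order_tendstoD(2)[OF sf, of "ennreal (e/3)"] e obtain i where
      i: "(\<integral>\<^sup>+x. ennreal (norm (f x - s i x)) \<partial>lborel) < ennreal (e/3)"
      by (auto simp: eventually_sequentially)
    have "\<forall>\<^sub>F h in at 0. (\<integral>\<^sup>+x. ennreal \<bar>s i (x - h) - s i x\<bar> \<partial>lborel) < ennreal (e/3)"
      using order_tendstoD(2)[OF lim.IH, of "ennreal (e/3)" i] e by simp
    then show "\<forall>\<^sub>F h in at 0. (\<integral>\<^sup>+x. ennreal \<bar>f (x - h) - f x\<bar> \<partial>lborel) < ennreal e"
    proof eventually_elim
      case (elim h)
      have "(\<integral>\<^sup>+x. ennreal \<bar>f (x - h) - f x\<bar> \<partial>lborel)
        \<le> (\<integral>\<^sup>+x. ennreal (norm (f (x - h) - s i (x - h))) + ennreal \<bar>s i (x - h) - s i x\<bar> + ennreal (norm (f x - s i x)) \<partial>lborel)"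
        by (intro nn_integral_mono) (simp flip: ennreal_plus)
      also have "\<dots> = (\<integral>\<^sup>+x. ennreal (norm (f x - s i x)) \<partial>lborel) + (\<integral>\<^sup>+x. ennreal \<bar>s i (x - h) - s i x\<bar> \<partial>lborel) + (\<integral>\<^sup>+x. ennreal (norm (f x - s i x)) \<partial>lborel)"
        using nn_integral_translate(3)[of "\<lambda>x. ennreal (norm (f x - s i x))" h] by (simp add: nn_integral_add)
      also have "\<dots> < ennreal (e/3) + ennreal (e/3) + ennreal (e/3)"
        by (intro add_strict_mono i elim)
      also have "\<dots> = ennreal e" using e by (simp flip: ennreal_plus)
      finally show ?case .
    qed
  qed
qed

text \<open>Carries continuity of translations from L1 to L2: t |t| is integrable when t is square
  integrable, and unlike t^2 it separates t from -t. The factor 2 is spent only when s and t have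
  opposite signs.\<close>

lemma sq_diff_le_abs: "(s - t)\<^sup>2 \<le> 2 * \<bar>s * \<bar>s\<bar> - t * \<bar>t\<bar>\<bar>" for s t :: real
proof -
  have same: "(s - t)\<^sup>2 \<le> 2 * \<bar>s\<^sup>2 - t\<^sup>2\<bar>" if "0 \<le> s" "0 \<le> t" for s t :: real
  proof -
    have "(s - t)\<^sup>2 = \<bar>s - t\<bar> * \<bar>s - t\<bar>" by (simp add: power2_eq_square)
    also have "\<dots> \<le> \<bar>s - t\<bar> * (s + t)" using that by (intro mult_left_mono) auto
    also have "\<dots> = \<bar>s\<^sup>2 - t\<^sup>2\<bar>" using that by (simp add: power2_eq_square square_diff_square_factored abs_mult mult.commute)
    also have "\<dots> \<le> 2 * \<bar>s\<^sup>2 - t\<^sup>2\<bar>" by simp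
    finally show ?thesis .
  qed
  have opp: "(s - t)\<^sup>2 \<le> 2 * (s\<^sup>2 + t\<^sup>2)" for s t :: real
    using zero_le_power2[of "s + t"] by (simp add: power2_eq_square algebra_simps)
  consider "0 \<le> s" "0 \<le> t" | "s < 0" "t < 0" | "0 \<le> s" "t < 0" | "s < 0" "0 \<le> t" by linarith
  then show ?thesis
  proof cases
    case 1 then show ?thesis using same[of s t] by (simp add: power2_eq_square)
  next
    case 2
    have "(s - t)\<^sup>2 = (- s - - t)\<^sup>2" by (simp add: power2_commute)
    also have "\<dots> \<le> 2 * \<bar>(-s)\<^sup>2 - (-t)\<^sup>2\<bar>" using 2 by (intro same) auto
    finally show ?thesis using 2 by (simp add: power2_eq_square abs_minus_commute)
  next
    case 3 then show ?thesis using opp[of s t] zero_le_square[of s] zero_le_square[of t] unfolding power2_eq_square by simp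
  next
    case 4
    then have "\<bar>s * \<bar>s\<bar> - t * \<bar>t\<bar>\<bar> = s\<^sup>2 + t\<^sup>2" using zero_le_square[of s] zero_le_square[of t] unfolding power2_eq_square by simp
    then show ?thesis using opp[of s t] by simp
  qed
qed

lemma L2_translation_continuous:
  assumes f: "f \<in> bL2"
  shows "((\<lambda>h. nL2 (\<lambda>x. f (x - h) - f x)) \<longlongrightarrow> 0) (at 0)"
proof -
  have [measurable]: "f \<in> borel_measurable borel" using f by (rule bL2_measurable)
  let ?g = "\<lambda>x. f x * \<bar>f x\<bar>"
  let ?N = "\<lambda>h. \<integral>\<^sup>+x. ennreal \<bar>?g (x - h) - ?g x\<bar> \<partial>lborel"
  have "integrable lborel ?g"
    using bL2_integrable[OF f] by (rule Bochner_Integration.integrable_bound) (auto simp: power2_eq_square abs_mult)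
  from L1_translation_continuous[OF this] have N: "(?N \<longlongrightarrow> 0) (at 0)" .
  have le: "ennreal ((nL2 (\<lambda>x. f (x - h) - f x))\<^sup>2) \<le> 2 * ?N h" for h
  proof -
    have "ennreal ((nL2 (\<lambda>x. f (x - h) - f x))\<^sup>2) = (\<integral>\<^sup>+x. ennreal ((f (x - h) - f x)\<^sup>2) \<partial>lborel)"
      using f by (intro nn_integral_nL2[symmetric] bL2_diff bL2_shift)
    also have "\<dots> \<le> (\<integral>\<^sup>+x. 2 * ennreal \<bar>?g (x - h) - ?g x\<bar> \<partial>lborel)"
    proof (rule nn_integral_mono)
      fix x
      have "ennreal ((f (x - h) - f x)\<^sup>2) \<le> ennreal (2 * \<bar>?g (x - h) - ?g x\<bar>)"
        by (intro ennreal_leI sq_diff_le_abs)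
      then show "ennreal ((f (x - h) - f x)\<^sup>2) \<le> 2 * ennreal \<bar>?g (x - h) - ?g x\<bar>"
        by (simp add: ennreal_mult')
    qed
    finally show ?thesis by (simp add: nn_integral_cmult)
  qed
  have "((\<lambda>h. ennreal ((nL2 (\<lambda>x. f (x - h) - f x))\<^sup>2)) \<longlongrightarrow> 0) (at 0)"
    by (rule ennreal_tendsto_0_le[OF _ le]) (use ennreal_tendsto_cmult[OF _ N, of 2] in simp)
  then have "((\<lambda>h. (nL2 (\<lambda>x. f (x - h) - f x))\<^sup>2) \<longlongrightarrow> 0) (at 0)"
    by (subst (asm) tendsto_ennreal_iff[of _ _ 0, simplified]) auto
  from tendsto_real_sqrt[OF this] show ?thesis by simp
qed

subsection \<open>Convolutions\<close>

text \<open>Covers the non-integrable case as well, where the left side is 0 by convention;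
  pointwise bounds on convolutions can thus be written down before it is known where they
  converge.\<close>

lemma ennreal_abs_integral_le:
  fixes f :: "'a \<Rightarrow> real"
  shows "ennreal \<bar>LINT x|M. f x\<bar> \<le> (\<integral>\<^sup>+x. ennreal \<bar>f x\<bar> \<partial>M)"
proof (cases "integrable M f")
  case True then show ?thesis using integral_norm_bound_ennreal[OF True] by simp
qed (simp add: not_integrable_integral_eq)

text \<open>Cauchy-Schwarz against the constant 1 in L2 of the measure with density K.\<close>

lemma nn_integral_weighted_cauchy_schwarz:
  fixes f K :: "'a \<Rightarrow> ennreal"
  assumes [measurable]: "f \<in> borel_measurable M" "K \<in> borel_measurable M"
  shows "(\<integral>\<^sup>+x. f x * K x \<partial>M)\<^sup>2 \<le> (\<integral>\<^sup>+x. (f x)\<^sup>2 * K x \<partial>M) * (\<integral>\<^sup>+x. K x \<partial>M)"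
  using Cauchy_Schwarz_nn_integral[of f "density M K" "\<lambda>_. 1"]
  by (simp add: nn_integral_density emeasure_density mult.commute)

text \<open>Young's inequality for a convolution of L1 with L2: weighted Cauchy-Schwarz inside, then
  Tonelli. In extended reals it settles integrability along with the bound.\<close>

lemma young_nn_integral:
  fixes u K :: "'a::euclidean_space \<Rightarrow> ennreal"
  assumes [measurable]: "u \<in> borel_measurable borel" "K \<in> borel_measurable borel"
  shows "(\<integral>\<^sup>+x. (\<integral>\<^sup>+y. u y * K (x - y) \<partial>lborel)\<^sup>2 \<partial>lborel)
    \<le> (\<integral>\<^sup>+s. K s \<partial>lborel)\<^sup>2 * (\<integral>\<^sup>+y. (u y)\<^sup>2 \<partial>lborel)"
proof -
  let ?k = "\<integral>\<^sup>+s. K s \<partial>lborel"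
  have "(\<integral>\<^sup>+x. (\<integral>\<^sup>+y. u y * K (x - y) \<partial>lborel)\<^sup>2 \<partial>lborel)
    \<le> (\<integral>\<^sup>+x. (\<integral>\<^sup>+y. (u y)\<^sup>2 * K (x - y) \<partial>lborel) * ?k \<partial>lborel)"
  proof (rule nn_integral_mono)
    fix x :: 'a
    show "(\<integral>\<^sup>+y. u y * K (x - y) \<partial>lborel)\<^sup>2 \<le> (\<integral>\<^sup>+y. (u y)\<^sup>2 * K (x - y) \<partial>lborel) * ?k"
      using nn_integral_weighted_cauchy_schwarz[of u lborel "\<lambda>y. K (x - y)"] nn_integral_reflect[of K x] by simp
  qed
  also have "\<dots> = (\<integral>\<^sup>+x. (\<integral>\<^sup>+y. (u y)\<^sup>2 * K (x - y) \<partial>lborel) \<partial>lborel) * ?k"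
    by (rule nn_integral_multc) measurable
  also have "(\<integral>\<^sup>+x. (\<integral>\<^sup>+y. (u y)\<^sup>2 * K (x - y) \<partial>lborel) \<partial>lborel) = (\<integral>\<^sup>+y. (\<integral>\<^sup>+x. (u y)\<^sup>2 * K (x - y) \<partial>lborel) \<partial>lborel)"
    by (rule lborel_pair.Fubini') measurable
  also have "\<dots> = (\<integral>\<^sup>+y. (u y)\<^sup>2 * ?k \<partial>lborel)"
    by (simp add: nn_integral_cmult nn_integral_translate)
  also have "\<dots> = (\<integral>\<^sup>+y. (u y)\<^sup>2 \<partial>lborel) * ?k" by (rule nn_integral_multc) measurable
  finally show ?thesis by (simp add: power2_eq_square mult_ac)
qed

definition conv :: "('a::euclidean_space \<Rightarrow> real) \<Rightarrow> ('a \<Rightarrow> real) \<Rightarrow> 'a \<Rightarrow> real" where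
  "conv f \<psi> x = (LINT y|lborel. f y * \<psi> (x - y))"

lemma conv_measurable [measurable]:
  assumes [measurable]: "f \<in> borel_measurable borel" "\<psi> \<in> borel_measurable borel"
  shows "conv f \<psi> \<in> borel_measurable borel"
  unfolding conv_def[abs_def] by measurable

lemma conv_family_measurable:
  fixes \<Psi> :: "'b::euclidean_space \<Rightarrow> 'a::euclidean_space \<Rightarrow> real"
  assumes [measurable]: "f \<in> borel_measurable borel" "(\<lambda>(z, s). \<Psi> z s) \<in> borel_measurable (borel \<Otimes>\<^sub>M borel)"
  shows "(\<lambda>(x, z). conv f (\<Psi> z) x) \<in> borel_measurable (borel \<Otimes>\<^sub>M borel)"
  unfolding conv_def[abs_def] by measurable

lemma bL2_reflect: assumes f: "f \<in> bL2"
  shows "(\<lambda>y. f (x - y)) \<in> bL2" "nL2 (\<lambda>y. f (x - y)) = nL2 f"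
proof -
  have [measurable]: "f \<in> borel_measurable borel" using f by (rule bL2_measurable)
  show "(\<lambda>y. f (x - y)) \<in> bL2"
    using lborel_integrable_shift[OF bL2_integrable[OF f], of x] by (auto simp: bL2_def)
  show "nL2 (\<lambda>y. f (x - y)) = nL2 f"
    using lborel_integral_shift[of "\<lambda>x. (f x)\<^sup>2"] by (simp_all add: nL2_def)
qed

lemma conv_integrable:
  "f \<in> bL2 \<Longrightarrow> \<psi> \<in> bL2 \<Longrightarrow> integrable lborel (\<lambda>y. f y * \<psi> (x - y))"
  by (intro bL2_mult_integrable bL2_reflect)

lemma conv_bounded:
  assumes "f \<in> bL2" "\<psi> \<in> bL2" shows "\<bar>conv f \<psi> x\<bar> \<le> nL2 f * nL2 \<psi>"
  using nL2_cauchy_schwarz[OF assms(1) bL2_reflect(1)[OF assms(2)], of x] bL2_reflect(2)[OF assms(2)]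
  by (simp add: conv_def)

lemma conv_add_right:
  assumes "f \<in> bL2" "\<psi> \<in> bL2" "\<psi>' \<in> bL2"
  shows "conv f (\<lambda>s. \<psi> s + \<psi>' s) x = conv f \<psi> x + conv f \<psi>' x"
  by (simp add: conv_def distrib_left conv_integrable assms)

lemma conv_diff_right:
  assumes "f \<in> bL2" "\<psi> \<in> bL2" "\<psi>' \<in> bL2"
  shows "conv f (\<lambda>s. \<psi> s - \<psi>' s) x = conv f \<psi> x - conv f \<psi>' x"
  by (simp add: conv_def right_diff_distrib conv_integrable assms)

lemma conv_diff_left:
  assumes "f \<in> bL2" "f' \<in> bL2" "\<psi> \<in> bL2"
  shows "conv (\<lambda>s. f s - f' s) \<psi> x = conv f \<psi> x - conv f' \<psi> x"
  by (simp add: conv_def left_diff_distrib conv_integrable assms)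

lemma conv_scale_right: "conv f (\<lambda>s. c * \<psi> s) x = c * conv f \<psi> x"
  by (simp add: conv_def mult.left_commute[of _ c])

lemma conv_scale_left: "conv (\<lambda>s. c * f s) \<psi> x = c * conv f \<psi> x"
  by (simp add: conv_def mult.assoc)

lemma conv_sum_right:
  assumes "f \<in> bL2" "\<And>i. i \<in> I \<Longrightarrow> \<psi> i \<in> bL2"
  shows "conv f (\<lambda>s. \<Sum>i\<in>I. \<psi> i s) x = (\<Sum>i\<in>I. conv f (\<psi> i) x)"
  using assms by (simp add: conv_def sum_distrib_left conv_integrable)

lemma conv_shift: "conv f (\<lambda>s. \<psi> (s - h)) x = conv f \<psi> (x - h)"
  by (simp add: conv_def algebra_simps)

text \<open>The common shape of all Taylor residuals: a superposition over jumps z of convolutions,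
  with a coefficient m that oscillates in x and so prevents the whole from being a convolution.
  Replacing m by its majorant w leaves a single convolution with the kernel \<open>K\<close>, to
  which Young's inequality applies. The operator norm on L2 is therefore controlled by the L1 norms
  of the kernels \<open>\<Psi> z\<close> alone.\<close>

lemma conv_superposition:
  fixes \<Psi> :: "'b::euclidean_space \<Rightarrow> 'a::euclidean_space \<Rightarrow> real"
  assumes u: "u \<in> bL2"
    and [measurable]: "(\<lambda>(z, s). \<Psi> z s) \<in> borel_measurable (borel \<Otimes>\<^sub>M borel)"
      "(\<lambda>(x, z). m x z) \<in> borel_measurable (borel \<Otimes>\<^sub>M borel)" "w \<in> borel_measurable borel"
    and m: "\<And>x z. \<bar>m x z\<bar> \<le> w z"
    and B: "(\<integral>\<^sup>+z. ennreal (w z) * (\<integral>\<^sup>+s. ennreal \<bar>\<Psi> z s\<bar> \<partial>lborel) \<partial>lborel) \<le> ennreal B" "B \<ge> 0"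
  defines "g \<equiv> (\<lambda>x. LINT z|lborel. m x z * conv u (\<Psi> z) x)"
  shows "g \<in> bL2" "nL2 g \<le> B * nL2 u"
proof -
  have [measurable]: "u \<in> borel_measurable borel" using u by (rule bL2_measurable)
  note conv_family_measurable[measurable]
  have g: "g \<in> borel_measurable borel" unfolding g_def by measurable
  define K where "K s = (\<integral>\<^sup>+z. ennreal (w z) * ennreal \<bar>\<Psi> z s\<bar> \<partial>lborel)" for s
  have [measurable]: "K \<in> borel_measurable borel" unfolding K_def[abs_def] by measurable
  have K: "(\<integral>\<^sup>+s. K s \<partial>lborel) \<le> ennreal B"
  proof -
    have "(\<integral>\<^sup>+s. K s \<partial>lborel) = (\<integral>\<^sup>+z. (\<integral>\<^sup>+s. ennreal (w z) * ennreal \<bar>\<Psi> z s\<bar> \<partial>lborel) \<partial>lborel)"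
      unfolding K_def by (rule lborel_pair.Fubini') measurable
    also have "\<dots> = (\<integral>\<^sup>+z. ennreal (w z) * (\<integral>\<^sup>+s. ennreal \<bar>\<Psi> z s\<bar> \<partial>lborel) \<partial>lborel)"
      by (simp add: nn_integral_cmult)
    finally show ?thesis using B by simp
  qed
  have le: "ennreal \<bar>g x\<bar> \<le> (\<integral>\<^sup>+y. ennreal \<bar>u y\<bar> * K (x - y) \<partial>lborel)" for x
  proof -
    have "ennreal \<bar>g x\<bar> \<le> (\<integral>\<^sup>+z. ennreal \<bar>m x z * conv u (\<Psi> z) x\<bar> \<partial>lborel)"
      unfolding g_def by (rule ennreal_abs_integral_le)
    also have "\<dots> \<le> (\<integral>\<^sup>+z. ennreal (w z) * (\<integral>\<^sup>+y. ennreal \<bar>u y\<bar> * ennreal \<bar>\<Psi> z (x - y)\<bar> \<partial>lborel) \<partial>lborel)"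
    proof (rule nn_integral_mono)
      fix z
      have "ennreal \<bar>m x z * conv u (\<Psi> z) x\<bar> = ennreal \<bar>m x z\<bar> * ennreal \<bar>conv u (\<Psi> z) x\<bar>"
        by (simp add: abs_mult ennreal_mult)
      also have "\<dots> \<le> ennreal (w z) * (\<integral>\<^sup>+y. ennreal \<bar>u y * \<Psi> z (x - y)\<bar> \<partial>lborel)"
        using m unfolding conv_def by (intro mult_mono ennreal_leI ennreal_abs_integral_le) auto
      finally show "ennreal \<bar>m x z * conv u (\<Psi> z) x\<bar> \<le> ennreal (w z) * (\<integral>\<^sup>+y. ennreal \<bar>u y\<bar> * ennreal \<bar>\<Psi> z (x - y)\<bar> \<partial>lborel)"
        by (simp add: abs_mult ennreal_mult)
    qed
    also have "\<dots> = (\<integral>\<^sup>+z. (\<integral>\<^sup>+y. ennreal (w z) * (ennreal \<bar>u y\<bar> * ennreal \<bar>\<Psi> z (x - y)\<bar>) \<partial>lborel) \<partial>lborel)"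
      by (simp add: nn_integral_cmult)
    also have "\<dots> = (\<integral>\<^sup>+y. (\<integral>\<^sup>+z. ennreal (w z) * (ennreal \<bar>u y\<bar> * ennreal \<bar>\<Psi> z (x - y)\<bar>) \<partial>lborel) \<partial>lborel)"
      by (rule lborel_pair.Fubini') measurable
    also have "\<dots> = (\<integral>\<^sup>+y. ennreal \<bar>u y\<bar> * K (x - y) \<partial>lborel)"
      unfolding K_def by (subst nn_integral_cmult[symmetric]) (auto simp: mult_ac intro!: nn_integral_cong)
    finally show ?thesis .
  qed
  have "(\<integral>\<^sup>+x. ennreal ((g x)\<^sup>2) \<partial>lborel) \<le> (\<integral>\<^sup>+x. (\<integral>\<^sup>+y. ennreal \<bar>u y\<bar> * K (x - y) \<partial>lborel)\<^sup>2 \<partial>lborel)"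
  proof (rule nn_integral_mono)
    fix x
    have "ennreal ((g x)\<^sup>2) = (ennreal \<bar>g x\<bar>)\<^sup>2" by (simp add: ennreal_power)
    also have "\<dots> \<le> (\<integral>\<^sup>+y. ennreal \<bar>u y\<bar> * K (x - y) \<partial>lborel)\<^sup>2" by (intro power_mono le) simp
    finally show "ennreal ((g x)\<^sup>2) \<le> (\<integral>\<^sup>+y. ennreal \<bar>u y\<bar> * K (x - y) \<partial>lborel)\<^sup>2" .
  qed
  also have "\<dots> \<le> (\<integral>\<^sup>+s. K s \<partial>lborel)\<^sup>2 * (\<integral>\<^sup>+y. (ennreal \<bar>u y\<bar>)\<^sup>2 \<partial>lborel)"
    by (rule young_nn_integral) measurable
  also have "\<dots> \<le> (ennreal B)\<^sup>2 * ennreal ((nL2 u)\<^sup>2)"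
    using K by (intro mult_mono power_mono) (auto simp: ennreal_power nn_integral_nL2[OF u])
  also have "\<dots> = ennreal ((B * nL2 u)\<^sup>2)"
    using B(2) by (simp add: ennreal_power power_mult_distrib ennreal_mult)
  finally show "g \<in> bL2" "nL2 g \<le> B * nL2 u"
    using g B(2) by (intro bL2_I[where C="B * nL2 u"]; simp)+
qed

lemma conv_bL2:
  assumes u: "u \<in> bL2" and [measurable]: "\<psi> \<in> borel_measurable borel"
    and B: "(\<integral>\<^sup>+s. ennreal \<bar>\<psi> s\<bar> \<partial>lborel) \<le> ennreal B" "B \<ge> 0"
  shows "conv u \<psi> \<in> bL2" "nL2 (conv u \<psi>) \<le> B * nL2 u"
proof -
  have [measurable]: "u \<in> borel_measurable borel" using u by (rule bL2_measurable)
  have "(\<integral>\<^sup>+x. ennreal ((conv u \<psi> x)\<^sup>2) \<partial>lborel) \<le> (\<integral>\<^sup>+x. (\<integral>\<^sup>+y. ennreal \<bar>u y\<bar> * ennreal \<bar>\<psi> (x - y)\<bar> \<partial>lborel)\<^sup>2 \<partial>lborel)"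
  proof (rule nn_integral_mono)
    fix x
    have "ennreal ((conv u \<psi> x)\<^sup>2) = (ennreal \<bar>conv u \<psi> x\<bar>)\<^sup>2" by (simp add: ennreal_power)
    also have "\<dots> \<le> (\<integral>\<^sup>+y. ennreal \<bar>u y * \<psi> (x - y)\<bar> \<partial>lborel)\<^sup>2"
      unfolding conv_def by (intro power_mono ennreal_abs_integral_le) simp
    finally show "ennreal ((conv u \<psi> x)\<^sup>2) \<le> (\<integral>\<^sup>+y. ennreal \<bar>u y\<bar> * ennreal \<bar>\<psi> (x - y)\<bar> \<partial>lborel)\<^sup>2"
      by (simp add: abs_mult ennreal_mult)
  qed
  also have "\<dots> \<le> (\<integral>\<^sup>+s. ennreal \<bar>\<psi> s\<bar> \<partial>lborel)\<^sup>2 * (\<integral>\<^sup>+y. (ennreal \<bar>u y\<bar>)\<^sup>2 \<partial>lborel)"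
    by (rule young_nn_integral) measurable
  also have "\<dots> \<le> (ennreal B)\<^sup>2 * ennreal ((nL2 u)\<^sup>2)"
    using B by (intro mult_mono power_mono) (auto simp: ennreal_power nn_integral_nL2[OF u])
  also have "\<dots> = ennreal ((B * nL2 u)\<^sup>2)"
    using B(2) by (simp add: ennreal_power power_mult_distrib ennreal_mult)
  finally show "conv u \<psi> \<in> bL2" "nL2 (conv u \<psi>) \<le> B * nL2 u"
    using B(2) by (intro bL2_I[where C="B * nL2 u"]; simp)+
qed

text \<open>The difference \<open>conv f \<rho> - f\<close> is the average of the translation errors
  of f with respect to the probability density \<rho>; Cauchy-Schwarz against \<rho> and Tonelli
  bound its L2 norm by the largest error among the shifts in the support of \<rho>.\<close>

lemma mollification_error:
  assumes f: "f \<in> bL2" and \<rho>: "\<rho> \<in> bL2" "\<And>s. \<rho> s \<ge> 0" "integrable lborel \<rho>" "(LINT s|lborel. \<rho> s) = 1"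
    and supp: "\<And>s. norm s > \<delta> \<Longrightarrow> \<rho> s = 0"
    and \<eta>: "\<And>s. norm s \<le> \<delta> \<Longrightarrow> nL2 (\<lambda>x. f (x - s) - f x) \<le> \<eta>" "\<eta> \<ge> 0"
  shows "nL2 (\<lambda>x. conv f \<rho> x - f x) \<le> \<eta>"
proof -
  have [measurable]: "f \<in> borel_measurable borel" "\<rho> \<in> borel_measurable borel"
    using f \<rho> by (auto intro: bL2_measurable)
  have \<rho>1: "(\<integral>\<^sup>+s. ennreal (\<rho> s) \<partial>lborel) = 1"
    using \<rho> by (simp add: nn_integral_eq_integral)
  have "conv f \<rho> x - f x = (LINT s|lborel. \<rho> s * (f (x - s) - f x))" for x
  proof -
    have i: "integrable lborel (\<lambda>s. f (x - s) * \<rho> s)"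
      using f \<rho>(1) by (intro bL2_mult_integrable bL2_reflect)
    have "conv f \<rho> x = (LINT s|lborel. f (x - s) * \<rho> s)"
      unfolding conv_def using lborel_integral_shift(2)[of "\<lambda>y. f y * \<rho> (x - y)" x] by simp
    moreover have "(LINT s|lborel. \<rho> s * (f (x - s) - f x)) = (LINT s|lborel. f (x - s) * \<rho> s) - (LINT s|lborel. f x * \<rho> s)"
      using i \<rho>(3) by (subst Bochner_Integration.integral_diff[symmetric]) (auto simp: algebra_simps)
    ultimately show ?thesis using \<rho>(4) by simp
  qed
  then have le: "ennreal ((conv f \<rho> x - f x)\<^sup>2) \<le> (\<integral>\<^sup>+s. (ennreal \<bar>f (x - s) - f x\<bar>)\<^sup>2 * ennreal (\<rho> s) \<partial>lborel)" for x
  proof -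
    assume eq: "\<And>x. conv f \<rho> x - f x = (LINT s|lborel. \<rho> s * (f (x - s) - f x))"
    have "ennreal ((conv f \<rho> x - f x)\<^sup>2) = (ennreal \<bar>LINT s|lborel. \<rho> s * (f (x - s) - f x)\<bar>)\<^sup>2"
      by (simp add: ennreal_power eq)
    also have "\<dots> \<le> (\<integral>\<^sup>+s. ennreal \<bar>\<rho> s * (f (x - s) - f x)\<bar> \<partial>lborel)\<^sup>2"
      by (intro power_mono ennreal_abs_integral_le) simp
    also have "\<dots> = (\<integral>\<^sup>+s. ennreal \<bar>f (x - s) - f x\<bar> * ennreal (\<rho> s) \<partial>lborel)\<^sup>2"
      using \<rho>(2) by (simp add: abs_mult ennreal_mult mult.commute)
    also have "\<dots> \<le> (\<integral>\<^sup>+s. (ennreal \<bar>f (x - s) - f x\<bar>)\<^sup>2 * ennreal (\<rho> s) \<partial>lborel) * (\<integral>\<^sup>+s. ennreal (\<rho> s) \<partial>lborel)"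
      by (rule nn_integral_weighted_cauchy_schwarz) measurable
    finally show ?thesis by (simp add: \<rho>1)
  qed
  have "(\<integral>\<^sup>+x. ennreal ((conv f \<rho> x - f x)\<^sup>2) \<partial>lborel)
     \<le> (\<integral>\<^sup>+x. (\<integral>\<^sup>+s. (ennreal \<bar>f (x - s) - f x\<bar>)\<^sup>2 * ennreal (\<rho> s) \<partial>lborel) \<partial>lborel)"
    by (rule nn_integral_mono) (rule le)
  also have "\<dots> = (\<integral>\<^sup>+s. (\<integral>\<^sup>+x. (ennreal \<bar>f (x - s) - f x\<bar>)\<^sup>2 * ennreal (\<rho> s) \<partial>lborel) \<partial>lborel)"
    by (rule lborel_pair.Fubini') measurable
  also have "\<dots> \<le> (\<integral>\<^sup>+s. ennreal (\<eta>\<^sup>2) * ennreal (\<rho> s) \<partial>lborel)"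
  proof (rule nn_integral_mono)
    fix s
    have "(\<integral>\<^sup>+x. (ennreal \<bar>f (x - s) - f x\<bar>)\<^sup>2 * ennreal (\<rho> s) \<partial>lborel)
      = ennreal ((nL2 (\<lambda>x. f (x - s) - f x))\<^sup>2) * ennreal (\<rho> s)"
      using nn_integral_nL2[OF bL2_diff[OF bL2_shift(1)[OF f, of s] f]]
      by (simp add: nn_integral_multc ennreal_power)
    also have "\<dots> \<le> ennreal (\<eta>\<^sup>2) * ennreal (\<rho> s)"
    proof (cases "norm s \<le> \<delta>")
      case True then show ?thesis using \<eta> by (intro mult_right_mono ennreal_leI power_mono) auto
    qed (use supp in simp)
    finally show "(\<integral>\<^sup>+x. (ennreal \<bar>f (x - s) - f x\<bar>)\<^sup>2 * ennreal (\<rho> s) \<partial>lborel) \<le> ennreal (\<eta>\<^sup>2) * ennreal (\<rho> s)" .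
  qed
  also have "\<dots> = ennreal (\<eta>\<^sup>2)" by (simp add: nn_integral_cmult \<rho>1)
  finally show ?thesis using \<eta>(2) by (intro bL2_I(2)) auto
qed

subsection \<open>Smooth functions\<close>

lemma partial_deriv_eq:
  assumes "(f has_derivative D) (at x)" shows "partial_deriv i f x = D (axis i 1)"
  using frechet_derivative_at[OF assms] by (simp add: partial_deriv_def)

lemma frechet_eq_partial_sum:
  fixes f :: "real ^ 'n \<Rightarrow> real"
  assumes "f differentiable (at x)"
  shows "(f has_derivative (\<lambda>v. \<Sum>i\<in>UNIV. v $ i * partial_deriv i f x)) (at x)"
proof -
  have D: "(f has_derivative frechet_derivative f (at x)) (at x)"
    using assms by (simp add: frechet_derivative_works)
  have lin: "linear (frechet_derivative f (at x))" using D by (rule has_derivative_linear)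
  have "frechet_derivative f (at x) v = (\<Sum>i\<in>UNIV. v $ i * partial_deriv i f x)" for v :: "real ^ 'n"
  proof -
    have "v = (\<Sum>i\<in>UNIV. v $ i *\<^sub>R axis i 1)"
      using basis_expansion[of v] by (simp add: scalar_mult_eq_scaleR)
    then have "frechet_derivative f (at x) v = frechet_derivative f (at x) (\<Sum>i\<in>UNIV. v $ i *\<^sub>R axis i 1)" by simp
    also have "\<dots> = (\<Sum>i\<in>UNIV. v $ i * partial_deriv i f x)"
      by (simp add: linear_sum[OF lin] linear_scale[OF lin] partial_deriv_def)
    finally show ?thesis .
  qed
  then show ?thesis using D by (metis (no_types, lifting) ext)
qed

lemma cd_differentiable: "continuously_differentiable (Suc k) f \<Longrightarrow> f differentiable (at x)"
  by simp

lemma cd_continuous_on: "continuously_differentiable k f \<Longrightarrow> continuous_on UNIV f"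
  by (cases k) (auto simp: continuous_on_eq_continuous_at intro!: differentiable_imp_continuous_within)

lemma cd_Suc: "continuously_differentiable (Suc k) f \<Longrightarrow> continuously_differentiable k f"
proof (induction k arbitrary: f)
  case 0
  then show ?case using cd_continuous_on[OF 0] by simp
qed simp

lemma cd_const: "continuously_differentiable k (\<lambda>x. c)"
proof (induction k arbitrary: c)
  case (Suc k)
  have "partial_deriv i (\<lambda>x. c) = (\<lambda>x. 0)" for i :: 'a by (auto simp: partial_deriv_def)
  then show ?case using Suc by simp
qed simp

lemma cd_coord: "continuously_differentiable k (\<lambda>x. x $ j)"
proof (cases k)
  case (Suc l)
  have d: "((\<lambda>x. x $ j) has_derivative (\<lambda>v. v $ j)) (at x)" for x :: "real ^ 'a"
    by (rule bounded_linear_imp_has_derivative[OF bounded_linear_vec_nth])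
  have "partial_deriv i (\<lambda>x. x $ j) = (\<lambda>x. axis i 1 $ j)" for i :: 'a
    using partial_deriv_eq[OF d] by auto
  then show ?thesis using Suc d cd_const by (auto simp: differentiable_def)
qed (simp add: continuous_on_component)

lemma partial_deriv_add:
  assumes "f differentiable (at x)" "g differentiable (at x)"
  shows "partial_deriv i (\<lambda>x. f x + g x) x = partial_deriv i f x + partial_deriv i g x"
  using partial_deriv_eq[OF has_derivative_add[OF assms[unfolded frechet_derivative_works]]]
  by (simp add: partial_deriv_def)

lemma partial_deriv_mult:
  fixes f g :: "real ^ 'n \<Rightarrow> real"
  assumes "f differentiable (at x)" "g differentiable (at x)"
  shows "partial_deriv i (\<lambda>x. f x * g x) x = f x * partial_deriv i g x + partial_deriv i f x * g x"
  using partial_deriv_eq[OF has_derivative_mult[OF assms[unfolded frechet_derivative_works]]]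
  by (simp add: partial_deriv_def)

lemma cd_add:
  "continuously_differentiable k f \<Longrightarrow> continuously_differentiable k g \<Longrightarrow> continuously_differentiable k (\<lambda>x. f x + g x)"
proof (induction k arbitrary: f g)
  case (Suc k)
  have "partial_deriv i (\<lambda>x. f x + g x) = (\<lambda>x. partial_deriv i f x + partial_deriv i g x)" for i
    using Suc.prems by (auto intro!: partial_deriv_add)
  then show ?case using Suc by (auto intro!: derivative_intros)
qed (auto intro: continuous_on_add)

lemma cd_mult:
  fixes f g :: "real ^ 'n \<Rightarrow> real"
  shows "continuously_differentiable k f \<Longrightarrow> continuously_differentiable k g \<Longrightarrow> continuously_differentiable k (\<lambda>x. f x * g x)"
proof (induction k arbitrary: f g)
  case (Suc k)
  have eq: "partial_deriv i (\<lambda>x. f x * g x) = (\<lambda>x. f x * partial_deriv i g x + partial_deriv i f x * g x)" for i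
    using Suc.prems by (auto intro!: partial_deriv_mult)
  have "continuously_differentiable k (\<lambda>x. f x * partial_deriv i g x + partial_deriv i f x * g x)" for i
    using Suc.prems cd_Suc[OF Suc.prems(1)] cd_Suc[OF Suc.prems(2)] by (intro cd_add Suc.IH) auto
  moreover have "(\<lambda>x. f x * g x) differentiable (at x)" for x
    using Suc.prems by (intro differentiable_mult) auto
  ultimately show ?case by (simp add: eq)
qed (auto intro: continuous_on_mult)

lemma cd_sum:
  "(\<And>i. i \<in> I \<Longrightarrow> continuously_differentiable k (f i)) \<Longrightarrow> continuously_differentiable k (\<lambda>x. \<Sum>i\<in>I. f i x)"
  by (induction I rule: infinite_finite_induct) (auto intro: cd_add cd_const)

lemma partial_deriv_compose:
  fixes q :: "real ^ 'n \<Rightarrow> real"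
  assumes "(F has_real_derivative F') (at (q x))" "q differentiable (at x)"
  shows "(\<lambda>x. F (q x)) differentiable (at x)" "partial_deriv i (\<lambda>x. F (q x)) x = F' * partial_deriv i q x"
proof -
  have D: "((\<lambda>x. F (q x)) has_derivative (\<lambda>v. F' * frechet_derivative q (at x) v)) (at x)"
    using has_derivative_compose[OF assms(2)[unfolded frechet_derivative_works] assms(1)[unfolded has_field_derivative_def]]
    by simp
  then show "(\<lambda>x. F (q x)) differentiable (at x)" by (auto simp: differentiable_def)
  show "partial_deriv i (\<lambda>x. F (q x)) x = F' * partial_deriv i q x"
    using partial_deriv_eq[OF D] by (simp add: partial_deriv_def)
qed

text \<open>F lists all successive derivatives of one function. Differentiating \<open>F n\<close>
  after q raises n and lowers k, so the induction on k must leave n arbitrary.\<close>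

lemma cd_compose:
  fixes q :: "real ^ 'n \<Rightarrow> real" and F :: "nat \<Rightarrow> real \<Rightarrow> real"
  assumes F: "\<And>n t. (F n has_real_derivative F (Suc n) t) (at t)" and q: "\<And>k. continuously_differentiable k q"
  shows "continuously_differentiable k (\<lambda>x. F n (q x))"
proof (induction k arbitrary: n)
  case 0
  have "continuous_on UNIV (F n)"
    using F by (auto simp: continuous_on_eq_continuous_at intro: DERIV_isCont)
  then show ?case using cd_continuous_on[OF q[of 0]] by (auto intro: continuous_on_compose2)
next
  case (Suc k)
  have dq: "q differentiable (at x)" for x using cd_differentiable[OF q[of "Suc 0"]] .
  have "partial_deriv i (\<lambda>x. F n (q x)) = (\<lambda>x. F (Suc n) (q x) * partial_deriv i q x)" for i
    using partial_deriv_compose(2)[where F="F n", OF F dq] by auto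
  moreover have "continuously_differentiable k (\<lambda>x. F (Suc n) (q x) * partial_deriv i q x)" for i
    using q[of "Suc k"] by (intro cd_mult Suc.IH) auto
  ultimately show ?case using partial_deriv_compose(1)[where F="F n", OF F dq] by simp
qed

lemma partial_deriv_affine:
  fixes f :: "real ^ 'n \<Rightarrow> real"
  assumes "f differentiable (at (c + s *\<^sub>R x))"
  shows "(\<lambda>x. f (c + s *\<^sub>R x)) differentiable (at x)"
    "partial_deriv i (\<lambda>x. f (c + s *\<^sub>R x)) x = s * partial_deriv i f (c + s *\<^sub>R x)"
proof -
  let ?D = "frechet_derivative f (at (c + s *\<^sub>R x))"
  have f: "(f has_derivative ?D) (at (c + s *\<^sub>R x))" using assms by (simp add: frechet_derivative_works)
  have a: "((\<lambda>x. c + s *\<^sub>R x) has_derivative (\<lambda>v. s *\<^sub>R v)) (at x)" by (auto intro!: derivative_eq_intros)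
  have D: "((\<lambda>x. f (c + s *\<^sub>R x)) has_derivative (\<lambda>v. ?D (s *\<^sub>R v))) (at x)"
    using has_derivative_compose[OF a f] by simp
  then show "(\<lambda>x. f (c + s *\<^sub>R x)) differentiable (at x)" by (auto simp: differentiable_def)
  show "partial_deriv i (\<lambda>x. f (c + s *\<^sub>R x)) x = s * partial_deriv i f (c + s *\<^sub>R x)"
    using partial_deriv_eq[OF D] linear_scale[OF has_derivative_linear[OF f]] by (simp add: partial_deriv_def)
qed

lemma cd_affine:
  fixes f :: "real ^ 'n \<Rightarrow> real"
  shows "continuously_differentiable k f \<Longrightarrow> continuously_differentiable k (\<lambda>x. f (c + s *\<^sub>R x))"
proof (induction k arbitrary: f)
  case 0
  then show ?case by (auto intro!: continuous_on_compose2[of UNIV f] continuous_intros)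
next
  case (Suc k)
  have "partial_deriv i (\<lambda>x. f (c + s *\<^sub>R x)) = (\<lambda>x. s * partial_deriv i f (c + s *\<^sub>R x))" for i
    using Suc.prems by (intro ext partial_deriv_affine(2)) simp
  moreover have "continuously_differentiable k (\<lambda>x. s * partial_deriv i f (c + s *\<^sub>R x))" for i
    using Suc by (intro cd_mult[OF cd_const]) auto
  ultimately show ?case using Suc.prems by (simp add: partial_deriv_affine(1))
qed

subsection \<open>Test functions\<close>

lemma test_function_iff:
  "test_function \<psi> \<longleftrightarrow> (\<forall>k. continuously_differentiable k \<psi>) \<and> (\<exists>R. \<forall>x. norm x > R \<longrightarrow> \<psi> x = 0)"
proof -
  have "compact (closure {x. \<psi> x \<noteq> 0}) \<longleftrightarrow> (\<exists>R. \<forall>x. norm x > R \<longrightarrow> \<psi> x = 0)"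
    unfolding compact_closure bounded_iff by (auto simp: not_less) (meson not_le, meson not_le)
  then show ?thesis by (simp add: test_function_def)
qed

lemma test_function_cd: "test_function \<psi> \<Longrightarrow> continuously_differentiable k \<psi>"
  by (simp add: test_function_def)

lemma test_function_differentiable: "test_function \<psi> \<Longrightarrow> \<psi> differentiable (at x)"
  using test_function_cd[of \<psi> "Suc 0"] by simp

lemma test_function_continuous: "test_function \<psi> \<Longrightarrow> continuous_on UNIV \<psi>"
  using test_function_cd[of \<psi> 0] by simp

lemma test_function_borel: "test_function \<psi> \<Longrightarrow> \<psi> \<in> borel_measurable borel"
  by (intro borel_measurable_continuous_onI test_function_continuous)

lemma test_function_support:
  assumes "test_function \<psi>" obtains R where "R > 0" "\<And>x. norm x > R \<Longrightarrow> \<psi> x = 0"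
proof -
  obtain R where "\<And>x. norm x > R \<Longrightarrow> \<psi> x = 0" using assms by (auto simp: test_function_iff)
  then show ?thesis by (intro that[of "max R 1"]) auto
qed

lemma partial_deriv_outside:
  fixes \<psi> :: "real ^ 'n \<Rightarrow> real"
  assumes "\<And>x. norm x > R \<Longrightarrow> \<psi> x = 0" "norm x > R"
  shows "partial_deriv i \<psi> x = 0"
proof -
  have "((\<lambda>x. 0) has_derivative (\<lambda>v. 0)) (at x)" by simp
  moreover have "open {x :: real ^ 'n. norm x > R}" by (intro open_Collect_less continuous_intros)
  ultimately have "(\<psi> has_derivative (\<lambda>v. 0)) (at x)"
    by (rule has_derivative_transform_within_open) (use assms in auto)
  then show ?thesis by (simp add: partial_deriv_eq)
qed

lemma test_function_partial: assumes "test_function \<psi>" shows "test_function (partial_deriv i \<psi>)"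
proof -
  have "continuously_differentiable k (partial_deriv i \<psi>)" for k
    using test_function_cd[OF assms, of "Suc k"] by simp
  moreover obtain R where "\<And>x. norm x > R \<Longrightarrow> \<psi> x = 0" using assms by (auto simp: test_function_iff)
  ultimately show ?thesis by (auto simp: test_function_iff intro!: exI[of _ R] partial_deriv_outside)
qed

lemma test_function_affine:
  assumes "test_function \<psi>" "s \<noteq> 0" shows "test_function (\<lambda>x. \<psi> (c + s *\<^sub>R x))"
proof -
  obtain R where R: "\<And>x. norm x > R \<Longrightarrow> \<psi> x = 0" using assms by (auto simp: test_function_iff)
  have "\<psi> (c + s *\<^sub>R x) = 0" if "norm x > (R + norm c) / \<bar>s\<bar>" for x
  proof -
    have "R + norm c < \<bar>s\<bar> * norm x" using that assms(2) by (simp add: field_simps)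
    also have "\<dots> \<le> norm (c + s *\<^sub>R x) + norm c" using norm_triangle_ineq4[of "c + s *\<^sub>R x" c] by simp
    finally show ?thesis using R by simp
  qed
  then show ?thesis using assms test_function_cd by (auto simp: test_function_iff intro!: cd_affine)
qed

lemma test_function_scale: assumes "test_function \<psi>" shows "test_function (\<lambda>x. c * \<psi> x)"
  using assms by (auto simp: test_function_iff intro!: cd_mult cd_const)

lemma test_function_bounded:
  fixes \<psi> :: "real ^ 'n \<Rightarrow> real"
  assumes "test_function \<psi>" obtains C where "C > 0" "\<And>x. \<bar>\<psi> x\<bar> \<le> C"
proof -
  obtain R where R: "R > 0" "\<And>x. norm x > R \<Longrightarrow> \<psi> x = 0" by (rule test_function_support[OF assms]) blast
  have "compact (\<psi> ` cball 0 R)"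
    using test_function_continuous[OF assms] by (intro compact_continuous_image) (auto intro: continuous_on_subset)
  then obtain C where "\<forall>y\<in>\<psi> ` cball 0 R. norm y \<le> C"
    using compact_imp_bounded[of "\<psi> ` cball 0 R"] unfolding bounded_iff by blast
  then have C: "\<bar>\<psi> x\<bar> \<le> C" if "norm x \<le> R" for x using that by auto
  have "\<bar>\<psi> x\<bar> \<le> max C 1" for x using C[of x] R(2)[of x] by (cases "norm x \<le> R") auto
  then show thesis using that[of "max C 1"] by simp
qed

text \<open>A Taylor remainder of a function supported in a ball lives on that ball and its
  translate by h. The volume involved does not depend on h, so a sup bound becomes an L1 bound of
  the same order in h.\<close>

lemma nn_integral_two_balls:
  fixes T :: "real ^ 'n \<Rightarrow> real"
  assumes B: "\<And>s. \<bar>T s\<bar> \<le> B" and supp: "\<And>s. norm s > R \<Longrightarrow> norm (s - h) > R \<Longrightarrow> T s = 0"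
  shows "(\<integral>\<^sup>+s. ennreal \<bar>T s\<bar> \<partial>lborel) \<le> ennreal (2 * measure lborel (cball 0 R :: (real ^ 'n) set) * B)"
proof -
  have B0: "B \<ge> 0" using B[of undefined] by linarith
  let ?v = "measure lborel (cball 0 R :: (real ^ 'n) set)"
  let ?I = "indicator (cball 0 R) :: real ^ 'n \<Rightarrow> ennreal"
  have [measurable]: "?I \<in> borel_measurable borel" by (intro borel_measurable_indicator borel_closed closed_cball)
  have fin: "emeasure lborel (cball 0 R :: (real ^ 'n) set) = ennreal ?v"
    using emeasure_bounded_finite[of "cball 0 R :: (real ^ 'n) set"] by (intro emeasure_eq_ennreal_measure) auto
  have "(\<integral>\<^sup>+s. ennreal \<bar>T s\<bar> \<partial>lborel) \<le> (\<integral>\<^sup>+s. ennreal B * (?I s + ?I (s - h)) \<partial>lborel)"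
  proof (rule nn_integral_mono)
    fix s
    show "ennreal \<bar>T s\<bar> \<le> ennreal B * (?I s + ?I (s - h))"
      using B[of s] supp[of s] B0
      by (cases "norm s \<le> R"; cases "norm (s - h) \<le> R")
         (auto simp: distrib_left mult_2_right intro: ennreal_leI add_increasing2)
  qed
  also have "\<dots> = ennreal B * ((\<integral>\<^sup>+s. ?I s \<partial>lborel) + (\<integral>\<^sup>+s. ?I s \<partial>lborel))"
    using nn_integral_translate(3)[of ?I h]
    by (simp add: nn_integral_cmult nn_integral_add del: nn_integral_indicator)
  also have "\<dots> = ennreal (2 * ?v * B)"
    using B0 by (simp add: fin mult_ac flip: ennreal_plus ennreal_mult)
  finally show ?thesis .
qed

lemma test_function_L1:
  fixes \<psi> :: "real ^ 'n \<Rightarrow> real"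
  assumes "test_function \<psi>" obtains C where "C > 0" "(\<integral>\<^sup>+s. ennreal \<bar>\<psi> s\<bar> \<partial>lborel) \<le> ennreal C"
proof -
  obtain R where R: "R > 0" "\<And>x. norm x > R \<Longrightarrow> \<psi> x = 0" by (rule test_function_support[OF assms]) blast
  obtain B where B: "B > 0" "\<And>x. \<bar>\<psi> x\<bar> \<le> B" by (rule test_function_bounded[OF assms]) blast
  have "(\<integral>\<^sup>+s. ennreal \<bar>\<psi> s\<bar> \<partial>lborel) \<le> ennreal (2 * measure lborel (cball 0 R :: (real ^ 'n) set) * B)"
    by (rule nn_integral_two_balls[where h=0]) (use R B in auto)
  also have "\<dots> \<le> ennreal (2 * measure lborel (cball 0 R :: (real ^ 'n) set) * B + 1)"
    by (rule ennreal_leI) simp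
  finally show thesis
    using B(1) by (intro that[of "2 * measure lborel (cball 0 R :: (real ^ 'n) set) * B + 1"]) (simp_all add: add_nonneg_pos)
qed

lemma test_function_integrable:
  fixes \<psi> :: "real ^ 'n \<Rightarrow> real"
  assumes "test_function \<psi>" shows "integrable lborel \<psi>"
proof -
  obtain C where "C > 0" "(\<integral>\<^sup>+s. ennreal \<bar>\<psi> s\<bar> \<partial>lborel) \<le> ennreal C" by (rule test_function_L1[OF assms]) blast
  then show ?thesis using test_function_borel[OF assms] by (auto simp: integrable_iff_bounded intro: le_less_trans)
qed

lemma test_function_bL2:
  fixes \<psi> :: "real ^ 'n \<Rightarrow> real"
  assumes "test_function \<psi>" shows "\<psi> \<in> bL2"
proof -
  obtain B where B: "B > 0" "\<And>x. \<bar>\<psi> x\<bar> \<le> B" by (rule test_function_bounded[OF assms]) blast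
  have [measurable]: "\<psi> \<in> borel_measurable borel" by (rule test_function_borel[OF assms])
  have "integrable lborel (\<lambda>x. (\<psi> x)\<^sup>2)"
  proof (rule Bochner_Integration.integrable_bound[of _ "\<lambda>x. B * \<psi> x"])
    show "AE x in lborel. norm ((\<psi> x)\<^sup>2) \<le> norm (B * \<psi> x)"
    proof (rule AE_I2)
      fix x
      have "\<bar>\<psi> x\<bar> * \<bar>\<psi> x\<bar> \<le> B * \<bar>\<psi> x\<bar>" using B by (intro mult_right_mono) auto
      then show "norm ((\<psi> x)\<^sup>2) \<le> norm (B * \<psi> x)" using B(1) by (simp add: power2_eq_square abs_mult)
    qed
  qed (use test_function_integrable[OF assms] in auto)
  then show ?thesis by (simp add: bL2_def)
qed

lemma path_derivative:
  fixes \<psi> :: "real ^ 'n \<Rightarrow> real"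
  assumes "test_function \<psi>"
  shows "((\<lambda>\<tau>. \<psi> (s - \<tau> *\<^sub>R h)) has_real_derivative - (\<Sum>i\<in>UNIV. h $ i * partial_deriv i \<psi> (s - \<tau> *\<^sub>R h))) (at \<tau>)"
proof -
  have a: "((\<lambda>\<tau>. s - \<tau> *\<^sub>R h) has_derivative (\<lambda>r. - (r *\<^sub>R h))) (at \<tau>)" by (auto intro!: derivative_eq_intros)
  have "((\<lambda>\<tau>. \<psi> (s - \<tau> *\<^sub>R h)) has_derivative (\<lambda>r. \<Sum>i\<in>UNIV. (- (r *\<^sub>R h)) $ i * partial_deriv i \<psi> (s - \<tau> *\<^sub>R h))) (at \<tau>)"
    by (rule has_derivative_compose[OF a frechet_eq_partial_sum[OF test_function_differentiable[OF assms]]])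
  then show ?thesis unfolding has_field_derivative_def
    by (rule has_derivative_eq_rhs) (auto simp: sum_negf sum_distrib_left sum_distrib_right mult_ac fun_eq_iff)
qed

lemma unit_interval_mean_value:
  fixes g g' :: "real \<Rightarrow> real"
  assumes "\<And>\<tau>. (g has_real_derivative g' \<tau>) (at \<tau>)" "\<And>\<tau>. 0 \<le> \<tau> \<Longrightarrow> \<tau> \<le> 1 \<Longrightarrow> \<bar>g' \<tau>\<bar> \<le> B"
  shows "\<bar>g 1 - g 0\<bar> \<le> B"
proof -
  obtain z where "0 < z" "z < 1" "g 1 - g 0 = (1 - 0) * g' z" using MVT2[of 0 1 g g'] assms(1) by auto
  then show ?thesis using assms(2)[of z] by simp
qed

lemma sum_component_bound:
  fixes h :: "real ^ 'n"
  assumes "\<And>i. \<bar>f i\<bar> \<le> B i" shows "\<bar>\<Sum>i\<in>UNIV. h $ i * f i\<bar> \<le> norm h * (\<Sum>i\<in>UNIV. B i)"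
proof -
  have "\<bar>\<Sum>i\<in>UNIV. h $ i * f i\<bar> \<le> (\<Sum>i\<in>UNIV. \<bar>h $ i * f i\<bar>)" by (rule sum_abs)
  also have "\<dots> \<le> (\<Sum>i\<in>UNIV. norm h * B i)"
    using assms by (intro sum_mono) (simp add: abs_mult component_le_norm_cart mult_mono)
  finally show ?thesis by (simp add: sum_distrib_left)
qed

text \<open>In the three remainders the increment is -h, as for a jump from x to x - \<epsilon> z;
  hence the first-order term is added and the second-order term subtracted. With h before s, a
  remainder with h fixed is again a kernel to convolve with.\<close>

definition taylor1 :: "(real ^ 'n \<Rightarrow> real) \<Rightarrow> real ^ 'n \<Rightarrow> real ^ 'n \<Rightarrow> real" where
  "taylor1 \<psi> h s = \<psi> (s - h) - \<psi> s"

definition taylor2 :: "(real ^ 'n \<Rightarrow> real) \<Rightarrow> real ^ 'n \<Rightarrow> real ^ 'n \<Rightarrow> real" where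
  "taylor2 \<psi> h s = \<psi> (s - h) - \<psi> s + (\<Sum>i\<in>UNIV. h $ i * partial_deriv i \<psi> s)"

definition taylor3 :: "(real ^ 'n \<Rightarrow> real) \<Rightarrow> real ^ 'n \<Rightarrow> real ^ 'n \<Rightarrow> real" where
  "taylor3 \<psi> h s = \<psi> (s - h) - \<psi> s + (\<Sum>i\<in>UNIV. h $ i * partial_deriv i \<psi> s)
     - (\<Sum>i\<in>UNIV. h $ i * (\<Sum>j\<in>UNIV. h $ j * partial_deriv j (partial_deriv i \<psi>) s)) / 2"

lemma taylor1_bound:
  fixes \<psi> :: "real ^ 'n \<Rightarrow> real"
  assumes \<psi>: "test_function \<psi>" shows "\<exists>C. \<forall>h s. \<bar>taylor1 \<psi> h s\<bar> \<le> C * norm h"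
proof -
  have "\<exists>B. \<forall>x. \<bar>partial_deriv i \<psi> x\<bar> \<le> B" for i
    by (rule test_function_bounded[OF test_function_partial[OF \<psi>, of i]]) blast
  then obtain B where B: "\<And>i x. \<bar>partial_deriv i \<psi> x\<bar> \<le> B i" by metis
  have "\<bar>taylor1 \<psi> h s\<bar> \<le> (\<Sum>i\<in>UNIV. B i) * norm h" for h s
  proof -
    have "\<bar>\<psi> (s - 1 *\<^sub>R h) - \<psi> (s - 0 *\<^sub>R h)\<bar> \<le> norm h * (\<Sum>i\<in>UNIV. B i)"
    proof (rule unit_interval_mean_value[OF path_derivative[OF \<psi>]])
      show "\<bar>- (\<Sum>i\<in>UNIV. h $ i * partial_deriv i \<psi> (s - \<tau> *\<^sub>R h))\<bar> \<le> norm h * (\<Sum>i\<in>UNIV. B i)" for \<tau>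
        using sum_component_bound[where f="\<lambda>i. partial_deriv i \<psi> (s - \<tau> *\<^sub>R h)", OF B] by simp
    qed
    then show ?thesis by (simp add: taylor1_def mult.commute)
  qed
  then show ?thesis by blast
qed

text \<open>Along the segment from s to s - h, the remainder of order two has as derivative the
  remainders of order one of the partial derivatives, contracted with -h. The mean value theorem
  thus raises the power of \<open>norm h\<close> by one; the next order is reached in the same
  way.\<close>

lemma taylor2_bound:
  fixes \<psi> :: "real ^ 'n \<Rightarrow> real"
  assumes \<psi>: "test_function \<psi>" shows "\<exists>C. \<forall>h s. \<bar>taylor2 \<psi> h s\<bar> \<le> C * norm h ^ 2"
proof -
  have "\<exists>B. \<forall>h s. \<bar>taylor1 (partial_deriv i \<psi>) h s\<bar> \<le> B * norm h" for i
    by (rule taylor1_bound[OF test_function_partial[OF \<psi>, of i]])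
  then obtain B where B: "\<And>i h s. \<bar>taylor1 (partial_deriv i \<psi>) h s\<bar> \<le> B i * norm h" by metis
  have "\<bar>taylor2 \<psi> h s\<bar> \<le> (\<Sum>i\<in>UNIV. B i) * norm h ^ 2" for h s
  proof -
    let ?g = "\<lambda>\<tau>. \<psi> (s - \<tau> *\<^sub>R h) - \<psi> s + \<tau> * (\<Sum>i\<in>UNIV. h $ i * partial_deriv i \<psi> s)"
    let ?g' = "\<lambda>\<tau>. - (\<Sum>i\<in>UNIV. h $ i * taylor1 (partial_deriv i \<psi>) (\<tau> *\<^sub>R h) s)"
    have "\<bar>?g 1 - ?g 0\<bar> \<le> norm h * (\<Sum>i\<in>UNIV. B i * norm h)"
    proof (rule unit_interval_mean_value[of ?g ?g'])
      show "(?g has_real_derivative ?g' \<tau>) (at \<tau>)" for \<tau>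
        by (rule derivative_eq_intros path_derivative[OF \<psi>] refl)+
           (simp add: taylor1_def sum_subtractf right_diff_distrib)
      fix \<tau> :: real assume \<tau>: "0 \<le> \<tau>" "\<tau> \<le> 1"
      have B0: "B i * norm h \<ge> 0" for i using B[of i h s] by linarith
      have "\<bar>taylor1 (partial_deriv i \<psi>) (\<tau> *\<^sub>R h) s\<bar> \<le> B i * norm h" for i
      proof -
        have "\<bar>taylor1 (partial_deriv i \<psi>) (\<tau> *\<^sub>R h) s\<bar> \<le> \<tau> * (B i * norm h)"
          using B[of i "\<tau> *\<^sub>R h" s] \<tau> by (simp add: mult_ac)
        also have "\<dots> \<le> 1 * (B i * norm h)" using \<tau> B0 by (intro mult_right_mono) auto
        finally show ?thesis by simp
      qed
      then show "\<bar>?g' \<tau>\<bar> \<le> norm h * (\<Sum>i\<in>UNIV. B i * norm h)"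
        using sum_component_bound[where f="\<lambda>i. taylor1 (partial_deriv i \<psi>) (\<tau> *\<^sub>R h) s" and B="\<lambda>i. B i * norm h"] by simp
    qed
    then show ?thesis by (simp add: taylor2_def power2_eq_square sum_distrib_right[symmetric] mult_ac)
  qed
  then show ?thesis by blast
qed

lemma taylor3_bound:
  fixes \<psi> :: "real ^ 'n \<Rightarrow> real"
  assumes \<psi>: "test_function \<psi>" shows "\<exists>C. \<forall>h s. \<bar>taylor3 \<psi> h s\<bar> \<le> C * norm h ^ 3"
proof -
  have "\<exists>B. \<forall>h s. \<bar>taylor2 (partial_deriv i \<psi>) h s\<bar> \<le> B * norm h ^ 2" for i
    by (rule taylor2_bound[OF test_function_partial[OF \<psi>, of i]])
  then obtain B where B: "\<And>i h s. \<bar>taylor2 (partial_deriv i \<psi>) h s\<bar> \<le> B i * norm h ^ 2" by metis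
  have "\<bar>taylor3 \<psi> h s\<bar> \<le> (\<Sum>i\<in>UNIV. B i) * norm h ^ 3" for h s
  proof -
    let ?q = "\<Sum>i\<in>UNIV. h $ i * (\<Sum>j\<in>UNIV. h $ j * partial_deriv j (partial_deriv i \<psi>) s)"
    let ?g = "\<lambda>\<tau>. \<psi> (s - \<tau> *\<^sub>R h) - \<psi> s + \<tau> * (\<Sum>i\<in>UNIV. h $ i * partial_deriv i \<psi> s) - \<tau>\<^sup>2 * (?q / 2)"
    let ?g' = "\<lambda>\<tau>. - (\<Sum>i\<in>UNIV. h $ i * taylor2 (partial_deriv i \<psi>) (\<tau> *\<^sub>R h) s)"
    have "\<bar>?g 1 - ?g 0\<bar> \<le> norm h * (\<Sum>i\<in>UNIV. B i * norm h ^ 2)"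
    proof (rule unit_interval_mean_value[of ?g ?g'])
      show "(?g has_real_derivative ?g' \<tau>) (at \<tau>)" for \<tau>
        by (rule derivative_eq_intros path_derivative[OF \<psi>] refl)+
           (simp add: taylor2_def sum_subtractf sum.distrib algebra_simps sum_distrib_left)
      fix \<tau> :: real assume \<tau>: "0 \<le> \<tau>" "\<tau> \<le> 1"
      have B0: "B i * norm h ^ 2 \<ge> 0" for i using B[of i h s] by linarith
      have "\<bar>taylor2 (partial_deriv i \<psi>) (\<tau> *\<^sub>R h) s\<bar> \<le> B i * norm h ^ 2" for i
      proof -
        have "\<bar>taylor2 (partial_deriv i \<psi>) (\<tau> *\<^sub>R h) s\<bar> \<le> \<tau>\<^sup>2 * (B i * norm h ^ 2)"
          using B[of i "\<tau> *\<^sub>R h" s] \<tau> by (simp add: mult_ac power_mult_distrib)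
        also have "\<dots> \<le> 1 * (B i * norm h ^ 2)" using \<tau> B0 by (intro mult_right_mono power_le_one) auto
        finally show ?thesis by simp
      qed
      then show "\<bar>?g' \<tau>\<bar> \<le> norm h * (\<Sum>i\<in>UNIV. B i * norm h ^ 2)"
        using sum_component_bound[where f="\<lambda>i. taylor2 (partial_deriv i \<psi>) (\<tau> *\<^sub>R h) s" and B="\<lambda>i. B i * norm h ^ 2"] by simp
    qed
    then show ?thesis by (simp add: taylor3_def power2_eq_square power3_eq_cube sum_distrib_right[symmetric] mult_ac)
  qed
  then show ?thesis by blast
qed

text \<open>Better than the cubic bound for large h, and integrable against \<open>a\<close>, whose
  moments are finite up to order two only. It serves as the majorant when the cubic bound is passed
  to the limit.\<close>

lemma taylor3_bound2:
  fixes \<psi> :: "real ^ 'n \<Rightarrow> real"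
  assumes \<psi>: "test_function \<psi>" shows "\<exists>C. \<forall>h s. \<bar>taylor3 \<psi> h s\<bar> \<le> C * norm h ^ 2"
proof -
  obtain B where B: "\<And>h s. \<bar>taylor2 \<psi> h s\<bar> \<le> B * norm h ^ 2" using taylor2_bound[OF \<psi>] by blast
  have "\<exists>D. \<forall>x. \<bar>partial_deriv j (partial_deriv i \<psi>) x\<bar> \<le> D" for i j
    by (rule test_function_bounded[OF test_function_partial[OF test_function_partial[OF \<psi>, of i], of j]]) blast
  then have "\<forall>i j. \<exists>D. \<forall>x. \<bar>partial_deriv j (partial_deriv i \<psi>) x\<bar> \<le> D" by blast
  then obtain D where D: "\<And>i j x. \<bar>partial_deriv j (partial_deriv i \<psi>) x\<bar> \<le> D i j" unfolding choice_iff by blast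
  have "\<bar>taylor3 \<psi> h s\<bar> \<le> (B + (\<Sum>i\<in>UNIV. \<Sum>j\<in>UNIV. D i j) / 2) * norm h ^ 2" for h s
  proof -
    let ?q = "\<Sum>i\<in>UNIV. h $ i * (\<Sum>j\<in>UNIV. h $ j * partial_deriv j (partial_deriv i \<psi>) s)"
    have "\<bar>?q\<bar> \<le> norm h * (\<Sum>i\<in>UNIV. norm h * (\<Sum>j\<in>UNIV. D i j))"
      by (intro sum_component_bound) (rule D)
    then have "\<bar>?q\<bar> \<le> (\<Sum>i\<in>UNIV. \<Sum>j\<in>UNIV. D i j) * norm h ^ 2"
      by (simp add: sum_distrib_left[symmetric] power2_eq_square mult_ac)
    moreover have "taylor3 \<psi> h s = taylor2 \<psi> h s - ?q / 2" by (simp add: taylor3_def taylor2_def)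
    ultimately show ?thesis using B[of h s] by (simp add: distrib_right)
  qed
  then show ?thesis by blast
qed

text \<open>The three remainders vanish off the same two balls, so each pointwise bound by a power
  of \<open>norm h\<close> turns into an L1 bound with a constant free of h.\<close>

lemma taylor_L1:
  fixes T :: "(real ^ 'n \<Rightarrow> real) \<Rightarrow> real ^ 'n \<Rightarrow> real ^ 'n \<Rightarrow> real"
  assumes \<psi>: "test_function \<psi>" and T: "T = taylor1 \<or> T = taylor2 \<or> T = taylor3"
    and bound: "\<exists>C. \<forall>h s. \<bar>T \<psi> h s\<bar> \<le> C * norm h ^ m"
  obtains C where "C > 0" "\<And>h. (\<integral>\<^sup>+s. ennreal \<bar>T \<psi> h s\<bar> \<partial>lborel) \<le> ennreal (C * norm h ^ m)"
proof -
  obtain R where R: "R > 0" "\<And>x. norm x > R \<Longrightarrow> \<psi> x = 0" by (rule test_function_support[OF \<psi>]) blast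
  obtain B where B: "\<And>h s. \<bar>T \<psi> h s\<bar> \<le> B * norm h ^ m" using bound by blast
  let ?v = "measure lborel (cball 0 R :: (real ^ 'n) set)"
  have p1: "partial_deriv i \<psi> x = 0" if "norm x > R" for x i
    by (rule partial_deriv_outside[OF R(2) that])
  have p2: "partial_deriv j (partial_deriv i \<psi>) x = 0" if "norm x > R" for x i j
    using partial_deriv_outside[of R, OF p1 that] .
  have "(\<integral>\<^sup>+s. ennreal \<bar>T \<psi> h s\<bar> \<partial>lborel) \<le> ennreal ((\<bar>2 * ?v * B\<bar> + 1) * norm h ^ m)" for h
  proof -
    have "(\<integral>\<^sup>+s. ennreal \<bar>T \<psi> h s\<bar> \<partial>lborel) \<le> ennreal (2 * ?v * (B * norm h ^ m))"
      by (rule nn_integral_two_balls[OF B, where h=h])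
         (use T in \<open>auto simp: taylor1_def taylor2_def taylor3_def R(2) p1 p2\<close>)
    also have "\<dots> \<le> ennreal ((\<bar>2 * ?v * B\<bar> + 1) * norm h ^ m)"
      unfolding mult.assoc[symmetric] by (intro ennreal_leI mult_right_mono) auto
    finally show ?thesis .
  qed
  then show thesis by (intro that[of "\<bar>2 * ?v * B\<bar> + 1"]) auto
qed

subsection \<open>Weak derivatives and convolution\<close>

lemma integral_lebesgue_representative:
  fixes f f' g :: "real ^ 'n \<Rightarrow> real"
  assumes "AE x in lebesgue. f x = f' x" "f \<in> borel_measurable lebesgue"
    and [measurable]: "f' \<in> borel_measurable borel" "g \<in> borel_measurable borel"
  shows "(LINT x|lebesgue. f x * g x) = (LINT x|lborel. f' x * g x)"
proof -
  have g: "g \<in> borel_measurable lebesgue" "f' \<in> borel_measurable lebesgue"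
    by (auto intro: measurable_completion)
  have "(LINT x|lebesgue. f x * g x) = (LINT x|lebesgue. f' x * g x)"
    using assms(1,2) g by (intro integral_cong_AE) auto
  also have "\<dots> = (LINT x|lborel. f' x * g x)" by (rule integral_completion) measurable
  finally show ?thesis .
qed

text \<open>The weak derivative is tested with y \<mapsto> \<psi> (x - y). The reflection reverses
  the sign of the derivative and so cancels the minus of integration by parts.\<close>

lemma weak_partial_deriv_conv:
  fixes f g f' g' :: "real ^ 'n \<Rightarrow> real"
  assumes w: "weak_partial_deriv i f g" and \<psi>: "test_function \<psi>"
    and f: "AE x in lebesgue. f x = f' x" "f \<in> borel_measurable lebesgue" "f' \<in> borel_measurable borel"
    and g: "AE x in lebesgue. g x = g' x" "g \<in> borel_measurable lebesgue" "g' \<in> borel_measurable borel"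
  shows "conv g' \<psi> x = conv f' (partial_deriv i \<psi>) x"
proof -
  let ?\<eta> = "\<lambda>y. \<psi> (x + (-1) *\<^sub>R y)"
  have \<eta>: "test_function ?\<eta>" by (rule test_function_affine[OF \<psi>]) simp
  have d: "partial_deriv i ?\<eta> y = - partial_deriv i \<psi> (x - y)" for y
    using partial_deriv_affine(2)[OF test_function_differentiable[OF \<psi>], where c=x and s="-1" and x=y and i=i] by simp
  note [measurable] = test_function_borel[OF test_function_partial[OF \<psi>, of i]] test_function_borel[OF \<psi>]
  have "(LINT y|lborel. f' y * (- partial_deriv i \<psi> (x - y))) = - (LINT y|lborel. g' y * \<psi> (x - y))"
  proof -
    have "(LINT y|lborel. f' y * (- partial_deriv i \<psi> (x - y))) = (LINT y|lebesgue. f y * (- partial_deriv i \<psi> (x - y)))"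
      by (rule integral_lebesgue_representative[OF f, symmetric]) measurable
    also have "\<dots> = - (LINT y|lebesgue. g y * \<psi> (x - y))"
      using w[unfolded weak_partial_deriv_def, rule_format, OF \<eta>] unfolding d by simp
    also have "(LINT y|lebesgue. g y * \<psi> (x - y)) = (LINT y|lborel. g' y * \<psi> (x - y))"
      by (rule integral_lebesgue_representative[OF g]) measurable
    finally show ?thesis .
  qed
  then show ?thesis by (simp add: conv_def)
qed

subsection \<open>A mollifier\<close>

text \<open>For t > 0 the n-th derivative of exp (-1/t) is this polynomial at 1/t times exp (-1/t).
  The factor \<open>[:0, 0, 1:]\<close> is the square of 1/t coming from the chain rule.\<close>

primrec bump_poly :: "nat \<Rightarrow> real poly" where
  "bump_poly 0 = 1"
| "bump_poly (Suc n) = [:0, 0, 1:] * (bump_poly n - pderiv (bump_poly n))"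

definition bump_deriv :: "nat \<Rightarrow> real \<Rightarrow> real" where
  "bump_deriv n t = (if t > 0 then poly (bump_poly n) (1 / t) * exp (- (1 / t)) else 0)"

lemma poly_times_exp_tendsto_0: "((\<lambda>x::real. poly p x * exp (- x)) \<longlongrightarrow> 0) at_top"
proof -
  have "((\<lambda>x::real. \<Sum>i\<le>degree p. coeff p i * (x ^ i / exp x)) \<longlongrightarrow> (\<Sum>i\<le>degree p. coeff p i * 0)) at_top"
    by (intro tendsto_intros tendsto_power_div_exp_0)
  then show ?thesis by (simp add: poly_altdef exp_minus divide_inverse sum_distrib_right mult.assoc)
qed

lemma bump_deriv_has_derivative: "(bump_deriv n has_real_derivative bump_deriv (Suc n) t) (at t)"
proof -
  consider "t < 0" | "t > 0" | "t = 0" by linarith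
  then show ?thesis
  proof cases
    case 1
    have "((\<lambda>t. 0) has_real_derivative 0) (at t)" by simp
    then have "(bump_deriv n has_real_derivative 0) (at t)"
      by (rule has_field_derivative_transform_within_open[where S="{..<0}"]) (use 1 in \<open>auto simp: bump_deriv_def\<close>)
    then show ?thesis using 1 by (simp add: bump_deriv_def)
  next
    case 2
    have d1: "((\<lambda>t. 1 / t) has_real_derivative - (1 / t\<^sup>2)) (at t)"
      using 2 by (auto intro!: derivative_eq_intros simp: power2_eq_square field_simps)
    have "((\<lambda>t. poly (bump_poly n) (1 / t) * exp (- (1 / t))) has_real_derivative
       poly (pderiv (bump_poly n)) (1 / t) * - (1 / t\<^sup>2) * exp (- (1 / t))
       + exp (- (1 / t)) * - (- (1 / t\<^sup>2)) * poly (bump_poly n) (1 / t)) (at t)"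
      by (intro DERIV_mult DERIV_chain2[OF poly_DERIV d1] DERIV_chain2[OF DERIV_exp DERIV_minus[OF d1]])
    also have "poly (pderiv (bump_poly n)) (1 / t) * - (1 / t\<^sup>2) * exp (- (1 / t))
       + exp (- (1 / t)) * - (- (1 / t\<^sup>2)) * poly (bump_poly n) (1 / t) = bump_deriv (Suc n) t"
      using 2 by (simp add: bump_deriv_def power2_eq_square algebra_simps)
    finally have "((\<lambda>t. poly (bump_poly n) (1 / t) * exp (- (1 / t))) has_real_derivative bump_deriv (Suc n) t) (at t)" .
    then show ?thesis
      by (rule has_field_derivative_transform_within_open[where S="{0<..}"]) (use 2 in \<open>auto simp: bump_deriv_def\<close>)
  next
    case 3
    \<comment> \<open>At 0 the two one-sided difference quotients are treated separately: the left
      one is 0, the right one is a polynomial in 1/h times exp (-1/h), since division by h only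
      multiplies the polynomial by its variable.\<close>
    have "((\<lambda>h. bump_deriv n h / h) \<longlongrightarrow> 0) (at 0)"
    proof (rule filterlim_split_at)
      have "((\<lambda>h. poly ([:0, 1:] * bump_poly n) (inverse h) * exp (- inverse h)) \<longlongrightarrow> 0) (at_right (0::real))"
        by (rule filterlim_compose[OF poly_times_exp_tendsto_0 filterlim_inverse_at_top_right])
      then show "((\<lambda>h. bump_deriv n h / h) \<longlongrightarrow> 0) (at_right 0)"
        by (rule Lim_transform_eventually)
           (auto simp: eventually_at_right_less bump_deriv_def divide_inverse mult_ac intro!: eventually_mono[OF eventually_at_right_less[of 0]])
      show "((\<lambda>h. bump_deriv n h / h) \<longlongrightarrow> 0) (at_left 0)"
        by (rule Lim_transform_eventually[OF tendsto_const])
           (auto simp: bump_deriv_def eventually_at_filter)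
    qed
    then show ?thesis using 3 by (simp add: has_field_derivative_iff bump_deriv_def)
  qed
qed

lemma mollifier_exists:
  assumes \<delta>: "\<delta> > 0"
  obtains \<rho> :: "real ^ 'n \<Rightarrow> real" where "test_function \<rho>" "\<And>s. \<rho> s \<ge> 0" "(LINT s|lborel. \<rho> s) = 1"
    "\<And>s. norm s > \<delta> \<Longrightarrow> \<rho> s = 0"
proof -
  \<comment> \<open>This is \<delta>^2 minus the squared norm, written in coordinates so that
    smoothness follows from the rules for sums and products. It is positive exactly on the open ball
    of radius \<delta>.\<close>
  let ?q = "\<lambda>x :: real ^ 'n. \<delta>\<^sup>2 + (-1) * (\<Sum>i\<in>UNIV. x $ i * x $ i)"
  define \<psi> where "\<psi> x = bump_deriv 0 (?q x)" for x
  have q: "?q x = \<delta>\<^sup>2 - (norm x)\<^sup>2" for x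
    by (simp add: power2_norm_eq_inner inner_vec_def)
  have cd: "continuously_differentiable k \<psi>" for k
    unfolding \<psi>_def
    by (rule cd_compose[where F=bump_deriv, OF bump_deriv_has_derivative]) (intro cd_add cd_mult cd_const cd_sum cd_coord)
  have supp: "\<psi> s = 0" if "norm s > \<delta>" for s
  proof -
    have "\<delta>\<^sup>2 < (norm s)\<^sup>2" using that \<delta> by (intro power_strict_mono) auto
    then show ?thesis unfolding \<psi>_def q by (simp add: bump_deriv_def)
  qed
  have t: "test_function \<psi>" using cd supp by (auto simp: test_function_iff)
  have nn: "\<psi> s \<ge> 0" for s by (simp add: \<psi>_def bump_deriv_def)
  have pos: "\<psi> s > 0" if "norm s < \<delta>" for s
  proof -
    have "(norm s)\<^sup>2 < \<delta>\<^sup>2" using that by (intro power_strict_mono) auto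
    then show ?thesis unfolding \<psi>_def q by (simp add: bump_deriv_def)
  qed
  have "(LINT s|lborel. \<psi> s) \<noteq> 0"
  proof
    assume "(LINT s|lborel. \<psi> s) = 0"
    then have "AE s in lborel. \<psi> s = 0"
      using integral_nonneg_eq_0_iff_AE[OF test_function_integrable[OF t]] nn by auto
    then have "AE s in lborel. s \<notin> ball (0 :: real ^ 'n) \<delta>" by eventually_elim (use pos in \<open>auto simp: less_le\<close>)
    then have "emeasure lborel (ball (0 :: real ^ 'n) \<delta>) = 0"
      by (subst (asm) AE_iff_measurable[where N="ball 0 \<delta>"]) auto
    then show False
      using content_ball_pos[OF \<delta>, of "0 :: real ^ 'n"] by (simp add: measure_def)
  qed
  moreover have "(LINT s|lborel. \<psi> s) \<ge> 0" using nn by (intro integral_nonneg_AE) auto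
  ultimately have I: "(LINT s|lborel. \<psi> s) > 0" by linarith
  show thesis
  proof (rule that[of "\<lambda>s. (1 / (LINT s|lborel. \<psi> s)) * \<psi> s"])
    show "test_function (\<lambda>s. (1 / (LINT s|lborel. \<psi> s)) * \<psi> s)" by (rule test_function_scale[OF t])
  qed (use I nn supp in auto)
qed

subsection \<open>The lattice and its fundamental cell\<close>

lemma integer_lattice_add: "k \<in> integer_lattice \<Longrightarrow> l \<in> integer_lattice \<Longrightarrow> k + l \<in> integer_lattice"
  by (simp add: integer_lattice_def)

lemma integer_lattice_uminus: "k \<in> integer_lattice \<Longrightarrow> - k \<in> integer_lattice"
  by (simp add: integer_lattice_def)

lemma integer_lattice_eq: "integer_lattice = range (\<lambda>f :: 'n::finite \<Rightarrow> int. (\<chi> i. of_int (f i)) :: real ^ 'n)"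
proof (intro set_eqI iffI)
  fix k :: "real ^ 'n" assume "k \<in> integer_lattice"
  then have "k = (\<lambda>f :: 'n \<Rightarrow> int. (\<chi> i. of_int (f i))) (\<lambda>i. \<lfloor>k $ i\<rfloor>)"
    by (simp add: integer_lattice_def vec_eq_iff)
  then show "k \<in> range (\<lambda>f :: 'n \<Rightarrow> int. (\<chi> i. of_int (f i)))" by (intro range_eqI[of _ _ "\<lambda>i. \<lfloor>k $ i\<rfloor>"]) simp
qed (auto simp: integer_lattice_def)

lemma integer_lattice_enumeration:
  obtains e :: "nat \<Rightarrow> real ^ 'n" where "bij_betw e UNIV integer_lattice"
proof -
  have "countable (integer_lattice :: (real ^ 'n) set)" unfolding integer_lattice_eq by blast
  moreover have "infinite (integer_lattice :: (real ^ 'n) set)"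
  proof
    assume "finite (integer_lattice :: (real ^ 'n) set)"
    moreover have "range (\<lambda>n::nat. (\<chi> i. of_nat n) :: real ^ 'n) \<subseteq> integer_lattice"
      by (auto simp: integer_lattice_def)
    ultimately have "finite (range (\<lambda>n::nat. (\<chi> i. of_nat n) :: real ^ 'n))" by (rule rev_finite_subset)
    moreover have "inj (\<lambda>n::nat. (\<chi> i. of_nat n) :: real ^ 'n)" by (auto simp: inj_def vec_eq_iff)
    ultimately show False using finite_imageD infinite_UNIV_nat by blast
  qed
  ultimately show thesis using that bij_betw_from_nat_into by blast
qed

definition lattice_part :: "real ^ 'n \<Rightarrow> real ^ 'n" where
  "lattice_part x = (\<chi> i. of_int \<lfloor>x $ i\<rfloor>)"

lemma lattice_part: "lattice_part x \<in> integer_lattice" "x - lattice_part x \<in> unit_cell"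
  by (auto simp: lattice_part_def integer_lattice_def unit_cell_def) linarith

lemma lattice_part_unique:
  assumes "k \<in> integer_lattice" "x - k \<in> unit_cell" shows "k = lattice_part x"
proof -
  have "k $ i = of_int \<lfloor>x $ i\<rfloor>" for i
  proof -
    from assms(1) obtain m where m: "k $ i = of_int m" by (auto simp: integer_lattice_def Ints_def)
    have "0 \<le> x $ i - k $ i" "x $ i - k $ i < 1" using assms(2) by (auto simp: unit_cell_def)
    then have "\<lfloor>x $ i\<rfloor> = m" using m by (intro floor_unique) auto
    then show ?thesis using m by simp
  qed
  then show ?thesis by (simp add: lattice_part_def vec_eq_iff)
qed

lemma lattice_part_measurable [measurable]: "lattice_part \<in> borel_measurable borel"
  unfolding borel_measurable_euclidean_space[of lattice_part]
proof
  fix b :: "real ^ 'a" assume "b \<in> Basis"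
  then obtain i where b: "b = axis i 1" by (auto simp: Basis_vec_def)
  have "(\<lambda>x :: real ^ 'a. x $ i) \<in> borel_measurable borel" by (intro borel_measurable_continuous_onI continuous_on_component continuous_on_id)
  then have "(\<lambda>x :: real ^ 'a. real_of_int \<lfloor>x $ i\<rfloor>) \<in> borel_measurable borel" by measurable
  then show "(\<lambda>x. lattice_part x \<bullet> b) \<in> borel_measurable borel" by (simp add: b inner_axis lattice_part_def)
qed

lemma unit_cell_borel [measurable]: "unit_cell \<in> sets borel"
proof -
  have "unit_cell = (\<Inter>i. {x :: real ^ 'a. 0 \<le> x $ i \<and> x $ i < 1})" by (auto simp: unit_cell_def)
  also have "\<dots> \<in> sets borel" by (intro sets.finite_INT) auto
  finally show ?thesis .
qed

lemma emeasure_unit_cell: "emeasure lborel (unit_cell :: (real ^ 'n) set) = 1"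
proof -
  let ?o = "(\<chi> i. 1) :: real ^ 'n"
  have o: "?o \<bullet> b = 1" if "b \<in> Basis" for b using that by (auto simp: Basis_vec_def inner_axis)
  have "box 0 ?o \<subseteq> unit_cell" "unit_cell \<subseteq> cbox 0 ?o"
    by (auto simp: unit_cell_def mem_box_cart less_imp_le)
  then have "emeasure lborel (box 0 ?o) \<le> emeasure lborel (unit_cell :: (real ^ 'n) set)"
    "emeasure lborel (unit_cell :: (real ^ 'n) set) \<le> emeasure lborel (cbox 0 ?o)"
    by (auto intro: emeasure_mono)
  moreover have "emeasure lborel (box 0 ?o) = 1" "emeasure lborel (cbox 0 ?o) = 1"
    by (simp_all add: emeasure_lborel_box_eq emeasure_lborel_cbox_eq o)
  ultimately show ?thesis by (simp add: antisym)
qed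

lemma suminf_indicator_translates:
  fixes e :: "nat \<Rightarrow> real ^ 'n"
  assumes e: "bij_betw e UNIV integer_lattice"
  shows "(\<Sum>i. indicator unit_cell (x - e i) :: ennreal) = 1"
proof -
  obtain i0 where i0: "e i0 = lattice_part x"
    using e lattice_part(1)[of x] by (metis bij_betw_imp_surj_on imageE)
  have "indicator unit_cell (x - e i) = (if i = i0 then 1 else 0 :: ennreal)" for i
  proof (cases "i = i0")
    case False
    then have "e i \<noteq> lattice_part x" using e i0 by (metis bij_betw_imp_inj_on injD)
    then have "x - e i \<notin> unit_cell" using lattice_part_unique[of "e i" x] bij_betwE[OF e] by auto
    then show ?thesis using False by simp
  qed (simp add: i0 lattice_part)
  then have "(\<lambda>i. indicator unit_cell (x - e i) :: ennreal) sums 1"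
    using sums_single[of i0 "\<lambda>_. 1 :: ennreal"] by simp
  then show ?thesis by (rule sums_unique[symmetric])
qed

lemma nn_integral_tiling:
  fixes e :: "nat \<Rightarrow> real ^ 'n"
  assumes e: "bij_betw e UNIV integer_lattice" and [measurable]: "f \<in> borel_measurable borel"
  shows "(\<integral>\<^sup>+x. f x \<partial>lborel) = (\<Sum>i. \<integral>\<^sup>+x\<in>unit_cell. f (x + e i) \<partial>lborel)"
proof -
  have "(\<integral>\<^sup>+x. f x \<partial>lborel) = (\<integral>\<^sup>+x. (\<Sum>i. f x * indicator unit_cell (x - e i)) \<partial>lborel)"
    by (simp only: ennreal_suminf_cmult suminf_indicator_translates[OF e] mult_1_right)
  also have "\<dots> = (\<Sum>i. \<integral>\<^sup>+x. f x * indicator unit_cell (x - e i) \<partial>lborel)"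
    by (rule nn_integral_suminf) measurable
  also have "\<dots> = (\<Sum>i. \<integral>\<^sup>+x. f (x + e i) * indicator unit_cell x \<partial>lborel)"
  proof (rule suminf_cong)
    fix i
    show "(\<integral>\<^sup>+x. f x * indicator unit_cell (x - e i) \<partial>lborel) = (\<integral>\<^sup>+x. f (x + e i) * indicator unit_cell x \<partial>lborel)"
      using nn_integral_translate(1)[of "\<lambda>x. f x * indicator unit_cell (x - e i)" "e i"] by simp
  qed
  finally show ?thesis .
qed

lemma bij_betw_uminus_lattice:
  fixes e :: "nat \<Rightarrow> real ^ 'n"
  assumes "bij_betw e UNIV integer_lattice" shows "bij_betw (\<lambda>i. - e i) UNIV integer_lattice"
proof -
  have "bij_betw uminus integer_lattice (integer_lattice :: (real ^ 'n) set)"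
    by (rule bij_betwI[where g=uminus]) (auto intro: integer_lattice_uminus)
  from bij_betw_trans[OF assms this] show ?thesis by (simp add: o_def)
qed

text \<open>The inner integral over the whole space is cut into lattice translates of the cell;
  joint periodicity moves the translation from y to x with the opposite sign; then the pieces are
  put together again in the other variable. This is what makes two operators with kernels on the
  whole space adjoint on the torus.\<close>

lemma nn_integral_cell_swap:
  fixes H :: "real ^ 'n \<Rightarrow> real ^ 'n \<Rightarrow> ennreal"
  assumes [measurable]: "(\<lambda>(x, y). H x y) \<in> borel_measurable (borel \<Otimes>\<^sub>M borel)"
    and per: "\<And>x y k. k \<in> integer_lattice \<Longrightarrow> H (x + k) (y + k) = H x y"
  shows "(\<integral>\<^sup>+x\<in>unit_cell. (\<integral>\<^sup>+y. H x y \<partial>lborel) \<partial>lborel) = (\<integral>\<^sup>+y\<in>unit_cell. (\<integral>\<^sup>+x. H x y \<partial>lborel) \<partial>lborel)"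
proof -
  obtain e :: "nat \<Rightarrow> real ^ 'n" where e: "bij_betw e UNIV integer_lattice" by (rule integer_lattice_enumeration)
  let ?C = "indicator unit_cell :: real ^ 'n \<Rightarrow> ennreal"
  have eL: "e i \<in> integer_lattice" for i using e by (auto simp: bij_betw_def)
  have "(\<integral>\<^sup>+x. (\<integral>\<^sup>+y. H x y \<partial>lborel) * ?C x \<partial>lborel) = (\<integral>\<^sup>+x. (\<Sum>i. (\<integral>\<^sup>+y. H x (y + e i) * ?C y \<partial>lborel) * ?C x) \<partial>lborel)"
  proof -
    have "(\<integral>\<^sup>+y. H x y \<partial>lborel) = (\<Sum>i. \<integral>\<^sup>+y\<in>unit_cell. H x (y + e i) \<partial>lborel)" for x
      by (rule nn_integral_tiling[OF e]) measurable
    then show ?thesis by (simp only: ennreal_suminf_multc)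
  qed
  also have "\<dots> = (\<Sum>i. \<integral>\<^sup>+x. (\<integral>\<^sup>+y. H x (y + e i) * ?C y \<partial>lborel) * ?C x \<partial>lborel)"
    by (rule nn_integral_suminf) measurable
  also have "\<dots> = (\<Sum>i. \<integral>\<^sup>+y. (\<integral>\<^sup>+x. H (x + - e i) y * ?C x \<partial>lborel) * ?C y \<partial>lborel)"
  proof (rule suminf_cong)
    fix i
    have H: "H x (y + e i) = H (x + - e i) y" for x y
      using per[OF eL[of i], of "x + - e i" y] by simp
    have "(\<integral>\<^sup>+x. (\<integral>\<^sup>+y. H x (y + e i) * ?C y \<partial>lborel) * ?C x \<partial>lborel) = (\<integral>\<^sup>+x. (\<integral>\<^sup>+y. H (x + - e i) y * ?C y * ?C x \<partial>lborel) \<partial>lborel)"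
      unfolding H by (subst nn_integral_multc) auto
    also have "\<dots> = (\<integral>\<^sup>+y. (\<integral>\<^sup>+x. H (x + - e i) y * ?C y * ?C x \<partial>lborel) \<partial>lborel)"
      by (rule lborel_pair.Fubini') measurable
    also have "\<dots> = (\<integral>\<^sup>+y. (\<integral>\<^sup>+x. H (x + - e i) y * ?C x * ?C y \<partial>lborel) \<partial>lborel)"
      by (simp add: mult_ac)
    also have "\<dots> = (\<integral>\<^sup>+y. (\<integral>\<^sup>+x. H (x + - e i) y * ?C x \<partial>lborel) * ?C y \<partial>lborel)"
      by (subst nn_integral_multc) auto
    finally show "(\<integral>\<^sup>+x. (\<integral>\<^sup>+y. H x (y + e i) * ?C y \<partial>lborel) * ?C x \<partial>lborel)
      = (\<integral>\<^sup>+y. (\<integral>\<^sup>+x. H (x + - e i) y * ?C x \<partial>lborel) * ?C y \<partial>lborel)" .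
  qed
  also have "\<dots> = (\<integral>\<^sup>+y. (\<Sum>i. (\<integral>\<^sup>+x. H (x + - e i) y * ?C x \<partial>lborel) * ?C y) \<partial>lborel)"
    by (rule nn_integral_suminf[symmetric]) measurable
  also have "\<dots> = (\<integral>\<^sup>+y. (\<integral>\<^sup>+x. H x y \<partial>lborel) * ?C y \<partial>lborel)"
  proof -
    have "(\<integral>\<^sup>+x. H x y \<partial>lborel) = (\<Sum>i. \<integral>\<^sup>+x\<in>unit_cell. H (x + - e i) y \<partial>lborel)" for y
      by (rule nn_integral_tiling[OF bij_betw_uminus_lattice[OF e]]) measurable
    then show ?thesis by (simp only: ennreal_suminf_multc)
  qed
  finally show ?thesis .
qed

definition periodic :: "(real ^ 'n \<Rightarrow> 'a) \<Rightarrow> bool" where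
  "periodic f \<longleftrightarrow> (\<forall>k\<in>integer_lattice. \<forall>x. f (x + k) = f x)"

lemma periodicD: "periodic f \<Longrightarrow> k \<in> integer_lattice \<Longrightarrow> f (x + k) = f x"
  "periodic f \<Longrightarrow> k \<in> integer_lattice \<Longrightarrow> f (x - k) = f x"
  using integer_lattice_uminus[of k] by (auto simp: periodic_def)

text \<open>The reflected cell is again a fundamental domain: cut along the lattice and moved back,
  its pieces fill the standard cell exactly once.\<close>

lemma nn_integral_cell_reflect:
  fixes f :: "real ^ 'n \<Rightarrow> ennreal"
  assumes [measurable]: "f \<in> borel_measurable borel" and f: "periodic f"
  shows "(\<integral>\<^sup>+w\<in>unit_cell. f (x - w) \<partial>lborel) = (\<integral>\<^sup>+w\<in>unit_cell. f w \<partial>lborel)"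
proof -
  obtain e :: "nat \<Rightarrow> real ^ 'n" where e: "bij_betw e UNIV integer_lattice" by (rule integer_lattice_enumeration)
  let ?C = "indicator unit_cell :: real ^ 'n \<Rightarrow> ennreal"
  have eL: "e i \<in> integer_lattice" for i using e by (auto simp: bij_betw_def)
  have "(\<integral>\<^sup>+w. f (x - w) * ?C w \<partial>lborel) = (\<integral>\<^sup>+v. f v * ?C (x - v) \<partial>lborel)"
    using nn_integral_reflect[of "\<lambda>w. f (x - w) * ?C w" x] by simp
  also have "\<dots> = (\<Sum>i. \<integral>\<^sup>+v. f v * ?C (x - v - e i) * ?C v \<partial>lborel)"
    by (subst nn_integral_tiling[OF e]) (simp_all add: periodicD[OF f eL] diff_diff_add)
  also have "\<dots> = (\<integral>\<^sup>+v. (\<Sum>i. f v * ?C (x - v - e i) * ?C v) \<partial>lborel)"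
    by (rule nn_integral_suminf[symmetric]) measurable
  also have "\<dots> = (\<integral>\<^sup>+v. f v * ?C v \<partial>lborel)"
    by (simp only: ennreal_suminf_cmult ennreal_suminf_multc suminf_indicator_translates[OF e] mult_1_right)
  finally show ?thesis .
qed

lemma nn_integral_translated_cell:
  fixes f :: "real ^ 'n \<Rightarrow> ennreal"
  assumes [measurable]: "f \<in> borel_measurable borel" and f: "periodic f" and k: "k \<in> integer_lattice"
  shows "(\<integral>\<^sup>+x. f x * indicator unit_cell (x - k) \<partial>lborel) = (\<integral>\<^sup>+x\<in>unit_cell. f x \<partial>lborel)"
  using nn_integral_translate(1)[of "\<lambda>x. f x * indicator unit_cell (x - k)" k] by (simp add: periodicD[OF f k])

lemma AE_periodic:
  fixes P :: "real ^ 'n \<Rightarrow> bool"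
  assumes [measurable]: "Measurable.pred borel P" and per: "periodic P" and ae: "AE x in lborel. x \<in> unit_cell \<longrightarrow> P x"
  shows "AE x in lborel. P x"
proof -
  obtain e :: "nat \<Rightarrow> real ^ 'n" where e: "bij_betw e UNIV integer_lattice" by (rule integer_lattice_enumeration)
  have eL: "e i \<in> integer_lattice" for i using e by (auto simp: bij_betw_def)
  let ?f = "\<lambda>x. indicator {x. \<not> P x} x :: ennreal"
  have [measurable]: "{x. \<not> P x} \<in> sets borel" by measurable
  have "(\<integral>\<^sup>+x. ?f x \<partial>lborel) = (\<Sum>i. \<integral>\<^sup>+x\<in>unit_cell. ?f (x + e i) \<partial>lborel)"
    by (rule nn_integral_tiling[OF e]) measurable
  also have "\<dots> = (\<Sum>i::nat. 0)"
  proof (rule suminf_cong)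
    fix i
    have "AE x in lborel. ?f (x + e i) * indicator unit_cell x = 0"
      using ae by eventually_elim (auto simp: indicator_def periodicD(1)[OF per eL])
    then show "(\<integral>\<^sup>+x\<in>unit_cell. ?f (x + e i) \<partial>lborel) = 0"
      by (subst nn_integral_0_iff_AE) auto
  qed
  finally have "(\<integral>\<^sup>+x. ?f x \<partial>lborel) = 0" by simp
  then have "AE x in lborel. ?f x = 0" by (subst (asm) nn_integral_0_iff_AE) auto
  then show ?thesis by eventually_elim (auto simp: indicator_def split: if_splits)
qed

subsection \<open>Bounded periodic functions\<close>

text \<open>Functions rather than classes, with a bound at every point: iterates of the chain,
  uniform limits and cell equations are then meant pointwise, and multiplication by such a function
  after any rescaling is bounded on L2 with the same constant.\<close>

definition BP :: "(real ^ 'n \<Rightarrow> real) set" where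
  "BP = {f. f \<in> borel_measurable borel \<and> periodic f \<and> (\<exists>C. \<forall>x. \<bar>f x\<bar> \<le> C)}"

lemma BP_measurable: "f \<in> BP \<Longrightarrow> f \<in> borel_measurable borel" by (simp add: BP_def)
lemma BP_periodic: "f \<in> BP \<Longrightarrow> periodic f" by (simp add: BP_def)
lemma BP_bounded: assumes "f \<in> BP" obtains C where "C > 0" "\<And>x. \<bar>f x\<bar> \<le> C"
proof -
  obtain C where C: "\<And>x. \<bar>f x\<bar> \<le> C" using assms by (auto simp: BP_def)
  have "\<bar>f x\<bar> \<le> max C 1" for x using C[of x] by linarith
  then show thesis by (intro that[of "max C 1"]) auto
qed
lemma BP_I: "f \<in> borel_measurable borel \<Longrightarrow> (\<And>k x. k \<in> integer_lattice \<Longrightarrow> f (x + k) = f x) \<Longrightarrow> (\<And>x. \<bar>f x\<bar> \<le> C) \<Longrightarrow> f \<in> BP"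
  by (auto simp: BP_def periodic_def)

lemma BP_const: "(\<lambda>x. c) \<in> BP" by (rule BP_I[where C="\<bar>c\<bar>"]) auto

lemma BP_add: assumes f: "f \<in> BP" and g: "g \<in> BP" shows "(\<lambda>x. f x + g x) \<in> BP"
proof -
  obtain C D where "\<And>x. \<bar>f x\<bar> \<le> C" "\<And>x. \<bar>g x\<bar> \<le> D" using BP_bounded[OF f] BP_bounded[OF g] by metis
  then have "\<bar>f x + g x\<bar> \<le> C + D" for x by (intro order_trans[OF abs_triangle_ineq] add_mono)
  then show ?thesis using BP_measurable[OF f] BP_measurable[OF g] BP_periodic[OF f] BP_periodic[OF g]
    by (intro BP_I) (auto simp: periodicD)
qed

lemma BP_mult: assumes f: "f \<in> BP" and g: "g \<in> BP" shows "(\<lambda>x. f x * g x) \<in> BP"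
proof -
  obtain C D where "\<And>x. \<bar>f x\<bar> \<le> C" "\<And>x. \<bar>g x\<bar> \<le> D" "C > 0" using BP_bounded[OF f] BP_bounded[OF g] by metis
  then have "\<bar>f x * g x\<bar> \<le> C * D" for x by (simp add: abs_mult mult_mono)
  then show ?thesis using BP_measurable[OF f] BP_measurable[OF g] BP_periodic[OF f] BP_periodic[OF g]
    by (intro BP_I) (auto simp: periodicD)
qed

lemma BP_scale: "f \<in> BP \<Longrightarrow> (\<lambda>x. c * f x) \<in> BP" by (rule BP_mult[OF BP_const])
lemma BP_diff: "f \<in> BP \<Longrightarrow> g \<in> BP \<Longrightarrow> (\<lambda>x. f x - g x) \<in> BP"
  using BP_add[of f "\<lambda>x. (-1) * g x"] BP_scale[of g "-1"] by simp
lemma BP_sum: "(\<And>i. i \<in> I \<Longrightarrow> f i \<in> BP) \<Longrightarrow> (\<lambda>x. \<Sum>i\<in>I. f i x) \<in> BP"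
  by (induction I rule: infinite_finite_induct) (auto intro: BP_add BP_const)

lemma BP_comp:
  assumes f: "f \<in> BP" and [measurable]: "h \<in> borel_measurable borel" and h: "\<And>t. \<bar>h t\<bar> \<le> \<bar>t\<bar> + D"
  shows "(\<lambda>x. h (f x)) \<in> BP"
proof -
  obtain C where C: "\<And>x. \<bar>f x\<bar> \<le> C" using BP_bounded[OF f] by metis
  have [measurable]: "f \<in> borel_measurable borel" by (rule BP_measurable[OF f])
  have "\<bar>h (f x)\<bar> \<le> C + D" for x using C[of x] h[of "f x"] by linarith
  then show ?thesis using BP_periodic[OF f] by (intro BP_I) (auto simp: periodicD)
qed

lemma BP_divide:
  assumes f: "f \<in> BP" and g: "g \<in> BP" and c: "c > 0" "\<And>x. g x \<ge> c"
  shows "(\<lambda>x. f x / g x) \<in> BP"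
proof -
  obtain C where C: "C > 0" "\<And>x. \<bar>f x\<bar> \<le> C" using BP_bounded[OF f] by metis
  have "\<bar>f x / g x\<bar> \<le> C / c" for x
    using C c(1) c(2)[of x] by (simp add: frac_le)
  then show ?thesis using BP_measurable[OF f] BP_measurable[OF g] BP_periodic[OF f] BP_periodic[OF g]
    by (intro BP_I) (auto simp: periodicD)
qed

definition cint :: "(real ^ 'n \<Rightarrow> real) \<Rightarrow> real" where
  "cint f = (LINT x|lborel. indicator unit_cell x * f x)"

lemma BP_cell_integrable: assumes f: "f \<in> BP" shows "integrable lborel (\<lambda>x. indicator unit_cell x * f x)"
proof -
  obtain C where C: "C > 0" "\<And>x. \<bar>f x\<bar> \<le> C" by (rule BP_bounded[OF f]) blast
  have [measurable]: "f \<in> borel_measurable borel" by (rule BP_measurable[OF f])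
  have "integrable lborel (\<lambda>x. indicator (unit_cell :: (real ^ 'a) set) x * C)"
    by (intro integrable_mult_left integrable_real_indicator) (auto simp: emeasure_unit_cell)
  then show ?thesis
    by (rule Bochner_Integration.integrable_bound) (use C in \<open>auto simp: indicator_def intro!: AE_I2\<close>)
qed

lemma cint_add: "f \<in> BP \<Longrightarrow> g \<in> BP \<Longrightarrow> cint (\<lambda>x. f x + g x) = cint f + cint g"
  by (simp add: cint_def distrib_left BP_cell_integrable)
lemma cint_diff: "f \<in> BP \<Longrightarrow> g \<in> BP \<Longrightarrow> cint (\<lambda>x. f x - g x) = cint f - cint g"
  by (simp add: cint_def right_diff_distrib BP_cell_integrable)
lemma cint_scale: "cint (\<lambda>x. c * f x) = c * cint f"
  by (simp add: cint_def mult.left_commute[of _ c])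
lemma cint_const: "cint (\<lambda>x :: real ^ 'n. c) = c"
  using emeasure_unit_cell[where 'n='n] by (simp add: cint_def measure_def)
lemma cint_sum: "(\<And>i. i \<in> I \<Longrightarrow> f i \<in> BP) \<Longrightarrow> cint (\<lambda>x. \<Sum>i\<in>I. f i x) = (\<Sum>i\<in>I. cint (f i))"
  by (simp add: cint_def sum_distrib_left BP_cell_integrable)
lemma cint_mono: "f \<in> BP \<Longrightarrow> g \<in> BP \<Longrightarrow> (\<And>x. f x \<le> g x) \<Longrightarrow> cint f \<le> cint g"
  unfolding cint_def by (intro integral_mono BP_cell_integrable mult_left_mono) auto
lemma cint_nonneg: "(\<And>x. f x \<ge> 0) \<Longrightarrow> cint f \<ge> 0"
  unfolding cint_def by (intro integral_nonneg_AE) auto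
lemma cint_abs: fixes f :: "real ^ 'n \<Rightarrow> real" assumes "f \<in> BP" "\<And>x. \<bar>f x\<bar> \<le> C" shows "\<bar>cint f\<bar> \<le> C"
proof -
  have "cint f \<le> cint (\<lambda>x :: real ^ 'n. C)"
    by (intro cint_mono BP_const assms(1)) (use assms(2) in \<open>simp add: abs_le_iff\<close>)
  moreover have "cint (\<lambda>x :: real ^ 'n. - C) \<le> cint f"
    by (intro cint_mono BP_const assms(1)) (use assms(2) in \<open>simp add: abs_le_iff minus_le_iff\<close>)
  ultimately show ?thesis by (simp add: cint_const abs_le_iff)
qed
lemma ennreal_cint: assumes "f \<in> BP" "\<And>x. f x \<ge> 0"
  shows "(\<integral>\<^sup>+x\<in>unit_cell. ennreal (f x) \<partial>lborel) = ennreal (cint f)"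
proof -
  have "(\<integral>\<^sup>+x\<in>unit_cell. ennreal (f x) \<partial>lborel) = (\<integral>\<^sup>+x. ennreal (indicator unit_cell x * f x) \<partial>lborel)"
    by (intro nn_integral_cong) (auto simp: indicator_def)
  also have "\<dots> = ennreal (cint f)"
    unfolding cint_def using assms by (intro nn_integral_eq_integral BP_cell_integrable) auto
  finally show ?thesis .
qed

subsection \<open>Minorization\<close>

text \<open>Although \<open>a\<close> may be discontinuous and vanish on large sets, the convolution
  of an integrable bounded function with itself is continuous, by continuity of translations in L1.
  Its total integral is the square of that of the function, so it is positive at some point and
  hence bounded below near it.\<close>

lemma autoconvolution_lower_bound:
  fixes a :: "'a::euclidean_space \<Rightarrow> real"
  assumes a: "integrable lborel a" "\<And>z. a z \<ge> 0" "(LINT z|lborel. a z) > 0"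
  obtains x0 r c where "r > 0" "c > 0"
    "\<And>x. norm (x - x0) < r \<Longrightarrow> ennreal c \<le> (\<integral>\<^sup>+w. ennreal (a (x - w)) * ennreal (a w) \<partial>lborel)"
proof -
  have [measurable]: "a \<in> borel_measurable borel" using a(1) by auto
  \<comment> \<open>Truncation makes all values of the autoconvolution finite and bounds its
    increments by the L1 modulus of continuity of b.\<close>
  define b where "b w = min (a w) 1" for w
  have [measurable]: "b \<in> borel_measurable borel" unfolding b_def[abs_def] by measurable
  have b: "b w \<ge> 0" "b w \<le> 1" "b w \<le> a w" for w using a(2)[of w] by (auto simp: b_def)
  have ib: "integrable lborel b"
    by (rule Bochner_Integration.integrable_bound[OF a(1)]) (use b a(2) in \<open>auto\<close>)
  define B where "B x = (LINT w|lborel. b (x - w) * b w)" for x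
  have i2: "integrable lborel (\<lambda>w. b (x - w) * b w)" for x
    by (rule Bochner_Integration.integrable_bound[OF ib]) (use b in \<open>auto simp: abs_mult intro!: mult_left_le_one_le\<close>)
  have Bnn: "ennreal (B x) = (\<integral>\<^sup>+w. ennreal (b (x - w)) * ennreal (b w) \<partial>lborel)" for x
    unfolding B_def using b i2 by (subst nn_integral_eq_integral[symmetric]) (auto simp: ennreal_mult)
  have "(\<integral>\<^sup>+w. ennreal (b w) \<partial>lborel) \<noteq> 0"
  proof
    assume "(\<integral>\<^sup>+w. ennreal (b w) \<partial>lborel) = 0"
    then have "AE w in lborel. ennreal (b w) = 0" by (subst (asm) nn_integral_0_iff_AE) auto
    then have "AE w in lborel. a w = 0" by eventually_elim (use a(2) in \<open>auto simp: b_def min_def ennreal_eq_0_iff antisym split: if_splits\<close>)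
    then have "(LINT z|lborel. a z) = 0" by (simp add: integral_eq_zero_AE)
    then show False using a(3) by simp
  qed
  moreover have "(\<integral>\<^sup>+x. ennreal (B x) \<partial>lborel) = (\<integral>\<^sup>+w. ennreal (b w) \<partial>lborel) * (\<integral>\<^sup>+w. ennreal (b w) \<partial>lborel)"
  proof -
    have "(\<integral>\<^sup>+x. ennreal (B x) \<partial>lborel) = (\<integral>\<^sup>+w. (\<integral>\<^sup>+x. ennreal (b (x - w)) * ennreal (b w) \<partial>lborel) \<partial>lborel)"
      unfolding Bnn by (rule lborel_pair.Fubini') measurable
    also have "\<dots> = (\<integral>\<^sup>+w. (\<integral>\<^sup>+w. ennreal (b w) \<partial>lborel) * ennreal (b w) \<partial>lborel)"
      by (simp add: nn_integral_multc nn_integral_translate(3)[of "\<lambda>x. ennreal (b x)"])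
    also have "\<dots> = (\<integral>\<^sup>+w. ennreal (b w) \<partial>lborel) * (\<integral>\<^sup>+w. ennreal (b w) \<partial>lborel)"
      by (rule nn_integral_cmult) measurable
    finally show ?thesis .
  qed
  ultimately have "(\<integral>\<^sup>+x. ennreal (B x) \<partial>lborel) \<noteq> 0" by simp
  then obtain x0 where x0: "B x0 > 0"
    using nn_integral_0_iff_AE by (metis (no_types, lifting) ennreal_neg nn_integral_0_iff_AE nn_integral_const mult_zero_left not_le nn_integral_cong)
  have diff: "ennreal \<bar>B x - B x0\<bar> \<le> (\<integral>\<^sup>+w. ennreal \<bar>b (w - (x0 - x)) - b w\<bar> \<partial>lborel)" for x
  proof -
    have "B x - B x0 = (LINT w|lborel. b (x - w) * b w - b (x0 - w) * b w)"
      unfolding B_def using i2 by simp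
    then have "ennreal \<bar>B x - B x0\<bar> \<le> (\<integral>\<^sup>+w. ennreal \<bar>b (x - w) * b w - b (x0 - w) * b w\<bar> \<partial>lborel)"
      using ennreal_abs_integral_le[of lborel "\<lambda>w. b (x - w) * b w - b (x0 - w) * b w"] by simp
    also have "\<dots> \<le> (\<integral>\<^sup>+w. ennreal \<bar>b (x - w) - b (x0 - w)\<bar> \<partial>lborel)"
      by (intro nn_integral_mono ennreal_leI)
         (auto simp: left_diff_distrib[symmetric] abs_mult b intro!: mult_right_le_one_le)
    also have "\<dots> = (\<integral>\<^sup>+w. ennreal \<bar>b (w - (x0 - x)) - b w\<bar> \<partial>lborel)"
      using nn_integral_reflect[of "\<lambda>w. ennreal \<bar>b (w - (x0 - x)) - b w\<bar>" x0] by (simp add: algebra_simps)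
    finally show ?thesis .
  qed
  have "\<forall>\<^sub>F h in at 0. (\<integral>\<^sup>+w. ennreal \<bar>b (w - h) - b w\<bar> \<partial>lborel) < ennreal (B x0 / 2)"
    using order_tendstoD(2)[OF L1_translation_continuous[OF ib], of "ennreal (B x0 / 2)"] x0 by simp
  then obtain r where r: "r > 0" "\<And>h. h \<noteq> 0 \<Longrightarrow> norm h < r \<Longrightarrow> (\<integral>\<^sup>+w. ennreal \<bar>b (w - h) - b w\<bar> \<partial>lborel) < ennreal (B x0 / 2)"
    by (auto simp: eventually_at dist_norm)
  show thesis
  proof (rule that[of r "B x0 / 2" x0])
    fix x assume x: "norm (x - x0) < r"
    have "B x \<ge> B x0 / 2"
    proof (cases "x = x0")
      case False
      then have "ennreal \<bar>B x - B x0\<bar> < ennreal (B x0 / 2)"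
        using r(2)[of "x0 - x"] x diff[of x] by (simp add: norm_minus_commute)
      then have "\<bar>B x - B x0\<bar> < B x0 / 2" using x0 by (simp add: ennreal_less_iff)
      then show ?thesis by linarith
    qed (use x0 in simp)
    then have "ennreal (B x0 / 2) \<le> ennreal (B x)" by (rule ennreal_leI)
    also have "\<dots> \<le> (\<integral>\<^sup>+w. ennreal (a (x - w)) * ennreal (a w) \<partial>lborel)"
      unfolding Bnn using b by (intro nn_integral_mono mult_mono ennreal_leI) auto
    finally show "ennreal (B x0 / 2) \<le> (\<integral>\<^sup>+w. ennreal (a (x - w)) * ennreal (a w) \<partial>lborel)" .
  qed (use r x0 in auto)
qed

text \<open>Convolving with the indicator of a ball of radius r enlarges a ball of radius R by r/2
  at the cost of a fixed factor, the volume of a ball of radius r/4. The enlargement by less than r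
  is what keeps the overlap from shrinking to nothing.\<close>

lemma ball_convolution_lower_bound:
  fixes p s :: "'a::euclidean_space"
  assumes r: "0 < r" "r \<le> R" and d: "norm (p - s) < R + r / 2"
  shows "emeasure lborel (ball (0 :: 'a) (r / 4))
    \<le> (\<integral>\<^sup>+\<eta>. indicator (ball 0 r) (p - \<eta>) * indicator (ball 0 R) (\<eta> - s) \<partial>lborel)"
proof -
  \<comment> \<open>The point at distance 3r/4 from p on the segment towards s, or s itself if that
    is closer. Both target balls then leave a margin r/4 around q: 3r/4 + r/4 = r, and (R + r/2 -
    3r/4) + r/4 = R.\<close>
  define q where "q = (if norm (p - s) \<le> 3 * r / 4 then s else p + (3 * r / (4 * norm (p - s))) *\<^sub>R (s - p))"
  have q: "norm (p - q) \<le> 3 * r / 4" "norm (q - s) \<le> R - r / 4"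
  proof -
    show "norm (p - q) \<le> 3 * r / 4" using r by (auto simp: q_def norm_minus_commute)
    show "norm (q - s) \<le> R - r / 4"
    proof (cases "norm (p - s) \<le> 3 * r / 4")
      case False
      define D where "D = norm (p - s)"
      have D: "D > 3 * r / 4" "D > 0" using False r by (auto simp: D_def)
      have "q - s = (1 - 3 * r / (4 * D)) *\<^sub>R (p - s)" using False by (simp add: q_def D_def algebra_simps)
      then have "norm (q - s) = \<bar>1 - 3 * r / (4 * D)\<bar> * D" by (simp add: D_def)
      also have "\<dots> = D - 3 * r / 4" using D by (simp add: field_simps abs_if)
      finally show ?thesis using d by (simp add: D_def)
    qed (use r in \<open>simp add: q_def\<close>)
  qed
  have "emeasure lborel (ball (0 :: 'a) (r / 4)) = (\<integral>\<^sup>+\<eta>. indicator (ball 0 (r / 4)) (\<eta> - q) \<partial>lborel)"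
    by (subst nn_integral_translate(3)) (auto intro: borel_measurable_indicator)
  also have "\<dots> \<le> (\<integral>\<^sup>+\<eta>. indicator (ball 0 r) (p - \<eta>) * indicator (ball 0 R) (\<eta> - s) \<partial>lborel)"
  proof (rule nn_integral_mono)
    fix \<eta> :: 'a
    have "norm (p - \<eta>) < r \<and> norm (\<eta> - s) < R" if "norm (\<eta> - q) < r / 4"
      using norm_triangle_ineq[of "p - q" "q - \<eta>"] norm_triangle_ineq[of "\<eta> - q" "q - s"] q that
      by (simp add: norm_minus_commute)
    then show "indicator (ball 0 (r / 4)) (\<eta> - q) \<le> indicator (ball 0 r) (p - \<eta>) * (indicator (ball 0 R) (\<eta> - s) :: ennreal)"
      by (auto simp: indicator_def)
  qed
  finally show ?thesis .
qed

text \<open>Points of the lattice cell containing x differ from x by at most 1 in each coordinate,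
  hence by at most \<open>CARD('n)\<close> in norm; the extra 1 puts the cell inside the open
  ball.\<close>

lemma cint_le_ball_integral:
  fixes f :: "real ^ 'n \<Rightarrow> real"
  assumes f: "f \<in> BP" "\<And>x. f x \<ge> 0" and R: "R \<ge> real CARD('n) + 1"
  shows "ennreal (cint f) \<le> (\<integral>\<^sup>+y. indicator (ball 0 R) (x - y) * ennreal (f y) \<partial>lborel)"
proof -
  have [measurable]: "f \<in> borel_measurable borel" by (rule BP_measurable[OF f(1)])
  have "ennreal (cint f) = (\<integral>\<^sup>+y. ennreal (f y) * indicator unit_cell (y - lattice_part x) \<partial>lborel)"
    using f BP_periodic[OF f(1)]
    by (subst nn_integral_translated_cell) (auto simp: ennreal_cint lattice_part periodic_def)
  also have "\<dots> \<le> (\<integral>\<^sup>+y. indicator (ball 0 R) (x - y) * ennreal (f y) \<partial>lborel)"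
  proof (rule nn_integral_mono)
    fix y
    have "norm (x - y) < R" if "y - lattice_part x \<in> unit_cell"
    proof -
      have "\<bar>(x - y) $ i\<bar> \<le> 1" for i
        using that by (auto simp: unit_cell_def lattice_part_def abs_le_iff) (smt (verit) of_int_floor_le real_of_int_floor_add_one_gt)+
      then have "(\<Sum>i\<in>UNIV. \<bar>(x - y) $ i\<bar>) \<le> (\<Sum>i\<in>(UNIV :: 'n set). 1)" by (intro sum_mono)
      then show ?thesis using norm_le_l1_cart[of "x - y"] R by simp
    qed
    then show "ennreal (f y) * indicator unit_cell (y - lattice_part x) \<le> indicator (ball 0 R) (x - y) * ennreal (f y)"
      by (auto simp: indicator_def)
  qed
  finally show ?thesis .
qed

text \<open>A Doeblin condition for any positive T that dominates a multiple of convolution with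
  \<open>a\<close>. Two steps see the autoconvolution of \<open>a\<close>, which is bounded below on
  a ball; every further pair of steps enlarges the ball at a fixed cost in the constant. The centre
  drifts by \<open>x0\<close> each time, which is harmless for periodic functions once the radius
  exceeds the size of a cell. T is abstract so that the result serves the chain and its dual
  alike.\<close>

lemma minorization:
  fixes T :: "(real ^ 'n \<Rightarrow> real) \<Rightarrow> real ^ 'n \<Rightarrow> real"
  assumes a: "integrable lborel a" "\<And>z. a z \<ge> 0" "(LINT z|lborel. a z) > 0" and c0: "c0 > 0"
    and TBP: "\<And>f. f \<in> BP \<Longrightarrow> T f \<in> BP" and Tnn: "\<And>f x. f \<in> BP \<Longrightarrow> (\<And>x. f x \<ge> 0) \<Longrightarrow> T f x \<ge> 0"
    and T: "\<And>f x. f \<in> BP \<Longrightarrow> (\<And>x. f x \<ge> 0) \<Longrightarrow>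
      ennreal c0 * (\<integral>\<^sup>+y. ennreal (a (x - y)) * ennreal (f y) \<partial>lborel) \<le> ennreal (T f x)"
  obtains N \<delta> where "\<delta> > 0" "N > 0" "\<And>f x. f \<in> BP \<Longrightarrow> (\<And>x. f x \<ge> 0) \<Longrightarrow> \<delta> * cint f \<le> (T ^^ N) f x"
proof -
  have [measurable]: "a \<in> borel_measurable borel" using a(1) by auto
  obtain x0 r c where r: "r > 0" and c: "c > 0" and
    A: "\<And>x. norm (x - x0) < r \<Longrightarrow> ennreal c \<le> (\<integral>\<^sup>+w. ennreal (a (x - w)) * ennreal (a w) \<partial>lborel)"
    by (rule autoconvolution_lower_bound[OF a]) blast
  define K where "K R v = (indicator (ball 0 R) v :: ennreal)" for R and v :: "real ^ 'n"
  have [measurable]: "K R \<in> borel_measurable borel" for R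
    unfolding K_def[abs_def] by (intro borel_measurable_indicator borel_open open_ball)
  define TT where "TT = (\<lambda>f. T (T f))"
  have TTBP: "f \<in> BP \<Longrightarrow> TT f \<in> BP" for f by (simp add: TT_def TBP)
  have TTnn: "f \<in> BP \<Longrightarrow> (\<And>x. f x \<ge> 0) \<Longrightarrow> TT f x \<ge> 0" for f x by (simp add: TT_def TBP Tnn)
  have step1: "ennreal (c0 * c0 * c) * (\<integral>\<^sup>+y. K r (x - x0 - y) * ennreal (f y) \<partial>lborel) \<le> ennreal (TT f x)"
    if f: "f \<in> BP" "\<And>x. f x \<ge> 0" for f x
  proof -
    have [measurable]: "f \<in> borel_measurable borel" by (rule BP_measurable[OF f(1)])
    have "ennreal (c0 * c0 * c) * (\<integral>\<^sup>+y. K r (x - x0 - y) * ennreal (f y) \<partial>lborel)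
      = ennreal c0 * (ennreal c0 * (\<integral>\<^sup>+y. ennreal c * (K r (x - x0 - y) * ennreal (f y)) \<partial>lborel))"
      using c0 c by (simp add: nn_integral_cmult ennreal_mult mult_ac)
    also have "\<dots> \<le> ennreal c0 * (ennreal c0 * (\<integral>\<^sup>+y. (\<integral>\<^sup>+\<eta>. ennreal (a (x - \<eta>)) * (ennreal (a (\<eta> - y)) * ennreal (f y)) \<partial>lborel) \<partial>lborel))"
    proof (intro mult_left_mono nn_integral_mono)
      fix y
      have "ennreal c * K r (x - x0 - y) \<le> (\<integral>\<^sup>+w. ennreal (a (x - y - w)) * ennreal (a w) \<partial>lborel)"
        using A[of "x - y"] by (auto simp: K_def indicator_def algebra_simps)
      also have "\<dots> = (\<integral>\<^sup>+\<eta>. ennreal (a (x - \<eta>)) * ennreal (a (\<eta> - y)) \<partial>lborel)"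
        using nn_integral_translate(3)[of "\<lambda>w. ennreal (a (x - y - w)) * ennreal (a w)" y] by (simp add: algebra_simps)
      finally have "ennreal c * K r (x - x0 - y) * ennreal (f y) \<le> (\<integral>\<^sup>+\<eta>. ennreal (a (x - \<eta>)) * ennreal (a (\<eta> - y)) \<partial>lborel) * ennreal (f y)"
        by (rule mult_right_mono) simp
      also have "\<dots> = (\<integral>\<^sup>+\<eta>. ennreal (a (x - \<eta>)) * ennreal (a (\<eta> - y)) * ennreal (f y) \<partial>lborel)"
        by (rule nn_integral_multc[symmetric]) measurable
      finally show "ennreal c * (K r (x - x0 - y) * ennreal (f y)) \<le> (\<integral>\<^sup>+\<eta>. ennreal (a (x - \<eta>)) * (ennreal (a (\<eta> - y)) * ennreal (f y)) \<partial>lborel)"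
        by (simp add: mult.assoc)
    qed auto
    also have "(\<integral>\<^sup>+y. (\<integral>\<^sup>+\<eta>. ennreal (a (x - \<eta>)) * (ennreal (a (\<eta> - y)) * ennreal (f y)) \<partial>lborel) \<partial>lborel)
       = (\<integral>\<^sup>+\<eta>. (\<integral>\<^sup>+y. ennreal (a (x - \<eta>)) * (ennreal (a (\<eta> - y)) * ennreal (f y)) \<partial>lborel) \<partial>lborel)"
      by (rule lborel_pair.Fubini') measurable
    also have "ennreal c0 * \<dots> = (\<integral>\<^sup>+\<eta>. ennreal (a (x - \<eta>)) * (ennreal c0 * (\<integral>\<^sup>+y. (ennreal (a (\<eta> - y)) * ennreal (f y)) \<partial>lborel)) \<partial>lborel)"
    proof -
      have "(\<integral>\<^sup>+y. ennreal (a (x - \<eta>)) * (ennreal (a (\<eta> - y)) * ennreal (f y)) \<partial>lborel)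
        = ennreal (a (x - \<eta>)) * (\<integral>\<^sup>+y. (ennreal (a (\<eta> - y)) * ennreal (f y)) \<partial>lborel)" for \<eta>
        by (rule nn_integral_cmult) measurable
      then show ?thesis
        by (subst nn_integral_cmult[symmetric], measurable) (simp only: mult.left_commute[of "ennreal c0"])
    qed
    also have "\<dots> \<le> (\<integral>\<^sup>+\<eta>. ennreal (a (x - \<eta>)) * ennreal (T f \<eta>) \<partial>lborel)"
      using T[OF f] by (intro nn_integral_mono mult_left_mono) auto
    also have "ennreal c0 * \<dots> \<le> ennreal (TT f x)"
      unfolding TT_def by (rule T[OF TBP[OF f(1)] Tnn[OF f]])
    finally show ?thesis by (simp add: mult_left_mono)
  qed
  define v where "v = measure lborel (ball (0 :: real ^ 'n) (r / 4))"
  have v: "v > 0" "emeasure lborel (ball (0 :: real ^ 'n) (r / 4)) = ennreal v"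
    using r emeasure_bounded_finite[of "ball (0 :: real ^ 'n) (r / 4)"]
    by (auto simp: v_def content_ball_pos intro!: emeasure_eq_ennreal_measure)
  define R where "R m = r + real m * r / 2" for m
  \<comment> \<open>One double step gives radius r, so m counts the additional ones: each adds r/2
    to the radius and multiplies the constant by \<open>c0 * c0 * c * v\<close>.\<close>
  have step2: "\<exists>d>0. \<forall>f\<in>BP. (\<forall>x. f x \<ge> 0) \<longrightarrow> (TT ^^ Suc m) f \<in> BP \<and> (\<forall>x. (TT ^^ Suc m) f x \<ge> 0) \<and>
     (\<forall>x. ennreal d * (\<integral>\<^sup>+y. K (R m) (x - real (Suc m) *\<^sub>R x0 - y) * ennreal (f y) \<partial>lborel) \<le> ennreal ((TT ^^ Suc m) f x))" for m
  proof (induction m)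
    case 0
    show ?case using step1 c0 c TTBP TTnn by (intro exI[of _ "c0 * c0 * c"]) (auto simp: R_def)
  next
    case (Suc m)
    then obtain d where d: "d > 0" and IH: "\<And>f. f \<in> BP \<Longrightarrow> (\<forall>x. f x \<ge> 0) \<Longrightarrow> (TT ^^ Suc m) f \<in> BP \<and> (\<forall>x. (TT ^^ Suc m) f x \<ge> 0) \<and>
     (\<forall>x. ennreal d * (\<integral>\<^sup>+y. K (R m) (x - real (Suc m) *\<^sub>R x0 - y) * ennreal (f y) \<partial>lborel) \<le> ennreal ((TT ^^ Suc m) f x))"
      by blast
    let ?D = "c0 * c0 * c * d * v"
    have "ennreal ?D * (\<integral>\<^sup>+y. K (R (Suc m)) (x - real (Suc (Suc m)) *\<^sub>R x0 - y) * ennreal (f y) \<partial>lborel) \<le> ennreal ((TT ^^ Suc (Suc m)) f x)"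
      if f: "f \<in> BP" "\<forall>x. f x \<ge> 0" for f x
    proof -
      have [measurable]: "f \<in> borel_measurable borel" by (rule BP_measurable[OF f(1)])
      let ?s = "\<lambda>y. y + real (Suc m) *\<^sub>R x0"
      let ?e = "ennreal (c0 * c0 * c)"
      have eD: "ennreal ?D = ?e * (ennreal d * ennreal v)" using c0 c d v by (simp add: ennreal_mult mult_ac)
      have "(\<integral>\<^sup>+y. K (R (Suc m)) (x - real (Suc (Suc m)) *\<^sub>R x0 - y) * ennreal (f y) \<partial>lborel) * ennreal v
        \<le> (\<integral>\<^sup>+y. (\<integral>\<^sup>+\<eta>. K r (x - x0 - \<eta>) * (K (R m) (\<eta> - ?s y) * ennreal (f y)) \<partial>lborel) \<partial>lborel)"
      proof (subst nn_integral_multc[symmetric], measurable, rule nn_integral_mono)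
        fix y
        have "K (R (Suc m)) (x - real (Suc (Suc m)) *\<^sub>R x0 - y) * ennreal v \<le> (\<integral>\<^sup>+\<eta>. K r (x - x0 - \<eta>) * K (R m) (\<eta> - ?s y) \<partial>lborel)"
        proof (cases "norm (x - real (Suc (Suc m)) *\<^sub>R x0 - y) < R (Suc m)")
          case True
          have "ennreal v \<le> (\<integral>\<^sup>+\<eta>. K r (x - x0 - \<eta>) * K (R m) (\<eta> - ?s y) \<partial>lborel)"
            unfolding v(2)[symmetric] K_def
          proof (rule ball_convolution_lower_bound[OF r])
            show "r \<le> R m" using r by (simp add: R_def)
            have "x - x0 - ?s y = x - real (Suc (Suc m)) *\<^sub>R x0 - y"
              by (simp only: of_nat_Suc[of "Suc m"] scaleR_left_distrib scaleR_one) simp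
            moreover have "R (Suc m) = R m + r / 2" by (simp add: R_def field_simps)
            ultimately show "norm (x - x0 - ?s y) < R m + r / 2" using True by (simp only:)
          qed
          then show ?thesis using True by (simp add: K_def)
        qed (simp add: K_def)
        then have "K (R (Suc m)) (x - real (Suc (Suc m)) *\<^sub>R x0 - y) * ennreal v * ennreal (f y)
          \<le> (\<integral>\<^sup>+\<eta>. K r (x - x0 - \<eta>) * K (R m) (\<eta> - ?s y) \<partial>lborel) * ennreal (f y)"
          by (rule mult_right_mono) simp
        also have "\<dots> = (\<integral>\<^sup>+\<eta>. K r (x - x0 - \<eta>) * K (R m) (\<eta> - ?s y) * ennreal (f y) \<partial>lborel)"
          by (rule nn_integral_multc[symmetric]) measurable
        finally show "K (R (Suc m)) (x - real (Suc (Suc m)) *\<^sub>R x0 - y) * ennreal (f y) * ennreal v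
          \<le> (\<integral>\<^sup>+\<eta>. K r (x - x0 - \<eta>) * (K (R m) (\<eta> - ?s y) * ennreal (f y)) \<partial>lborel)" by (simp add: mult_ac)
      qed
      also have "\<dots> = (\<integral>\<^sup>+\<eta>. (\<integral>\<^sup>+y. K r (x - x0 - \<eta>) * (K (R m) (\<eta> - ?s y) * ennreal (f y)) \<partial>lborel) \<partial>lborel)"
        by (rule lborel_pair.Fubini') measurable
      also have "\<dots> = (\<integral>\<^sup>+\<eta>. K r (x - x0 - \<eta>) * (\<integral>\<^sup>+y. K (R m) (\<eta> - real (Suc m) *\<^sub>R x0 - y) * ennreal (f y) \<partial>lborel) \<partial>lborel)"
      proof (rule nn_integral_cong)
        fix \<eta>
        have "\<eta> - ?s y = \<eta> - real (Suc m) *\<^sub>R x0 - y" for y by (simp add: diff_diff_add add.commute)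
        then show "(\<integral>\<^sup>+y. K r (x - x0 - \<eta>) * (K (R m) (\<eta> - ?s y) * ennreal (f y)) \<partial>lborel)
          = K r (x - x0 - \<eta>) * (\<integral>\<^sup>+y. K (R m) (\<eta> - real (Suc m) *\<^sub>R x0 - y) * ennreal (f y) \<partial>lborel)"
          by (simp only:) (rule nn_integral_cmult, measurable)
      qed
      finally have "ennreal d * ((\<integral>\<^sup>+y. K (R (Suc m)) (x - real (Suc (Suc m)) *\<^sub>R x0 - y) * ennreal (f y) \<partial>lborel) * ennreal v)
        \<le> ennreal d * (\<integral>\<^sup>+\<eta>. K r (x - x0 - \<eta>) * (\<integral>\<^sup>+y. K (R m) (\<eta> - real (Suc m) *\<^sub>R x0 - y) * ennreal (f y) \<partial>lborel) \<partial>lborel)"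
        by (rule mult_left_mono) simp
      also have "\<dots> = (\<integral>\<^sup>+\<eta>. K r (x - x0 - \<eta>) * (ennreal d * (\<integral>\<^sup>+y. K (R m) (\<eta> - real (Suc m) *\<^sub>R x0 - y) * ennreal (f y) \<partial>lborel)) \<partial>lborel)"
        by (subst nn_integral_cmult[symmetric], measurable) (simp add: mult_ac)
      also have "\<dots> \<le> (\<integral>\<^sup>+\<eta>. K r (x - x0 - \<eta>) * ennreal ((TT ^^ Suc m) f \<eta>) \<partial>lborel)"
        using IH[OF f] by (intro nn_integral_mono mult_left_mono) auto
      finally have "?e * (ennreal d * ((\<integral>\<^sup>+y. K (R (Suc m)) (x - real (Suc (Suc m)) *\<^sub>R x0 - y) * ennreal (f y) \<partial>lborel) * ennreal v))
        \<le> ?e * (\<integral>\<^sup>+\<eta>. K r (x - x0 - \<eta>) * ennreal ((TT ^^ Suc m) f \<eta>) \<partial>lborel)"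
        by (rule mult_left_mono) simp
      also have "\<dots> \<le> ennreal (TT ((TT ^^ Suc m) f) x)"
        using IH[OF f] by (intro step1) auto
      finally show ?thesis unfolding eD by (simp add: mult_ac)
    qed
    moreover have "?D > 0" using c0 c d v by simp
    moreover have "(TT ^^ Suc (Suc m)) f \<in> BP \<and> (\<forall>x. (TT ^^ Suc (Suc m)) f x \<ge> 0)" if "f \<in> BP" "\<forall>x. f x \<ge> 0" for f
      using IH[OF that] TTBP TTnn by auto
    ultimately show ?case by blast
  qed
  \<comment> \<open>Enough double steps for the ball to contain a whole cell, wherever its centre
    has drifted.\<close>
  obtain m :: nat where m: "real m > 2 * (real CARD('n) + 1) / r" using reals_Archimedean2 by blast
  have Rm: "R m \<ge> real CARD('n) + 1" using m r by (simp add: R_def field_simps)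
  obtain d where d: "d > 0" and D: "\<And>f. f \<in> BP \<Longrightarrow> (\<forall>x. f x \<ge> 0) \<Longrightarrow> (TT ^^ Suc m) f \<in> BP \<and> (\<forall>x. (TT ^^ Suc m) f x \<ge> 0) \<and>
     (\<forall>x. ennreal d * (\<integral>\<^sup>+y. K (R m) (x - real (Suc m) *\<^sub>R x0 - y) * ennreal (f y) \<partial>lborel) \<le> ennreal ((TT ^^ Suc m) f x))"
    using step2[of m] by blast
  have TT: "TT ^^ n = T ^^ (2 * n)" for n
  proof -
    have "TT = T ^^ 2" by (simp add: TT_def numeral_2_eq_2 o_def fun_eq_iff)
    then show ?thesis by (simp add: funpow_mult)
  qed
  show thesis
  proof (rule that[of d "2 * Suc m"])
    fix f :: "real ^ 'n \<Rightarrow> real" and x assume f: "f \<in> BP" "\<And>x. f x \<ge> 0"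
    have "ennreal (d * cint f) = ennreal d * ennreal (cint f)" using d by (simp add: ennreal_mult')
    also have "\<dots> \<le> ennreal d * (\<integral>\<^sup>+y. K (R m) (x - real (Suc m) *\<^sub>R x0 - y) * ennreal (f y) \<partial>lborel)"
      unfolding K_def by (intro mult_left_mono cint_le_ball_integral f Rm) auto
    also have "\<dots> \<le> ennreal ((TT ^^ Suc m) f x)" using D[of f] f by blast
    finally show "d * cint f \<le> (T ^^ (2 * Suc m)) f x"
      using D[of f] f unfolding TT[symmetric] by (meson ennreal_le_iff)
  qed (use d in auto)
qed

subsection \<open>The jump chain and its invariant density\<close>

lemma kernel_integrable:
  fixes a :: "real ^ 'n \<Rightarrow> real" and h :: "real ^ 'n \<Rightarrow> real ^ 'n \<Rightarrow> real"
  assumes a: "integrable lborel a" and h: "(\<lambda>(x, y). h x y) \<in> borel_measurable (borel \<Otimes>\<^sub>M borel)"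
    "\<And>x y. \<bar>h x y\<bar> \<le> c * a (x - y)" and f: "f \<in> borel_measurable borel" "\<And>y. \<bar>f y\<bar> \<le> C"
  shows "integrable lborel (\<lambda>y. h x y * f y)" "\<bar>LINT y|lborel. h x y * f y\<bar> \<le> c * (LINT z|lborel. a z) * C"
proof -
  note [measurable] = h(1) f(1)
  have [measurable]: "(\<lambda>y. h x y) \<in> borel_measurable borel" by measurable
  have C: "C \<ge> 0" using f(2)[of undefined] by linarith
  have i: "integrable lborel (\<lambda>y. c * a (x - y) * C)"
    using lborel_integrable_shift(2)[OF a, of x] by (intro integrable_mult_left integrable_mult_right)
  have le: "\<bar>h x y * f y\<bar> \<le> c * a (x - y) * C" for y
    using h(2)[of x y] f(2)[of y] C by (auto simp: abs_mult intro!: mult_mono order_trans[OF _ h(2)])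
  show i2: "integrable lborel (\<lambda>y. h x y * f y)"
    by (rule Bochner_Integration.integrable_bound[OF i]) (use le in \<open>auto intro!: AE_I2 order_trans[OF le abs_ge_self]\<close>)
  have "\<bar>LINT y|lborel. h x y * f y\<bar> \<le> (LINT y|lborel. \<bar>h x y * f y\<bar>)" by (rule integral_abs_bound)
  also have "\<dots> \<le> (LINT y|lborel. c * a (x - y) * C)"
    using i i2 le by (intro integral_mono) auto
  also have "\<dots> = c * (LINT z|lborel. a z) * C"
    using lborel_integral_shift(2)[of a x] a by simp
  finally show "\<bar>LINT y|lborel. h x y * f y\<bar> \<le> c * (LINT z|lborel. a z) * C" .
qed

lemma kernel_BP:
  fixes a :: "real ^ 'n \<Rightarrow> real" and h :: "real ^ 'n \<Rightarrow> real ^ 'n \<Rightarrow> real"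
  assumes a: "integrable lborel a" and h: "(\<lambda>(x, y). h x y) \<in> borel_measurable (borel \<Otimes>\<^sub>M borel)"
    "\<And>x y. \<bar>h x y\<bar> \<le> c * a (x - y)"
    and per: "\<And>x y k. k \<in> integer_lattice \<Longrightarrow> h (x + k) (y + k) = h x y" and f: "f \<in> BP"
  shows "(\<lambda>x. LINT y|lborel. h x y * f y) \<in> BP"
proof -
  obtain C where C: "C > 0" "\<And>x. \<bar>f x\<bar> \<le> C" by (rule BP_bounded[OF f]) blast
  have [measurable]: "f \<in> borel_measurable borel" by (rule BP_measurable[OF f])
  note [measurable] = h(1)
  show ?thesis
  proof (rule BP_I)
    fix k x :: "real ^ 'n" assume k: "k \<in> integer_lattice"
    have "(\<lambda>y. h (x + k) y * f y) \<in> borel_measurable borel" by measurable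
    from lborel_integral_shift(3)[OF this, of k]
    show "(LINT y|lborel. h (x + k) y * f y) = (LINT y|lborel. h x y * f y)"
      by (simp add: per[OF k] periodicD[OF BP_periodic[OF f] k])
  qed (measurable, rule kernel_integrable(2)[OF a h _ C(2)], measurable)
qed

lemma BP_uniform_limit:
  assumes s: "\<And>n. s n \<in> BP" and l: "uniform_limit UNIV s f sequentially"
  shows "f \<in> BP"
proof -
  have lim: "(\<lambda>n. s n x) \<longlonglongrightarrow> f x" for x by (rule tendsto_uniform_limitI[OF l]) simp
  have m: "f \<in> borel_measurable borel" using lim BP_measurable[OF s] by (rule borel_measurable_LIMSEQ_real)
  have p: "f (x + k) = f x" if "k \<in> integer_lattice" for k x
    using lim[of "x + k"] lim[of x] periodicD(1)[OF BP_periodic[OF s] that] by (auto intro: LIMSEQ_unique)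
  obtain n where n: "\<And>x. dist (s n x) (f x) < 1"
    using uniform_limitD[OF l, of 1] by (auto simp: eventually_sequentially)
  obtain C where C: "\<And>x. \<bar>s n x\<bar> \<le> C" using BP_bounded[OF s] by metis
  have "\<bar>f x\<bar> \<le> C + 1" for x using n[of x] C[of x] by (auto simp: dist_real_def)
  then show ?thesis using m p by (intro BP_I) auto
qed

lemma periodization_eq_suminf:
  fixes e :: "nat \<Rightarrow> real ^ 'n"
  assumes e: "bij_betw e UNIV integer_lattice"
  shows "periodization a \<eta> = (\<Sum>i. ennreal (a (\<eta> + e i)))"
proof -
  have "periodization a \<eta> = (\<Sum>\<^sub>\<infinity>i. ennreal (a (\<eta> + e i)))"
    unfolding periodization_def using infsum_reindex_bij_betw[OF e, of "\<lambda>k. ennreal (a (\<eta> + k))"] by simp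
  also have "\<dots> = (\<Sum>i. ennreal (a (\<eta> + e i)))"
  proof -
    have "((\<lambda>i. ennreal (a (\<eta> + e i))) has_sum (\<Sum>\<^sub>\<infinity>i. ennreal (a (\<eta> + e i)))) UNIV"
      by (intro has_sum_infsum nonneg_summable_on_complete) simp
    then show ?thesis using has_sum_imp_sums sums_unique by blast
  qed
  finally show ?thesis .
qed

lemma periodization_periodic: "periodic (periodization a)"
  unfolding periodic_def
proof safe
  fix k x :: "real ^ 'a" assume k: "k \<in> integer_lattice"
  have b: "bij_betw ((+) k) integer_lattice integer_lattice"
    using k by (intro bij_betwI[where g="\<lambda>x. x - k"])
      (auto intro: integer_lattice_add simp: diff_conv_add_uminus integer_lattice_add integer_lattice_uminus simp del: add_uminus_conv_diff)
  show "periodization a (x + k) = periodization a x"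
    unfolding periodization_def using infsum_reindex_bij_betw[OF b, of "\<lambda>l. ennreal (a (x + l))"]
    by (simp add: add.assoc)
qed

lemma periodization_measurable:
  assumes [measurable]: "a \<in> borel_measurable borel"
  shows "periodization a \<in> borel_measurable (borel :: (real ^ 'n) measure)"
proof -
  obtain e :: "nat \<Rightarrow> real ^ 'n" where e: "bij_betw e UNIV integer_lattice" by (rule integer_lattice_enumeration)
  have "periodization a = (\<lambda>\<eta>. \<Sum>i. ennreal (a (\<eta> + e i)))" by (rule ext) (rule periodization_eq_suminf[OF e])
  then show ?thesis by simp
qed

text \<open>Measurability is Borel and periodicity, bounds and sign hold at every point, so that
  sections, iterated integrals and pointwise identities raise no questions of null sets.\<close>

locale periodic_kernel =
  fixes a :: "real ^ 'n \<Rightarrow> real" and \<mu> :: "real ^ 'n \<Rightarrow> real ^ 'n \<Rightarrow> real" and \<alpha>\<^sub>1 \<alpha>\<^sub>2 :: real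
  assumes a_int: "integrable lborel a" and a_nonneg: "\<And>z. a z \<ge> 0" and a_pos: "(LINT z|lborel. a z) > 0"
    and a_second: "integrable lborel (\<lambda>z. (norm z)\<^sup>2 * a z)"
    and a_periodization: "(\<integral>\<^sup>+\<eta>\<in>unit_cell. (periodization a \<eta>)\<^sup>2 \<partial>lborel) < \<infinity>"
    and \<mu>_borel [measurable]: "(\<lambda>(x, y). \<mu> x y) \<in> borel_measurable (borel \<Otimes>\<^sub>M borel)"
    and \<mu>_per: "\<And>x y k. k \<in> integer_lattice \<Longrightarrow> \<mu> (x + k) y = \<mu> x y"
      "\<And>x y k. k \<in> integer_lattice \<Longrightarrow> \<mu> x (y + k) = \<mu> x y"
    and \<mu>_bounds: "0 < \<alpha>\<^sub>1" "\<And>x y. \<alpha>\<^sub>1 \<le> \<mu> x y" "\<And>x y. \<mu> x y \<le> \<alpha>\<^sub>2"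
begin

lemma a_borel [measurable]: "a \<in> borel_measurable borel" using a_int by auto

definition mass :: real where "mass = (LINT z|lborel. a z)"

lemma mass_pos: "mass > 0" using a_pos by (simp add: mass_def)

lemma \<alpha>2_pos: "\<alpha>\<^sub>2 > 0" using \<mu>_bounds(1) \<mu>_bounds(2)[of 0 0] \<mu>_bounds(3)[of 0 0] by linarith

lemma \<mu>_nonneg: "\<mu> x y \<ge> 0" using \<mu>_bounds(1) \<mu>_bounds(2)[of x y] by linarith

definition rate :: "real ^ 'n \<Rightarrow> real" where "rate \<xi> = (LINT \<eta>|lborel. a (\<xi> - \<eta>) * \<mu> \<xi> \<eta>)"

lemma kernel_bound: "\<bar>a (\<xi> - \<eta>) * \<mu> \<xi> \<eta>\<bar> \<le> \<alpha>\<^sub>2 * a (\<xi> - \<eta>)"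
  using \<mu>_bounds(3)[of \<xi> \<eta>] \<mu>_nonneg[of \<xi> \<eta>] a_nonneg[of "\<xi> - \<eta>"] by (simp add: abs_mult mult.commute mult_right_mono)

lemma kernel_per: "k \<in> integer_lattice \<Longrightarrow> a (\<xi> + k - (\<eta> + k)) * \<mu> (\<xi> + k) (\<eta> + k) = a (\<xi> - \<eta>) * \<mu> \<xi> \<eta>"
  by (simp add: \<mu>_per)

lemma rate_BP: "rate \<in> BP"
  using kernel_BP[of a "\<lambda>\<xi> \<eta>. a (\<xi> - \<eta>) * \<mu> \<xi> \<eta>" \<alpha>\<^sub>2 "\<lambda>_. 1", OF a_int _ kernel_bound kernel_per BP_const]
  by (simp add: rate_def[abs_def])

lemma rate_integrable: "integrable lborel (\<lambda>\<eta>. a (\<xi> - \<eta>) * \<mu> \<xi> \<eta>)"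
  using kernel_integrable(1)[OF a_int _ kernel_bound, of "\<lambda>_. 1" 1] by simp

lemma rate_lower: "\<alpha>\<^sub>1 * mass \<le> rate \<xi>"
proof -
  have "\<alpha>\<^sub>1 * mass = (LINT \<eta>|lborel. \<alpha>\<^sub>1 * a (\<xi> - \<eta>))"
    using lborel_integral_shift(2)[of a \<xi>] by (simp add: mass_def)
  also have "\<dots> \<le> rate \<xi>" unfolding rate_def
    using \<mu>_bounds a_nonneg lborel_integrable_shift(2)[OF a_int, of \<xi>]
    by (intro integral_mono rate_integrable) (auto simp: mult.commute intro!: mult_right_mono)
  finally show ?thesis .
qed

lemma rate_upper: "rate \<xi> \<le> \<alpha>\<^sub>2 * mass"
  using kernel_integrable(2)[OF a_int _ kernel_bound, of "\<lambda>_. 1" 1 \<xi>] by (simp add: rate_def mass_def)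

lemma rate_pos: "rate \<xi> > 0"
  using rate_lower[of \<xi>] mult_pos_pos[OF \<mu>_bounds(1) mass_pos] by linarith

definition jump :: "real ^ 'n \<Rightarrow> real ^ 'n \<Rightarrow> real" where
  "jump \<xi> \<eta> = a (\<xi> - \<eta>) * \<mu> \<xi> \<eta> / rate \<xi>"

lemma jump_measurable [measurable]: "(\<lambda>(x, y). jump x y) \<in> borel_measurable (borel \<Otimes>\<^sub>M borel)"
proof -
  have [measurable]: "rate \<in> borel_measurable borel" by (rule BP_measurable[OF rate_BP])
  show ?thesis unfolding jump_def[abs_def] by measurable
qed

lemma jump_nonneg: "jump \<xi> \<eta> \<ge> 0"
  using rate_pos[of \<xi>] a_nonneg \<mu>_nonneg by (simp add: jump_def)

definition c_low :: real where "c_low = \<alpha>\<^sub>1 / (\<alpha>\<^sub>2 * mass)"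
definition c_up :: real where "c_up = \<alpha>\<^sub>2 / (\<alpha>\<^sub>1 * mass)"

lemma c_pos: "c_low > 0" "c_up > 0"
  using \<mu>_bounds(1) \<alpha>2_pos mass_pos by (auto simp: c_low_def c_up_def)

lemma jump_lower: "c_low * a (\<xi> - \<eta>) \<le> jump \<xi> \<eta>"
proof -
  have "\<alpha>\<^sub>1 * a (\<xi> - \<eta>) / (\<alpha>\<^sub>2 * mass) \<le> a (\<xi> - \<eta>) * \<mu> \<xi> \<eta> / rate \<xi>"
    using \<mu>_bounds a_nonneg rate_pos rate_upper \<alpha>2_pos mass_pos
    by (intro frac_le) (auto simp: mult.commute intro: mult_right_mono mult_nonneg_nonneg \<mu>_nonneg)
  then show ?thesis by (simp add: c_low_def jump_def)
qed

lemma jump_upper: "jump \<xi> \<eta> \<le> c_up * a (\<xi> - \<eta>)"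
proof -
  have "a (\<xi> - \<eta>) * \<mu> \<xi> \<eta> / rate \<xi> \<le> \<alpha>\<^sub>2 * a (\<xi> - \<eta>) / (\<alpha>\<^sub>1 * mass)"
    using \<mu>_bounds a_nonneg rate_pos rate_lower \<alpha>2_pos mass_pos \<mu>_nonneg
    by (intro frac_le) (auto simp: mult.commute intro: mult_right_mono mult_nonneg_nonneg \<mu>_nonneg)
  then show ?thesis by (simp add: c_up_def jump_def)
qed

lemma jump_abs: "\<bar>jump \<xi> \<eta>\<bar> \<le> c_up * a (\<xi> - \<eta>)"
  using jump_upper jump_nonneg by simp

lemma jump_per: "k \<in> integer_lattice \<Longrightarrow> jump (\<xi> + k) (\<eta> + k) = jump \<xi> \<eta>"
  unfolding jump_def using kernel_per periodicD(1)[OF BP_periodic[OF rate_BP]] by simp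

lemma a_refl_int: "integrable lborel (\<lambda>z. a (- z))" "(LINT z|lborel. a (- z)) = mass"
  using lborel_integrable_shift(2)[OF a_int, of 0] lborel_integral_shift(2)[of a 0] by (auto simp: mass_def)

lemma jump_abs': "\<bar>jump \<xi> \<eta>\<bar> \<le> c_up * (\<lambda>z. a (- z)) (\<eta> - \<xi>)"
  using jump_abs by simp

lemma jump_measurable' [measurable]: "(\<lambda>(x, y). jump y x) \<in> borel_measurable (borel \<Otimes>\<^sub>M borel)"
  using measurable_pair_swap[OF jump_measurable] by (simp add: case_prod_beta)

text \<open>P is the transition operator acting on functions and Q below its adjoint for Lebesgue
  measure on the cell, acting on densities. Integrating over the whole space against periodic
  functions amounts to summing the kernel over the lattice.\<close>

definition P :: "(real ^ 'n \<Rightarrow> real) \<Rightarrow> real ^ 'n \<Rightarrow> real" where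
  "P f \<xi> = (LINT \<eta>|lborel. jump \<xi> \<eta> * f \<eta>)"

definition Q :: "(real ^ 'n \<Rightarrow> real) \<Rightarrow> real ^ 'n \<Rightarrow> real" where
  "Q p \<eta> = (LINT \<xi>|lborel. jump \<xi> \<eta> * p \<xi>)"

lemma P_BP: "f \<in> BP \<Longrightarrow> P f \<in> BP"
  unfolding P_def[abs_def] by (rule kernel_BP[OF a_int jump_measurable jump_abs jump_per])

lemma Q_BP: "f \<in> BP \<Longrightarrow> Q f \<in> BP"
  unfolding Q_def[abs_def]
  by (rule kernel_BP[OF a_refl_int(1) jump_measurable' jump_abs' jump_per])

lemma P_integrable: assumes f: "f \<in> BP" shows "integrable lborel (\<lambda>\<eta>. jump \<xi> \<eta> * f \<eta>)"
proof -
  obtain C where C: "C > 0" "\<And>x. \<bar>f x\<bar> \<le> C" by (rule BP_bounded[OF f]) blast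
  show ?thesis by (rule kernel_integrable(1)[OF a_int jump_measurable jump_abs BP_measurable[OF f] C(2)])
qed

lemma Q_integrable: assumes f: "f \<in> BP" shows "integrable lborel (\<lambda>\<xi>. jump \<xi> \<eta> * f \<xi>)"
proof -
  obtain C where C: "C > 0" "\<And>x. \<bar>f x\<bar> \<le> C" by (rule BP_bounded[OF f]) blast
  show ?thesis by (rule kernel_integrable(1)[OF a_refl_int(1) jump_measurable' jump_abs' BP_measurable[OF f] C(2)])
qed

lemma Q_bound: assumes f: "f \<in> BP" and C: "\<And>x. \<bar>f x\<bar> \<le> C" shows "\<bar>Q f x\<bar> \<le> c_up * mass * C"
  unfolding Q_def using kernel_integrable(2)[OF a_refl_int(1) jump_measurable' jump_abs' BP_measurable[OF f] C]
  by (simp add: a_refl_int(2))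

lemma P_diff: "f \<in> BP \<Longrightarrow> g \<in> BP \<Longrightarrow> P (\<lambda>x. f x - g x) = (\<lambda>x. P f x - P g x)"
  by (auto simp: P_def right_diff_distrib P_integrable)
lemma Q_diff: "f \<in> BP \<Longrightarrow> g \<in> BP \<Longrightarrow> Q (\<lambda>x. f x - g x) = (\<lambda>x. Q f x - Q g x)"
  by (auto simp: Q_def right_diff_distrib Q_integrable)
lemma P_add: "f \<in> BP \<Longrightarrow> g \<in> BP \<Longrightarrow> P (\<lambda>x. f x + g x) = (\<lambda>x. P f x + P g x)"
  by (auto simp: P_def distrib_left P_integrable)
lemma P_const: "P (\<lambda>x. c) = (\<lambda>x. c)"
proof
  fix \<xi>
  have "P (\<lambda>x. c) \<xi> = (LINT \<eta>|lborel. a (\<xi> - \<eta>) * \<mu> \<xi> \<eta>) / rate \<xi> * c"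
    unfolding P_def jump_def by simp
  then show "P (\<lambda>x. c) \<xi> = c" using rate_pos[of \<xi>] by (simp add: rate_def[symmetric])
qed

lemma P_mono: "f \<in> BP \<Longrightarrow> g \<in> BP \<Longrightarrow> (\<And>x. f x \<le> g x) \<Longrightarrow> P f x \<le> P g x"
  unfolding P_def by (intro integral_mono P_integrable mult_left_mono jump_nonneg)
lemma Q_nonneg: "(\<And>x. f x \<ge> 0) \<Longrightarrow> Q f x \<ge> 0"
  unfolding Q_def by (intro integral_nonneg_AE AE_I2 mult_nonneg_nonneg jump_nonneg)
lemma P_nonneg: "(\<And>x. f x \<ge> 0) \<Longrightarrow> P f x \<ge> 0"
  unfolding P_def by (intro integral_nonneg_AE AE_I2 mult_nonneg_nonneg jump_nonneg)

lemma P_nn: "f \<in> BP \<Longrightarrow> (\<And>x. f x \<ge> 0) \<Longrightarrow> ennreal (P f \<xi>) = (\<integral>\<^sup>+\<eta>. ennreal (jump \<xi> \<eta>) * ennreal (f \<eta>) \<partial>lborel)"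
  unfolding P_def using jump_nonneg
  by (subst nn_integral_eq_integral[symmetric]) (auto simp: P_integrable ennreal_mult)
lemma Q_nn: "f \<in> BP \<Longrightarrow> (\<And>x. f x \<ge> 0) \<Longrightarrow> ennreal (Q f \<eta>) = (\<integral>\<^sup>+\<xi>. ennreal (jump \<xi> \<eta>) * ennreal (f \<xi>) \<partial>lborel)"
  unfolding Q_def using jump_nonneg
  by (subst nn_integral_eq_integral[symmetric]) (auto simp: Q_integrable ennreal_mult)

lemma P_range: "f \<in> BP \<Longrightarrow> (\<And>x. l \<le> f x) \<Longrightarrow> (\<And>x. f x \<le> u) \<Longrightarrow> l \<le> P f x \<and> P f x \<le> u"
  using P_mono[of "\<lambda>_. l" f x] P_mono[of f "\<lambda>_. u" x] by (simp add: P_const BP_const)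

lemma Ppow_BP: "f \<in> BP \<Longrightarrow> (P ^^ n) f \<in> BP" by (induction n) (auto intro: P_BP)
lemma Qpow_BP: "f \<in> BP \<Longrightarrow> (Q ^^ n) f \<in> BP" by (induction n) (auto intro: Q_BP)
lemma Ppow_range: assumes "f \<in> BP" "\<And>x. l \<le> f x" "\<And>x. f x \<le> u" shows "l \<le> (P ^^ n) f x \<and> (P ^^ n) f x \<le> u"
proof (induction n arbitrary: x)
  case (Suc n) then show ?case using P_range[OF Ppow_BP[OF assms(1), of n], of l u x] by auto
qed (use assms in simp)

lemma Ppow_diff: "f \<in> BP \<Longrightarrow> g \<in> BP \<Longrightarrow> (P ^^ n) (\<lambda>x. f x - g x) = (\<lambda>x. (P ^^ n) f x - (P ^^ n) g x)"
  by (induction n) (auto simp: P_diff Ppow_BP)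
lemma Ppow_const: "(P ^^ n) (\<lambda>x. c) = (\<lambda>x. c)" by (induction n) (auto simp: P_const)

lemma duality_nonneg:
  assumes p: "p \<in> BP" "\<And>x. p x \<ge> 0" and f: "f \<in> BP" "\<And>x. f x \<ge> 0"
  shows "cint (\<lambda>x. p x * P f x) = cint (\<lambda>x. Q p x * f x)"
proof -
  have [measurable]: "p \<in> borel_measurable borel" "f \<in> borel_measurable borel" using p f by (auto intro: BP_measurable)
  let ?H = "\<lambda>x y. ennreal (p x) * (ennreal (jump x y) * ennreal (f y))"
  have "ennreal (cint (\<lambda>x. p x * P f x)) = (\<integral>\<^sup>+x\<in>unit_cell. ennreal (p x * P f x) \<partial>lborel)"
    using p f by (intro ennreal_cint[symmetric] BP_mult P_BP) (auto intro!: mult_nonneg_nonneg P_nonneg)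
  also have "\<dots> = (\<integral>\<^sup>+x\<in>unit_cell. (\<integral>\<^sup>+y. ?H x y \<partial>lborel) \<partial>lborel)"
    using p f by (simp add: ennreal_mult P_nonneg P_nn nn_integral_cmult)
  also have "\<dots> = (\<integral>\<^sup>+y\<in>unit_cell. (\<integral>\<^sup>+x. ?H x y \<partial>lborel) \<partial>lborel)"
    by (rule nn_integral_cell_swap) (measurable, simp add: jump_per periodicD(1)[OF BP_periodic] p f)
  also have "\<dots> = (\<integral>\<^sup>+y\<in>unit_cell. ennreal (Q p y * f y) \<partial>lborel)"
  proof (rule nn_integral_cong)
    fix y
    have "(\<integral>\<^sup>+x. ?H x y \<partial>lborel) = (\<integral>\<^sup>+x. ennreal (jump x y) * ennreal (p x) * ennreal (f y) \<partial>lborel)"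
      by (simp add: mult_ac)
    also have "\<dots> = (\<integral>\<^sup>+x. ennreal (jump x y) * ennreal (p x) \<partial>lborel) * ennreal (f y)"
      by (rule nn_integral_multc) measurable
    also have "\<dots> = ennreal (Q p y * f y)" using p f by (simp add: ennreal_mult Q_nonneg Q_nn)
    finally show "(\<integral>\<^sup>+x. ?H x y \<partial>lborel) * indicator unit_cell y = ennreal (Q p y * f y) * indicator unit_cell y" by simp
  qed
  also have "\<dots> = ennreal (cint (\<lambda>x. Q p x * f x))"
    using p f by (intro ennreal_cint BP_mult Q_BP) (auto intro!: mult_nonneg_nonneg Q_nonneg)
  finally show ?thesis
    using p f by (subst (asm) ennreal_inj) (auto intro!: cint_nonneg mult_nonneg_nonneg P_nonneg Q_nonneg)
qed

text \<open>Adding constants makes first f and then p nonnegative, where the exchange of integrals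
  is available; the contributions of the constants are removed by linearity.\<close>

lemma duality: assumes p: "p \<in> BP" and f: "f \<in> BP"
  shows "cint (\<lambda>x. p x * P f x) = cint (\<lambda>x. Q p x * f x)"
proof -
  have *: "cint (\<lambda>x. p x * P f x) = cint (\<lambda>x. Q p x * f x)" if p: "p \<in> BP" "\<And>x. p x \<ge> 0" and f: "f \<in> BP" for p f
  proof -
    obtain C where C: "C > 0" "\<And>x. \<bar>f x\<bar> \<le> C" by (rule BP_bounded[OF f]) blast
    have f1: "(\<lambda>x. f x + C) \<in> BP" by (intro BP_add f BP_const)
    have "0 \<le> f x + C" for x using C(2)[of x] by linarith
    then have 1: "cint (\<lambda>x. p x * P (\<lambda>x. f x + C) x) = cint (\<lambda>x. Q p x * (f x + C))"
      by (intro duality_nonneg p f1)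
    have 2: "cint (\<lambda>x. p x * P (\<lambda>x. C) x) = cint (\<lambda>x. Q p x * C)"
      using C by (intro duality_nonneg p BP_const) auto
    show ?thesis using 1 2 p f
      by (simp add: P_add BP_const distrib_left cint_add BP_mult P_BP Q_BP)
  qed
  obtain C where C: "C > 0" "\<And>x. \<bar>p x\<bar> \<le> C" by (rule BP_bounded[OF p]) blast
  have p1: "(\<lambda>x. p x + C) \<in> BP" by (intro BP_add p BP_const)
  have "0 \<le> p x + C" for x using C(2)[of x] by linarith
  then have 1: "cint (\<lambda>x. (p x + C) * P f x) = cint (\<lambda>x. Q (\<lambda>x. p x + C) x * f x)"
    by (intro * p1 f)
  have 2: "cint (\<lambda>x. C * P f x) = cint (\<lambda>x. Q (\<lambda>x. C) x * f x)"
    using C by (intro * f BP_const) auto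
  have "Q (\<lambda>x. p x + C) = (\<lambda>x. Q p x + Q (\<lambda>x. C) x)"
    using Q_diff[OF p1 BP_const[of C]] by (auto simp: fun_eq_iff)
  then show ?thesis using 1 2 p f
    by (simp add: distrib_right cint_add BP_mult P_BP Q_BP BP_const BP_scale)
qed

lemma duality_pow: "p \<in> BP \<Longrightarrow> f \<in> BP \<Longrightarrow> cint (\<lambda>x. p x * (P ^^ n) f x) = cint (\<lambda>x. (Q ^^ n) p x * f x)"
proof (induction n arbitrary: f)
  case (Suc n)
  have "cint (\<lambda>x. p x * (P ^^ Suc n) f x) = cint (\<lambda>x. p x * (P ^^ n) (P f) x)" by (simp add: funpow_swap1)
  also have "\<dots> = cint (\<lambda>x. (Q ^^ n) p x * P f x)" using Suc by (simp add: P_BP)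
  also have "\<dots> = cint (\<lambda>x. (Q ^^ Suc n) p x * f x)" using Suc.prems by (simp add: duality Qpow_BP)
  finally show ?case .
qed simp

section \<open>Geometric ergodicity of the chain\<close>

lemma P_minorization:
  obtains N \<delta> where "\<delta> > 0" "N > 0" "\<And>f x. f \<in> BP \<Longrightarrow> (\<And>x. f x \<ge> 0) \<Longrightarrow> \<delta> * cint f \<le> (P ^^ N) f x"
proof (rule minorization[OF a_int a_nonneg a_pos c_pos(1), of P])
  fix f :: "real ^ 'n \<Rightarrow> real" and x assume f: "f \<in> BP" "\<And>x. f x \<ge> 0"
  have [measurable]: "f \<in> borel_measurable borel" by (rule BP_measurable[OF f(1)])
  have "ennreal c_low * (\<integral>\<^sup>+y. ennreal (a (x - y)) * ennreal (f y) \<partial>lborel)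
     = (\<integral>\<^sup>+y. ennreal (c_low * a (x - y)) * ennreal (f y) \<partial>lborel)"
    using c_pos by (simp add: nn_integral_cmult[symmetric] ennreal_mult' mult.assoc)
  also have "\<dots> \<le> ennreal (P f x)"
    unfolding P_nn[OF f] using jump_lower by (intro nn_integral_mono mult_right_mono ennreal_leI) auto
  finally show "ennreal c_low * (\<integral>\<^sup>+y. ennreal (a (x - y)) * ennreal (f y) \<partial>lborel) \<le> ennreal (P f x)" .
qed (auto intro: P_BP P_nonneg that)

lemma Q_minorization:
  obtains N \<delta> where "\<delta> > 0" "N > 0" "\<And>f x. f \<in> BP \<Longrightarrow> (\<And>x. f x \<ge> 0) \<Longrightarrow> \<delta> * cint f \<le> (Q ^^ N) f x"
proof (rule minorization[OF a_refl_int(1), of c_low Q])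
  fix f :: "real ^ 'n \<Rightarrow> real" and x assume f: "f \<in> BP" "\<And>x. f x \<ge> 0"
  have [measurable]: "f \<in> borel_measurable borel" by (rule BP_measurable[OF f(1)])
  have "ennreal c_low * (\<integral>\<^sup>+y. ennreal (a (- (x - y))) * ennreal (f y) \<partial>lborel)
     = (\<integral>\<^sup>+y. ennreal (c_low * a (y - x)) * ennreal (f y) \<partial>lborel)"
    using c_pos by (simp add: nn_integral_cmult[symmetric] ennreal_mult' mult.assoc)
  also have "\<dots> \<le> ennreal (Q f x)"
    unfolding Q_nn[OF f] using jump_lower by (intro nn_integral_mono mult_right_mono ennreal_leI) auto
  finally show "ennreal c_low * (\<integral>\<^sup>+y. ennreal (a (- (x - y))) * ennreal (f y) \<partial>lborel) \<le> ennreal (Q f x)" .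
qed (auto intro: Q_BP Q_nonneg that a_nonneg c_pos simp: a_refl_int(2) mass_pos)

text \<open>Doeblin's contraction. Minorization applied to f - l and u - f raises the lower bound
  and lowers the upper one after N steps; the gains \<open>\<delta> * (cint f - l)\<close> and
  \<open>\<delta> * (u - cint f)\<close> add up to \<delta> times the width, whatever the mean is.
  Carrying an enclosing interval instead of the oscillation avoids infima and suprema.\<close>

lemma P_decay:
  obtains C \<rho> where "C > 0" "0 < \<rho>" "\<rho> < 1"
    "\<And>f l u n. f \<in> BP \<Longrightarrow> (\<And>x. l \<le> f x) \<Longrightarrow> (\<And>x. f x \<le> u) \<Longrightarrow>
      \<exists>l' u'. (\<forall>x. l' \<le> (P ^^ n) f x \<and> (P ^^ n) f x \<le> u') \<and> u' - l' \<le> C * \<rho> ^ n * (u - l)"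
proof -
  obtain N \<delta>' where d': "\<delta>' > 0" "N > 0" and min': "\<And>f x. f \<in> BP \<Longrightarrow> (\<And>x. f x \<ge> 0) \<Longrightarrow> \<delta>' * cint f \<le> (P ^^ N) f x"
    by (rule P_minorization) blast
  \<comment> \<open>The cap keeps the contraction factor 1 - \<delta> positive, so that its N-th
    root can serve as the rate.\<close>
  define \<delta> where "\<delta> = min \<delta>' (1/2)"
  have d: "\<delta> > 0" "\<delta> < 1" using d' by (auto simp: \<delta>_def)
  have min: "\<delta> * cint f \<le> (P ^^ N) f x" if f: "f \<in> BP" "\<And>x. f x \<ge> 0" for f x
  proof -
    have "\<delta> * cint f \<le> \<delta>' * cint f" using f(2) by (intro mult_right_mono cint_nonneg) (auto simp: \<delta>_def)
    then show ?thesis using min'[OF f, of x] by linarith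
  qed
  let ?r = "1 - \<delta>"
  have step: "\<exists>l' u'. (\<forall>x. l' \<le> (P ^^ N) f x \<and> (P ^^ N) f x \<le> u') \<and> u' - l' = ?r * (u - l)"
    if f: "f \<in> BP" and r: "\<And>x. l \<le> f x" "\<And>x. f x \<le> u" for f l u
  proof -
    have "\<delta> * cint (\<lambda>x. f x - l) \<le> (P ^^ N) (\<lambda>x. f x - l) x" for x
      using r by (intro min BP_diff f BP_const) auto
    then have 1: "\<delta> * (cint f - l) + l \<le> (P ^^ N) f x" for x
      by (simp add: Ppow_diff f BP_const Ppow_const cint_diff cint_const algebra_simps)
    have "\<delta> * cint (\<lambda>x. u - f x) \<le> (P ^^ N) (\<lambda>x. u - f x) x" for x
      using r by (intro min BP_diff f BP_const) auto
    then have 2: "(P ^^ N) f x \<le> u - \<delta> * (u - cint f)" for x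
      by (simp add: Ppow_diff f BP_const Ppow_const cint_diff cint_const algebra_simps)
    show ?thesis using 1 2
      by (intro exI[of _ "\<delta> * (cint f - l) + l"] exI[of _ "u - \<delta> * (u - cint f)"]) (simp add: algebra_simps)
  qed
  have iter: "\<exists>l' u'. (\<forall>x. l' \<le> (P ^^ (k * N)) f x \<and> (P ^^ (k * N)) f x \<le> u') \<and> u' - l' = ?r ^ k * (u - l)"
    if f: "f \<in> BP" and r: "\<And>x. l \<le> f x" "\<And>x. f x \<le> u" for f l u k
  proof (induction k)
    case 0 then show ?case using r by auto
  next
    case (Suc k)
    then obtain l' u' where IH: "\<And>x. l' \<le> (P ^^ (k * N)) f x" "\<And>x. (P ^^ (k * N)) f x \<le> u'" "u' - l' = ?r ^ k * (u - l)" by blast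
    have "(P ^^ (Suc k * N)) f = (P ^^ N) ((P ^^ (k * N)) f)" by (simp add: funpow_add)
    then show ?case using step[OF Ppow_BP[OF f] IH(1,2)] by (simp add: IH(3) mult.assoc)
  qed
  define \<rho> where "\<rho> = root N ?r"
  have \<rho>: "0 < \<rho>" "\<rho> < 1" "\<rho> ^ N = ?r" using d d' by (auto simp: \<rho>_def)
  \<comment> \<open>Only complete blocks of N steps contract; the unfinished block costs at most one
    factor \<open>1 / ?r\<close>.\<close>
  have pow: "?r ^ (n div N) \<le> 1 / ?r * \<rho> ^ n" for n
  proof -
    have "?r ^ (n div N) * ?r \<le> ?r ^ (n div N) * \<rho> ^ (n mod N)"
      using \<rho> d d' by (intro mult_left_mono) (auto simp: \<rho>(3)[symmetric] simp del: \<rho>(3) intro!: power_decreasing less_imp_le)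
    also have "\<dots> = \<rho> ^ (N * (n div N) + n mod N)" unfolding power_add power_mult \<rho>(3) ..
    also have "\<dots> = \<rho> ^ n" by simp
    finally show ?thesis using d by (simp add: field_simps)
  qed
  show thesis
  proof (rule that[of "1 / ?r" \<rho>])
    fix f :: "real ^ 'n \<Rightarrow> real" and l u n assume f: "f \<in> BP" and r: "\<And>x. l \<le> f x" "\<And>x. f x \<le> u"
    obtain l' u' where 1: "\<And>x. l' \<le> (P ^^ ((n div N) * N)) f x" "\<And>x. (P ^^ ((n div N) * N)) f x \<le> u'" "u' - l' = ?r ^ (n div N) * (u - l)"
      using iter[OF f r, of "n div N"] by blast
    have "(P ^^ n) f = (P ^^ (n mod N + (n div N) * N)) f" by simp
    also have "\<dots> = (P ^^ (n mod N)) ((P ^^ ((n div N) * N)) f)" by (simp only: funpow_add o_apply)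
    finally have eq: "(P ^^ n) f = (P ^^ (n mod N)) ((P ^^ ((n div N) * N)) f)" .
    have "l' \<le> (P ^^ n) f x \<and> (P ^^ n) f x \<le> u'" for x
      unfolding eq by (rule Ppow_range[OF Ppow_BP[OF f] 1(1,2)])
    moreover have "u' - l' \<le> 1 / ?r * \<rho> ^ n * (u - l)"
      unfolding 1(3) using order_trans[OF r(1) r(2)] by (intro mult_right_mono pow) simp
    ultimately show "\<exists>l' u'. (\<forall>x. l' \<le> (P ^^ n) f x \<and> (P ^^ n) f x \<le> u') \<and> u' - l' \<le> 1 / ?r * \<rho> ^ n * (u - l)" by blast
  qed (use d \<rho> in auto)
qed

text \<open>By the Cauchy-Schwarz inequality two steps of the chain have a density bounded by a multiple of
  the squared $L^2$ norm of the periodization. Only here the square integrability of the periodization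
  is needed.\<close>

lemma Q_smoothing:
  obtains C where "C > 0" "\<And>g \<eta>. g \<in> BP \<Longrightarrow> \<bar>Q (Q g) \<eta>\<bar> \<le> C * cint (\<lambda>x. \<bar>g x\<bar>)"
proof -
  obtain e :: "nat \<Rightarrow> real ^ 'n" where e: "bij_betw e UNIV integer_lattice" by (rule integer_lattice_enumeration)
  have eL: "e i \<in> integer_lattice" for i using e by (auto simp: bij_betw_def)
  let ?C = "indicator unit_cell :: real ^ 'n \<Rightarrow> ennreal"
  define h where "h = periodization a"
  have h[measurable]: "h \<in> borel_measurable borel" unfolding h_def by (rule periodization_measurable) measurable
  have hper: "periodic h" unfolding h_def by (rule periodization_periodic)
  have hs: "h x = (\<Sum>i. ennreal (a (x + e i)))" for x unfolding h_def by (rule periodization_eq_suminf[OF e])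
  define M where "M = enn2real (\<integral>\<^sup>+\<eta>\<in>unit_cell. (h \<eta>)\<^sup>2 \<partial>lborel)"
  have M0: "M \<ge> 0" by (simp add: M_def)
  have M: "(\<integral>\<^sup>+\<eta>\<in>unit_cell. (h \<eta>)\<^sup>2 \<partial>lborel) = ennreal M"
    using a_periodization unfolding M_def h_def by (simp add: less_top[symmetric])
  define A where "A x = (\<integral>\<^sup>+w. ennreal (a (x - w)) * ennreal (a w) \<partial>lborel)" for x
  have [measurable]: "A \<in> borel_measurable borel" unfolding A_def[abs_def] by measurable
  \<comment> \<open>Periodizing the autoconvolution of \<open>a\<close> gives the autoconvolution
    over the cell of its periodization \<open>h\<close>; Cauchy-Schwarz bounds it by the squared L2
    norm, since reflecting and shifting the argument do not change cell integrals.\<close>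
  have Asum: "(\<Sum>i. A (x + e i)) \<le> ennreal M" for x
  proof -
    have "(\<Sum>i. A (x + e i)) = (\<integral>\<^sup>+w. (\<Sum>i. ennreal (a (x + e i - w)) * ennreal (a w)) \<partial>lborel)"
      unfolding A_def by (rule nn_integral_suminf[symmetric]) measurable
    also have "\<dots> = (\<integral>\<^sup>+w. h (x - w) * ennreal (a w) \<partial>lborel)"
      by (simp add: hs ennreal_suminf_multc diff_add_eq)
    also have "\<dots> = (\<Sum>j. \<integral>\<^sup>+w\<in>unit_cell. h (x - (w + e j)) * ennreal (a (w + e j)) \<partial>lborel)"
      by (rule nn_integral_tiling[OF e]) measurable
    also have "\<dots> = (\<Sum>j. \<integral>\<^sup>+w. h (x - w) * ennreal (a (w + e j)) * ?C w \<partial>lborel)"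
      using periodicD(2)[OF hper eL] by (simp add: diff_diff_add[symmetric])
    also have "\<dots> = (\<integral>\<^sup>+w. (\<Sum>j. h (x - w) * ennreal (a (w + e j)) * ?C w) \<partial>lborel)"
      by (rule nn_integral_suminf[symmetric]) measurable
    also have "\<dots> = (\<integral>\<^sup>+w\<in>unit_cell. h (x - w) * h w \<partial>lborel)"
      by (simp only: ennreal_suminf_multc ennreal_suminf_cmult hs[symmetric])
    also have "\<dots> = (\<integral>\<^sup>+w. (h (x - w) * ?C w) * (h w * ?C w) \<partial>lborel)"
      by (intro nn_integral_cong) (auto simp: indicator_def)
    finally have S: "(\<Sum>i. A (x + e i)) = (\<integral>\<^sup>+w. (h (x - w) * ?C w) * (h w * ?C w) \<partial>lborel)" .
    have "(\<Sum>i. A (x + e i))\<^sup>2 \<le> (\<integral>\<^sup>+w. (h (x - w) * ?C w)\<^sup>2 \<partial>lborel) * (\<integral>\<^sup>+w. (h w * ?C w)\<^sup>2 \<partial>lborel)"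
      unfolding S by (rule Cauchy_Schwarz_nn_integral) measurable
    also have "(\<integral>\<^sup>+w. (h (x - w) * ?C w)\<^sup>2 \<partial>lborel) = (\<integral>\<^sup>+w\<in>unit_cell. (h (x - w))\<^sup>2 \<partial>lborel)"
      by (intro nn_integral_cong) (auto simp: indicator_def)
    also have "\<dots> = (\<integral>\<^sup>+w\<in>unit_cell. (h w)\<^sup>2 \<partial>lborel)"
      using hper by (intro nn_integral_cell_reflect) (auto simp: periodic_def)
    also have "(\<integral>\<^sup>+w. (h w * ?C w)\<^sup>2 \<partial>lborel) = (\<integral>\<^sup>+w\<in>unit_cell. (h w)\<^sup>2 \<partial>lborel)"
      by (intro nn_integral_cong) (auto simp: indicator_def)
    finally have "(\<Sum>i. A (x + e i))\<^sup>2 \<le> (ennreal M)\<^sup>2" by (simp only: M power2_eq_square[of "ennreal M"])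
    then show ?thesis
      by (cases "\<Sum>i. A (x + e i)") (auto simp: ennreal_power M0 top_unique intro!: ennreal_leI elim: power2_le_imp_le)
  qed
  have bound: "\<bar>Q (Q g) \<eta>\<bar> \<le> c_up * c_up * M * cint (\<lambda>x. \<bar>g x\<bar>)" if g: "g \<in> BP" for g \<eta>
  proof -
    have [measurable]: "g \<in> borel_measurable borel" by (rule BP_measurable[OF g])
    let ?G = "\<lambda>\<xi>. ennreal \<bar>g \<xi>\<bar>"
    have qa: "ennreal (jump x y) \<le> ennreal c_up * ennreal (a (x - y))" for x y
      using jump_upper[of x y] c_pos a_nonneg by (simp add: ennreal_mult[symmetric] ennreal_leI)
    have Q1: "ennreal \<bar>Q f y\<bar> \<le> ennreal c_up * (\<integral>\<^sup>+x. ennreal (a (x - y)) * ennreal \<bar>f x\<bar> \<partial>lborel)"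
      if [measurable]: "f \<in> borel_measurable borel" for f y
    proof -
      have "ennreal \<bar>Q f y\<bar> \<le> (\<integral>\<^sup>+x. ennreal \<bar>jump x y * f x\<bar> \<partial>lborel)" unfolding Q_def by (rule ennreal_abs_integral_le)
      also have "\<dots> \<le> (\<integral>\<^sup>+x. ennreal c_up * (ennreal (a (x - y)) * ennreal \<bar>f x\<bar>) \<partial>lborel)"
      proof (rule nn_integral_mono)
        fix x
        have "ennreal \<bar>jump x y * f x\<bar> = ennreal (jump x y) * ennreal \<bar>f x\<bar>"
          using jump_nonneg[of x y] by (simp add: abs_mult ennreal_mult)
        then show "ennreal \<bar>jump x y * f x\<bar> \<le> ennreal c_up * (ennreal (a (x - y)) * ennreal \<bar>f x\<bar>)"
          using mult_right_mono[OF qa[of x y], of "ennreal \<bar>f x\<bar>"] by (simp add: mult.assoc)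
      qed
      also have "\<dots> = ennreal c_up * (\<integral>\<^sup>+x. ennreal (a (x - y)) * ennreal \<bar>f x\<bar> \<partial>lborel)" by (rule nn_integral_cmult) measurable
      finally show ?thesis .
    qed
    have Qgm: "Q g \<in> borel_measurable borel" by (rule BP_measurable[OF Q_BP[OF g]])
    have "ennreal \<bar>Q (Q g) \<eta>\<bar> \<le> ennreal c_up * (\<integral>\<^sup>+\<zeta>. ennreal (a (\<zeta> - \<eta>)) * ennreal \<bar>Q g \<zeta>\<bar> \<partial>lborel)"
      by (rule Q1[OF Qgm])
    also have "\<dots> \<le> ennreal c_up * (\<integral>\<^sup>+\<zeta>. ennreal (a (\<zeta> - \<eta>)) * (ennreal c_up * (\<integral>\<^sup>+\<xi>. ennreal (a (\<xi> - \<zeta>)) * ?G \<xi> \<partial>lborel)) \<partial>lborel)"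
      by (intro mult_left_mono nn_integral_mono Q1) auto
    also have "\<dots> = ennreal c_up * (ennreal c_up * (\<integral>\<^sup>+\<zeta>. (\<integral>\<^sup>+\<xi>. ennreal (a (\<zeta> - \<eta>)) * (ennreal (a (\<xi> - \<zeta>)) * ?G \<xi>) \<partial>lborel) \<partial>lborel))"
      by (subst nn_integral_cmult[symmetric], measurable) (simp add: nn_integral_cmult mult.left_commute)
    also have "(\<integral>\<^sup>+\<zeta>. (\<integral>\<^sup>+\<xi>. ennreal (a (\<zeta> - \<eta>)) * (ennreal (a (\<xi> - \<zeta>)) * ?G \<xi>) \<partial>lborel) \<partial>lborel)
      = (\<integral>\<^sup>+\<xi>. (\<integral>\<^sup>+\<zeta>. ennreal (a (\<zeta> - \<eta>)) * (ennreal (a (\<xi> - \<zeta>)) * ?G \<xi>) \<partial>lborel) \<partial>lborel)"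
      by (rule lborel_pair.Fubini') measurable
    also have "\<dots> = (\<integral>\<^sup>+\<xi>. A (\<xi> - \<eta>) * ?G \<xi> \<partial>lborel)"
    proof (rule nn_integral_cong)
      fix \<xi>
      have "A (\<xi> - \<eta>) = (\<integral>\<^sup>+\<zeta>. ennreal (a (\<xi> - \<zeta>)) * ennreal (a (\<zeta> - \<eta>)) \<partial>lborel)"
        unfolding A_def using nn_integral_translate(3)[of "\<lambda>w. ennreal (a (\<xi> - \<eta> - w)) * ennreal (a w)" \<eta>] by simp
      then have "A (\<xi> - \<eta>) * ?G \<xi> = (\<integral>\<^sup>+\<zeta>. ennreal (a (\<xi> - \<zeta>)) * ennreal (a (\<zeta> - \<eta>)) * ?G \<xi> \<partial>lborel)"
        by (simp add: nn_integral_multc)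
      then show "(\<integral>\<^sup>+\<zeta>. ennreal (a (\<zeta> - \<eta>)) * (ennreal (a (\<xi> - \<zeta>)) * ?G \<xi>) \<partial>lborel) = A (\<xi> - \<eta>) * ?G \<xi>"
        by (simp add: mult_ac)
    qed
    also have "\<dots> = (\<Sum>i. \<integral>\<^sup>+\<xi>\<in>unit_cell. A (\<xi> + e i - \<eta>) * ?G (\<xi> + e i) \<partial>lborel)"
      by (rule nn_integral_tiling[OF e]) measurable
    also have "\<dots> = (\<Sum>i. \<integral>\<^sup>+\<xi>. A (\<xi> - \<eta> + e i) * (?G \<xi> * ?C \<xi>) \<partial>lborel)"
      by (simp add: periodicD[OF BP_periodic[OF g] eL] algebra_simps)
    also have "\<dots> = (\<integral>\<^sup>+\<xi>. (\<Sum>i. A (\<xi> - \<eta> + e i) * (?G \<xi> * ?C \<xi>)) \<partial>lborel)"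
      by (rule nn_integral_suminf[symmetric]) measurable
    also have "\<dots> \<le> (\<integral>\<^sup>+\<xi>. ennreal M * (?G \<xi> * ?C \<xi>) \<partial>lborel)"
      unfolding ennreal_suminf_multc by (intro nn_integral_mono mult_right_mono Asum) simp
    also have "\<dots> = ennreal M * (\<integral>\<^sup>+\<xi>\<in>unit_cell. ennreal \<bar>g \<xi>\<bar> \<partial>lborel)" by (rule nn_integral_cmult) measurable
    also have "(\<integral>\<^sup>+\<xi>\<in>unit_cell. ennreal \<bar>g \<xi>\<bar> \<partial>lborel) = ennreal (cint (\<lambda>x. \<bar>g x\<bar>))"
      using BP_comp[OF g, of abs 0] by (intro ennreal_cint) auto
    finally have "ennreal \<bar>Q (Q g) \<eta>\<bar> \<le> ennreal c_up * (ennreal c_up * (ennreal M * ennreal (cint (\<lambda>x. \<bar>g x\<bar>))))"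
      by (simp add: mult_left_mono)
    also have "\<dots> = ennreal (c_up * c_up * M * cint (\<lambda>x. \<bar>g x\<bar>))"
      using c_pos by (simp add: ennreal_mult[symmetric] M_def cint_nonneg mult.assoc)
    finally show ?thesis
      using c_pos by (subst (asm) ennreal_le_iff) (auto simp: M_def intro!: mult_nonneg_nonneg cint_nonneg)
  qed
  have "\<bar>Q (Q g) \<eta>\<bar> \<le> (c_up * c_up * M + 1) * cint (\<lambda>x. \<bar>g x\<bar>)" if "g \<in> BP" for g \<eta>
    using bound[OF that, of \<eta>] cint_nonneg[of "\<lambda>x. \<bar>g x\<bar>"] by (simp add: distrib_right)
  moreover have "c_up * c_up * M + 1 > 0" using c_pos by (intro add_nonneg_pos mult_nonneg_nonneg) (auto simp: M_def)
  ultimately show thesis using that by blast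
qed

text \<open>The densities \<open>Q ^^ n\<close> of 1 are shown to converge uniformly. By duality the
  contraction of P gives geometric decay of their increments in L1 of the cell only; two further
  steps of Q convert this into decay in the sup norm, so the telescoping series converges to a
  bounded function and invariance passes to the limit.\<close>

lemma invariant_density:
  obtains \<pi> \<delta> where "\<pi> \<in> BP" "\<delta> > 0" "\<And>x. \<pi> x \<ge> \<delta>" "cint \<pi> = 1" "Q \<pi> = \<pi>"
proof -
  obtain K where K: "K > 0" "\<And>g \<eta>. g \<in> BP \<Longrightarrow> \<bar>Q (Q g) \<eta>\<bar> \<le> K * cint (\<lambda>x. \<bar>g x\<bar>)" by (rule Q_smoothing) blast
  obtain C \<rho> where \<rho>: "C > 0" "0 < \<rho>" "\<rho> < 1" and dec: "\<And>f l u n. f \<in> BP \<Longrightarrow> (\<And>x. l \<le> f x) \<Longrightarrow> (\<And>x. f x \<le> u) \<Longrightarrow>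
      \<exists>l' u'. (\<forall>x. l' \<le> (P ^^ n) f x \<and> (P ^^ n) f x \<le> u') \<and> u' - l' \<le> C * \<rho> ^ n * (u - l)"
    by (rule P_decay) blast
  define p where "p n = (Q ^^ n) (\<lambda>_. 1)" for n
  have p: "p n \<in> BP" for n unfolding p_def by (rule Qpow_BP[OF BP_const])
  have pS: "Q (p n) = p (Suc n)" for n by (simp add: p_def)
  define d where "d n x = p (Suc n) x - p n x" for n x
  have d: "d n \<in> BP" for n unfolding d_def[abs_def] by (intro BP_diff p)
  have dS: "Q (d n) = d (Suc n)" for n unfolding d_def[abs_def] by (simp add: Q_diff p pS)
  \<comment> \<open>The increment is tested with its own sign f. By duality its L1 norm is the mean
    of \<open>P ((P ^^ n) f) - (P ^^ n) f\<close>, and both terms take values in the same interval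
    of geometrically small width.\<close>
  have d1: "cint (\<lambda>x. \<bar>d n x\<bar>) \<le> C * \<rho> ^ n * 2" for n
  proof -
    define f where "f x = sgn (d n x)" for x
    have f: "f \<in> BP" unfolding f_def[abs_def] using BP_comp[OF d, of sgn 1 n] by (auto simp: sgn_if)
    have fr: "-1 \<le> f x" "f x \<le> 1" for x by (auto simp: f_def sgn_if)
    obtain l' u' where lu: "\<And>x. l' \<le> (P ^^ n) f x" "\<And>x. (P ^^ n) f x \<le> u'" "u' - l' \<le> C * \<rho> ^ n * (1 - - 1)"
      using dec[OF f fr, of n] by blast
    have Pf: "(P ^^ n) f \<in> BP" by (rule Ppow_BP[OF f])
    have "\<bar>d n x\<bar> = p (Suc n) x * f x - p n x * f x" for x
      by (simp add: f_def left_diff_distrib[symmetric] d_def[symmetric] abs_sgn)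
    then have "cint (\<lambda>x. \<bar>d n x\<bar>) = cint (\<lambda>x. p (Suc n) x * f x) - cint (\<lambda>x. p n x * f x)"
      by (simp add: cint_diff BP_mult p f)
    also have "\<dots> = cint (\<lambda>x. P ((P ^^ n) f) x - (P ^^ n) f x)"
      using duality_pow[OF BP_const[of 1] f, of "Suc n"] duality_pow[OF BP_const[of 1] f, of n]
      by (simp add: p_def[symmetric] cint_diff P_BP Pf pS)
    also have "\<dots> \<le> C * \<rho> ^ n * 2"
    proof -
      have "\<bar>P ((P ^^ n) f) x - (P ^^ n) f x\<bar> \<le> C * \<rho> ^ n * 2" for x
        using P_range[OF Pf lu(1,2), of x] lu(1)[of x] lu(2)[of x] lu(3) by (simp add: abs_le_iff)
      from cint_abs[OF BP_diff[OF P_BP[OF Pf] Pf] this] show ?thesis by linarith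
    qed
    finally show ?thesis .
  qed
  \<comment> \<open>The two applications of \<open>Q\<close> spent on smoothing are the reason for
    the index shift by 2 in the series for \<open>\<pi>\<close>.\<close>
  have dsup: "\<bar>d (n + 2) x\<bar> \<le> K * (C * \<rho> ^ n * 2)" for n x
  proof -
    have "\<bar>d (n + 2) x\<bar> = \<bar>Q (Q (d n)) x\<bar>" by (simp add: dS)
    also have "\<dots> \<le> K * cint (\<lambda>x. \<bar>d n x\<bar>)" by (rule K(2)[OF d])
    also have "\<dots> \<le> K * (C * \<rho> ^ n * 2)" using K(1) d1 by (intro mult_left_mono) auto
    finally show ?thesis .
  qed
  define \<pi> where "\<pi> x = p 2 x + (\<Sum>n. d (n + 2) x)" for x
  have "uniform_limit UNIV (\<lambda>n x. \<Sum>i<n. d (i + 2) x) (\<lambda>x. \<Sum>n. d (n + 2) x) sequentially"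
    by (rule Weierstrass_m_test[where M="\<lambda>n. K * (C * \<rho> ^ n * 2)"])
       (use dsup \<rho> in \<open>auto intro!: summable_mult summable_mult2 summable_geometric\<close>)
  note ulsum = this
  have "uniform_limit UNIV (\<lambda>n x. p 2 x + (\<Sum>i<n. d (i + 2) x)) \<pi> sequentially"
    unfolding \<pi>_def[abs_def] by (intro uniform_limit_add uniform_limit_const ulsum)
  moreover have "(\<lambda>n x. p 2 x + (\<Sum>i<n. d (i + 2) x)) = (\<lambda>n. p (n + 2))"
    using sum_lessThan_telescope[of "\<lambda>i. p (i + 2) _"] by (simp add: d_def fun_eq_iff numeral_2_eq_2)
  ultimately have ul: "uniform_limit UNIV (\<lambda>n. p (n + 2)) \<pi> sequentially" by simp
  have \<pi>: "\<pi> \<in> BP" by (rule BP_uniform_limit[OF p ul])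
  have lim: "(\<lambda>n. p (n + 2) x) \<longlonglongrightarrow> \<pi> x" for x by (rule tendsto_uniform_limitI[OF ul]) simp
  have pn: "p n x \<ge> 0" for n x unfolding p_def by (induction n arbitrary: x) (auto intro: Q_nonneg)
  have \<pi>0: "\<pi> x \<ge> 0" for x by (rule LIMSEQ_le_const[OF lim]) (use pn in auto)
  have close: "\<exists>n. \<forall>x. \<bar>p (n + 2) x - \<pi> x\<bar> < e \<and> \<bar>p (Suc n + 2) x - \<pi> x\<bar> < e" if epos: "e > 0" for e
  proof -
    obtain N where "\<And>n x. n \<ge> N \<Longrightarrow> dist (p (n + 2) x) (\<pi> x) < e"
      using uniform_limitD[OF ul epos] by (auto simp: eventually_sequentially)
    then show ?thesis by (intro exI[of _ N]) (auto simp: dist_real_def)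
  qed
  have cp: "cint (p n) = 1" for n
    using duality_pow[OF BP_const[of 1] BP_const[of 1], of n] by (simp add: p_def Ppow_const cint_const)
  have c1: "cint \<pi> = 1"
  proof (rule ccontr)
    assume "cint \<pi> \<noteq> 1"
    then have "\<bar>1 - cint \<pi>\<bar> > 0" by simp
    from close[OF this] obtain n where n: "\<And>x. \<bar>p (n + 2) x - \<pi> x\<bar> < \<bar>1 - cint \<pi>\<bar>" by blast
    define e where "e = \<bar>1 - cint \<pi>\<bar> / 2"
    from close[of e] \<open>\<bar>1 - cint \<pi>\<bar> > 0\<close> obtain n where n: "\<And>x. \<bar>p (n + 2) x - \<pi> x\<bar> < e" by (auto simp: e_def)
    have "\<bar>cint (\<lambda>x. p (n + 2) x - \<pi> x)\<bar> \<le> e" using n by (intro cint_abs BP_diff p \<pi>) (auto intro: less_imp_le)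
    then show False using \<open>\<bar>1 - cint \<pi>\<bar> > 0\<close> by (simp add: cint_diff p \<pi> cp e_def)
  qed
  have Q\<pi>: "Q \<pi> = \<pi>"
  proof
    fix x
    show "Q \<pi> x = \<pi> x"
    proof (rule ccontr)
      assume ne: "Q \<pi> x \<noteq> \<pi> x"
      \<comment> \<open>Q has sup norm at most \<open>c_up * mass\<close>, so an approximation of
        the limit within e on two consecutive steps confines the supposed gap to half of
        itself.\<close>
      define e where "e = \<bar>Q \<pi> x - \<pi> x\<bar> / (2 * (c_up * mass + 1))"
      have cm: "c_up * mass > 0" using c_pos mass_pos by simp
      have e: "e > 0" using ne cm by (auto simp: e_def intro!: divide_pos_pos)
      obtain n where n: "\<And>x. \<bar>p (n + 2) x - \<pi> x\<bar> < e" "\<And>x. \<bar>p (Suc n + 2) x - \<pi> x\<bar> < e" using close[OF e] by blast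
      have "\<bar>Q (\<lambda>x. p (n + 2) x - \<pi> x) x\<bar> \<le> c_up * mass * e"
        using n(1) by (intro Q_bound BP_diff p \<pi>) (auto intro: less_imp_le)
      then have "\<bar>p (Suc n + 2) x - Q \<pi> x\<bar> \<le> c_up * mass * e" by (simp add: Q_diff p \<pi> pS)
      then have "\<bar>Q \<pi> x - \<pi> x\<bar> \<le> (c_up * mass + 1) * e" using n(2)[of x] by (simp add: distrib_right)
      also have "\<dots> = \<bar>Q \<pi> x - \<pi> x\<bar> / 2" using cm by (simp add: e_def field_simps)
      finally show False using ne by simp
    qed
  qed
  \<comment> \<open>The lower bound comes from the minorization of the dual chain, applied to a
    nonnegative fixed point of integral 1.\<close>
  obtain N \<delta> where d: "\<delta> > 0" "N > 0" and min: "\<And>f x. f \<in> BP \<Longrightarrow> (\<And>x. f x \<ge> 0) \<Longrightarrow> \<delta> * cint f \<le> (Q ^^ N) f x"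
    by (rule Q_minorization) blast
  have "(Q ^^ N) \<pi> = \<pi>" for N by (induction N) (auto simp: Q\<pi>)
  then have "\<pi> x \<ge> \<delta>" for x using min[OF \<pi> \<pi>0, of x] c1 by simp
  then show thesis using that \<pi> d(1) c1 Q\<pi> by blast
qed

definition \<pi> :: "real ^ 'n \<Rightarrow> real" where
  "\<pi> = (SOME \<pi>. \<pi> \<in> BP \<and> (\<exists>\<delta>>0. \<forall>x. \<pi> x \<ge> \<delta>) \<and> cint \<pi> = 1 \<and> Q \<pi> = \<pi>)"

lemma \<pi>: "\<pi> \<in> BP" "\<exists>\<delta>>0. \<forall>x. \<pi> x \<ge> \<delta>" "cint \<pi> = 1" "Q \<pi> = \<pi>"
proof -
  have "\<exists>\<pi>. \<pi> \<in> BP \<and> (\<exists>\<delta>>0. \<forall>x. \<pi> x \<ge> \<delta>) \<and> cint \<pi> = 1 \<and> Q \<pi> = \<pi>"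
    by (rule invariant_density) blast
  from someI_ex[OF this] show "\<pi> \<in> BP" "\<exists>\<delta>>0. \<forall>x. \<pi> x \<ge> \<delta>" "cint \<pi> = 1" "Q \<pi> = \<pi>"
    unfolding \<pi>_def by blast+
qed

text \<open>Neumann series. Invariance of \<pi> preserves the orthogonality condition under P, so
  every iterate has mean 0 with respect to \<pi> and its enclosing interval must contain 0. Decay of
  the width of that interval therefore is decay in the sup norm, and the series converges
  uniformly.\<close>

lemma poisson_equation:
  assumes f: "f \<in> BP" and c: "cint (\<lambda>x. \<pi> x * f x) = 0"
  obtains g where "g \<in> BP" "\<And>x. g x - P g x = f x"
proof -
  obtain C \<rho> where \<rho>: "C > 0" "0 < \<rho>" "\<rho> < 1" and dec: "\<And>f l u n. f \<in> BP \<Longrightarrow> (\<And>x. l \<le> f x) \<Longrightarrow> (\<And>x. f x \<le> u) \<Longrightarrow>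
      \<exists>l' u'. (\<forall>x. l' \<le> (P ^^ n) f x \<and> (P ^^ n) f x \<le> u') \<and> u' - l' \<le> C * \<rho> ^ n * (u - l)"
    by (rule P_decay) blast
  obtain B where B: "B > 0" "\<And>x. \<bar>f x\<bar> \<le> B" by (rule BP_bounded[OF f]) blast
  obtain \<delta> where \<delta>: "\<delta> > 0" "\<And>x. \<pi> x \<ge> \<delta>" using \<pi>(2) by blast
  have \<pi>0: "\<pi> x \<ge> 0" for x using \<delta>(1) \<delta>(2)[of x] by linarith
  have Pb: "\<bar>(P ^^ n) f x\<bar> \<le> C * \<rho> ^ n * (2 * B)" for n x
  proof -
    have fr: "- B \<le> f x" "f x \<le> B" for x using B(2)[of x] by (auto simp: abs_le_iff minus_le_iff)
    obtain l' u' where lu: "\<And>x. l' \<le> (P ^^ n) f x" "\<And>x. (P ^^ n) f x \<le> u'" "u' - l' \<le> C * \<rho> ^ n * (B - - B)"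
      using dec[OF f fr, of n] by blast
    have Pf: "(P ^^ n) f \<in> BP" by (rule Ppow_BP[OF f])
    have "(Q ^^ n) \<pi> = \<pi>" by (induction n) (auto simp: \<pi>(4))
    then have z: "cint (\<lambda>x. \<pi> x * (P ^^ n) f x) = 0" using duality_pow[OF \<pi>(1) f, of n] c by simp
    have "cint (\<lambda>x. l' * \<pi> x) \<le> cint (\<lambda>x. \<pi> x * (P ^^ n) f x)"
      by (intro cint_mono BP_scale \<pi>(1) BP_mult[OF \<pi>(1) Pf]) (subst mult.commute, rule mult_left_mono[OF lu(1) \<pi>0])
    moreover have "cint (\<lambda>x. \<pi> x * (P ^^ n) f x) \<le> cint (\<lambda>x. u' * \<pi> x)"
      by (intro cint_mono BP_scale \<pi>(1) BP_mult[OF \<pi>(1) Pf]) (subst (2) mult.commute, rule mult_left_mono[OF lu(2) \<pi>0])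
    ultimately have "l' \<le> 0" "0 \<le> u'" using z by (simp_all add: cint_scale \<pi>)
    then show ?thesis using lu(1)[of x] lu(2)[of x] lu(3) by (simp add: abs_le_iff)
  qed
  define S where "S m x = (\<Sum>n<m. (P ^^ n) f x)" for m x
  have S: "S m \<in> BP" for m unfolding S_def[abs_def] by (intro BP_sum Ppow_BP f)
  have PS: "P (S m) x = S (Suc m) x - f x" for m x
  proof (induction m)
    case 0 then show ?case by (simp add: S_def[abs_def] P_const)
  next
    case (Suc m)
    have "S (Suc m) = (\<lambda>x. S m x + (P ^^ m) f x)" by (simp add: S_def[abs_def])
    then have "P (S (Suc m)) x = P (S m) x + (P ^^ Suc m) f x" by (simp add: P_add S Ppow_BP f)
    moreover have "S (Suc (Suc m)) x = S (Suc m) x + (P ^^ Suc m) f x" by (simp add: S_def)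
    ultimately show ?case using Suc by linarith
  qed
  define g where "g x = (\<Sum>n. (P ^^ n) f x)" for x
  have ul: "uniform_limit UNIV S g sequentially"
    unfolding S_def[abs_def] g_def[abs_def]
    by (rule Weierstrass_m_test[where M="\<lambda>n. C * \<rho> ^ n * (2 * B)"])
       (use Pb \<rho> in \<open>auto intro!: summable_mult summable_mult2 summable_geometric\<close>)
  have g: "g \<in> BP" by (rule BP_uniform_limit[OF S ul])
  have "g x - P g x = f x" for x
  proof (rule ccontr)
    assume ne: "g x - P g x \<noteq> f x"
    define e where "e = \<bar>g x - P g x - f x\<bar> / 4"
    have e: "e > 0" using ne by (simp add: e_def)
    obtain N where N: "\<And>n x. n \<ge> N \<Longrightarrow> dist (S n x) (g x) < e"
      using uniform_limitD[OF ul e] by (auto simp: eventually_sequentially)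
    have 1: "\<bar>S (Suc N) x - g x\<bar> < e" using N[of "Suc N" x] by (simp add: dist_real_def)
    have b: "\<bar>S N y - g y\<bar> < e" for y using N[of N y] by (simp add: dist_real_def)
    have r: "- e \<le> S N y - g y" "S N y - g y \<le> e" for y using b[of y] by linarith+
    have "- e \<le> P (\<lambda>x. S N x - g x) x \<and> P (\<lambda>x. S N x - g x) x \<le> e"
      by (intro P_range BP_diff S g r)
    then have "\<bar>S (Suc N) x - f x - P g x\<bar> \<le> e" by (simp add: P_diff S g PS abs_le_iff)
    then have "\<bar>g x - P g x - f x\<bar> < 2 * e" using 1 by linarith
    then show False using e by (simp add: e_def)
  qed
  from that[OF g this] show thesis .
qed

end

lemma component_measurable [measurable (raw)]:
  fixes f :: "'a \<Rightarrow> real ^ 'n"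
  assumes "f \<in> borel_measurable M" shows "(\<lambda>x. f x $ i) \<in> borel_measurable M"
  using measurable_compose[OF assms borel_measurable_nth] .

lemma BP_shift: assumes f: "f \<in> BP" shows "(\<lambda>x. f (x - z)) \<in> BP"
proof -
  obtain C where C: "C > 0" "\<And>x. \<bar>f x\<bar> \<le> C" by (rule BP_bounded[OF f]) blast
  have [measurable]: "f \<in> borel_measurable borel" by (rule BP_measurable[OF f])
  show ?thesis
  proof (rule BP_I[OF _ _ C(2)])
    fix k x :: "real ^ 'a" assume k: "k \<in> integer_lattice"
    show "f (x + k - z) = f (x - z)" using periodicD(1)[OF BP_periodic[OF f] k, of "x - z"] by (simp add: algebra_simps)
  qed measurable
qed

text \<open>The reflections in z and in 0 have the same cell integral, and together they make a
  shift; adding a constant reduces the claim to nonnegative functions.\<close>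

lemma cint_shift: assumes f: "f \<in> BP" shows "cint (\<lambda>x. f (x - z)) = cint f"
proof -
  have nn: "cint (\<lambda>x. f (x - z)) = cint f" if f: "f \<in> BP" "\<And>x. f x \<ge> 0" for f :: "real ^ 'a \<Rightarrow> real"
  proof -
    have [measurable]: "f \<in> borel_measurable borel" by (rule BP_measurable[OF f(1)])
    have p: "periodic (\<lambda>w. ennreal (f (- w)))"
      using periodicD(2)[OF BP_periodic[OF f(1)], of _ "- _"] by (auto simp: periodic_def)
    have "ennreal (cint (\<lambda>x. f (x - z))) = (\<integral>\<^sup>+x\<in>unit_cell. ennreal (f (- (z - x))) \<partial>lborel)"
      using f by (subst ennreal_cint[symmetric]) (auto intro: BP_shift)
    also have "\<dots> = (\<integral>\<^sup>+x\<in>unit_cell. ennreal (f (- (0 - x))) \<partial>lborel)"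
      using nn_integral_cell_reflect[OF _ p, of z] nn_integral_cell_reflect[OF _ p, of 0] by simp
    also have "\<dots> = ennreal (cint f)" using f by (simp add: ennreal_cint)
    finally show ?thesis using f by (subst (asm) ennreal_inj) (auto intro: cint_nonneg)
  qed
  obtain C where C: "C > 0" "\<And>x. \<bar>f x\<bar> \<le> C" by (rule BP_bounded[OF f]) blast
  have "0 \<le> f x + C" for x using C(2)[of x] by linarith
  then have "cint (\<lambda>x. f (x - z) + C) = cint (\<lambda>x. f x + C)" by (intro nn BP_add f BP_const)
  then show ?thesis using f by (simp add: cint_add BP_shift BP_const)
qed

context periodic_kernel
begin

subsection \<open>The cell problems\<close>

text \<open>The stationary density in continuous time is that of the jump chain divided by the jump rate.\<close>

definition p0 :: "real ^ 'n \<Rightarrow> real" where "p0 x = \<pi> x / rate x"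

lemma p0_BP: "p0 \<in> BP"
  unfolding p0_def[abs_def]
  by (rule BP_divide[OF \<pi>(1) rate_BP _ rate_lower]) (use \<mu>_bounds mass_pos in simp)

lemma p0_lower: obtains c where "c > 0" "\<And>x. p0 x \<ge> c"
proof -
  obtain \<delta> where \<delta>: "\<delta> > 0" "\<And>x. \<pi> x \<ge> \<delta>" using \<pi>(2) by blast
  have "p0 x \<ge> \<delta> / (\<alpha>\<^sub>2 * mass)" for x
    unfolding p0_def using \<delta>(1) \<delta>(2)[of x] rate_upper[of x] rate_pos[of x] by (intro frac_le) linarith+
  note le = this
  have "\<delta> / (\<alpha>\<^sub>2 * mass) > 0" using \<delta> \<alpha>2_pos mass_pos by simp
  from that[OF this le] show thesis .
qed

lemma p0_nonneg: "p0 x \<ge> 0"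
proof -
  obtain c where "c > 0" "\<And>x. p0 x \<ge> c" by (rule p0_lower) blast
  note c = this
  show ?thesis using c(1) c(2)[of x] by linarith
qed

lemma cint_p0_pos: "cint p0 > 0"
proof -
  obtain c where c: "c > 0" "\<And>x. p0 x \<ge> c" by (rule p0_lower) blast
  have "cint (\<lambda>x :: real ^ 'n. c) \<le> cint p0" using c by (intro cint_mono BP_const p0_BP)
  then show ?thesis using c by (simp add: cint_const)
qed

text \<open>Detailed as a balance of fluxes: the flow into y from all points equals the flow out of
  y. In this form stationarity enters the energy inequality.\<close>

lemma p0_stationary: "(LINT x|lborel. p0 x * (a (x - y) * \<mu> x y)) = p0 y * rate y"
proof -
  have "p0 y * rate y = Q \<pi> y" using rate_pos[of y] by (simp add: p0_def \<pi>(4))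
  also have "\<dots> = (LINT x|lborel. p0 x * (a (x - y) * \<mu> x y))"
    unfolding Q_def p0_def jump_def by (intro Bochner_Integration.integral_cong) auto
  finally show ?thesis by simp
qed

text \<open>The kernel in jump variables: z is the displacement of a jump from \<xi> to \<xi> - z,
  so the moments of \<open>a\<close> control it directly.\<close>

definition K :: "real ^ 'n \<Rightarrow> real ^ 'n \<Rightarrow> real" where "K \<xi> z = a z * \<mu> \<xi> (\<xi> - z)"

lemma K_measurable [measurable]: "(\<lambda>(x, z). K x z) \<in> borel_measurable (borel \<Otimes>\<^sub>M borel)"
proof -
  have "(\<lambda>p. \<mu> (fst p) (fst p - snd p)) \<in> borel_measurable (borel \<Otimes>\<^sub>M borel)" by measurable
  then show ?thesis unfolding K_def[abs_def] by (simp add: case_prod_beta)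
qed

lemma K_nonneg: "K \<xi> z \<ge> 0" unfolding K_def using a_nonneg \<mu>_nonneg by simp
lemma K_le: "K \<xi> z \<le> \<alpha>\<^sub>2 * a z"
  unfolding K_def using mult_left_mono[OF \<mu>_bounds(3) a_nonneg] by (simp add: mult.commute)
lemma K_ge: "\<alpha>\<^sub>1 * a z \<le> K \<xi> z"
  unfolding K_def using mult_left_mono[OF \<mu>_bounds(2) a_nonneg] by (simp add: mult.commute)
lemma K_per: "k \<in> integer_lattice \<Longrightarrow> K (\<xi> + k) z = K \<xi> z"
  unfolding K_def using \<mu>_per(1)[of k \<xi>] \<mu>_per(2)[of k \<xi> "\<xi> - z"] by (metis add_diff_eq add.commute \<mu>_per)

lemma weight_integrable: "integrable lborel (\<lambda>z. a z * (1 + (norm z)\<^sup>2))"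
  using Bochner_Integration.integrable_add[OF a_int a_second] by (simp add: algebra_simps)

lemma moment_integrable:
  assumes [measurable]: "h \<in> borel_measurable borel" and h: "\<And>z. \<bar>h z\<bar> \<le> C * (1 + (norm z)\<^sup>2)"
  shows "integrable lborel (\<lambda>z. K \<xi> z * h z)"
    "\<bar>LINT z|lborel. K \<xi> z * h z\<bar> \<le> \<alpha>\<^sub>2 * C * (LINT z|lborel. a z * (1 + (norm z)\<^sup>2))"
proof -
  have [measurable]: "K \<xi> \<in> borel_measurable borel" by measurable
  have i: "integrable lborel (\<lambda>z. \<alpha>\<^sub>2 * C * (a z * (1 + (norm z)\<^sup>2)))" by (intro integrable_mult_right weight_integrable)
  have le: "\<bar>K \<xi> z * h z\<bar> \<le> \<alpha>\<^sub>2 * C * (a z * (1 + (norm z)\<^sup>2))" for z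
  proof -
    have "\<bar>K \<xi> z * h z\<bar> = K \<xi> z * \<bar>h z\<bar>" using K_nonneg by (simp add: abs_mult)
    also have "\<dots> \<le> (\<alpha>\<^sub>2 * a z) * (C * (1 + (norm z)\<^sup>2))"
      using \<alpha>2_pos a_nonneg by (intro mult_mono K_le h) auto
    finally show ?thesis by (simp add: mult_ac)
  qed
  show i2: "integrable lborel (\<lambda>z. K \<xi> z * h z)"
    by (rule Bochner_Integration.integrable_bound[OF i]) (use le in \<open>auto intro!: AE_I2 order_trans[OF le abs_ge_self]\<close>)
  have "\<bar>LINT z|lborel. K \<xi> z * h z\<bar> \<le> (LINT z|lborel. \<bar>K \<xi> z * h z\<bar>)" by (rule integral_abs_bound)
  also have "\<dots> \<le> (LINT z|lborel. \<alpha>\<^sub>2 * C * (a z * (1 + (norm z)\<^sup>2)))"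
    by (intro integral_mono integrable_abs i i2 le)
  finally show "\<bar>LINT z|lborel. K \<xi> z * h z\<bar> \<le> \<alpha>\<^sub>2 * C * (LINT z|lborel. a z * (1 + (norm z)\<^sup>2))" by simp
qed

lemma moment_BP:
  assumes [measurable]: "(\<lambda>(x, z). h x z) \<in> borel_measurable (borel \<Otimes>\<^sub>M borel)" and h: "\<And>x z. \<bar>h x z\<bar> \<le> C * (1 + (norm z)\<^sup>2)"
    and per: "\<And>k x z. k \<in> integer_lattice \<Longrightarrow> h (x + k) z = h x z"
  shows "(\<lambda>\<xi>. LINT z|lborel. K \<xi> z * h \<xi> z) \<in> BP"
proof (rule BP_I)
  show "\<bar>LINT z|lborel. K \<xi> z * h \<xi> z\<bar> \<le> \<alpha>\<^sub>2 * C * (LINT z|lborel. a z * (1 + (norm z)\<^sup>2))" for \<xi>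
    by (rule moment_integrable(2)) (measurable, rule h)
qed (measurable, simp add: K_per per)

lemma norm_le_weight: "norm z \<le> 1 + (norm z)\<^sup>2" for z :: "real ^ 'n"
proof -
  have "2 * norm z \<le> (norm z)\<^sup>2 + 1" using zero_le_power2[of "norm z - 1"] unfolding power2_diff by simp
  then show ?thesis using norm_ge_zero[of z] by linarith
qed

lemma component_weight: "\<bar>z $ i\<bar> \<le> 1 + (norm z)\<^sup>2" "\<bar>z $ i * z $ j\<bar> \<le> 1 + (norm z)\<^sup>2" for z :: "real ^ 'n"
proof -
  show "\<bar>z $ i\<bar> \<le> 1 + (norm z)\<^sup>2" using component_le_norm_cart[of z i] norm_le_weight[of z] by linarith
  have "\<bar>z $ i\<bar> * \<bar>z $ j\<bar> \<le> norm z * norm z" by (intro mult_mono component_le_norm_cart) auto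
  then show "\<bar>z $ i * z $ j\<bar> \<le> 1 + (norm z)\<^sup>2" by (simp add: abs_mult power2_eq_square)
qed

text \<open>The operator at \<epsilon> = 1 in jump variables, that is, the generator of the
  continuous-time process whose embedded chain is \<open>P\<close>.\<close>

definition gen :: "(real ^ 'n \<Rightarrow> real) \<Rightarrow> real ^ 'n \<Rightarrow> real" where
  "gen g \<xi> = (LINT z|lborel. K \<xi> z * (g (\<xi> - z) - g \<xi>))"

lemma K_shift_integrable: assumes g: "g \<in> BP" shows "integrable lborel (\<lambda>z. K \<xi> z * g (\<xi> - z))"
proof -
  obtain C where C: "C > 0" "\<And>x. \<bar>g x\<bar> \<le> C" by (rule BP_bounded[OF g]) blast
  have [measurable]: "g \<in> borel_measurable borel" by (rule BP_measurable[OF g])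
  show ?thesis
  proof (rule moment_integrable(1)[where C=C])
    show "\<bar>g (\<xi> - z)\<bar> \<le> C * (1 + (norm z)\<^sup>2)" for z
    proof -
      have "C * 1 \<le> C * (1 + (norm z)\<^sup>2)" using C(1) by (intro mult_left_mono) auto
      then show ?thesis using C(2)[of "\<xi> - z"] by simp
    qed
  qed measurable
qed

lemma K_integrable: "integrable lborel (\<lambda>z. K \<xi> z)"
  using K_shift_integrable[OF BP_const[of 1], of \<xi>] by simp

lemma K_integral: "(LINT z|lborel. K \<xi> z) = rate \<xi>"
proof -
  have [measurable]: "\<mu> \<xi> \<in> borel_measurable borel" by measurable
  show ?thesis unfolding K_def rate_def
    using lborel_integral_shift(2)[of "\<lambda>\<eta>. a (\<xi> - \<eta>) * \<mu> \<xi> \<eta>" \<xi>] by simp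
qed

lemma gen_eq: assumes g: "g \<in> BP" shows "gen g \<xi> = rate \<xi> * (P g \<xi> - g \<xi>)"
proof -
  have [measurable]: "\<mu> \<xi> \<in> borel_measurable borel" "g \<in> borel_measurable borel" using BP_measurable[OF g] by measurable
  have "gen g \<xi> = (LINT z|lborel. K \<xi> z * g (\<xi> - z)) - (LINT z|lborel. K \<xi> z * g \<xi>)"
    unfolding gen_def using K_shift_integrable[OF g] K_integrable by (simp add: right_diff_distrib)
  also have "(LINT z|lborel. K \<xi> z * g (\<xi> - z)) = (LINT \<eta>|lborel. a (\<xi> - \<eta>) * \<mu> \<xi> \<eta> * g \<eta>)"
    unfolding K_def using lborel_integral_shift(2)[of "\<lambda>\<eta>. a (\<xi> - \<eta>) * \<mu> \<xi> \<eta> * g \<eta>" \<xi>] by simp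
  also have "\<dots> = rate \<xi> * P g \<xi>"
    unfolding P_def jump_def using rate_pos[of \<xi>] by (subst integral_mult_right_zero[symmetric]) (simp add: mult.assoc)
  finally show ?thesis by (simp add: K_integral right_diff_distrib)
qed

lemma gen_BP: assumes g: "g \<in> BP" shows "gen g \<in> BP"
  unfolding gen_eq[OF g, abs_def] by (intro BP_mult rate_BP BP_diff P_BP g)

lemma cint_p0_gen: assumes g: "g \<in> BP" shows "cint (\<lambda>x. p0 x * gen g x) = 0"
proof -
  have "p0 x * gen g x = \<pi> x * P g x - \<pi> x * g x" for x
    using rate_pos[of x] by (simp add: p0_def gen_eq[OF g] right_diff_distrib)
  then show ?thesis using duality[OF \<pi>(1) g] by (simp add: cint_diff BP_mult \<pi> P_BP g)
qed

definition mean :: "(real ^ 'n \<Rightarrow> real) \<Rightarrow> real" where "mean f = cint (\<lambda>x. p0 x * f x) / cint p0"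

text \<open>Division by the jump rate turns the equation for the generator into the Poisson equation
  of the chain. Since \<open>p0\<close> is \<pi> divided by the rate, subtracting the
  \<open>p0\<close>-mean is exactly the solvability condition.\<close>

lemma cell_equation: assumes f: "f \<in> BP" obtains g where "g \<in> BP" "\<And>\<xi>. gen g \<xi> = f \<xi> - mean f"
proof -
  define F where "F x = (mean f - f x) / rate x" for x
  have F: "F \<in> BP" unfolding F_def[abs_def]
    by (rule BP_divide[OF BP_diff[OF BP_const f] rate_BP _ rate_lower]) (use \<mu>_bounds mass_pos in simp)
  have "\<pi> x * F x = mean f * p0 x - p0 x * f x" for x by (simp add: F_def p0_def field_simps diff_divide_distrib)
  then have "cint (\<lambda>x. \<pi> x * F x) = mean f * cint p0 - cint (\<lambda>x. p0 x * f x)"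
    by (simp add: cint_diff BP_scale BP_mult p0_BP f cint_scale)
  also have "\<dots> = 0" using cint_p0_pos by (simp add: mean_def)
  finally obtain g where g: "g \<in> BP" "\<And>x. g x - P g x = F x" by (rule poisson_equation[OF F]) blast
  have "gen g \<xi> = f \<xi> - mean f" for \<xi>
  proof -
    have "gen g \<xi> = rate \<xi> * - F \<xi>" unfolding gen_eq[OF g(1)] using g(2)[of \<xi>] by (metis minus_diff_eq)
    then show ?thesis using rate_pos[of \<xi>] by (simp add: F_def)
  qed
  from that[OF g(1) this] show thesis .
qed

definition first_moment :: "'n \<Rightarrow> real ^ 'n \<Rightarrow> real" where
  "first_moment i \<xi> = (LINT z|lborel. K \<xi> z * z $ i)"

lemma first_moment_BP: "first_moment i \<in> BP"
  unfolding first_moment_def[abs_def] by (rule moment_BP[where C=1], measurable) (simp_all add: component_weight)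

text \<open>The generator has mean 0 against \<open>p0\<close>, so this is the only constant vector
  for which the equations of the first correctors are solvable.\<close>

definition drift :: "real ^ 'n" where "drift = (\<chi> i. mean (first_moment i))"

definition corr :: "'n \<Rightarrow> real ^ 'n \<Rightarrow> real" where
  "corr i = (SOME g. g \<in> BP \<and> (\<forall>\<xi>. gen g \<xi> = first_moment i \<xi> - drift $ i))"

lemma corr: "corr i \<in> BP" "gen (corr i) \<xi> = first_moment i \<xi> - drift $ i"
proof -
  have "\<exists>g. g \<in> BP \<and> (\<forall>\<xi>. gen g \<xi> = first_moment i \<xi> - drift $ i)"
    using cell_equation[OF first_moment_BP[of i]] by (auto simp: drift_def)
  from someI_ex[OF this] show "corr i \<in> BP" "gen (corr i) \<xi> = first_moment i \<xi> - drift $ i"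
    unfolding corr_def by blast+
qed

text \<open>The coefficient of the second derivatives once the first corrector is inserted: the
  second-order Taylor term of the jump, the correlation of the jump with the corrector at its
  endpoint, and the transport of the corrector by the moving frame. It is not symmetrised in i and
  j, so neither is \<open>Theta\<close>.\<close>

definition second_moment :: "'n \<Rightarrow> 'n \<Rightarrow> real ^ 'n \<Rightarrow> real" where
  "second_moment i j \<xi> = (LINT z|lborel. K \<xi> z * (z $ i * z $ j / 2 - z $ j * corr i (\<xi> - z))) + drift $ j * corr i \<xi>"

lemma linear_shift_bound:
  fixes z :: "real ^ 'n"
  assumes "\<And>x. \<bar>g x\<bar> \<le> C" "C \<ge> 0" shows "\<bar>z $ j * g (\<xi> - z)\<bar> \<le> C * (1 + (norm z)\<^sup>2)"
  using mult_mono[OF component_weight(1)[of z j] assms(1)[of "\<xi> - z"]] by (simp add: abs_mult mult.commute)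

lemma second_moment_BP: "second_moment i j \<in> BP"
proof -
  obtain C where C: "C > 0" "\<And>x. \<bar>corr i x\<bar> \<le> C" by (rule BP_bounded[OF corr(1)]) blast
  have [measurable]: "corr i \<in> borel_measurable borel" by (rule BP_measurable[OF corr(1)])
  have "(\<lambda>\<xi>. LINT z|lborel. K \<xi> z * (z $ i * z $ j / 2 - z $ j * corr i (\<xi> - z))) \<in> BP"
  proof (rule moment_BP[where C="1 + C"])
    show "\<bar>z $ i * z $ j / 2 - z $ j * corr i (\<xi> - z)\<bar> \<le> (1 + C) * (1 + (norm z)\<^sup>2)" for \<xi> z
    proof -
      have "\<bar>z $ j * corr i (\<xi> - z)\<bar> \<le> C * (1 + (norm z)\<^sup>2)" using C by (intro linear_shift_bound) auto
      moreover have "\<bar>z $ i * z $ j / 2\<bar> \<le> 1 + (norm z)\<^sup>2" using component_weight(2)[of z i j] by simp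
      ultimately show ?thesis
        unfolding distrib_right mult_1_left by (intro order_trans[OF abs_triangle_ineq4] add_mono)
    qed
    fix k x z :: "real ^ 'n" assume k: "k \<in> integer_lattice"
    show "z $ i * z $ j / 2 - z $ j * corr i (x + k - z) = z $ i * z $ j / 2 - z $ j * corr i (x - z)"
      using periodicD(1)[OF BP_periodic[OF corr(1)[of i]] k, of "x - z"] by (simp add: algebra_simps)
  qed measurable
  then show ?thesis unfolding second_moment_def[abs_def] by (intro BP_add BP_scale corr(1))
qed

definition Theta :: "real ^ 'n ^ 'n" where "Theta = (\<chi> i j. mean (second_moment i j))"

definition corr2 :: "'n \<Rightarrow> 'n \<Rightarrow> real ^ 'n \<Rightarrow> real" where
  "corr2 i j = (SOME g. g \<in> BP \<and> (\<forall>\<xi>. gen g \<xi> = Theta $ i $ j - second_moment i j \<xi>))"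

lemma corr2: "corr2 i j \<in> BP" "gen (corr2 i j) \<xi> = Theta $ i $ j - second_moment i j \<xi>"
proof -
  have "(\<lambda>\<xi>. - second_moment i j \<xi>) \<in> BP" using BP_scale[OF second_moment_BP[of i j], of "-1"] by simp
  from cell_equation[OF this] obtain g where g: "g \<in> BP" "\<And>\<xi>. gen g \<xi> = - second_moment i j \<xi> - mean (\<lambda>\<xi>. - second_moment i j \<xi>)" by blast
  moreover have "mean (\<lambda>\<xi>. - second_moment i j \<xi>) = - Theta $ i $ j"
    using cint_scale[of "-1" "\<lambda>x. p0 x * second_moment i j x"] by (simp add: mean_def Theta_def)
  moreover note g(1)
  ultimately have "\<exists>g. g \<in> BP \<and> (\<forall>\<xi>. gen g \<xi> = Theta $ i $ j - second_moment i j \<xi>)" by (intro exI[of _ g]) auto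
  from someI_ex[OF this] show "corr2 i j \<in> BP" "gen (corr2 i j) \<xi> = Theta $ i $ j - second_moment i j \<xi>"
    unfolding corr2_def by blast+
qed

end

section \<open>Positive definiteness of the effective matrix\<close>

lemma AE_lborel_hyperplane:
  fixes r :: "'a::euclidean_space"
  assumes "r \<noteq> 0" shows "AE z in lborel. z \<bullet> r \<noteq> 0"
proof -
  have "{z. r \<bullet> z = 0} \<in> null_sets lebesgue"
    using negligible_hyperplane[of r 0] assms by (simp add: negligible_iff_null_sets)
  moreover have "{z. r \<bullet> z = 0} \<in> sets borel" by (intro borel_closed closed_hyperplane)
  ultimately have "{z. r \<bullet> z = 0} \<in> null_sets lborel" by (simp add: null_sets_def)
  then show ?thesis by (rule AE_I') (auto simp: inner_commute)
qed

context periodic_kernel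
begin

text \<open>The quadratic form of \<open>Theta\<close> is the Dirichlet form of a linear function
  corrected by X. Expanding the square in \<open>E\<close> gives the second-moment form plus half of
  \<open>gen\<close> applied to X^2; the corrector equation accounts for the product of X with
  \<open>gen X\<close>, and the generator has mean 0 against \<open>p0\<close>.\<close>

lemma dirichlet_identity:
  fixes r :: "real ^ 'n"
  defines "X \<equiv> \<lambda>x. \<Sum>i\<in>UNIV. r $ i * corr i x"
  defines "E \<equiv> \<lambda>\<xi>. LINT z|lborel. K \<xi> z * ((z \<bullet> r - X (\<xi> - z) + X \<xi>)\<^sup>2 / 2)"
  shows "X \<in> BP" "E \<in> BP" "cint (\<lambda>x. p0 x * E x) = cint p0 * ((Theta *v r) \<bullet> r)"
proof -
  show X: "X \<in> BP" unfolding X_def by (intro BP_sum BP_scale corr(1))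
  have [measurable]: "X \<in> borel_measurable borel" by (rule BP_measurable[OF X])
  have X2: "(\<lambda>x. X x * X x) \<in> BP" by (intro BP_mult X)
  obtain C where C: "C > 0" "\<And>x. \<bar>X x\<bar> \<le> C" by (rule BP_bounded[OF X]) blast
  have hX: "\<bar>z \<bullet> r - X (\<xi> - z) + X \<xi>\<bar> \<le> norm r * norm z + 2 * C" for z \<xi>
    using C(2)[of "\<xi> - z"] C(2)[of \<xi>] Cauchy_Schwarz_ineq2[of z r] by (simp add: mult.commute)
  have E_bound: "\<bar>(z \<bullet> r - X (\<xi> - z) + X \<xi>)\<^sup>2 / 2\<bar> \<le> ((norm r)\<^sup>2 + (2 * C)\<^sup>2) * (1 + (norm z)\<^sup>2)" for z \<xi>
  proof -
    have "(z \<bullet> r - X (\<xi> - z) + X \<xi>)\<^sup>2 \<le> (norm r * norm z + 2 * C)\<^sup>2"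
      using power_mono[OF hX abs_ge_zero, of z \<xi> 2] by simp
    also have "\<dots> \<le> 2 * ((norm r * norm z)\<^sup>2 + (2 * C)\<^sup>2)"
      using sum_squares_bound[of "norm r * norm z" "2 * C"] by (simp add: power2_sum)
    also have "\<dots> \<le> 2 * (((norm r)\<^sup>2 + (2 * C)\<^sup>2) * (1 + (norm z)\<^sup>2))"
      by (simp add: algebra_simps power_mult_distrib)
    finally show ?thesis by simp
  qed
  show E: "E \<in> BP" unfolding E_def
  proof (rule moment_BP[OF _ E_bound])
    fix k x z :: "real ^ 'n" assume k: "k \<in> integer_lattice"
    show "(z \<bullet> r - X (x + k - z) + X (x + k))\<^sup>2 / 2 = (z \<bullet> r - X (x - z) + X x)\<^sup>2 / 2"
      using periodicD(1)[OF BP_periodic[OF X] k, of "x - z"] periodicD(1)[OF BP_periodic[OF X] k, of x]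
      by (simp add: algebra_simps)
  qed measurable
  define F where "F x = (\<Sum>i\<in>UNIV. \<Sum>j\<in>UNIV. r $ i * r $ j * second_moment i j x)" for x
  have F: "F \<in> BP" unfolding F_def[abs_def] by (intro BP_sum BP_scale second_moment_BP)
  have i1: "integrable lborel (\<lambda>z. K \<xi> z * (z $ i * z $ j / 2 - z $ j * corr i (\<xi> - z)))" for \<xi> i j
  proof -
    obtain D where D: "D > 0" "\<And>x. \<bar>corr i x\<bar> \<le> D" by (rule BP_bounded[OF corr(1)]) blast
    have [measurable]: "corr i \<in> borel_measurable borel" by (rule BP_measurable[OF corr(1)])
    show ?thesis
    proof (rule moment_integrable(1)[where C="1 + D"])
      show "\<bar>z $ i * z $ j / 2 - z $ j * corr i (\<xi> - z)\<bar> \<le> (1 + D) * (1 + (norm z)\<^sup>2)" for z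
      proof -
        have "\<bar>z $ j * corr i (\<xi> - z)\<bar> \<le> D * (1 + (norm z)\<^sup>2)" using D by (intro linear_shift_bound) auto
        moreover have "\<bar>z $ i * z $ j / 2\<bar> \<le> 1 + (norm z)\<^sup>2" using component_weight(2)[of z i j] by simp
        ultimately show ?thesis
          unfolding distrib_right mult_1_left by (intro order_trans[OF abs_triangle_ineq4] add_mono)
      qed
    qed measurable
  qed
  have i2: "integrable lborel (\<lambda>z. K \<xi> z * z $ i)" for \<xi> i
    by (rule moment_integrable(1)[where C=1], measurable) (simp add: component_weight)
  have Fint: "F \<xi> = (LINT z|lborel. K \<xi> z * ((z \<bullet> r)\<^sup>2 / 2 - (z \<bullet> r) * X (\<xi> - z))) + (drift \<bullet> r) * X \<xi>" for \<xi>
  proof -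
    have "F \<xi> = (\<Sum>i\<in>UNIV. \<Sum>j\<in>UNIV. LINT z|lborel. r $ i * r $ j * (K \<xi> z * (z $ i * z $ j / 2 - z $ j * corr i (\<xi> - z))))
       + (\<Sum>i\<in>UNIV. \<Sum>j\<in>UNIV. r $ i * r $ j * (drift $ j * corr i \<xi>))"
      unfolding F_def second_moment_def using i1 by (simp add: distrib_left sum.distrib)
    also have "(\<Sum>i\<in>UNIV. \<Sum>j\<in>UNIV. LINT z|lborel. r $ i * r $ j * (K \<xi> z * (z $ i * z $ j / 2 - z $ j * corr i (\<xi> - z))))
       = (LINT z|lborel. (\<Sum>i\<in>UNIV. \<Sum>j\<in>UNIV. r $ i * r $ j * (K \<xi> z * (z $ i * z $ j / 2 - z $ j * corr i (\<xi> - z)))))"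
      using i1 by (simp add: Bochner_Integration.integral_sum)
    also have "\<dots> = (LINT z|lborel. K \<xi> z * ((z \<bullet> r)\<^sup>2 / 2 - (z \<bullet> r) * X (\<xi> - z)))"
    proof (rule Bochner_Integration.integral_cong[OF refl])
      fix z
      have "(z \<bullet> r)\<^sup>2 = (\<Sum>i\<in>UNIV. \<Sum>j\<in>UNIV. (z $ i * r $ i) * (z $ j * r $ j))"
        by (simp add: power2_eq_square inner_vec_def sum_product)
      moreover have "X (\<xi> - z) * (z \<bullet> r) = (\<Sum>i\<in>UNIV. \<Sum>j\<in>UNIV. (r $ i * corr i (\<xi> - z)) * (z $ j * r $ j))"
        by (simp add: X_def inner_vec_def sum_product)
      then have "(z \<bullet> r) * X (\<xi> - z) = (\<Sum>i\<in>UNIV. \<Sum>j\<in>UNIV. (r $ i * corr i (\<xi> - z)) * (z $ j * r $ j))"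
        by (simp only: mult.commute[of "z \<bullet> r"])
      ultimately show "(\<Sum>i\<in>UNIV. \<Sum>j\<in>UNIV. r $ i * r $ j * (K \<xi> z * (z $ i * z $ j / 2 - z $ j * corr i (\<xi> - z))))
        = K \<xi> z * ((z \<bullet> r)\<^sup>2 / 2 - (z \<bullet> r) * X (\<xi> - z))"
        by (simp only:) (simp add: sum_distrib_left sum_divide_distrib sum_subtractf[symmetric] right_diff_distrib mult_ac)
    qed
    also have "(\<Sum>i\<in>UNIV. \<Sum>j\<in>UNIV. r $ i * r $ j * (drift $ j * corr i \<xi>)) = (drift \<bullet> r) * X \<xi>"
      unfolding inner_vec_def X_def sum_product
      by (subst sum.swap) (simp add: mult_ac)
    finally show ?thesis .
  qed
  have genX: "gen X \<xi> = (LINT z|lborel. K \<xi> z * (z \<bullet> r)) - drift \<bullet> r" for \<xi>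
  proof -
    have Ki: "integrable lborel (\<lambda>z. K \<xi> z * (corr i (\<xi> - z) - corr i \<xi>))" for i
      using K_shift_integrable[OF corr(1), of \<xi> i] K_integrable[of \<xi>] by (simp add: right_diff_distrib)
    have "gen X \<xi> = (LINT z|lborel. (\<Sum>i\<in>UNIV. r $ i * (K \<xi> z * (corr i (\<xi> - z) - corr i \<xi>))))"
      unfolding gen_def X_def
      by (intro Bochner_Integration.integral_cong[OF refl]) (simp add: sum_subtractf[symmetric] sum_distrib_left right_diff_distrib mult_ac)
    also have "\<dots> = (\<Sum>i\<in>UNIV. r $ i * gen (corr i) \<xi>)"
      unfolding gen_def using Ki by (simp add: Bochner_Integration.integral_sum)
    also have "\<dots> = (\<Sum>i\<in>UNIV. r $ i * first_moment i \<xi>) - drift \<bullet> r"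
      by (simp add: corr(2) right_diff_distrib sum_subtractf inner_vec_def mult.commute)
    also have "(\<Sum>i\<in>UNIV. r $ i * first_moment i \<xi>) = (LINT z|lborel. (\<Sum>i\<in>UNIV. r $ i * (K \<xi> z * z $ i)))"
      unfolding first_moment_def using i2 by (simp add: Bochner_Integration.integral_sum)
    also have "\<dots> = (LINT z|lborel. K \<xi> z * (z \<bullet> r))"
      by (intro Bochner_Integration.integral_cong[OF refl]) (simp add: inner_vec_def sum_distrib_left mult_ac)
    finally show ?thesis .
  qed
  have EF: "E \<xi> = F \<xi> + gen (\<lambda>x. X x * X x) \<xi> / 2" for \<xi>
  proof -
    let ?M = "LINT z|lborel. K \<xi> z * (z \<bullet> r)"
    have j1: "integrable lborel (\<lambda>z. K \<xi> z * ((z \<bullet> r)\<^sup>2 / 2 - (z \<bullet> r) * X (\<xi> - z)))"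
    proof (rule moment_integrable(1)[where C="(norm r)\<^sup>2 + norm r * C"])
      fix z
      have a: "\<bar>z \<bullet> r\<bar> \<le> norm r * norm z" using Cauchy_Schwarz_ineq2[of z r] by (simp add: mult.commute)
      have "\<bar>(z \<bullet> r)\<^sup>2 / 2\<bar> \<le> (norm r)\<^sup>2 * (1 + (norm z)\<^sup>2)"
      proof -
        have "(z \<bullet> r)\<^sup>2 \<le> (norm r * norm z)\<^sup>2" using power_mono[OF a abs_ge_zero, of 2] by simp
        also have "\<dots> \<le> (norm r)\<^sup>2 * (1 + (norm z)\<^sup>2)" by (simp add: power_mult_distrib mult_left_mono)
        finally have "(z \<bullet> r)\<^sup>2 \<le> (norm r)\<^sup>2 * (1 + (norm z)\<^sup>2)" .
        moreover have "\<bar>(z \<bullet> r)\<^sup>2 / 2\<bar> = (z \<bullet> r)\<^sup>2 / 2" by simp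
        ultimately show ?thesis using zero_le_power2[of "z \<bullet> r"] by linarith
      qed
      moreover have "\<bar>(z \<bullet> r) * X (\<xi> - z)\<bar> \<le> norm r * C * (1 + (norm z)\<^sup>2)"
      proof -
        have "\<bar>(z \<bullet> r) * X (\<xi> - z)\<bar> \<le> (norm r * norm z) * C"
          unfolding abs_mult using a C by (intro mult_mono) auto
        also have "\<dots> = norm r * C * norm z" by simp
        also have "\<dots> \<le> norm r * C * (1 + (norm z)\<^sup>2)" using C by (intro mult_left_mono norm_le_weight) auto
        finally show ?thesis .
      qed
      ultimately show "\<bar>(z \<bullet> r)\<^sup>2 / 2 - (z \<bullet> r) * X (\<xi> - z)\<bar> \<le> ((norm r)\<^sup>2 + norm r * C) * (1 + (norm z)\<^sup>2)"
        unfolding distrib_right by (intro order_trans[OF abs_triangle_ineq4] add_mono)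
    qed measurable
    have j2: "integrable lborel (\<lambda>z. K \<xi> z * (z \<bullet> r))"
    proof (rule moment_integrable(1)[where C="norm r"])
      fix z
      have "\<bar>z \<bullet> r\<bar> \<le> norm r * norm z" using Cauchy_Schwarz_ineq2[of z r] by (simp add: mult.commute)
      also have "\<dots> \<le> norm r * (1 + (norm z)\<^sup>2)" by (intro mult_left_mono norm_le_weight) auto
      finally show "\<bar>z \<bullet> r\<bar> \<le> norm r * (1 + (norm z)\<^sup>2)" .
    qed measurable
    have j3: "integrable lborel (\<lambda>z. K \<xi> z * (X (\<xi> - z) * X (\<xi> - z) - X \<xi> * X \<xi>))"
      using K_shift_integrable[OF X2, of \<xi>] K_integrable[of \<xi>] by (simp add: right_diff_distrib mult.assoc)
    have j4: "integrable lborel (\<lambda>z. K \<xi> z * (X (\<xi> - z) - X \<xi>))"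
      using K_shift_integrable[OF X, of \<xi>] K_integrable[of \<xi>] by (simp add: right_diff_distrib)
    \<comment> \<open>The square is arranged so that every piece integrates to a known quantity. The
      pieces \<open>X \<xi> * ?M\<close> and \<open>X \<xi> * gen X \<xi>\<close> then collapse to X
      times the component of the drift along r, which is the drift term of F.\<close>
    have "E \<xi> = (LINT z|lborel. K \<xi> z * ((z \<bullet> r)\<^sup>2 / 2 - (z \<bullet> r) * X (\<xi> - z)) + X \<xi> * (K \<xi> z * (z \<bullet> r))
        + (K \<xi> z * (X (\<xi> - z) * X (\<xi> - z) - X \<xi> * X \<xi>)) / 2 - X \<xi> * (K \<xi> z * (X (\<xi> - z) - X \<xi>)))"
      unfolding E_def by (intro Bochner_Integration.integral_cong[OF refl]) (simp add: power2_eq_square field_simps)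
    also have "\<dots> = (LINT z|lborel. K \<xi> z * ((z \<bullet> r)\<^sup>2 / 2 - (z \<bullet> r) * X (\<xi> - z))) + X \<xi> * ?M
        + gen (\<lambda>x. X x * X x) \<xi> / 2 - X \<xi> * gen X \<xi>"
      unfolding gen_def using j1 j2 j3 j4 by simp
    finally show ?thesis unfolding Fint genX by (simp add: algebra_simps)
  qed
  have "cint (\<lambda>x. p0 x * E x) = cint (\<lambda>x. p0 x * F x) + cint (\<lambda>x. (1 / 2) * (p0 x * gen (\<lambda>x. X x * X x) x))"
  proof -
    have "(\<lambda>x. p0 x * E x) = (\<lambda>x. p0 x * F x + (1 / 2) * (p0 x * gen (\<lambda>x. X x * X x) x))"
      by (simp add: EF distrib_left)
    then show ?thesis
      using cint_add[OF BP_mult[OF p0_BP F] BP_scale[OF BP_mult[OF p0_BP gen_BP[OF X2]]], of "1 / 2"] by simp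
  qed
  also have "\<dots> = cint (\<lambda>x. p0 x * F x)" unfolding cint_scale using cint_p0_gen[OF X2] by simp
  also have "\<dots> = (\<Sum>i\<in>UNIV. \<Sum>j\<in>UNIV. r $ i * r $ j * cint (\<lambda>x. p0 x * second_moment i j x))"
    unfolding F_def sum_distrib_left
    by (simp add: cint_sum BP_sum BP_scale BP_mult p0_BP second_moment_BP cint_scale mult.left_commute[of "p0 _"])
  also have "\<dots> = cint p0 * ((Theta *v r) \<bullet> r)"
  proof -
    have "cint (\<lambda>x. p0 x * second_moment i j x) = cint p0 * Theta $ i $ j" for i j
      using cint_p0_pos by (simp add: Theta_def mean_def)
    then show ?thesis by (simp add: matrix_vector_mult_def inner_vec_def sum_distrib_left sum_distrib_right mult_ac)
  qed
  finally show "cint (\<lambda>x. p0 x * E x) = cint p0 * ((Theta *v r) \<bullet> r)" .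
qed

text \<open>If the quadratic form vanished, a single jump \<open>z\<close> with \<open>z \<bullet> r \<noteq> 0\<close> would shift the bounded
  periodic corrector by the constant \<open>z \<bullet> r\<close>, which is impossible since a shift preserves its mean.\<close>

lemma positive_definite_Theta: "positive_definite Theta"
  unfolding positive_definite_def
proof safe
  fix r :: "real ^ 'n" assume r: "r \<noteq> 0"
  define X where "X x = (\<Sum>i\<in>UNIV. r $ i * corr i x)" for x
  define E where "E \<xi> = (LINT z|lborel. K \<xi> z * ((z \<bullet> r - X (\<xi> - z) + X \<xi>)\<^sup>2 / 2))" for \<xi>
  have X: "X \<in> BP" and E: "E \<in> BP" and eq: "cint (\<lambda>x. p0 x * E x) = cint p0 * ((Theta *v r) \<bullet> r)"
    using dirichlet_identity[of r] by (auto simp: X_def[abs_def] E_def[abs_def])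
  have [measurable]: "X \<in> borel_measurable borel" "E \<in> borel_measurable borel" "p0 \<in> borel_measurable borel"
    using X E p0_BP by (auto intro: BP_measurable)
  have E0: "E \<xi> \<ge> 0" for \<xi> unfolding E_def by (intro integral_nonneg_AE AE_I2 mult_nonneg_nonneg K_nonneg) auto
  have "cint (\<lambda>x. p0 x * E x) \<noteq> 0"
  proof
    assume "cint (\<lambda>x. p0 x * E x) = 0"
    then have "AE x in lborel. indicator unit_cell x * (p0 x * E x) = 0"
      unfolding cint_def using E0 p0_nonneg
      by (subst (asm) integral_nonneg_eq_0_iff_AE) (auto intro!: BP_cell_integrable BP_mult p0_BP E)
    then have "AE x in lborel. x \<in> unit_cell \<longrightarrow> E x = 0"
    proof eventually_elim
      case (elim x)
      obtain c where c: "c > 0" "\<And>x. p0 x \<ge> c" by (rule p0_lower) blast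
      have "p0 x \<noteq> 0" using c(1) c(2)[of x] by linarith
      then show ?case using elim by (simp add: indicator_def split: if_splits)
    qed
    then have AE_E: "AE x in lborel. E x = 0"
    proof (rule AE_periodic[rotated 2])
      show "periodic (\<lambda>x. E x = 0)" using BP_periodic[OF E] by (simp add: periodic_def)
    qed measurable
    have [measurable]: "(\<lambda>(x, z). K x z * ((z \<bullet> r - X (x - z) + X x)\<^sup>2 / 2)) \<in> borel_measurable (borel \<Otimes>\<^sub>M borel)"
      by measurable
    have "(\<integral>\<^sup>+x. (\<integral>\<^sup>+z. ennreal (K x z * ((z \<bullet> r - X (x - z) + X x)\<^sup>2 / 2)) \<partial>lborel) \<partial>lborel) = 0"
    proof -
      obtain C where C: "C > 0" "\<And>x. \<bar>X x\<bar> \<le> C" by (rule BP_bounded[OF X]) blast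
      have i: "integrable lborel (\<lambda>z. K \<xi> z * ((z \<bullet> r - X (\<xi> - z) + X \<xi>)\<^sup>2 / 2))" for \<xi>
      proof (rule moment_integrable(1)[where C="(norm r)\<^sup>2 + (2 * C)\<^sup>2"])
        fix z
        have hX: "\<bar>z \<bullet> r - X (\<xi> - z) + X \<xi>\<bar> \<le> norm r * norm z + 2 * C"
          using C(2)[of "\<xi> - z"] C(2)[of \<xi>] Cauchy_Schwarz_ineq2[of z r] by (simp add: mult.commute)
        have "(z \<bullet> r - X (\<xi> - z) + X \<xi>)\<^sup>2 \<le> (norm r * norm z + 2 * C)\<^sup>2"
          using power_mono[OF hX abs_ge_zero, of 2] by simp
        also have "\<dots> \<le> 2 * ((norm r * norm z)\<^sup>2 + (2 * C)\<^sup>2)"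
          using sum_squares_bound[of "norm r * norm z" "2 * C"] by (simp add: power2_sum)
        also have "\<dots> \<le> 2 * (((norm r)\<^sup>2 + (2 * C)\<^sup>2) * (1 + (norm z)\<^sup>2))"
          by (simp add: algebra_simps power_mult_distrib)
        finally show "\<bar>(z \<bullet> r - X (\<xi> - z) + X \<xi>)\<^sup>2 / 2\<bar> \<le> ((norm r)\<^sup>2 + (2 * C)\<^sup>2) * (1 + (norm z)\<^sup>2)" by simp
      qed measurable
      have "AE x in lborel. (\<integral>\<^sup>+z. ennreal (K x z * ((z \<bullet> r - X (x - z) + X x)\<^sup>2 / 2)) \<partial>lborel) = 0"
        using AE_E
      proof eventually_elim
        case (elim x)
        have "(\<integral>\<^sup>+z. ennreal (K x z * ((z \<bullet> r - X (x - z) + X x)\<^sup>2 / 2)) \<partial>lborel) = ennreal (E x)"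
          unfolding E_def by (rule nn_integral_eq_integral[OF i]) (simp add: K_nonneg)
        then show ?case using elim by simp
      qed
      then show ?thesis by (subst nn_integral_0_iff_AE) auto
    qed
    \<comment> \<open>Tonelli turns a statement about almost every x into one about almost every z,
      so that a single jump z can be held fixed while x varies over a set of full measure.\<close>
    moreover have "(\<integral>\<^sup>+x. (\<integral>\<^sup>+z. ennreal (K x z * ((z \<bullet> r - X (x - z) + X x)\<^sup>2 / 2)) \<partial>lborel) \<partial>lborel)
      = (\<integral>\<^sup>+z. (\<integral>\<^sup>+x. ennreal (K x z * ((z \<bullet> r - X (x - z) + X x)\<^sup>2 / 2)) \<partial>lborel) \<partial>lborel)"
      by (rule lborel_pair.Fubini') measurable
    ultimately have "(\<integral>\<^sup>+z. (\<integral>\<^sup>+x. ennreal (K x z * ((z \<bullet> r - X (x - z) + X x)\<^sup>2 / 2)) \<partial>lborel) \<partial>lborel) = 0"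
      by (simp only:)
    then have "AE z in lborel. (\<integral>\<^sup>+x. ennreal (K x z * ((z \<bullet> r - X (x - z) + X x)\<^sup>2 / 2)) \<partial>lborel) = 0"
      by (subst (asm) nn_integral_0_iff_AE) measurable
    then have "AE z in lborel. a z = 0"
      using AE_lborel_hyperplane[OF r]
    proof eventually_elim
      case (elim z)
      show ?case
      proof (rule ccontr)
        assume "a z \<noteq> 0"
        then have az: "a z > 0" using a_nonneg[of z] by simp
        have Kp: "K x z > 0" for x using K_ge[of z x] mult_pos_pos[OF \<mu>_bounds(1) az] by linarith
        have "AE x in lborel. ennreal (K x z * ((z \<bullet> r - X (x - z) + X x)\<^sup>2 / 2)) = 0"
          using elim(1) by (subst (asm) nn_integral_0_iff_AE) auto
        then have ae: "AE x in lborel. indicator unit_cell x * (X (x - z) - X x) = indicator unit_cell x * (z \<bullet> r)"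
        proof eventually_elim
          case (elim x)
          then have "K x z * ((z \<bullet> r - X (x - z) + X x)\<^sup>2 / 2) = 0"
            using Kp[of x] by (simp add: ennreal_eq_0_iff mult_le_0_iff)
          then have "z \<bullet> r - X (x - z) + X x = 0" using Kp[of x] by auto
          then show ?case by simp
        qed
        have "cint (\<lambda>x. X (x - z) - X x) = cint (\<lambda>x :: real ^ 'n. z \<bullet> r)"
          unfolding cint_def by (rule integral_cong_AE[OF _ _ ae]) measurable
        then have "z \<bullet> r = 0" by (simp add: cint_diff X BP_shift cint_shift cint_const)
        then show False using elim(2) by simp
      qed
    qed
    then have "(LINT z|lborel. a z) = 0" by (simp add: integral_eq_zero_AE)
    then show False using a_pos by simp
  qed
  moreover have "cint (\<lambda>x. p0 x * E x) \<ge> 0" using E0 p0_nonneg by (intro cint_nonneg) auto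
  ultimately have "cint (\<lambda>x. p0 x * E x) > 0" by linarith
  then show "(Theta *v r) \<bullet> r > 0" using cint_p0_pos unfolding eq by (simp add: zero_less_mult_iff)
qed

end

subsection \<open>Paths in $L^2$\<close>

definition cont_L2 :: "(real \<Rightarrow> 'a::euclidean_space \<Rightarrow> real) \<Rightarrow> bool" where
  "cont_L2 z \<longleftrightarrow> (\<forall>s\<ge>0. z s \<in> bL2) \<and> (\<forall>t\<ge>0. ((\<lambda>s. nL2 (\<lambda>x. z s x - z t x)) \<longlongrightarrow> 0) (at t within {0..}))"

text \<open>Square integrability of the path at nonnegative times and t > 0 are part of the notion,
  which frees the closure rules from side conditions. As t > 0, the two-sided limit eventually sees
  only nonnegative times.\<close>

definition deriv_L2 :: "(real \<Rightarrow> 'a::euclidean_space \<Rightarrow> real) \<Rightarrow> ('a \<Rightarrow> real) \<Rightarrow> real \<Rightarrow> bool" where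
  "deriv_L2 z z' t \<longleftrightarrow> (\<forall>s\<ge>0. z s \<in> bL2) \<and> t > 0 \<and> z' \<in> bL2 \<and>
     ((\<lambda>s. nL2 (\<lambda>x. (z s x - z t x) / (s - t) - z' x)) \<longlongrightarrow> 0) (at t)"

lemma cont_L2D:
  assumes "cont_L2 z" "t \<ge> 0"
  shows "z t \<in> bL2" "((\<lambda>s. nL2 (\<lambda>x. z s x - z t x)) \<longlongrightarrow> 0) (at t within {0..})"
  using assms by (auto simp: cont_L2_def)

lemma deriv_L2D:
  assumes "deriv_L2 z z' t"
  shows "s \<ge> 0 \<Longrightarrow> z s \<in> bL2" "t > 0" "z' \<in> bL2" "((\<lambda>s. nL2 (\<lambda>x. (z s x - z t x) / (s - t) - z' x)) \<longlongrightarrow> 0) (at t)"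
  using assms by (auto simp: deriv_L2_def)

lemma eventually_at_nonneg: "t > 0 \<Longrightarrow> \<forall>\<^sub>F s in at t. (s :: real) \<ge> 0"
  using eventually_at_in_open'[of "{0<..}" t] by (auto elim!: eventually_mono)

lemma tendsto_0_dominated:
  fixes f g :: "'a \<Rightarrow> real"
  assumes "(g \<longlongrightarrow> 0) F" "\<forall>\<^sub>F x in F. f x \<le> g x" "\<And>x. f x \<ge> 0" shows "(f \<longlongrightarrow> 0) F"
  by (rule Lim_null_comparison[OF _ assms(1)]) (use assms(2,3) in \<open>auto elim!: eventually_mono\<close>)

lemma bL2_quotient: "f \<in> bL2 \<Longrightarrow> g \<in> bL2 \<Longrightarrow> h \<in> bL2 \<Longrightarrow> (\<lambda>x. (f x - g x) / c - h x) \<in> bL2"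
  using bL2_diff[OF bL2_scale[OF bL2_diff[of f g], of "inverse c"], of h] by (simp add: divide_inverse mult.commute)

lemma cont_L2_add:
  assumes "cont_L2 y" "cont_L2 z" shows "cont_L2 (\<lambda>t x. y t x + z t x)"
  unfolding cont_L2_def
proof (intro conjI allI impI)
  fix t :: real assume t: "t \<ge> 0"
  then show "(\<lambda>x. y t x + z t x) \<in> bL2" using assms by (intro bL2_add cont_L2D)
  show "((\<lambda>s. nL2 (\<lambda>x. y s x + z s x - (y t x + z t x))) \<longlongrightarrow> 0) (at t within {0..})"
  proof (rule tendsto_0_dominated)
    show "((\<lambda>s. nL2 (\<lambda>x. y s x - y t x) + nL2 (\<lambda>x. z s x - z t x)) \<longlongrightarrow> 0) (at t within {0..})"
      using tendsto_add[OF cont_L2D(2)[OF assms(1) t] cont_L2D(2)[OF assms(2) t]] by simp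
    have "nL2 (\<lambda>x. y s x + z s x - (y t x + z t x)) \<le> nL2 (\<lambda>x. y s x - y t x) + nL2 (\<lambda>x. z s x - z t x)" if "s \<ge> 0" for s
    proof -
      have "(\<lambda>x. y s x + z s x - (y t x + z t x)) = (\<lambda>x. (y s x - y t x) + (z s x - z t x))" by auto
      then show ?thesis using assms t that by (simp only:) (intro nL2_triangle bL2_diff cont_L2D)
    qed
    then show "\<forall>\<^sub>F s in at t within {0..}. nL2 (\<lambda>x. y s x + z s x - (y t x + z t x)) \<le> nL2 (\<lambda>x. y s x - y t x) + nL2 (\<lambda>x. z s x - z t x)"
      by (simp add: eventually_at_filter)
  qed simp
qed

lemma cont_L2_mult:
  assumes z: "cont_L2 z" and g: "g \<in> borel_measurable borel" "\<And>x. \<bar>g x\<bar> \<le> C" shows "cont_L2 (\<lambda>t x. g x * z t x)"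
  unfolding cont_L2_def
proof (intro conjI allI impI)
  fix t :: real assume t: "t \<ge> 0"
  show "(\<lambda>x. g x * z t x) \<in> bL2" by (rule bL2_bounded_mult(1)[OF cont_L2D(1)[OF z t] g])
  show "((\<lambda>s. nL2 (\<lambda>x. g x * z s x - g x * z t x)) \<longlongrightarrow> 0) (at t within {0..})"
  proof (rule tendsto_0_dominated)
    show "((\<lambda>s. C * nL2 (\<lambda>x. z s x - z t x)) \<longlongrightarrow> 0) (at t within {0..})"
      using tendsto_mult_left[OF cont_L2D(2)[OF z t], of C] by simp
    have "nL2 (\<lambda>x. g x * z s x - g x * z t x) \<le> C * nL2 (\<lambda>x. z s x - z t x)" if "s \<ge> 0" for s
      using bL2_bounded_mult(2)[OF bL2_diff[OF cont_L2D(1)[OF z that] cont_L2D(1)[OF z t]] g] by (simp add: right_diff_distrib)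
    then show "\<forall>\<^sub>F s in at t within {0..}. nL2 (\<lambda>x. g x * z s x - g x * z t x) \<le> C * nL2 (\<lambda>x. z s x - z t x)"
      by (simp add: eventually_at_filter)
  qed simp
qed

lemma cont_L2_zero: "cont_L2 (\<lambda>t x. 0)"
  by (simp add: cont_L2_def bL2_zero nL2_def)

lemma cont_L2_sum:
  "(\<And>i. i \<in> I \<Longrightarrow> cont_L2 (z i)) \<Longrightarrow> cont_L2 (\<lambda>t x. \<Sum>i\<in>I. z i t x)"
  by (induction I rule: infinite_finite_induct) (auto intro: cont_L2_add cont_L2_zero)

lemma cont_L2_diff: "cont_L2 y \<Longrightarrow> cont_L2 z \<Longrightarrow> cont_L2 (\<lambda>t x. y t x - z t x)"
  using cont_L2_add[of y "\<lambda>t x. (-1) * z t x"] cont_L2_mult[of z "\<lambda>_. -1" 1] by simp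

lemma deriv_L2_add:
  assumes y: "deriv_L2 y y' t" and z: "deriv_L2 z z' t" shows "deriv_L2 (\<lambda>t x. y t x + z t x) (\<lambda>x. y' x + z' x) t"
  unfolding deriv_L2_def
proof (intro conjI allI impI)
  show "(\<lambda>x. y s x + z s x) \<in> bL2" if "s \<ge> 0" for s using that y z by (intro bL2_add deriv_L2D(1))
  show "t > 0" "(\<lambda>x. y' x + z' x) \<in> bL2" using y z by (auto intro: bL2_add deriv_L2D)
  let ?A = "\<lambda>s x. (y s x - y t x) / (s - t) - y' x" and ?B = "\<lambda>s x. (z s x - z t x) / (s - t) - z' x"
  show "((\<lambda>s. nL2 (\<lambda>x. (y s x + z s x - (y t x + z t x)) / (s - t) - (y' x + z' x))) \<longlongrightarrow> 0) (at t)"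
  proof (rule tendsto_0_dominated)
    show "((\<lambda>s. nL2 (?A s) + nL2 (?B s)) \<longlongrightarrow> 0) (at t)"
      using tendsto_add[OF deriv_L2D(4)[OF y] deriv_L2D(4)[OF z]] by simp
    show "\<forall>\<^sub>F s in at t. nL2 (\<lambda>x. (y s x + z s x - (y t x + z t x)) / (s - t) - (y' x + z' x)) \<le> nL2 (?A s) + nL2 (?B s)"
      using eventually_at_nonneg[OF deriv_L2D(2)[OF y]]
    proof eventually_elim
      case (elim s)
      have "(\<lambda>x. (y s x + z s x - (y t x + z t x)) / (s - t) - (y' x + z' x)) = (\<lambda>x. ?A s x + ?B s x)"
        by (simp add: diff_divide_distrib add_divide_distrib algebra_simps)
      then show ?case using elim deriv_L2D[OF y] deriv_L2D[OF z]
        by (simp only:) (intro nL2_triangle bL2_quotient; simp)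
    qed
  qed simp
qed

lemma deriv_L2_mult:
  assumes z: "deriv_L2 z z' t" and g: "g \<in> borel_measurable borel" "\<And>x. \<bar>g x\<bar> \<le> C"
  shows "deriv_L2 (\<lambda>t x. g x * z t x) (\<lambda>x. g x * z' x) t"
  unfolding deriv_L2_def
proof (intro conjI allI impI)
  show "(\<lambda>x. g x * z s x) \<in> bL2" if "s \<ge> 0" for s by (rule bL2_bounded_mult(1)[OF deriv_L2D(1)[OF z that] g])
  show "t > 0" "(\<lambda>x. g x * z' x) \<in> bL2" using z bL2_bounded_mult(1)[OF _ g] by (auto dest: deriv_L2D)
  let ?B = "\<lambda>s x. (z s x - z t x) / (s - t) - z' x"
  show "((\<lambda>s. nL2 (\<lambda>x. (g x * z s x - g x * z t x) / (s - t) - g x * z' x)) \<longlongrightarrow> 0) (at t)"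
  proof (rule tendsto_0_dominated)
    show "((\<lambda>s. C * nL2 (?B s)) \<longlongrightarrow> 0) (at t)"
      using tendsto_mult_left[OF deriv_L2D(4)[OF z], of C] by simp
    show "\<forall>\<^sub>F s in at t. nL2 (\<lambda>x. (g x * z s x - g x * z t x) / (s - t) - g x * z' x) \<le> C * nL2 (?B s)"
      using eventually_at_nonneg[OF deriv_L2D(2)[OF z]]
    proof eventually_elim
      case (elim s)
      have "(\<lambda>x. (g x * z s x - g x * z t x) / (s - t) - g x * z' x) = (\<lambda>x. g x * ?B s x)"
        by (simp add: right_diff_distrib[symmetric] times_divide_eq_right[symmetric] del: times_divide_eq_right)
      then show ?case using elim deriv_L2D[OF z]
        by (simp only:) (intro bL2_bounded_mult(2)[OF bL2_quotient g]; simp)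
    qed
  qed simp
qed

lemma deriv_L2_sum:
  assumes "finite I" "t > 0"
  shows "(\<And>i. i \<in> I \<Longrightarrow> deriv_L2 (z i) (z' i) t) \<Longrightarrow> deriv_L2 (\<lambda>t x. \<Sum>i\<in>I. z i t x) (\<lambda>x. \<Sum>i\<in>I. z' i x) t"
  using assms(1)
proof (induction I rule: finite_induct)
  case empty then show ?case using assms(2) by (simp add: deriv_L2_def bL2_zero nL2_def)
qed (auto intro: deriv_L2_add)

lemma deriv_L2_diff:
  "deriv_L2 y y' t \<Longrightarrow> deriv_L2 z z' t \<Longrightarrow> deriv_L2 (\<lambda>t x. y t x - z t x) (\<lambda>x. y' x - z' x) t"
  using deriv_L2_add[of y y' t "\<lambda>t x. (-1) * z t x" "\<lambda>x. (-1) * z' x"] deriv_L2_mult[of z z' t "\<lambda>_. -1" 1] by simp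

lemma deriv_L2_tendsto:
  assumes z: "deriv_L2 z z' t" shows "((\<lambda>s. nL2 (\<lambda>x. z s x - z t x)) \<longlongrightarrow> 0) (at t)"
proof (rule tendsto_0_dominated)
  let ?B = "\<lambda>s x. (z s x - z t x) / (s - t) - z' x"
  have "((\<lambda>s. \<bar>s - t\<bar> * (nL2 (?B s) + nL2 z')) \<longlongrightarrow> \<bar>t - t\<bar> * (0 + nL2 z')) (at t)"
    by (intro tendsto_intros deriv_L2D(4)[OF z])
  then show "((\<lambda>s. \<bar>s - t\<bar> * (nL2 (?B s) + nL2 z')) \<longlongrightarrow> 0) (at t)" by simp
  show "\<forall>\<^sub>F s in at t. nL2 (\<lambda>x. z s x - z t x) \<le> \<bar>s - t\<bar> * (nL2 (?B s) + nL2 z')"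
    using eventually_at_nonneg[OF deriv_L2D(2)[OF z]] eventually_neq_at_within[of t t UNIV]
  proof eventually_elim
    case (elim s)
    have "(\<lambda>x. z s x - z t x) = (\<lambda>x. (s - t) * (?B s x + z' x))" using elim(2) by auto
    then have "nL2 (\<lambda>x. z s x - z t x) = \<bar>s - t\<bar> * nL2 (\<lambda>x. ?B s x + z' x)" by (simp only: nL2_scale)
    also have "\<dots> \<le> \<bar>s - t\<bar> * (nL2 (?B s) + nL2 z')"
      by (intro mult_left_mono nL2_triangle bL2_quotient deriv_L2D[OF z] elim) (use deriv_L2D(2)[OF z] in auto)
    finally show ?case .
  qed
qed simp

section \<open>Mollified paths in a moving frame\<close>

lemma shifted_test:
  fixes \<psi> :: "real ^ 'n \<Rightarrow> real"
  assumes "test_function \<psi>" shows "test_function (\<lambda>s. \<psi> (s - h))"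
  using test_function_affine[OF assms, of 1 "- h"] by simp

lemma nn_integral_abs_shift:
  fixes \<psi> :: "'a::euclidean_space \<Rightarrow> real"
  assumes [measurable]: "\<psi> \<in> borel_measurable borel"
  shows "(\<integral>\<^sup>+s. ennreal \<bar>\<psi> (s - h)\<bar> \<partial>lborel) = (\<integral>\<^sup>+s. ennreal \<bar>\<psi> s\<bar> \<partial>lborel)"
  by (rule nn_integral_translate(3)) measurable

lemma taylor_measurable:
  assumes "test_function \<psi>"
  shows "(\<lambda>(h, s). taylor1 \<psi> h s) \<in> borel_measurable (borel \<Otimes>\<^sub>M borel)"
    "(\<lambda>(h, s). taylor2 \<psi> h s) \<in> borel_measurable (borel \<Otimes>\<^sub>M borel)"
    "(\<lambda>(h, s). taylor3 \<psi> h s) \<in> borel_measurable (borel \<Otimes>\<^sub>M borel)"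
proof -
  have [measurable]: "\<psi> \<in> borel_measurable borel" "\<And>i. partial_deriv i \<psi> \<in> borel_measurable borel"
    "\<And>i j. partial_deriv j (partial_deriv i \<psi>) \<in> borel_measurable borel"
    using assms by (auto intro: test_function_borel test_function_partial)
  have [measurable]: "(\<lambda>p :: (real^'a) \<times> (real ^ 'a). fst p $ i) \<in> borel_measurable (borel \<Otimes>\<^sub>M borel)" for i
    by (rule measurable_compose[OF measurable_fst borel_measurable_nth])
  show "(\<lambda>(h, s). taylor1 \<psi> h s) \<in> borel_measurable (borel \<Otimes>\<^sub>M borel)"
    "(\<lambda>(h, s). taylor2 \<psi> h s) \<in> borel_measurable (borel \<Otimes>\<^sub>M borel)"
    "(\<lambda>(h, s). taylor3 \<psi> h s) \<in> borel_measurable (borel \<Otimes>\<^sub>M borel)"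
    unfolding taylor1_def taylor2_def taylor3_def case_prod_beta by measurable
qed

text \<open>The translation by \<open>s *\<^sub>R c\<close> is moved onto the smooth factor of the convolution, so that
  differentiating it in time needs no spatial derivative of \<open>u\<close>.\<close>

lemma conv_path:
  fixes u :: "real \<Rightarrow> real ^ 'n \<Rightarrow> real" and c :: "real ^ 'n"
  assumes \<psi>: "test_function \<psi>"
  defines "G \<equiv> \<lambda>s x. conv (u s) \<psi> (x - s *\<^sub>R c)"
  shows "cont_L2 u \<Longrightarrow> cont_L2 G"
    and "deriv_L2 u v t \<Longrightarrow>
      deriv_L2 G (\<lambda>x. conv v \<psi> (x - t *\<^sub>R c) - (\<Sum>i\<in>UNIV. c $ i * conv (u t) (partial_deriv i \<psi>) (x - t *\<^sub>R c))) t"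
proof -
  let ?\<psi> = "\<lambda>t s. \<psi> (s - t *\<^sub>R c)"
  have G: "G s = conv (u s) (?\<psi> s)" for s by (auto simp: G_def conv_shift fun_eq_iff)
  note T = shifted_test[OF \<psi>]
  have [measurable]: "\<psi> \<in> borel_measurable borel" by (rule test_function_borel[OF \<psi>])
  obtain C0 where C0: "C0 > 0" "(\<integral>\<^sup>+s. ennreal \<bar>\<psi> s\<bar> \<partial>lborel) \<le> ennreal C0" by (rule test_function_L1[OF \<psi>]) blast
  obtain C1 where C1: "C1 > 0" "\<And>h. (\<integral>\<^sup>+s. ennreal \<bar>taylor1 \<psi> h s\<bar> \<partial>lborel) \<le> ennreal (C1 * norm h ^ 1)"
    by (rule taylor_L1[OF \<psi>, of taylor1 1]) (use taylor1_bound[OF \<psi>] in auto)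
  obtain C2 where C2: "C2 > 0" "\<And>h. (\<integral>\<^sup>+s. ennreal \<bar>taylor2 \<psi> h s\<bar> \<partial>lborel) \<le> ennreal (C2 * norm h ^ 2)"
    by (rule taylor_L1[OF \<psi>, of taylor2 2]) (use taylor2_bound[OF \<psi>] in auto)
  have tm: "taylor1 \<psi> h \<in> borel_measurable borel" "taylor2 \<psi> h \<in> borel_measurable borel" for h
    using measurable_compose[OF measurable_Pair1'[of h borel borel] taylor_measurable(1)[OF \<psi>]]
      measurable_compose[OF measurable_Pair1'[of h borel borel] taylor_measurable(2)[OF \<psi>]] by auto
  have tm': "(\<lambda>y. taylor1 \<psi> h (y - k)) \<in> borel_measurable borel" "(\<lambda>y. taylor2 \<psi> h (y - k)) \<in> borel_measurable borel" for h k
    by (rule measurable_compose[OF _ tm(1)], measurable) (rule measurable_compose[OF _ tm(2)], measurable)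
  have n0: "conv f (?\<psi> s) \<in> bL2" "nL2 (conv f (?\<psi> s)) \<le> C0 * nL2 f" if "f \<in> bL2" for f s
  proof -
    have b: "(\<integral>\<^sup>+y. ennreal \<bar>\<psi> (y - s *\<^sub>R c)\<bar> \<partial>lborel) \<le> ennreal C0" using C0 by (simp add: nn_integral_abs_shift)
    show "conv f (?\<psi> s) \<in> bL2" "nL2 (conv f (?\<psi> s)) \<le> C0 * nL2 f"
      by (intro conv_bL2[OF that _ b]; use C0 in simp)+
  qed
  have d1: "?\<psi> s y - ?\<psi> t y = taylor1 \<psi> ((s - t) *\<^sub>R c) (y - t *\<^sub>R c)" for s t y
    by (simp add: taylor1_def algebra_simps)
  have n1: "conv f (\<lambda>y. ?\<psi> s y - ?\<psi> t y) \<in> bL2" "nL2 (conv f (\<lambda>y. ?\<psi> s y - ?\<psi> t y)) \<le> C1 * norm c * \<bar>s - t\<bar> * nL2 f" if "f \<in> bL2" for f s t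
  proof -
    have b: "(\<integral>\<^sup>+y. ennreal \<bar>taylor1 \<psi> ((s - t) *\<^sub>R c) (y - t *\<^sub>R c)\<bar> \<partial>lborel) \<le> ennreal (C1 * norm c * \<bar>s - t\<bar>)"
      unfolding nn_integral_abs_shift[OF tm(1)] using C1(2)[of "(s - t) *\<^sub>R c"] by (simp add: mult_ac)
    show "conv f (\<lambda>y. ?\<psi> s y - ?\<psi> t y) \<in> bL2" "nL2 (conv f (\<lambda>y. ?\<psi> s y - ?\<psi> t y)) \<le> C1 * norm c * \<bar>s - t\<bar> * nL2 f"
      unfolding d1 by (intro conv_bL2[OF that _ b]; use C1(1) tm' in simp)+
  qed
  show "cont_L2 G" if u: "cont_L2 u"
      unfolding cont_L2_def
    proof (intro conjI allI impI)
      fix t :: real assume t: "t \<ge> 0"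
      show "G t \<in> bL2" unfolding G by (rule n0(1)[OF cont_L2D(1)[OF u t]])
      show "((\<lambda>s. nL2 (\<lambda>x. G s x - G t x)) \<longlongrightarrow> 0) (at t within {0..})"
      proof (rule tendsto_0_dominated)
        have "((\<lambda>s. C0 * nL2 (\<lambda>x. u s x - u t x) + C1 * norm c * \<bar>s - t\<bar> * nL2 (u t)) \<longlongrightarrow> C0 * 0 + C1 * norm c * \<bar>t - t\<bar> * nL2 (u t)) (at t within {0..})"
          by (intro tendsto_intros cont_L2D(2)[OF u t])
        then show "((\<lambda>s. C0 * nL2 (\<lambda>x. u s x - u t x) + C1 * norm c * \<bar>s - t\<bar> * nL2 (u t)) \<longlongrightarrow> 0) (at t within {0..})" by simp
        have "nL2 (\<lambda>x. G s x - G t x) \<le> C0 * nL2 (\<lambda>x. u s x - u t x) + C1 * norm c * \<bar>s - t\<bar> * nL2 (u t)" if s: "s \<ge> 0" for s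
        proof -
          note us = cont_L2D(1)[OF u s] and ut = cont_L2D(1)[OF u t]
          have eq: "(\<lambda>x. G s x - G t x) = (\<lambda>x. conv (\<lambda>x. u s x - u t x) (?\<psi> s) x + conv (u t) (\<lambda>y. ?\<psi> s y - ?\<psi> t y) x)"
            unfolding G by (simp add: conv_diff_left conv_diff_right us ut test_function_bL2[OF T] fun_eq_iff)
          have "nL2 (\<lambda>x. G s x - G t x) \<le> nL2 (conv (\<lambda>x. u s x - u t x) (?\<psi> s)) + nL2 (conv (u t) (\<lambda>y. ?\<psi> s y - ?\<psi> t y))"
            unfolding eq by (rule nL2_triangle[OF n0(1)[OF bL2_diff[OF us ut]] n1(1)[OF ut]])
          also have "\<dots> \<le> C0 * nL2 (\<lambda>x. u s x - u t x) + C1 * norm c * \<bar>s - t\<bar> * nL2 (u t)"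
            by (rule add_mono[OF n0(2)[OF bL2_diff[OF us ut]] n1(2)[OF ut]])
          finally show ?thesis .
        qed
        then show "\<forall>\<^sub>F s in at t within {0..}. nL2 (\<lambda>x. G s x - G t x) \<le> C0 * nL2 (\<lambda>x. u s x - u t x) + C1 * norm c * \<bar>s - t\<bar> * nL2 (u t)"
          by (simp add: eventually_at_filter)
      qed simp
    qed
  show "deriv_L2 G (\<lambda>x. conv v \<psi> (x - t *\<^sub>R c) - (\<Sum>i\<in>UNIV. c $ i * conv (u t) (partial_deriv i \<psi>) (x - t *\<^sub>R c))) t"
    if u: "deriv_L2 u v t"
  proof -
    let ?D = "\<lambda>y. \<Sum>i\<in>UNIV. c $ i * partial_deriv i \<psi> (y - t *\<^sub>R c)"
    note v = deriv_L2D(3)[OF u] and t = deriv_L2D(2)[OF u] and ub = deriv_L2D(1)[OF u]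
    have ut: "u t \<in> bL2" using t by (intro ub) simp
    have Tp: "(\<lambda>y. partial_deriv i \<psi> (y - h)) \<in> bL2" for i h
      by (intro test_function_bL2 shifted_test test_function_partial \<psi>)
    have Db: "?D \<in> bL2" by (intro bL2_sum bL2_scale Tp)
    have Dc: "(\<Sum>i\<in>UNIV. c $ i * conv (u t) (partial_deriv i \<psi>) (x - t *\<^sub>R c)) = conv (u t) ?D x" for x
      by (simp add: conv_sum_right[OF ut] bL2_scale Tp conv_scale_right conv_shift)
    obtain D0 where D0: "D0 > 0" "(\<integral>\<^sup>+s. ennreal \<bar>?D s\<bar> \<partial>lborel) \<le> ennreal D0"
    proof -
      have "integrable lborel ?D"
        by (intro Bochner_Integration.integrable_sum integrable_mult_right test_function_integrable shifted_test test_function_partial \<psi>)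
      then have "(\<integral>\<^sup>+s. ennreal \<bar>?D s\<bar> \<partial>lborel) < \<infinity>" by (simp add: integrable_iff_bounded)
      then obtain d where d: "(\<integral>\<^sup>+s. ennreal \<bar>?D s\<bar> \<partial>lborel) = ennreal d" by (cases "\<integral>\<^sup>+s. ennreal \<bar>?D s\<bar> \<partial>lborel") auto
      show thesis by (rule that[of "max d 1"]) (auto simp: d intro: ennreal_leI)
    qed
    have cD: "conv (u t) ?D \<in> bL2"
      by (rule conv_bL2(1)[OF ut _ D0(2)]) (use D0 bL2_measurable[OF Db] in auto)
    \<comment> \<open>The difference quotient of the translated kernel plus its exact derivative is
      a second-order Taylor remainder divided by s - t, so its L1 norm is of order |s - t|.\<close>
    have d2: "(?\<psi> s y - ?\<psi> t y) / (s - t) + ?D y = taylor2 \<psi> ((s - t) *\<^sub>R c) (y - t *\<^sub>R c) / (s - t)" if "s \<noteq> t" for s y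
    proof -
      have "(\<Sum>i\<in>UNIV. ((s - t) *\<^sub>R c) $ i * partial_deriv i \<psi> (y - t *\<^sub>R c)) = (s - t) * ?D y"
        by (simp add: sum_distrib_left mult.assoc)
      then have "taylor2 \<psi> ((s - t) *\<^sub>R c) (y - t *\<^sub>R c) = (?\<psi> s y - ?\<psi> t y) + (s - t) * ?D y"
        unfolding taylor2_def by (simp add: algebra_simps)
      then show ?thesis using that by (simp add: field_simps)
    qed
    have n2: "conv (u t) (\<lambda>y. (?\<psi> s y - ?\<psi> t y) / (s - t) + ?D y) \<in> bL2"
      "nL2 (conv (u t) (\<lambda>y. (?\<psi> s y - ?\<psi> t y) / (s - t) + ?D y)) \<le> C2 * (norm c)\<^sup>2 * \<bar>s - t\<bar> * nL2 (u t)" if "s \<noteq> t" for s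
    proof -
      have "(\<integral>\<^sup>+y. ennreal \<bar>taylor2 \<psi> ((s - t) *\<^sub>R c) (y - t *\<^sub>R c) / (s - t)\<bar> \<partial>lborel)
        = (\<integral>\<^sup>+y. ennreal (1 / \<bar>s - t\<bar>) * ennreal \<bar>taylor2 \<psi> ((s - t) *\<^sub>R c) (y - t *\<^sub>R c)\<bar> \<partial>lborel)"
        by (intro nn_integral_cong) (simp add: abs_mult abs_inverse divide_inverse mult.commute flip: ennreal_mult)
      also have "\<dots> = ennreal (1 / \<bar>s - t\<bar>) * (\<integral>\<^sup>+y. ennreal \<bar>taylor2 \<psi> ((s - t) *\<^sub>R c) y\<bar> \<partial>lborel)"
        unfolding nn_integral_abs_shift[OF tm(2), symmetric, of _ "t *\<^sub>R c"]
        using tm'(2)[of _ "t *\<^sub>R c"] by (intro nn_integral_cmult) simp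
      also have "\<dots> \<le> ennreal (1 / \<bar>s - t\<bar>) * ennreal (C2 * norm ((s - t) *\<^sub>R c) ^ 2)"
        by (intro mult_left_mono C2) simp
      also have "\<dots> = ennreal (C2 * (norm c)\<^sup>2 * \<bar>s - t\<bar>)"
      proof -
        have "1 / d * (C2 * (d * norm c)\<^sup>2) = C2 * (norm c)\<^sup>2 * d" if "d \<noteq> 0" for d
          using that by (simp add: power2_eq_square)
        from this[of "\<bar>s - t\<bar>"] show ?thesis
          using C2(1) \<open>s \<noteq> t\<close> by (simp only: norm_scaleR) (simp flip: ennreal_mult)
      qed
      finally have b: "(\<integral>\<^sup>+y. ennreal \<bar>taylor2 \<psi> ((s - t) *\<^sub>R c) (y - t *\<^sub>R c) / (s - t)\<bar> \<partial>lborel) \<le> ennreal (C2 * (norm c)\<^sup>2 * \<bar>s - t\<bar>)" .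
      show "conv (u t) (\<lambda>y. (?\<psi> s y - ?\<psi> t y) / (s - t) + ?D y) \<in> bL2"
        "nL2 (conv (u t) (\<lambda>y. (?\<psi> s y - ?\<psi> t y) / (s - t) + ?D y)) \<le> C2 * (norm c)\<^sup>2 * \<bar>s - t\<bar> * nL2 (u t)"
        unfolding d2[OF that] by (intro conv_bL2[OF ut _ b]; use C2(1) tm'(2) in simp)+
    qed
    show "deriv_L2 G (\<lambda>x. conv v \<psi> (x - t *\<^sub>R c) - (\<Sum>i\<in>UNIV. c $ i * conv (u t) (partial_deriv i \<psi>) (x - t *\<^sub>R c))) t"
      unfolding deriv_L2_def Dc
    proof (intro conjI allI impI t)
      show "G s \<in> bL2" if "s \<ge> 0" for s unfolding G by (rule n0(1)[OF ub[OF that]])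
      have cv: "conv v \<psi> (x - t *\<^sub>R c) = conv v (?\<psi> t) x" for x by (simp add: conv_shift)
      show "(\<lambda>x. conv v \<psi> (x - t *\<^sub>R c) - conv (u t) ?D x) \<in> bL2"
        unfolding cv by (rule bL2_diff[OF n0(1)[OF v] cD])
      let ?q = "\<lambda>s x. (u s x - u t x) / (s - t) - v x"
      show "((\<lambda>s. nL2 (\<lambda>x. (G s x - G t x) / (s - t) - (conv v \<psi> (x - t *\<^sub>R c) - conv (u t) ?D x))) \<longlongrightarrow> 0) (at t)"
      proof (rule tendsto_0_dominated)
        let ?B = "\<lambda>s. C0 * nL2 (?q s) + C1 * norm c * \<bar>s - t\<bar> * nL2 v + C2 * (norm c)\<^sup>2 * \<bar>s - t\<bar> * nL2 (u t)"
        have "(?B \<longlongrightarrow> C0 * 0 + C1 * norm c * \<bar>t - t\<bar> * nL2 v + C2 * (norm c)\<^sup>2 * \<bar>t - t\<bar> * nL2 (u t)) (at t)"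
          by (intro tendsto_intros deriv_L2D(4)[OF u])
        then show "(?B \<longlongrightarrow> 0) (at t)" by simp
        show "\<forall>\<^sub>F s in at t. nL2 (\<lambda>x. (G s x - G t x) / (s - t) - (conv v \<psi> (x - t *\<^sub>R c) - conv (u t) ?D x)) \<le> ?B s"
          using eventually_at_nonneg[OF t] eventually_neq_at_within[of t t UNIV]
        proof eventually_elim
          case (elim s)
          note us = ub[OF elim(1)]
          have q: "?q s \<in> bL2" by (intro bL2_quotient us ut v)
          have Tb: "?\<psi> s \<in> bL2" for s by (rule test_function_bL2[OF T])
          \<comment> \<open>The product rule with its three errors: the difference quotient of u
            against the kernel at time s, the derivative v against the change of the kernel, and u
            at time t against the difference quotient of the kernel.\<close>
          have eq: "(\<lambda>x. (G s x - G t x) / (s - t) - (conv v \<psi> (x - t *\<^sub>R c) - conv (u t) ?D x))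
            = (\<lambda>x. (conv (?q s) (?\<psi> s) x + conv v (\<lambda>y. ?\<psi> s y - ?\<psi> t y) x) + conv (u t) (\<lambda>y. (?\<psi> s y - ?\<psi> t y) / (s - t) + ?D y) x)"
          proof
            fix x
            have 1: "conv (?q s) (?\<psi> s) x = (conv (u s) (?\<psi> s) x - conv (u t) (?\<psi> s) x) / (s - t) - conv v (?\<psi> s) x"
            proof -
              have d: "(\<lambda>x. (1 / (s - t)) * (u s x - u t x)) \<in> bL2" by (intro bL2_scale bL2_diff us ut)
              have "conv (?q s) (?\<psi> s) x = conv (\<lambda>x. (1 / (s - t)) * (u s x - u t x)) (?\<psi> s) x - conv v (?\<psi> s) x"
                using conv_diff_left[OF d v Tb] by simp
              then show ?thesis unfolding conv_scale_left by (simp add: conv_diff_left us ut Tb)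
            qed
            have 2: "conv v (\<lambda>y. ?\<psi> s y - ?\<psi> t y) x = conv v (?\<psi> s) x - conv v (?\<psi> t) x" by (rule conv_diff_right[OF v Tb Tb])
            have 3: "conv (u t) (\<lambda>y. (?\<psi> s y - ?\<psi> t y) / (s - t) + ?D y) x = (conv (u t) (?\<psi> s) x - conv (u t) (?\<psi> t) x) / (s - t) + conv (u t) ?D x"
            proof -
              have d: "(\<lambda>y. (1 / (s - t)) * (?\<psi> s y - ?\<psi> t y)) \<in> bL2" by (intro bL2_scale bL2_diff Tb)
              have "conv (u t) (\<lambda>y. (?\<psi> s y - ?\<psi> t y) / (s - t) + ?D y) x = conv (u t) (\<lambda>y. (1 / (s - t)) * (?\<psi> s y - ?\<psi> t y)) x + conv (u t) ?D x"
                using conv_add_right[OF ut d Db] by simp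
              then show ?thesis unfolding conv_scale_right by (simp add: conv_diff_right ut Tb)
            qed
            show "(G s x - G t x) / (s - t) - (conv v \<psi> (x - t *\<^sub>R c) - conv (u t) ?D x)
              = (conv (?q s) (?\<psi> s) x + conv v (\<lambda>y. ?\<psi> s y - ?\<psi> t y) x) + conv (u t) (\<lambda>y. (?\<psi> s y - ?\<psi> t y) / (s - t) + ?D y) x"
              unfolding 1 2 3 G cv by (simp add: diff_divide_distrib)
          qed
          have "nL2 (\<lambda>x. (G s x - G t x) / (s - t) - (conv v \<psi> (x - t *\<^sub>R c) - conv (u t) ?D x)) \<le> nL2 (\<lambda>x. conv (?q s) (?\<psi> s) x + conv v (\<lambda>y. ?\<psi> s y - ?\<psi> t y) x) + nL2 (conv (u t) (\<lambda>y. (?\<psi> s y - ?\<psi> t y) / (s - t) + ?D y))"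
            unfolding eq by (rule nL2_triangle[OF bL2_add[OF n0(1)[OF q] n1(1)[OF v]] n2(1)[OF elim(2)]])
          also have "\<dots> \<le> (nL2 (conv (?q s) (?\<psi> s)) + nL2 (conv v (\<lambda>y. ?\<psi> s y - ?\<psi> t y))) + nL2 (conv (u t) (\<lambda>y. (?\<psi> s y - ?\<psi> t y) / (s - t) + ?D y))"
            by (rule add_right_mono[OF nL2_triangle[OF n0(1)[OF q] n1(1)[OF v]]])
          also have "\<dots> \<le> ?B s"
            by (rule add_mono[OF add_mono[OF n0(2)[OF q] n1(2)[OF v]] n2(2)[OF elim(2)]])
          finally show ?case .
        qed
      qed simp
    qed
  qed
qed

subsection \<open>The energy estimate\<close>

definition energy :: "('a::euclidean_space \<Rightarrow> real) \<Rightarrow> ('a \<Rightarrow> real) \<Rightarrow> real" where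
  "energy p f = (LINT x|lborel. p x * (f x)\<^sup>2)"

locale weight =
  fixes p :: "'a::euclidean_space \<Rightarrow> real" and c1 c2 :: real
  assumes p_borel [measurable]: "p \<in> borel_measurable borel" and c1: "c1 > 0" and p_lower: "\<And>x. c1 \<le> p x" and p_upper: "\<And>x. p x \<le> c2"
begin

lemma c2: "c2 > 0" using c1 p_lower[of undefined] p_upper[of undefined] by linarith
lemma p_abs: "\<bar>p x\<bar> \<le> c2" using c1 p_lower[of x] p_upper[of x] by linarith
lemma p_nonneg: "p x \<ge> 0" using c1 p_lower[of x] by linarith

lemma weighted_integrable: "f \<in> bL2 \<Longrightarrow> g \<in> bL2 \<Longrightarrow> integrable lborel (\<lambda>x. p x * (f x * g x))"
  using bL2_mult_integrable[OF bL2_bounded_mult(1)[OF _ p_borel p_abs], of f g] by (simp add: mult.assoc)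

lemma energy_bounds:
  assumes f: "f \<in> bL2" shows "c1 * (nL2 f)\<^sup>2 \<le> energy p f" "energy p f \<le> c2 * (nL2 f)\<^sup>2"
proof -
  have i: "integrable lborel (\<lambda>x. p x * (f x)\<^sup>2)" using weighted_integrable[OF f f] by (simp add: power2_eq_square)
  have "c1 * (nL2 f)\<^sup>2 = (LINT x|lborel. c1 * (f x)\<^sup>2)" by (simp add: nL2_sq)
  also have "\<dots> \<le> energy p f" unfolding energy_def
    using bL2_integrable[OF f] i p_lower by (intro integral_mono mult_right_mono) auto
  finally show "c1 * (nL2 f)\<^sup>2 \<le> energy p f" .
  have "energy p f \<le> (LINT x|lborel. c2 * (f x)\<^sup>2)" unfolding energy_def
    using bL2_integrable[OF f] i p_upper by (intro integral_mono mult_right_mono) auto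
  then show "energy p f \<le> c2 * (nL2 f)\<^sup>2" by (simp add: nL2_sq)
qed

lemma weighted_bound:
  assumes f: "f \<in> bL2" and g: "g \<in> bL2" shows "\<bar>LINT x|lborel. p x * (f x * g x)\<bar> \<le> c2 * nL2 f * nL2 g"
proof -
  have pf: "(\<lambda>x. p x * f x) \<in> bL2" "nL2 (\<lambda>x. p x * f x) \<le> c2 * nL2 f"
    using bL2_bounded_mult[OF f p_borel p_abs] by auto
  have "\<bar>LINT x|lborel. (p x * f x) * g x\<bar> \<le> nL2 (\<lambda>x. p x * f x) * nL2 g" by (rule nL2_cauchy_schwarz[OF pf(1) g])
  also have "\<dots> \<le> c2 * nL2 f * nL2 g" by (intro mult_right_mono pf) simp
  finally show ?thesis by (simp add: mult.assoc)
qed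

lemma energy_diff:
  assumes f: "f \<in> bL2" and g: "g \<in> bL2"
  shows "energy p f - energy p g = (LINT x|lborel. p x * ((f x - g x) * (f x + g x)))"
proof -
  have "energy p f - energy p g = (LINT x|lborel. p x * (f x * f x) - p x * (g x * g x))"
    unfolding energy_def power2_eq_square using weighted_integrable[OF f f] weighted_integrable[OF g g] by simp
  also have "\<dots> = (LINT x|lborel. p x * ((f x - g x) * (f x + g x)))"
    by (intro Bochner_Integration.integral_cong) (auto simp: algebra_simps)
  finally show ?thesis .
qed

lemma energy_diff_bound:
  assumes f: "f \<in> bL2" and g: "g \<in> bL2"
  shows "\<bar>energy p f - energy p g\<bar> \<le> c2 * nL2 (\<lambda>x. f x - g x) * (nL2 (\<lambda>x. f x - g x) + 2 * nL2 g)"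
proof -
  have "nL2 (\<lambda>x. f x + g x) \<le> nL2 (\<lambda>x. f x - g x) + 2 * nL2 g"
    using nL2_triangle[OF bL2_diff[OF f g] bL2_scale[OF g, of 2]] by (simp add: nL2_scale add.commute)
  then have "c2 * nL2 (\<lambda>x. f x - g x) * nL2 (\<lambda>x. f x + g x) \<le> c2 * nL2 (\<lambda>x. f x - g x) * (nL2 (\<lambda>x. f x - g x) + 2 * nL2 g)"
    using c2 by (intro mult_left_mono mult_nonneg_nonneg) auto
  moreover have "\<bar>energy p f - energy p g\<bar> \<le> c2 * nL2 (\<lambda>x. f x - g x) * nL2 (\<lambda>x. f x + g x)"
    unfolding energy_diff[OF f g] by (rule weighted_bound[OF bL2_diff[OF f g] bL2_add[OF f g]])
  ultimately show ?thesis by (rule order_trans[rotated])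
qed

lemma energy_continuous:
  assumes z: "cont_L2 z" and t: "t \<ge> 0" shows "((\<lambda>s. energy p (z s)) \<longlongrightarrow> energy p (z t)) (at t within {0..})"
proof -
  let ?n = "\<lambda>s. nL2 (\<lambda>x. z s x - z t x)"
  have "((\<lambda>s. \<bar>energy p (z s) - energy p (z t)\<bar>) \<longlongrightarrow> 0) (at t within {0..})"
  proof (rule tendsto_0_dominated)
    have "((\<lambda>s. c2 * ?n s * (?n s + 2 * nL2 (z t))) \<longlongrightarrow> c2 * 0 * (0 + 2 * nL2 (z t))) (at t within {0..})"
      by (intro tendsto_intros cont_L2D(2)[OF z t])
    then show "((\<lambda>s. c2 * ?n s * (?n s + 2 * nL2 (z t))) \<longlongrightarrow> 0) (at t within {0..})" by simp
    show "\<forall>\<^sub>F s in at t within {0..}. \<bar>energy p (z s) - energy p (z t)\<bar> \<le> c2 * ?n s * (?n s + 2 * nL2 (z t))"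
    proof -
      have "\<bar>energy p (z s) - energy p (z t)\<bar> \<le> c2 * ?n s * (?n s + 2 * nL2 (z t))" if "s \<ge> 0" for s
        by (rule energy_diff_bound[OF cont_L2D(1)[OF z that] cont_L2D(1)[OF z t]])
      then show ?thesis by (simp add: eventually_at_filter)
    qed
  qed simp
  then have "((\<lambda>s. energy p (z s) - energy p (z t)) \<longlongrightarrow> 0) (at t within {0..})" by (rule tendsto_rabs_zero_cancel)
  then show ?thesis by (simp add: LIM_zero_iff)
qed

lemma energy_has_derivative:
  assumes z: "deriv_L2 z z' t"
  shows "((\<lambda>s. energy p (z s)) has_real_derivative 2 * (LINT x|lborel. p x * (z t x * z' x))) (at t)"
proof -
  note zb = deriv_L2D(1)[OF z] and t = deriv_L2D(2)[OF z] and z' = deriv_L2D(3)[OF z]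
  have zt: "z t \<in> bL2" using t by (intro zb) simp
  let ?q = "\<lambda>s x. (z s x - z t x) / (s - t)" and ?n = "\<lambda>s. nL2 (\<lambda>x. z s x - z t x)"
  let ?e = "\<lambda>s. nL2 (\<lambda>x. ?q s x - z' x)"
  let ?B = "\<lambda>s. c2 * ?e s * (?n s + 2 * nL2 (z t)) + c2 * nL2 z' * ?n s"
  have "((\<lambda>s. \<bar>(energy p (z s) - energy p (z t)) / (s - t) - 2 * (LINT x|lborel. p x * (z t x * z' x))\<bar>) \<longlongrightarrow> 0) (at t)"
  proof (rule tendsto_0_dominated)
    have "(?B \<longlongrightarrow> c2 * 0 * (0 + 2 * nL2 (z t)) + c2 * nL2 z' * 0) (at t)"
      by (intro tendsto_intros deriv_L2D(4)[OF z] deriv_L2_tendsto[OF z])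
    then show "(?B \<longlongrightarrow> 0) (at t)" by simp
    show "\<forall>\<^sub>F s in at t. \<bar>(energy p (z s) - energy p (z t)) / (s - t) - 2 * (LINT x|lborel. p x * (z t x * z' x))\<bar> \<le> ?B s"
      using eventually_at_nonneg[OF t]
    proof eventually_elim
      case (elim s)
      have zs: "z s \<in> bL2" by (rule zb[OF elim])
      have e: "(\<lambda>x. ?q s x - z' x) \<in> bL2" by (intro bL2_quotient zs zt z')
      have pl: "(\<lambda>x. z s x + z t x) \<in> bL2" by (intro bL2_add zs zt)
      have mi: "(\<lambda>x. z s x - z t x) \<in> bL2" by (intro bL2_diff zs zt)
      have "(energy p (z s) - energy p (z t)) / (s - t) = (LINT x|lborel. p x * (?q s x * (z s x + z t x)))"
        unfolding energy_diff[OF zs zt] by (subst integral_divide_zero[symmetric]) simp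
      \<comment> \<open>The quotient is compared with z' inside the product, and the factor z s + z
        t is written as z s - z t plus twice z t; all but the last summand tend to 0.\<close>
      also have "\<dots> = (LINT x|lborel. p x * ((?q s x - z' x) * (z s x + z t x)) + p x * (z' x * (z s x - z t x)) + 2 * (p x * (z t x * z' x)))"
        by (intro Bochner_Integration.integral_cong) (auto simp: algebra_simps)
      also have "\<dots> = (LINT x|lborel. p x * ((?q s x - z' x) * (z s x + z t x))) + (LINT x|lborel. p x * (z' x * (z s x - z t x))) + 2 * (LINT x|lborel. p x * (z t x * z' x))"
        using weighted_integrable[OF e pl] weighted_integrable[OF z' mi] weighted_integrable[OF zt z'] by simp
      finally have eq: "(energy p (z s) - energy p (z t)) / (s - t) - 2 * (LINT x|lborel. p x * (z t x * z' x))
        = (LINT x|lborel. p x * ((?q s x - z' x) * (z s x + z t x))) + (LINT x|lborel. p x * (z' x * (z s x - z t x)))" by simp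
      have "nL2 (\<lambda>x. z s x + z t x) \<le> ?n s + 2 * nL2 (z t)"
        using nL2_triangle[OF bL2_diff[OF zs zt] bL2_scale[OF zt, of 2]] by (simp add: nL2_scale add.commute)
      then have le: "c2 * ?e s * nL2 (\<lambda>x. z s x + z t x) \<le> c2 * ?e s * (?n s + 2 * nL2 (z t))"
        using c2 by (intro mult_left_mono mult_nonneg_nonneg) auto
      show ?case
        unfolding eq
        by (rule order_trans[OF abs_triangle_ineq add_mono[OF order_trans[OF weighted_bound[OF e pl] le] weighted_bound[OF z' mi]]])
    qed
  qed simp
  then have "((\<lambda>s. (energy p (z s) - energy p (z t)) / (s - t)) \<longlongrightarrow> 2 * (LINT x|lborel. p x * (z t x * z' x))) (at t)"
    by (rule LIM_zero_cancel[OF tendsto_rabs_zero_cancel])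
  then show ?thesis by (simp add: has_field_derivative_iff)
qed

text \<open>Gronwall's inequality: \<open>exp (- s) * energy p (z s) - B * s\<close> is decreasing.
  Differentiability enters at positive times; the initial time is reached by continuity of the
  path.\<close>

lemma energy_estimate:
  assumes z: "cont_L2 z" and z': "\<And>t. t > 0 \<Longrightarrow> deriv_L2 z (z' t) t"
    and ineq: "\<And>t. 0 < t \<Longrightarrow> t < T \<Longrightarrow> 2 * (LINT x|lborel. p x * (z t x * z' t x)) \<le> energy p (z t) + B"
    and t: "0 \<le> t" "t \<le> T" and B: "B \<ge> 0"
  shows "energy p (z t) \<le> exp T * (energy p (z 0) + B * T)"
proof -
  let ?g = "\<lambda>s. exp (- s) * energy p (z s) - B * s"
  have "?g t \<le> ?g 0"
  proof (cases "t = 0")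
    case False
    show ?thesis
    proof (rule DERIV_nonpos_imp_decreasing_open[of 0 t ?g])
      fix s assume s: "0 < s" "s < t"
      have "(?g has_real_derivative exp (- s) * (2 * (LINT x|lborel. p x * (z s x * z' s x)) - energy p (z s)) - B) (at s)"
        by (rule derivative_eq_intros energy_has_derivative[OF z'[OF s(1)]] refl)+ (simp add: algebra_simps)
      moreover have "exp (- s) * (2 * (LINT x|lborel. p x * (z s x * z' s x)) - energy p (z s)) - B \<le> 0"
      proof -
        have "exp (- s) * (2 * (LINT x|lborel. p x * (z s x * z' s x)) - energy p (z s)) \<le> exp (- s) * B"
          using ineq[of s] s t by (intro mult_left_mono) auto
        also have "\<dots> \<le> 1 * B" using s B by (intro mult_right_mono) auto
        finally show ?thesis by simp
      qed
      ultimately show "\<exists>y. (?g has_real_derivative y) (at s) \<and> y \<le> 0" by blast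
    next
      have "continuous_on {0..t} (\<lambda>s. energy p (z s))"
        unfolding continuous_on_def
        by (auto intro!: tendsto_within_subset[OF energy_continuous[OF z]])
      then show "continuous_on {0..t} ?g" by (intro continuous_intros)
    qed (use t False in auto)
  qed simp
  then have "exp (- t) * energy p (z t) \<le> energy p (z 0) + B * t" by simp
  also have "\<dots> \<le> energy p (z 0) + B * T" using t B by (intro add_left_mono mult_left_mono) auto
  finally have "exp t * (exp (- t) * energy p (z t)) \<le> exp t * (energy p (z 0) + B * T)" by (rule mult_left_mono) simp
  moreover have "energy p (z 0) \<ge> 0"
    unfolding energy_def using p_nonneg by (intro integral_nonneg_AE) auto
  ultimately have "energy p (z t) \<le> exp t * (energy p (z 0) + B * T)" "0 \<le> energy p (z 0) + B * T"
    using t B by (auto simp: mult.assoc[symmetric] exp_minus_inverse)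
  moreover have "exp t * (energy p (z 0) + B * T) \<le> exp T * (energy p (z 0) + B * T)"
    using calculation(2) t by (intro mult_right_mono) auto
  ultimately show ?thesis by linarith
qed

end

subsection \<open>The rescaled operator\<close>

context periodic_kernel
begin

definition Lop :: "real \<Rightarrow> (real ^ 'n \<Rightarrow> real) \<Rightarrow> real ^ 'n \<Rightarrow> real" where
  "Lop \<epsilon> f x = (1 / \<epsilon>\<^sup>2) * (LINT z|lborel. K (x /\<^sub>R \<epsilon>) z * (f (x - \<epsilon> *\<^sub>R z) - f x))"

text \<open>The substitution y = x - \<epsilon> z absorbs \<epsilon> to the power of the dimension
  and leaves the factor 1/\<epsilon>^2.\<close>

lemma nonlocal_operator_eq:
  assumes \<epsilon>: "\<epsilon> > 0" and [measurable]: "f \<in> borel_measurable borel"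
  shows "nonlocal_operator a \<mu> \<epsilon> f x = Lop \<epsilon> f x"
proof -
  let ?h = "\<lambda>y. a ((x - y) /\<^sub>R \<epsilon>) * \<mu> (x /\<^sub>R \<epsilon>) (y /\<^sub>R \<epsilon>) * (f y - f x)"
  have "(\<lambda>y. \<mu> (x /\<^sub>R \<epsilon>) (y /\<^sub>R \<epsilon>)) \<in> borel_measurable borel" by measurable
  then have [measurable]: "?h \<in> borel_measurable borel" by measurable
  have "(LINT y|lebesgue. ?h y) = (LINT y|lborel. ?h y)" by (rule integral_completion) measurable
  also have "\<dots> = \<bar>- \<epsilon>\<bar> ^ DIM(real ^ 'n) * (LINT z|lborel. ?h (x + (- \<epsilon>) *\<^sub>R z))"
    by (rule lborel_integral_affine) (use \<epsilon> in auto)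
  also have "(LINT z|lborel. ?h (x + (- \<epsilon>) *\<^sub>R z)) = (LINT z|lborel. K (x /\<^sub>R \<epsilon>) z * (f (x - \<epsilon> *\<^sub>R z) - f x))"
    using \<epsilon> by (intro Bochner_Integration.integral_cong[OF refl]) (simp add: K_def scaleR_diff_right)
  finally show ?thesis
    using \<epsilon> by (simp add: nonlocal_operator_def Lop_def power_add power2_eq_square)
qed

text \<open>For a square integrable f and an individual x these integrals may diverge; Tonelli and
  translation invariance make them finite for almost every x. The linear integral follows from the
  quadratic one by |t| \<le> 1 + t^2 and integrability of the kernel.\<close>

lemma AE_K_square_integrable:
  assumes f: "f \<in> bL2" and \<epsilon>: "\<epsilon> > 0"
  shows "AE x in lborel. integrable lborel (\<lambda>z. K (x /\<^sub>R \<epsilon>) z * (f (x - \<epsilon> *\<^sub>R z))\<^sup>2) \<and> integrable lborel (\<lambda>z. K (x /\<^sub>R \<epsilon>) z * f (x - \<epsilon> *\<^sub>R z))"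
proof -
  have [measurable]: "f \<in> borel_measurable borel" by (rule bL2_measurable[OF f])
  have "(\<integral>\<^sup>+x. (\<integral>\<^sup>+z. ennreal (a z) * ennreal ((f (x - \<epsilon> *\<^sub>R z))\<^sup>2) \<partial>lborel) \<partial>lborel)
     = (\<integral>\<^sup>+z. (\<integral>\<^sup>+x. ennreal (a z) * ennreal ((f (x - \<epsilon> *\<^sub>R z))\<^sup>2) \<partial>lborel) \<partial>lborel)"
    by (rule lborel_pair.Fubini') measurable
  also have "\<dots> = (\<integral>\<^sup>+z. ennreal (a z) * ennreal ((nL2 f)\<^sup>2) \<partial>lborel)"
    using nn_integral_translate(3)[of "\<lambda>x. ennreal ((f x)\<^sup>2)"] by (simp add: nn_integral_cmult nn_integral_nL2[OF f])
  also have "\<dots> = ennreal mass * ennreal ((nL2 f)\<^sup>2)"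
    unfolding mass_def using a_int a_nonneg by (simp add: nn_integral_multc nn_integral_eq_integral)
  also have "\<dots> < \<infinity>" by (simp add: ennreal_mult_less_top)
  finally have "AE x in lborel. (\<integral>\<^sup>+z. ennreal (a z) * ennreal ((f (x - \<epsilon> *\<^sub>R z))\<^sup>2) \<partial>lborel) \<noteq> \<infinity>"
    by (intro nn_integral_PInf_AE) auto
  then show ?thesis
  proof eventually_elim
    case (elim x)
    have [measurable]: "K (x /\<^sub>R \<epsilon>) \<in> borel_measurable borel" by measurable
    have i: "integrable lborel (\<lambda>z. a z * (f (x - \<epsilon> *\<^sub>R z))\<^sup>2)"
      using elim a_nonneg by (simp add: integrable_iff_bounded ennreal_mult less_top abs_mult)
    have 1: "integrable lborel (\<lambda>z. K (x /\<^sub>R \<epsilon>) z * (f (x - \<epsilon> *\<^sub>R z))\<^sup>2)"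
    proof (rule Bochner_Integration.integrable_bound)
      show "integrable lborel (\<lambda>z. \<alpha>\<^sub>2 * (a z * (f (x - \<epsilon> *\<^sub>R z))\<^sup>2))" by (intro integrable_mult_right i)
      have "K (x /\<^sub>R \<epsilon>) z * (f (x - \<epsilon> *\<^sub>R z))\<^sup>2 \<le> \<alpha>\<^sub>2 * a z * (f (x - \<epsilon> *\<^sub>R z))\<^sup>2" for z
        by (intro mult_right_mono K_le) simp
      then show "AE z in lborel. norm (K (x /\<^sub>R \<epsilon>) z * (f (x - \<epsilon> *\<^sub>R z))\<^sup>2) \<le> norm (\<alpha>\<^sub>2 * (a z * (f (x - \<epsilon> *\<^sub>R z))\<^sup>2))"
        using K_nonneg \<alpha>2_pos a_nonneg by (simp add: abs_mult mult.assoc)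
    qed measurable
    have 2: "integrable lborel (\<lambda>z. K (x /\<^sub>R \<epsilon>) z * f (x - \<epsilon> *\<^sub>R z))"
    proof (rule Bochner_Integration.integrable_bound)
      show "integrable lborel (\<lambda>z. K (x /\<^sub>R \<epsilon>) z + K (x /\<^sub>R \<epsilon>) z * (f (x - \<epsilon> *\<^sub>R z))\<^sup>2)"
        by (intro Bochner_Integration.integrable_add K_integrable 1)
      have "\<bar>t\<bar> \<le> 1 + t\<^sup>2" for t :: real
        using zero_le_power2[of "\<bar>t\<bar> - 1"] unfolding power2_diff by simp
      then have "K (x /\<^sub>R \<epsilon>) z * \<bar>f (x - \<epsilon> *\<^sub>R z)\<bar> \<le> K (x /\<^sub>R \<epsilon>) z * (1 + (f (x - \<epsilon> *\<^sub>R z))\<^sup>2)" for z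
        by (intro mult_left_mono K_nonneg)
      then show "AE z in lborel. norm (K (x /\<^sub>R \<epsilon>) z * f (x - \<epsilon> *\<^sub>R z)) \<le> norm (K (x /\<^sub>R \<epsilon>) z + K (x /\<^sub>R \<epsilon>) z * (f (x - \<epsilon> *\<^sub>R z))\<^sup>2)"
        using K_nonneg by (simp add: abs_mult distrib_left)
    qed measurable
    from 1 2 show ?case ..
  qed
qed

lemma Lop_diff:
  assumes f: "f \<in> bL2" and g: "g \<in> bL2" and \<epsilon>: "\<epsilon> > 0"
  shows "AE x in lborel. Lop \<epsilon> (\<lambda>x. f x - g x) x = Lop \<epsilon> f x - Lop \<epsilon> g x"
  using AE_K_square_integrable[OF f \<epsilon>] AE_K_square_integrable[OF g \<epsilon>]
proof eventually_elim
  case (elim x)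
  have "integrable lborel (\<lambda>z. K (x /\<^sub>R \<epsilon>) z * (f (x - \<epsilon> *\<^sub>R z) - f x))" "integrable lborel (\<lambda>z. K (x /\<^sub>R \<epsilon>) z * (g (x - \<epsilon> *\<^sub>R z) - g x))"
    using elim K_integrable[of "x /\<^sub>R \<epsilon>"] by (simp_all add: right_diff_distrib)
  from Bochner_Integration.integral_diff[OF this]
  have "(LINT z|lborel. K (x /\<^sub>R \<epsilon>) z * ((f (x - \<epsilon> *\<^sub>R z) - g (x - \<epsilon> *\<^sub>R z)) - (f x - g x)))
    = (LINT z|lborel. K (x /\<^sub>R \<epsilon>) z * (f (x - \<epsilon> *\<^sub>R z) - f x)) - (LINT z|lborel. K (x /\<^sub>R \<epsilon>) z * (g (x - \<epsilon> *\<^sub>R z) - g x))"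
    by (simp add: algebra_simps)
  then show ?case by (simp only: Lop_def right_diff_distrib)
qed

text \<open>Pointwise f(x) (f(x - \<epsilon> z) - f(x)) is at most half the difference of the
  squares. Integrated against \<open>p0\<close>, the gain of squares from all jumps equals the loss,
  which is stationarity transported by translation. If the integrand on the left is not integrable,
  its integral is 0 by convention and nothing remains to be shown.\<close>

lemma Lop_dissipative:
  assumes f: "f \<in> bL2" and \<epsilon>: "\<epsilon> > 0"
  shows "(LINT x|lborel. p0 (x /\<^sub>R \<epsilon>) * (f x * Lop \<epsilon> f x)) \<le> 0"
proof (cases "integrable lborel (\<lambda>x. p0 (x /\<^sub>R \<epsilon>) * (f x * Lop \<epsilon> f x))")
  case False then show ?thesis by (simp add: not_integrable_integral_eq)
next
  case True
  have [measurable]: "f \<in> borel_measurable borel" "p0 \<in> borel_measurable borel" "rate \<in> borel_measurable borel"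
    using bL2_measurable[OF f] BP_measurable[OF p0_BP] BP_measurable[OF rate_BP] by auto
  define I where "I x = (LINT z|lborel. K (x /\<^sub>R \<epsilon>) z * (f (x - \<epsilon> *\<^sub>R z))\<^sup>2)" for x
  have [measurable]: "I \<in> borel_measurable borel" unfolding I_def[abs_def] by measurable
  define D where "D x = p0 (x /\<^sub>R \<epsilon>) * rate (x /\<^sub>R \<epsilon>) * (f x)\<^sup>2" for x
  have inner: "(\<integral>\<^sup>+z. ennreal (p0 (\<eta> + z)) * ennreal (K (\<eta> + z) z) \<partial>lborel) = ennreal (p0 \<eta> * rate \<eta>)" for \<eta>
  proof -
    have "(\<lambda>x. \<mu> x \<eta>) \<in> borel_measurable borel" by measurable
    then have [measurable]: "(\<lambda>x. p0 x * (a (x - \<eta>) * \<mu> x \<eta>)) \<in> borel_measurable borel" by measurable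
    have "(\<integral>\<^sup>+z. ennreal (p0 (\<eta> + z)) * ennreal (K (\<eta> + z) z) \<partial>lborel) = (\<integral>\<^sup>+z. ennreal (p0 (\<eta> + z) * (a (\<eta> + z - \<eta>) * \<mu> (\<eta> + z) \<eta>)) \<partial>lborel)"
      unfolding ennreal_mult[OF p0_nonneg K_nonneg, symmetric] by (simp add: K_def)
    also have "\<dots> = (\<integral>\<^sup>+x. ennreal (p0 x * (a (x - \<eta>) * \<mu> x \<eta>)) \<partial>lborel)"
      by (rule nn_integral_translate(2)) measurable
    also have "\<dots> = ennreal (LINT x|lborel. p0 x * (a (x - \<eta>) * \<mu> x \<eta>))"
    proof (rule nn_integral_eq_integral)
      have "integrable lborel (\<lambda>x. jump x \<eta> * \<pi> x)" by (rule Q_integrable[OF \<pi>(1)])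
      moreover have "(\<lambda>x. jump x \<eta> * \<pi> x) = (\<lambda>x. p0 x * (a (x - \<eta>) * \<mu> x \<eta>))"
        by (simp add: p0_def jump_def fun_eq_iff)
      ultimately show "integrable lborel (\<lambda>x. p0 x * (a (x - \<eta>) * \<mu> x \<eta>))" by simp
    qed (use p0_nonneg a_nonneg \<mu>_nonneg in auto)
    finally show ?thesis by (simp add: p0_stationary)
  qed
  have D: "integrable lborel D"
  proof -
    have b: "(\<lambda>x. p0 x * rate x) \<in> BP" by (intro BP_mult p0_BP rate_BP)
    obtain C where C: "C > 0" "\<And>x. \<bar>p0 x * rate x\<bar> \<le> C" by (rule BP_bounded[OF b]) blast
    show ?thesis
    proof (rule Bochner_Integration.integrable_bound)
      show "integrable lborel (\<lambda>x. C * (f x)\<^sup>2)" by (intro integrable_mult_right bL2_integrable f)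
      have "\<bar>p0 (x /\<^sub>R \<epsilon>) * rate (x /\<^sub>R \<epsilon>)\<bar> * (f x)\<^sup>2 \<le> C * (f x)\<^sup>2" for x by (intro mult_right_mono C) simp
      then show "AE x in lborel. norm (D x) \<le> norm (C * (f x)\<^sup>2)" using C(1) by (simp add: D_def abs_mult)
      show "D \<in> borel_measurable lborel" unfolding D_def[abs_def] by measurable
    qed
  qed
  have D0: "D x \<ge> 0" for x using p0_nonneg rate_pos[of "x /\<^sub>R \<epsilon>"] by (simp add: D_def)
  have AEK: "AE x in lborel. ennreal (p0 (x /\<^sub>R \<epsilon>) * I x) = ennreal (p0 (x /\<^sub>R \<epsilon>)) * (\<integral>\<^sup>+z. ennreal (K (x /\<^sub>R \<epsilon>) z) * ennreal ((f (x - \<epsilon> *\<^sub>R z))\<^sup>2) \<partial>lborel)"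
    using AE_K_square_integrable[OF f \<epsilon>]
  proof eventually_elim
    case (elim x)
    have "ennreal (I x) = (\<integral>\<^sup>+z. ennreal (K (x /\<^sub>R \<epsilon>) z * (f (x - \<epsilon> *\<^sub>R z))\<^sup>2) \<partial>lborel)"
      unfolding I_def using elim by (intro nn_integral_eq_integral[symmetric]) (auto simp: K_nonneg)
    then show ?case by (simp add: ennreal_mult'[OF p0_nonneg] ennreal_mult'[OF K_nonneg])
  qed
  \<comment> \<open>Translating x by \<epsilon> z moves the square of f to a fixed point y; what is
    left is an integral over z of \<open>p0\<close> times the kernel at the shifted point, evaluated
    by \<open>inner\<close>.\<close>
  have eqn: "(\<integral>\<^sup>+x. ennreal (p0 (x /\<^sub>R \<epsilon>) * I x) \<partial>lborel) = (\<integral>\<^sup>+x. ennreal (D x) \<partial>lborel)"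
  proof -
    have "(\<integral>\<^sup>+x. ennreal (p0 (x /\<^sub>R \<epsilon>) * I x) \<partial>lborel)
      = (\<integral>\<^sup>+x. ennreal (p0 (x /\<^sub>R \<epsilon>)) * (\<integral>\<^sup>+z. ennreal (K (x /\<^sub>R \<epsilon>) z) * ennreal ((f (x - \<epsilon> *\<^sub>R z))\<^sup>2) \<partial>lborel) \<partial>lborel)"
      by (rule nn_integral_cong_AE[OF AEK])
    also have "\<dots> = (\<integral>\<^sup>+x. (\<integral>\<^sup>+z. ennreal (p0 (x /\<^sub>R \<epsilon>)) * (ennreal (K (x /\<^sub>R \<epsilon>) z) * ennreal ((f (x - \<epsilon> *\<^sub>R z))\<^sup>2)) \<partial>lborel) \<partial>lborel)"
      by (intro nn_integral_cong nn_integral_cmult[symmetric]) measurable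
    also have "\<dots> = (\<integral>\<^sup>+z. (\<integral>\<^sup>+x. ennreal (p0 (x /\<^sub>R \<epsilon>)) * (ennreal (K (x /\<^sub>R \<epsilon>) z) * ennreal ((f (x - \<epsilon> *\<^sub>R z))\<^sup>2)) \<partial>lborel) \<partial>lborel)"
      by (rule lborel_pair.Fubini') measurable
    also have "\<dots> = (\<integral>\<^sup>+z. (\<integral>\<^sup>+y. ennreal (p0 (y /\<^sub>R \<epsilon> + z)) * (ennreal (K (y /\<^sub>R \<epsilon> + z) z) * ennreal ((f y)\<^sup>2)) \<partial>lborel) \<partial>lborel)"
    proof (rule nn_integral_cong)
      fix z
      have [measurable]: "(\<lambda>x. K x z) \<in> borel_measurable borel" by measurable
      have e: "(y + \<epsilon> *\<^sub>R z) /\<^sub>R \<epsilon> = y /\<^sub>R \<epsilon> + z" for y using \<epsilon> by (simp add: scaleR_add_right)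
      show "(\<integral>\<^sup>+x. ennreal (p0 (x /\<^sub>R \<epsilon>)) * (ennreal (K (x /\<^sub>R \<epsilon>) z) * ennreal ((f (x - \<epsilon> *\<^sub>R z))\<^sup>2)) \<partial>lborel)
        = (\<integral>\<^sup>+y. ennreal (p0 (y /\<^sub>R \<epsilon> + z)) * (ennreal (K (y /\<^sub>R \<epsilon> + z) z) * ennreal ((f y)\<^sup>2)) \<partial>lborel)"
        using nn_integral_translate(1)[of "\<lambda>x. ennreal (p0 (x /\<^sub>R \<epsilon>)) * (ennreal (K (x /\<^sub>R \<epsilon>) z) * ennreal ((f (x - \<epsilon> *\<^sub>R z))\<^sup>2))" "\<epsilon> *\<^sub>R z"]
        by (simp add: e)
    qed
    also have "\<dots> = (\<integral>\<^sup>+y. (\<integral>\<^sup>+z. ennreal (p0 (y /\<^sub>R \<epsilon> + z)) * (ennreal (K (y /\<^sub>R \<epsilon> + z) z) * ennreal ((f y)\<^sup>2)) \<partial>lborel) \<partial>lborel)"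
      by (rule lborel_pair.Fubini') measurable
    also have "\<dots> = (\<integral>\<^sup>+y. ennreal (D y) \<partial>lborel)"
    proof (rule nn_integral_cong)
      fix y
      have [measurable]: "(\<lambda>z. K (y /\<^sub>R \<epsilon> + z) z) \<in> borel_measurable borel" by measurable
      have "(\<integral>\<^sup>+z. ennreal (p0 (y /\<^sub>R \<epsilon> + z)) * (ennreal (K (y /\<^sub>R \<epsilon> + z) z) * ennreal ((f y)\<^sup>2)) \<partial>lborel)
        = (\<integral>\<^sup>+z. ennreal (p0 (y /\<^sub>R \<epsilon> + z)) * ennreal (K (y /\<^sub>R \<epsilon> + z) z) \<partial>lborel) * ennreal ((f y)\<^sup>2)"
        by (subst nn_integral_multc[symmetric]) (auto simp: mult.assoc)
      then show "(\<integral>\<^sup>+z. ennreal (p0 (y /\<^sub>R \<epsilon> + z)) * (ennreal (K (y /\<^sub>R \<epsilon> + z) z) * ennreal ((f y)\<^sup>2)) \<partial>lborel) = ennreal (D y)"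
        unfolding inner D_def using p0_nonneg rate_pos[of "y /\<^sub>R \<epsilon>"] by (simp add: ennreal_mult' )
    qed
    finally show ?thesis .
  qed
  have I0: "p0 (x /\<^sub>R \<epsilon>) * I x \<ge> 0" for x
    unfolding I_def using p0_nonneg K_nonneg by (intro mult_nonneg_nonneg integral_nonneg_AE AE_I2) auto
  have pI: "integrable lborel (\<lambda>x. p0 (x /\<^sub>R \<epsilon>) * I x)"
  proof (rule integrableI_nonneg)
    show "(\<integral>\<^sup>+x. ennreal (p0 (x /\<^sub>R \<epsilon>) * I x) \<partial>lborel) < \<infinity>"
      unfolding eqn using D D0 by (simp add: nn_integral_eq_integral)
  qed (use I0 in auto)
  have eq: "(LINT x|lborel. p0 (x /\<^sub>R \<epsilon>) * I x) = (LINT x|lborel. D x)"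
    using eqn I0 D0 pI D by (simp add: nn_integral_eq_integral integral_nonneg_AE)
  have "(LINT x|lborel. p0 (x /\<^sub>R \<epsilon>) * (f x * Lop \<epsilon> f x)) \<le> (LINT x|lborel. (1 / (2 * \<epsilon>\<^sup>2)) * (p0 (x /\<^sub>R \<epsilon>) * I x - D x))"
  proof (rule integral_mono_AE[OF True])
    show "integrable lborel (\<lambda>x. (1 / (2 * \<epsilon>\<^sup>2)) * (p0 (x /\<^sub>R \<epsilon>) * I x - D x))"
      by (intro integrable_mult_right Bochner_Integration.integrable_diff pI D)
    show "AE x in lborel. p0 (x /\<^sub>R \<epsilon>) * (f x * Lop \<epsilon> f x) \<le> (1 / (2 * \<epsilon>\<^sup>2)) * (p0 (x /\<^sub>R \<epsilon>) * I x - D x)"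
      using AE_K_square_integrable[OF f \<epsilon>]
    proof eventually_elim
      case (elim x)
      let ?K = "K (x /\<^sub>R \<epsilon>)"
      have i1: "integrable lborel (\<lambda>z. ?K z * (f (x - \<epsilon> *\<^sub>R z) - f x))"
        using elim K_integrable[of "x /\<^sub>R \<epsilon>"] by (simp add: right_diff_distrib)
      have i2: "integrable lborel (\<lambda>z. ?K z * (f (x - \<epsilon> *\<^sub>R z))\<^sup>2 - (f x)\<^sup>2 * ?K z)"
        using elim K_integrable[of "x /\<^sub>R \<epsilon>"] by simp
      have "f x * (LINT z|lborel. ?K z * (f (x - \<epsilon> *\<^sub>R z) - f x)) = (LINT z|lborel. f x * (?K z * (f (x - \<epsilon> *\<^sub>R z) - f x)))" by simp
      also have "\<dots> \<le> (LINT z|lborel. (1 / 2) * (?K z * (f (x - \<epsilon> *\<^sub>R z))\<^sup>2 - (f x)\<^sup>2 * ?K z))"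
      proof (intro integral_mono integrable_mult_right i1 i2)
        fix z
        have "f x * (t - f x) \<le> (t\<^sup>2 - (f x)\<^sup>2) / 2" for t
          using zero_le_power2[of "t - f x"] by (simp add: power2_eq_square field_simps)
        then have "?K z * (f x * (f (x - \<epsilon> *\<^sub>R z) - f x)) \<le> ?K z * (((f (x - \<epsilon> *\<^sub>R z))\<^sup>2 - (f x)\<^sup>2) / 2)"
          by (intro mult_left_mono K_nonneg)
        then show "f x * (?K z * (f (x - \<epsilon> *\<^sub>R z) - f x)) \<le> (1 / 2) * (?K z * (f (x - \<epsilon> *\<^sub>R z))\<^sup>2 - (f x)\<^sup>2 * ?K z)"
          by (simp add: algebra_simps)
      qed
      also have "\<dots> = (1 / 2) * (I x - rate (x /\<^sub>R \<epsilon>) * (f x)\<^sup>2)"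
        unfolding I_def using elim K_integrable[of "x /\<^sub>R \<epsilon>"] K_integral[of "x /\<^sub>R \<epsilon>"] by (simp add: mult.commute)
      finally have "(p0 (x /\<^sub>R \<epsilon>) / \<epsilon>\<^sup>2) * (f x * (LINT z|lborel. ?K z * (f (x - \<epsilon> *\<^sub>R z) - f x)))
         \<le> (p0 (x /\<^sub>R \<epsilon>) / \<epsilon>\<^sup>2) * ((1 / 2) * (I x - rate (x /\<^sub>R \<epsilon>) * (f x)\<^sup>2))"
        using p0_nonneg by (intro mult_left_mono) auto
      then show ?case unfolding Lop_def D_def by (simp add: field_simps)
    qed
  qed
  also have "\<dots> = 0" using pI D eq by simp
  finally show ?thesis .
qed

subsection \<open>The two-scale expansion\<close>

text \<open>Integrability against the kernel as a predicate closed under linear combinations, so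
  that the long expressions of the expansion are handled by introduction rules.\<close>

definition KI :: "real ^ 'n \<Rightarrow> (real ^ 'n \<Rightarrow> real) \<Rightarrow> bool" where
  "KI \<xi> h \<longleftrightarrow> integrable lborel (\<lambda>z. K \<xi> z * h z)"

lemma KI_add: "KI \<xi> f \<Longrightarrow> KI \<xi> g \<Longrightarrow> KI \<xi> (\<lambda>z. f z + g z)"
  by (simp add: KI_def distrib_left)
lemma KI_diff: "KI \<xi> f \<Longrightarrow> KI \<xi> g \<Longrightarrow> KI \<xi> (\<lambda>z. f z - g z)"
  by (simp add: KI_def right_diff_distrib)
lemma KI_scale: "KI \<xi> f \<Longrightarrow> KI \<xi> (\<lambda>z. c * f z)"
  by (simp add: KI_def mult.left_commute[of _ c])
lemma KI_sum: "(\<And>i. i \<in> I \<Longrightarrow> KI \<xi> (f i)) \<Longrightarrow> KI \<xi> (\<lambda>z. \<Sum>i\<in>I. f i z)"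
  by (simp add: KI_def sum_distrib_left)
lemma KI_const: "KI \<xi> (\<lambda>z. c)"
  using K_integrable by (simp add: KI_def)

lemma KI_weight:
  assumes "h \<in> borel_measurable borel" "\<And>z. \<bar>h z\<bar> \<le> C * (1 + (norm z)\<^sup>2)" shows "KI \<xi> h"
  unfolding KI_def using assms by (rule moment_integrable(1))

lemma KI_bounded:
  assumes h: "h \<in> borel_measurable borel" "\<And>z. \<bar>h z\<bar> \<le> C" shows "KI \<xi> h"
proof (rule KI_weight[OF h(1)])
  fix z :: "real ^ 'n"
  have "C * 1 \<le> C * (1 + (norm z)\<^sup>2)" using h(2)[of z] by (intro mult_left_mono) auto
  then show "\<bar>h z\<bar> \<le> C * (1 + (norm z)\<^sup>2)" using h(2)[of z] by simp
qed

lemma KI_component: "KI \<xi> (\<lambda>z. z $ i)"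
  by (rule KI_weight[where C=1]) (simp_all add: component_weight)

lemma KI_components: "KI \<xi> (\<lambda>z. z $ i * z $ j)"
proof (rule KI_weight[where C=1])
  show "\<bar>z $ i * z $ j\<bar> \<le> 1 * (1 + (norm z)\<^sup>2)" for z :: "real ^ 'n" using component_weight(2)[of z i j] by simp
qed measurable

lemma KI_component_bounded:
  assumes [measurable]: "h \<in> borel_measurable borel" and h: "\<And>z. \<bar>h z\<bar> \<le> C" shows "KI \<xi> (\<lambda>z. z $ j * h z)"
proof (rule KI_weight[where C=C])
  fix z :: "real ^ 'n"
  show "\<bar>z $ j * h z\<bar> \<le> C * (1 + (norm z)\<^sup>2)"
    using mult_mono[OF component_weight(1)[of z j] h[of z]] h[of z] by (simp add: abs_mult mult.commute)
qed measurable

abbreviation "D1 \<rho> i \<equiv> partial_deriv i \<rho>"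
abbreviation "D2 \<rho> i j \<equiv> partial_deriv j (partial_deriv i \<rho>)"

definition heat :: "(real ^ 'n \<Rightarrow> real) \<Rightarrow> real ^ 'n \<Rightarrow> real" where
  "heat \<psi> s = (\<Sum>i\<in>UNIV. \<Sum>j\<in>UNIV. Theta $ i $ j * D2 \<psi> i j s)"

text \<open>Here \<open>f\<close> stands for the limit solution at time \<open>t\<close>, which is merely square integrable, \<open>\<rho>\<close> for a
  mollifier, which supplies the derivatives of the expansion, and \<open>\<tau>\<close> for the displacement
  \<open>(t / \<epsilon>) *\<^sub>R drift\<close> of the moving frame.\<close>

definition ansatz :: "(real ^ 'n \<Rightarrow> real) \<Rightarrow> real \<Rightarrow> (real ^ 'n \<Rightarrow> real) \<Rightarrow> real ^ 'n \<Rightarrow> real ^ 'n \<Rightarrow> real" where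
  "ansatz \<rho> \<epsilon> f \<tau> x = conv f \<rho> (x - \<tau>)
     + (\<Sum>i\<in>UNIV. \<epsilon> * corr i (x /\<^sub>R \<epsilon>) * conv f (D1 \<rho> i) (x - \<tau>))
     + (\<Sum>i\<in>UNIV. \<Sum>j\<in>UNIV. \<epsilon>\<^sup>2 * corr2 i j (x /\<^sub>R \<epsilon>) * conv f (D2 \<rho> i j) (x - \<tau>))"

text \<open>The time derivative of \<open>conv (u t) \<psi> (x - \<tau>)\<close> along the limit
  equation: diffusion acts through \<psi>, and the frame moves with velocity drift /
  \<epsilon>.\<close>

definition flow :: "(real ^ 'n \<Rightarrow> real) \<Rightarrow> real \<Rightarrow> (real ^ 'n \<Rightarrow> real) \<Rightarrow> real ^ 'n \<Rightarrow> real ^ 'n \<Rightarrow> real" where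
  "flow \<psi> \<epsilon> f \<tau> x = conv f (heat \<psi>) (x - \<tau>) - (\<Sum>k\<in>UNIV. drift $ k / \<epsilon> * conv f (D1 \<psi> k) (x - \<tau>))"

definition ansatz_dt :: "(real ^ 'n \<Rightarrow> real) \<Rightarrow> real \<Rightarrow> (real ^ 'n \<Rightarrow> real) \<Rightarrow> real ^ 'n \<Rightarrow> real ^ 'n \<Rightarrow> real" where
  "ansatz_dt \<rho> \<epsilon> f \<tau> x = flow \<rho> \<epsilon> f \<tau> x
     + (\<Sum>i\<in>UNIV. \<epsilon> * corr i (x /\<^sub>R \<epsilon>) * flow (D1 \<rho> i) \<epsilon> f \<tau> x)
     + (\<Sum>i\<in>UNIV. \<Sum>j\<in>UNIV. \<epsilon>\<^sup>2 * corr2 i j (x /\<^sub>R \<epsilon>) * flow (D2 \<rho> i j) \<epsilon> f \<tau> x)"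

text \<open>\<open>res3\<close>, \<open>res2\<close> and \<open>res1\<close> are the Taylor
  remainders of the leading term, of the terms with the first corrector and of those with the second
  corrector. Each successive corrector carries one more derivative of \<rho> and one more factor
  \<epsilon>, hence a remainder of one order less.\<close>

definition res3 where "res3 \<rho> \<epsilon> f \<tau> x = (LINT z|lborel. K (x /\<^sub>R \<epsilon>) z * conv f (taylor3 \<rho> (\<epsilon> *\<^sub>R z)) (x - \<tau>))"
definition res2 where "res2 \<rho> \<epsilon> f \<tau> i x = (LINT z|lborel. K (x /\<^sub>R \<epsilon>) z * (corr i (x /\<^sub>R \<epsilon> - z) * conv f (taylor2 (D1 \<rho> i) (\<epsilon> *\<^sub>R z)) (x - \<tau>)))"
definition res1 where "res1 \<rho> \<epsilon> f \<tau> i j x = (LINT z|lborel. K (x /\<^sub>R \<epsilon>) z * (corr2 i j (x /\<^sub>R \<epsilon> - z) * conv f (taylor1 (D2 \<rho> i j) (\<epsilon> *\<^sub>R z)) (x - \<tau>)))"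

definition residual :: "(real ^ 'n \<Rightarrow> real) \<Rightarrow> real \<Rightarrow> (real ^ 'n \<Rightarrow> real) \<Rightarrow> real ^ 'n \<Rightarrow> real ^ 'n \<Rightarrow> real" where
  "residual \<rho> \<epsilon> f \<tau> x = (1 / \<epsilon>\<^sup>2) * res3 \<rho> \<epsilon> f \<tau> x + (\<Sum>i\<in>UNIV. (1 / \<epsilon>) * res2 \<rho> \<epsilon> f \<tau> i x)
     + (\<Sum>i\<in>UNIV. \<Sum>j\<in>UNIV. res1 \<rho> \<epsilon> f \<tau> i j x)
     - (\<Sum>i\<in>UNIV. \<epsilon> * corr i (x /\<^sub>R \<epsilon>) * conv f (heat (D1 \<rho> i)) (x - \<tau>))
     - (\<Sum>i\<in>UNIV. \<Sum>j\<in>UNIV. \<epsilon>\<^sup>2 * corr2 i j (x /\<^sub>R \<epsilon>) * flow (D2 \<rho> i j) \<epsilon> f \<tau> x)"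

lemma conv_heat:
  assumes "test_function \<psi>" "f \<in> bL2"
  shows "conv f (heat \<psi>) x = (\<Sum>i\<in>UNIV. \<Sum>j\<in>UNIV. Theta $ i $ j * conv f (D2 \<psi> i j) x)"
proof -
  have b: "D2 \<psi> i j \<in> bL2" for i j using assms(1) by (intro test_function_bL2 test_function_partial)
  show ?thesis unfolding heat_def[abs_def]
    by (simp add: conv_sum_right[OF assms(2)] bL2_sum bL2_scale b conv_scale_right)
qed

lemma conv_taylor:
  fixes f \<psi> :: "real ^ 'n \<Rightarrow> real"
  assumes \<psi>: "test_function \<psi>" and f: "f \<in> bL2"
  shows "conv f (taylor1 \<psi> h) y = conv f \<psi> (y - h) - conv f \<psi> y"
    "conv f (taylor2 \<psi> h) y = conv f \<psi> (y - h) - conv f \<psi> y + (\<Sum>i\<in>UNIV. h $ i * conv f (D1 \<psi> i) y)"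
    "conv f (taylor3 \<psi> h) y = conv f \<psi> (y - h) - conv f \<psi> y + (\<Sum>i\<in>UNIV. h $ i * conv f (D1 \<psi> i) y)
       - (\<Sum>i\<in>UNIV. h $ i * (\<Sum>j\<in>UNIV. h $ j * conv f (D2 \<psi> i j) y)) / 2"
proof -
  have b0: "(\<lambda>s. \<psi> (s - h)) \<in> bL2" by (rule test_function_bL2[OF shifted_test[OF \<psi>]])
  have b: "\<psi> \<in> bL2" "\<And>i. D1 \<psi> i \<in> bL2" "\<And>i j. D2 \<psi> i j \<in> bL2"
    using \<psi> by (auto intro!: test_function_bL2 test_function_partial)
  have 1: "(\<lambda>s. \<psi> (s - h) - \<psi> s) \<in> bL2" by (intro bL2_diff b0 b)
  have s1: "(\<lambda>s. \<Sum>i\<in>UNIV. h $ i * D1 \<psi> i s) \<in> bL2" by (intro bL2_sum bL2_scale b)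
  have 2: "(\<lambda>s. \<psi> (s - h) - \<psi> s + (\<Sum>i\<in>UNIV. h $ i * D1 \<psi> i s)) \<in> bL2" by (rule bL2_add[OF 1 s1])
  have s2: "(\<lambda>s. \<Sum>i\<in>UNIV. h $ i * (\<Sum>j\<in>UNIV. h $ j * D2 \<psi> i j s)) \<in> bL2" by (intro bL2_sum bL2_scale b)
  have s3: "(\<lambda>s. (1 / 2) * (\<Sum>i\<in>UNIV. h $ i * (\<Sum>j\<in>UNIV. h $ j * D2 \<psi> i j s))) \<in> bL2" by (rule bL2_scale[OF s2])
  have c1: "conv f (\<lambda>s. \<psi> (s - h) - \<psi> s) y = conv f \<psi> (y - h) - conv f \<psi> y"
    by (simp add: conv_diff_right f b0 b conv_shift)
  have cs1: "conv f (\<lambda>s. \<Sum>i\<in>UNIV. h $ i * D1 \<psi> i s) y = (\<Sum>i\<in>UNIV. h $ i * conv f (D1 \<psi> i) y)"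
    by (simp add: conv_sum_right f bL2_scale b conv_scale_right)
  have cs2: "conv f (\<lambda>s. \<Sum>i\<in>UNIV. h $ i * (\<Sum>j\<in>UNIV. h $ j * D2 \<psi> i j s)) y = (\<Sum>i\<in>UNIV. h $ i * (\<Sum>j\<in>UNIV. h $ j * conv f (D2 \<psi> i j) y))"
    by (simp add: conv_sum_right f bL2_scale bL2_sum b conv_scale_right)
  show "conv f (taylor1 \<psi> h) y = conv f \<psi> (y - h) - conv f \<psi> y" unfolding taylor1_def[abs_def] by (rule c1)
  have c2: "conv f (\<lambda>s. \<psi> (s - h) - \<psi> s + (\<Sum>i\<in>UNIV. h $ i * D1 \<psi> i s)) y = conv f \<psi> (y - h) - conv f \<psi> y + (\<Sum>i\<in>UNIV. h $ i * conv f (D1 \<psi> i) y)"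
    unfolding conv_add_right[OF f 1 s1] c1 cs1 ..
  then show "conv f (taylor2 \<psi> h) y = conv f \<psi> (y - h) - conv f \<psi> y + (\<Sum>i\<in>UNIV. h $ i * conv f (D1 \<psi> i) y)"
    unfolding taylor2_def[abs_def] .
  have "taylor3 \<psi> h = (\<lambda>s. (\<psi> (s - h) - \<psi> s + (\<Sum>i\<in>UNIV. h $ i * D1 \<psi> i s)) - (1 / 2) * (\<Sum>i\<in>UNIV. h $ i * (\<Sum>j\<in>UNIV. h $ j * D2 \<psi> i j s)))"
    by (simp add: taylor3_def fun_eq_iff)
  then have "conv f (taylor3 \<psi> h) y = conv f (\<lambda>s. \<psi> (s - h) - \<psi> s + (\<Sum>i\<in>UNIV. h $ i * D1 \<psi> i s)) y - conv f (\<lambda>s. (1 / 2) * (\<Sum>i\<in>UNIV. h $ i * (\<Sum>j\<in>UNIV. h $ j * D2 \<psi> i j s))) y"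
    by (simp only: conv_diff_right[OF f 2 s3])
  then show "conv f (taylor3 \<psi> h) y = conv f \<psi> (y - h) - conv f \<psi> y + (\<Sum>i\<in>UNIV. h $ i * conv f (D1 \<psi> i) y)
       - (\<Sum>i\<in>UNIV. h $ i * (\<Sum>j\<in>UNIV. h $ j * conv f (D2 \<psi> i j) y)) / 2"
    unfolding c2 conv_scale_right cs2 by simp
qed

text \<open>The algebra behind the choice of the cell problems, stated for numbers: unprimed quantities are
  taken at \<open>x\<close>, primed ones at \<open>x - \<epsilon> *\<^sub>R z\<close>.\<close>

lemma expansion_algebra:
  fixes A0 A0' :: real and A1 A1' X X' :: "'n \<Rightarrow> real" and A2 A2' Y Y' :: "'n \<Rightarrow> 'n \<Rightarrow> real" and z :: "'n \<Rightarrow> real"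
  shows "(A0' + (\<Sum>i\<in>UNIV. \<epsilon> * X' i * A1' i) + (\<Sum>i\<in>UNIV. \<Sum>j\<in>UNIV. \<epsilon>\<^sup>2 * Y' i j * A2' i j))
     - (A0 + (\<Sum>i\<in>UNIV. \<epsilon> * X i * A1 i) + (\<Sum>i\<in>UNIV. \<Sum>j\<in>UNIV. \<epsilon>\<^sup>2 * Y i j * A2 i j))
   = (A0' - A0 + (\<Sum>i\<in>UNIV. \<epsilon> * z i * A1 i) - (\<Sum>i\<in>UNIV. \<epsilon> * z i * (\<Sum>j\<in>UNIV. \<epsilon> * z j * A2 i j)) / 2)
     + (\<Sum>i\<in>UNIV. \<epsilon> * (X' i * (A1' i - A1 i + (\<Sum>j\<in>UNIV. \<epsilon> * z j * A2 i j))))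
     + (\<Sum>i\<in>UNIV. \<Sum>j\<in>UNIV. \<epsilon>\<^sup>2 * (Y' i j * (A2' i j - A2 i j)))
     + (\<Sum>i\<in>UNIV. \<epsilon> * A1 i * ((X' i - X i) - z i))
     + (\<Sum>i\<in>UNIV. \<Sum>j\<in>UNIV. \<epsilon>\<^sup>2 * A2 i j * ((z i * z j / 2 - z j * X' i) + (Y' i j - Y i j)))"
proof -
  have 1: "(\<Sum>i\<in>UNIV. \<epsilon> * (X' i * (A1' i - A1 i + (\<Sum>j\<in>UNIV. \<epsilon> * z j * A2 i j))))
    = (\<Sum>i\<in>UNIV. \<epsilon> * X' i * A1' i) - (\<Sum>i\<in>UNIV. \<epsilon> * X' i * A1 i) + (\<Sum>i\<in>UNIV. \<Sum>j\<in>UNIV. \<epsilon>\<^sup>2 * A2 i j * (z j * X' i))"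
    by (simp add: distrib_left right_diff_distrib sum.distrib sum_subtractf sum_distrib_left power2_eq_square mult_ac)
  have 2: "(\<Sum>i\<in>UNIV. \<Sum>j\<in>UNIV. \<epsilon>\<^sup>2 * (Y' i j * (A2' i j - A2 i j)))
    = (\<Sum>i\<in>UNIV. \<Sum>j\<in>UNIV. \<epsilon>\<^sup>2 * Y' i j * A2' i j) - (\<Sum>i\<in>UNIV. \<Sum>j\<in>UNIV. \<epsilon>\<^sup>2 * Y' i j * A2 i j)"
    by (simp add: right_diff_distrib sum_subtractf mult_ac)
  have 3: "(\<Sum>i\<in>UNIV. \<epsilon> * A1 i * ((X' i - X i) - z i)) = (\<Sum>i\<in>UNIV. \<epsilon> * X' i * A1 i) - (\<Sum>i\<in>UNIV. \<epsilon> * X i * A1 i) - (\<Sum>i\<in>UNIV. \<epsilon> * z i * A1 i)"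
    by (simp add: right_diff_distrib sum_subtractf mult_ac)
  have 4: "(\<Sum>i\<in>UNIV. \<Sum>j\<in>UNIV. \<epsilon>\<^sup>2 * A2 i j * ((z i * z j / 2 - z j * X' i) + (Y' i j - Y i j)))
    = (\<Sum>i\<in>UNIV. \<Sum>j\<in>UNIV. \<epsilon>\<^sup>2 * A2 i j * (z i * z j)) / 2 - (\<Sum>i\<in>UNIV. \<Sum>j\<in>UNIV. \<epsilon>\<^sup>2 * A2 i j * (z j * X' i))
      + (\<Sum>i\<in>UNIV. \<Sum>j\<in>UNIV. \<epsilon>\<^sup>2 * Y' i j * A2 i j) - (\<Sum>i\<in>UNIV. \<Sum>j\<in>UNIV. \<epsilon>\<^sup>2 * Y i j * A2 i j)"
    by (simp add: distrib_left right_diff_distrib sum.distrib sum_subtractf sum_divide_distrib mult_ac)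
  have 5: "(\<Sum>i\<in>UNIV. \<epsilon> * z i * (\<Sum>j\<in>UNIV. \<epsilon> * z j * A2 i j)) = (\<Sum>i\<in>UNIV. \<Sum>j\<in>UNIV. \<epsilon>\<^sup>2 * A2 i j * (z i * z j))"
    by (simp add: sum_distrib_left power2_eq_square mult_ac)
  show ?thesis unfolding 1 2 3 4 5 by simp
qed

text \<open>Cancellation by orders of \<epsilon>: the term -b left by the first corrector meets the
  transport of the leading term at order 1/\<epsilon>; at order 1, \<Theta> meets the diffusion and
  \<open>b j * X i\<close> the transport of the first corrector. The time derivative of the second
  corrector terms is not compensated and stays, as F.\<close>

lemma collect_algebra:
  fixes R3 :: real and R2 X H A1 b :: "'n \<Rightarrow> real" and R1 A2 \<Theta> Y F :: "'n \<Rightarrow> 'n \<Rightarrow> real"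
  assumes \<epsilon>: "\<epsilon> > 0"
  shows "(1 / \<epsilon>\<^sup>2) * (R3 + (\<Sum>i\<in>UNIV. \<epsilon> * R2 i) + (\<Sum>i\<in>UNIV. \<Sum>j\<in>UNIV. \<epsilon>\<^sup>2 * R1 i j)
      + (\<Sum>i\<in>UNIV. \<epsilon> * A1 i * (- b i)) + (\<Sum>i\<in>UNIV. \<Sum>j\<in>UNIV. \<epsilon>\<^sup>2 * A2 i j * (\<Theta> i j - b j * X i)))
    - (((\<Sum>i\<in>UNIV. \<Sum>j\<in>UNIV. \<Theta> i j * A2 i j) - (\<Sum>k\<in>UNIV. b k / \<epsilon> * A1 k))
      + (\<Sum>i\<in>UNIV. \<epsilon> * X i * (H i - (\<Sum>k\<in>UNIV. b k / \<epsilon> * A2 i k))) + (\<Sum>i\<in>UNIV. \<Sum>j\<in>UNIV. \<epsilon>\<^sup>2 * Y i j * F i j))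
   = (1 / \<epsilon>\<^sup>2) * R3 + (\<Sum>i\<in>UNIV. (1 / \<epsilon>) * R2 i) + (\<Sum>i\<in>UNIV. \<Sum>j\<in>UNIV. R1 i j)
      - (\<Sum>i\<in>UNIV. \<epsilon> * X i * H i) - (\<Sum>i\<in>UNIV. \<Sum>j\<in>UNIV. \<epsilon>\<^sup>2 * Y i j * F i j)"
proof -
  have c: "1 / \<epsilon>\<^sup>2 * (\<epsilon> * t) = 1 / \<epsilon> * t" "1 / \<epsilon>\<^sup>2 * (\<epsilon>\<^sup>2 * t) = t" "\<epsilon> * s * (t / \<epsilon> * r) = t * s * r" for t s r
    using \<epsilon> by (simp_all add: power2_eq_square field_simps)
  have 1: "(1 / \<epsilon>\<^sup>2) * (\<Sum>i\<in>UNIV. \<epsilon> * R2 i) = (\<Sum>i\<in>UNIV. (1 / \<epsilon>) * R2 i)"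
    by (simp only: sum_distrib_left c)
  have 2: "(1 / \<epsilon>\<^sup>2) * (\<Sum>i\<in>UNIV. \<Sum>j\<in>UNIV. \<epsilon>\<^sup>2 * R1 i j) = (\<Sum>i\<in>UNIV. \<Sum>j\<in>UNIV. R1 i j)"
    by (simp only: sum_distrib_left c)
  have 3: "(1 / \<epsilon>\<^sup>2) * (\<Sum>i\<in>UNIV. \<epsilon> * A1 i * (- b i)) = - (\<Sum>k\<in>UNIV. b k / \<epsilon> * A1 k)"
    by (simp only: sum_distrib_left mult.assoc c) (simp add: sum_negf mult.commute)
  have 4: "(1 / \<epsilon>\<^sup>2) * (\<Sum>i\<in>UNIV. \<Sum>j\<in>UNIV. \<epsilon>\<^sup>2 * A2 i j * (\<Theta> i j - b j * X i))
     = (\<Sum>i\<in>UNIV. \<Sum>j\<in>UNIV. \<Theta> i j * A2 i j) - (\<Sum>i\<in>UNIV. \<Sum>j\<in>UNIV. b j * X i * A2 i j)"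
    by (simp only: sum_distrib_left mult.assoc c) (simp add: right_diff_distrib sum_subtractf mult_ac)
  have 5: "(\<Sum>i\<in>UNIV. \<epsilon> * X i * (H i - (\<Sum>k\<in>UNIV. b k / \<epsilon> * A2 i k))) = (\<Sum>i\<in>UNIV. \<epsilon> * X i * H i) - (\<Sum>i\<in>UNIV. \<Sum>k\<in>UNIV. b k * X i * A2 i k)"
    by (simp only: right_diff_distrib sum_subtractf sum_distrib_left c)
  show ?thesis unfolding distrib_left[of "1 / \<epsilon>\<^sup>2"] 1 2 3 4 5 by simp
qed

text \<open>An identity at every x for f merely in L2: all derivatives sit on \<rho>, and every term
  of the expansion is bounded or grows at most quadratically in z, so the integral against the
  kernel may be split. The cell problems then evaluate the two parts that are not
  remainders.\<close>

lemma Lop_ansatz: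
  assumes \<rho>: "test_function \<rho>" and f: "f \<in> bL2" and \<epsilon>: "\<epsilon> > 0"
  shows "Lop \<epsilon> (ansatz \<rho> \<epsilon> f \<tau>) x - ansatz_dt \<rho> \<epsilon> f \<tau> x = residual \<rho> \<epsilon> f \<tau> x"
proof -
  define \<xi> where "\<xi> = x /\<^sub>R \<epsilon>"
  have \<xi>': "(x - \<epsilon> *\<^sub>R z) /\<^sub>R \<epsilon> = \<xi> - z" for z using \<epsilon> by (simp add: \<xi>_def scaleR_diff_right)
  have b: "\<rho> \<in> bL2" "\<And>i. D1 \<rho> i \<in> bL2" "\<And>i j. D2 \<rho> i j \<in> bL2"
    using \<rho> by (auto intro!: test_function_bL2 test_function_partial)
  have fb: "f \<in> borel_measurable borel" by (rule bL2_measurable[OF f])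
  define y where "y = x - \<tau>"
  have sh: "x - \<epsilon> *\<^sub>R z - \<tau> = y - \<epsilon> *\<^sub>R z" for z by (simp add: y_def)
  define T3 where "T3 z = conv f (taylor3 \<rho> (\<epsilon> *\<^sub>R z)) y" for z
  define T2 where "T2 i z = corr i (\<xi> - z) * conv f (taylor2 (D1 \<rho> i) (\<epsilon> *\<^sub>R z)) y" for i z
  define T1 where "T1 i j z = corr2 i j (\<xi> - z) * conv f (taylor1 (D2 \<rho> i j) (\<epsilon> *\<^sub>R z)) y" for i j z
  define A1 where "A1 i = conv f (D1 \<rho> i) y" for i
  define A2 where "A2 i j = conv f (D2 \<rho> i j) y" for i j
  \<comment> \<open>U and W collect what multiplies the first and second derivatives. Their
    integrals against the kernel are given by the two cell problems: U yields minus the drift and W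
    yields \<open>Theta\<close> minus the transport of the first corrector.\<close>
  define U where "U i z = (corr i (\<xi> - z) - corr i \<xi>) - z $ i" for i z
  define W where "W i j z = (z $ i * z $ j / 2 - z $ j * corr i (\<xi> - z)) + (corr2 i j (\<xi> - z) - corr2 i j \<xi>)" for i j z
  have t3: "T3 z = conv f \<rho> (y - \<epsilon> *\<^sub>R z) - conv f \<rho> y + (\<Sum>i\<in>UNIV. \<epsilon> * z $ i * A1 i) - (\<Sum>i\<in>UNIV. \<epsilon> * z $ i * (\<Sum>j\<in>UNIV. \<epsilon> * z $ j * A2 i j)) / 2" for z
    unfolding T3_def A1_def A2_def conv_taylor[OF \<rho> f] by simp
  have t2: "T2 i z = corr i (\<xi> - z) * (conv f (D1 \<rho> i) (y - \<epsilon> *\<^sub>R z) - A1 i + (\<Sum>j\<in>UNIV. \<epsilon> * z $ j * A2 i j))" for i z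
    unfolding T2_def A1_def A2_def conv_taylor[OF test_function_partial[OF \<rho>] f] by simp
  have t1: "T1 i j z = corr2 i j (\<xi> - z) * (conv f (D2 \<rho> i j) (y - \<epsilon> *\<^sub>R z) - A2 i j)" for i j z
    unfolding T1_def A1_def A2_def conv_taylor[OF test_function_partial[OF test_function_partial[OF \<rho>]] f] by simp
  have pt: "ansatz \<rho> \<epsilon> f \<tau> (x - \<epsilon> *\<^sub>R z) - ansatz \<rho> \<epsilon> f \<tau> x
    = T3 z + (\<Sum>i\<in>UNIV. \<epsilon> * T2 i z) + (\<Sum>i\<in>UNIV. \<Sum>j\<in>UNIV. \<epsilon>\<^sup>2 * T1 i j z)
      + (\<Sum>i\<in>UNIV. \<epsilon> * A1 i * U i z) + (\<Sum>i\<in>UNIV. \<Sum>j\<in>UNIV. \<epsilon>\<^sup>2 * A2 i j * W i j z)" for z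
    unfolding ansatz_def \<xi>' \<xi>_def[symmetric] sh y_def[symmetric] t3 t2 t1 U_def W_def A1_def A2_def
    by (rule expansion_algebra)
  have cb: "\<exists>C. \<forall>z. \<bar>conv f \<psi> (y - \<epsilon> *\<^sub>R z)\<bar> \<le> C" if "\<psi> \<in> bL2" for \<psi>
    using conv_bounded[OF f that] by blast
  have cm: "(\<lambda>z. conv f \<psi> (y - \<epsilon> *\<^sub>R z)) \<in> borel_measurable borel" if "\<psi> \<in> bL2" for \<psi>
    by (rule measurable_compose[OF _ conv_measurable[OF fb bL2_measurable[OF that]]]) measurable
  have Km: "KI \<xi> (\<lambda>z. g (\<xi> - z))" "KI \<xi> (\<lambda>z. z $ j * g (\<xi> - z))" if g: "g \<in> BP" for g j
  proof -
    obtain C where C: "C > 0" "\<And>x. \<bar>g x\<bar> \<le> C" by (rule BP_bounded[OF g]) blast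
    have gm: "(\<lambda>z. g (\<xi> - z)) \<in> borel_measurable borel" by (rule measurable_compose[OF _ BP_measurable[OF g]]) measurable
    show "KI \<xi> (\<lambda>z. g (\<xi> - z))" by (rule KI_bounded[OF gm C(2)])
    show "KI \<xi> (\<lambda>z. z $ j * g (\<xi> - z))" by (rule KI_component_bounded[OF gm C(2)])
  qed
  have Kc: "KI \<xi> (\<lambda>z. conv f \<psi> (y - \<epsilon> *\<^sub>R z))" if "\<psi> \<in> bL2" for \<psi>
    using cb[OF that] KI_bounded[OF cm[OF that]] by blast
  have Kgc: "KI \<xi> (\<lambda>z. g (\<xi> - z) * conv f \<psi> (y - \<epsilon> *\<^sub>R z))" if g: "g \<in> BP" and psi: "\<psi> \<in> bL2" for g \<psi>
  proof -
    obtain C where C: "C > 0" "\<And>x. \<bar>g x\<bar> \<le> C" by (rule BP_bounded[OF g]) blast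
    have gm: "(\<lambda>z. g (\<xi> - z)) \<in> borel_measurable borel" by (rule measurable_compose[OF _ BP_measurable[OF g]]) measurable
    obtain D where D: "\<And>z. \<bar>conv f \<psi> (y - \<epsilon> *\<^sub>R z)\<bar> \<le> D" using cb[OF psi] by blast
    show ?thesis
    proof (rule KI_bounded[OF borel_measurable_times[OF gm cm[OF psi]]])
      show "\<bar>g (\<xi> - z) * conv f \<psi> (y - \<epsilon> *\<^sub>R z)\<bar> \<le> C * D" for z
        unfolding abs_mult using C D by (intro mult_mono) auto
    qed
  qed
  \<comment> \<open>Integrability is read off the expanded form, whose summands are bounded, linear
    or quadratic in z.\<close>
  have kT3: "KI \<xi> T3"
  proof -
    have "KI \<xi> (\<lambda>z. conv f \<rho> (y - \<epsilon> *\<^sub>R z) - conv f \<rho> y + (\<Sum>i\<in>UNIV. (\<epsilon> * A1 i) * z $ i) - (1 / 2) * (\<Sum>i\<in>UNIV. \<Sum>j\<in>UNIV. (\<epsilon> * \<epsilon> * A2 i j) * (z $ i * z $ j)))"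
      by (intro KI_diff KI_add KI_scale KI_sum Kc b KI_const KI_component KI_components)
    moreover have "T3 = (\<lambda>z. conv f \<rho> (y - \<epsilon> *\<^sub>R z) - conv f \<rho> y + (\<Sum>i\<in>UNIV. (\<epsilon> * A1 i) * z $ i) - (1 / 2) * (\<Sum>i\<in>UNIV. \<Sum>j\<in>UNIV. (\<epsilon> * \<epsilon> * A2 i j) * (z $ i * z $ j)))"
      by (auto simp: t3 fun_eq_iff sum_distrib_left mult_ac)
    ultimately show ?thesis by (simp only:)
  qed
  have kT2: "KI \<xi> (T2 i)" for i
  proof -
    have "KI \<xi> (\<lambda>z. corr i (\<xi> - z) * conv f (D1 \<rho> i) (y - \<epsilon> *\<^sub>R z) - A1 i * corr i (\<xi> - z) + (\<Sum>j\<in>UNIV. (\<epsilon> * A2 i j) * (z $ j * corr i (\<xi> - z))))"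
      by (intro KI_diff KI_add KI_scale KI_sum Kgc b Km corr(1))
    moreover have "T2 i = (\<lambda>z. corr i (\<xi> - z) * conv f (D1 \<rho> i) (y - \<epsilon> *\<^sub>R z) - A1 i * corr i (\<xi> - z) + (\<Sum>j\<in>UNIV. (\<epsilon> * A2 i j) * (z $ j * corr i (\<xi> - z))))"
      by (simp add: t2 fun_eq_iff sum_distrib_left distrib_left right_diff_distrib mult_ac)
    ultimately show ?thesis by (simp only:)
  qed
  have kT1: "KI \<xi> (T1 i j)" for i j
  proof -
    have "KI \<xi> (\<lambda>z. corr2 i j (\<xi> - z) * conv f (D2 \<rho> i j) (y - \<epsilon> *\<^sub>R z) - A2 i j * corr2 i j (\<xi> - z))"
      by (intro KI_diff KI_scale Kgc b Km corr2(1))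
    moreover have "T1 i j = (\<lambda>z. corr2 i j (\<xi> - z) * conv f (D2 \<rho> i j) (y - \<epsilon> *\<^sub>R z) - A2 i j * corr2 i j (\<xi> - z))"
      by (simp add: t1 fun_eq_iff right_diff_distrib mult_ac)
    ultimately show ?thesis by (simp only:)
  qed
  have kX: "KI \<xi> (\<lambda>z. corr i (\<xi> - z) - corr i \<xi>)" for i by (intro KI_diff Km corr(1) KI_const)
  have kY: "KI \<xi> (\<lambda>z. corr2 i j (\<xi> - z) - corr2 i j \<xi>)" for i j by (intro KI_diff Km corr2(1) KI_const)
  have kZ: "KI \<xi> (\<lambda>z. z $ i * z $ j / 2 - z $ j * corr i (\<xi> - z))" for i j
    using KI_diff[OF KI_scale[OF KI_components, of \<xi> "1 / 2" i j] Km(2)[OF corr(1)], of j i] by simp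
  have kU: "KI \<xi> (U i)" for i unfolding U_def[abs_def] by (intro KI_diff kX KI_component)
  have kW: "KI \<xi> (W i j)" for i j unfolding W_def[abs_def] by (intro KI_add kY kZ)
  have iU: "(LINT z|lborel. K \<xi> z * U i z) = - drift $ i" for i
  proof -
    have "(LINT z|lborel. K \<xi> z * U i z) = gen (corr i) \<xi> - first_moment i \<xi>"
      unfolding U_def gen_def first_moment_def using kX[of i] KI_component[of \<xi> i]
      by (simp add: KI_def right_diff_distrib[of "K \<xi> _" "_ - _"])
    then show ?thesis by (simp add: corr(2))
  qed
  have iW: "(LINT z|lborel. K \<xi> z * W i j z) = Theta $ i $ j - drift $ j * corr i \<xi>" for i j
  proof -
    have "(LINT z|lborel. K \<xi> z * W i j z) = (second_moment i j \<xi> - drift $ j * corr i \<xi>) + gen (corr2 i j) \<xi>"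
      unfolding W_def gen_def second_moment_def using kY[of i j] kZ[of i j] by (simp add: KI_def distrib_left)
    then show ?thesis by (simp add: corr2(2))
  qed
  have "(LINT z|lborel. K \<xi> z * (ansatz \<rho> \<epsilon> f \<tau> (x - \<epsilon> *\<^sub>R z) - ansatz \<rho> \<epsilon> f \<tau> x))
    = (LINT z|lborel. K \<xi> z * T3 z + (\<Sum>i\<in>UNIV. \<epsilon> * (K \<xi> z * T2 i z)) + (\<Sum>i\<in>UNIV. \<Sum>j\<in>UNIV. \<epsilon>\<^sup>2 * (K \<xi> z * T1 i j z))
      + (\<Sum>i\<in>UNIV. \<epsilon> * A1 i * (K \<xi> z * U i z)) + (\<Sum>i\<in>UNIV. \<Sum>j\<in>UNIV. \<epsilon>\<^sup>2 * A2 i j * (K \<xi> z * W i j z)))"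
    unfolding pt by (intro Bochner_Integration.integral_cong[OF refl]) (simp add: distrib_left sum_distrib_left mult_ac)
  also have "\<dots> = (LINT z|lborel. K \<xi> z * T3 z) + (\<Sum>i\<in>UNIV. \<epsilon> * (LINT z|lborel. K \<xi> z * T2 i z)) + (\<Sum>i\<in>UNIV. \<Sum>j\<in>UNIV. \<epsilon>\<^sup>2 * (LINT z|lborel. K \<xi> z * T1 i j z))
      + (\<Sum>i\<in>UNIV. \<epsilon> * A1 i * (LINT z|lborel. K \<xi> z * U i z)) + (\<Sum>i\<in>UNIV. \<Sum>j\<in>UNIV. \<epsilon>\<^sup>2 * A2 i j * (LINT z|lborel. K \<xi> z * W i j z))"
    using kT3 kT2 kT1 kU kW unfolding KI_def by simp
  also have "(LINT z|lborel. K \<xi> z * T3 z) = res3 \<rho> \<epsilon> f \<tau> x" by (simp add: res3_def T3_def \<xi>_def y_def)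
  finally have main: "(LINT z|lborel. K \<xi> z * (ansatz \<rho> \<epsilon> f \<tau> (x - \<epsilon> *\<^sub>R z) - ansatz \<rho> \<epsilon> f \<tau> x))
    = res3 \<rho> \<epsilon> f \<tau> x + (\<Sum>i\<in>UNIV. \<epsilon> * (LINT z|lborel. K \<xi> z * T2 i z)) + (\<Sum>i\<in>UNIV. \<Sum>j\<in>UNIV. \<epsilon>\<^sup>2 * (LINT z|lborel. K \<xi> z * T1 i j z))
      + (\<Sum>i\<in>UNIV. \<epsilon> * A1 i * (- drift $ i)) + (\<Sum>i\<in>UNIV. \<Sum>j\<in>UNIV. \<epsilon>\<^sup>2 * A2 i j * (Theta $ i $ j - drift $ j * corr i \<xi>))"
    unfolding iU iW .
  have r2: "(LINT z|lborel. K \<xi> z * T2 i z) = res2 \<rho> \<epsilon> f \<tau> i x" for i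
    by (simp add: res2_def T2_def \<xi>_def y_def)
  have r1: "(LINT z|lborel. K \<xi> z * T1 i j z) = res1 \<rho> \<epsilon> f \<tau> i j x" for i j
    by (simp add: res1_def T1_def \<xi>_def y_def)
  have "ansatz_dt \<rho> \<epsilon> f \<tau> x = ((\<Sum>i\<in>UNIV. \<Sum>j\<in>UNIV. Theta $ i $ j * A2 i j) - (\<Sum>k\<in>UNIV. drift $ k / \<epsilon> * A1 k))
      + (\<Sum>i\<in>UNIV. \<epsilon> * corr i \<xi> * (conv f (heat (D1 \<rho> i)) y - (\<Sum>k\<in>UNIV. drift $ k / \<epsilon> * A2 i k)))
      + (\<Sum>i\<in>UNIV. \<Sum>j\<in>UNIV. \<epsilon>\<^sup>2 * corr2 i j \<xi> * flow (D2 \<rho> i j) \<epsilon> f \<tau> x)"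
    unfolding ansatz_dt_def \<xi>_def[symmetric]
    by (simp add: flow_def[of \<rho>] flow_def[of "D1 \<rho> _"] conv_heat[OF \<rho> f] A1_def A2_def y_def)
  then show ?thesis
    unfolding Lop_def \<xi>_def[symmetric] main r2 r1 residual_def
    by (simp only: collect_algebra[OF \<epsilon>] y_def)
qed

end

subsection \<open>Smallness of the residual\<close>

text \<open>The bound is uniform in the last parameter \<tau>, because the displacement (t /
  \<epsilon>) times the drift is in general unbounded as \<epsilon> tends to 0. The function R
  carries no sign.\<close>

definition op_bound :: "(real \<Rightarrow> real) \<Rightarrow> (real \<Rightarrow> ('a::euclidean_space \<Rightarrow> real) \<Rightarrow> 'b \<Rightarrow> 'a \<Rightarrow> real) \<Rightarrow> bool" where
  "op_bound R G \<longleftrightarrow> (\<forall>\<epsilon>>0. \<forall>f\<in>bL2. \<forall>\<tau>. G \<epsilon> f \<tau> \<in> bL2 \<and> nL2 (G \<epsilon> f \<tau>) \<le> R \<epsilon> * nL2 f)"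

definition vanishing :: "(real \<Rightarrow> ('a::euclidean_space \<Rightarrow> real) \<Rightarrow> 'b \<Rightarrow> 'a \<Rightarrow> real) \<Rightarrow> bool" where
  "vanishing G \<longleftrightarrow> (\<exists>R. (R \<longlongrightarrow> 0) (at_right 0) \<and> op_bound R G)"

lemma op_boundD:
  assumes "op_bound R G" "\<epsilon> > 0" "f \<in> bL2" shows "G \<epsilon> f \<tau> \<in> bL2" "nL2 (G \<epsilon> f \<tau>) \<le> R \<epsilon> * nL2 f"
  using assms by (auto simp: op_bound_def)

lemma op_bound_add:
  fixes G H :: "real \<Rightarrow> ('a::euclidean_space \<Rightarrow> real) \<Rightarrow> 'b \<Rightarrow> 'a \<Rightarrow> real"
  assumes "op_bound R G" "op_bound S H" shows "op_bound (\<lambda>\<epsilon>. R \<epsilon> + S \<epsilon>) (\<lambda>\<epsilon> f \<tau> x. G \<epsilon> f \<tau> x + H \<epsilon> f \<tau> x)"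
  unfolding op_bound_def
proof (intro allI impI ballI conjI)
  fix \<epsilon> :: real and f :: "'a \<Rightarrow> real" and \<tau> assume *: "\<epsilon> > 0" "f \<in> bL2"
  note G = op_boundD[OF assms(1) *, of \<tau>] and H = op_boundD[OF assms(2) *, of \<tau>]
  show "(\<lambda>x. G \<epsilon> f \<tau> x + H \<epsilon> f \<tau> x) \<in> bL2" by (rule bL2_add[OF G(1) H(1)])
  show "nL2 (\<lambda>x. G \<epsilon> f \<tau> x + H \<epsilon> f \<tau> x) \<le> (R \<epsilon> + S \<epsilon>) * nL2 f"
    using nL2_triangle[OF G(1) H(1)] G(2) H(2) by (simp add: distrib_right)
qed

lemma op_bound_scale:
  fixes G :: "real \<Rightarrow> ('a::euclidean_space \<Rightarrow> real) \<Rightarrow> 'b \<Rightarrow> 'a \<Rightarrow> real"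
  assumes "op_bound R G" shows "op_bound (\<lambda>\<epsilon>. \<bar>c \<epsilon>\<bar> * R \<epsilon>) (\<lambda>\<epsilon> f \<tau> x. c \<epsilon> * G \<epsilon> f \<tau> x)"
  unfolding op_bound_def
proof (intro allI impI ballI conjI)
  fix \<epsilon> :: real and f :: "'a \<Rightarrow> real" and \<tau> assume *: "\<epsilon> > 0" "f \<in> bL2"
  note G = op_boundD[OF assms(1) *, of \<tau>]
  show "(\<lambda>x. c \<epsilon> * G \<epsilon> f \<tau> x) \<in> bL2" by (rule bL2_scale[OF G(1)])
  show "nL2 (\<lambda>x. c \<epsilon> * G \<epsilon> f \<tau> x) \<le> \<bar>c \<epsilon>\<bar> * R \<epsilon> * nL2 f"
    using mult_left_mono[OF G(2), of "\<bar>c \<epsilon>\<bar>"] by (simp add: nL2_scale mult.assoc)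
qed

lemma op_bound_zero: "op_bound (\<lambda>_. 0) (\<lambda>\<epsilon> f \<tau> x. 0)"
  by (simp add: op_bound_def bL2_zero nL2_def)

lemma op_bound_sum:
  "(\<And>i. i \<in> I \<Longrightarrow> op_bound (R i) (G i)) \<Longrightarrow> op_bound (\<lambda>\<epsilon>. \<Sum>i\<in>I. R i \<epsilon>) (\<lambda>\<epsilon> f \<tau> x. \<Sum>i\<in>I. G i \<epsilon> f \<tau> x)"
  by (induction I rule: infinite_finite_induct) (auto intro: op_bound_add op_bound_zero)

lemma vanishing_add: "vanishing G \<Longrightarrow> vanishing H \<Longrightarrow> vanishing (\<lambda>\<epsilon> f \<tau> x. G \<epsilon> f \<tau> x + H \<epsilon> f \<tau> x)"
  unfolding vanishing_def using op_bound_add tendsto_add_zero by blast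

lemma vanishing_scale:
  assumes "vanishing G" shows "vanishing (\<lambda>\<epsilon> f \<tau> x. c * G \<epsilon> f \<tau> x)"
proof -
  obtain R where R: "(R \<longlongrightarrow> 0) (at_right 0)" "op_bound R G" using assms by (auto simp: vanishing_def)
  have "((\<lambda>\<epsilon>. \<bar>c\<bar> * R \<epsilon>) \<longlongrightarrow> 0) (at_right 0)" by (rule tendsto_mult_right_zero[OF R(1)])
  then show ?thesis unfolding vanishing_def using op_bound_scale[OF R(2), of "\<lambda>_. c"] by blast
qed

lemma vanishing_diff: "vanishing G \<Longrightarrow> vanishing H \<Longrightarrow> vanishing (\<lambda>\<epsilon> f \<tau> x. G \<epsilon> f \<tau> x - H \<epsilon> f \<tau> x)"
  using vanishing_add[of G "\<lambda>\<epsilon> f \<tau> x. (-1) * H \<epsilon> f \<tau> x"] vanishing_scale[of H "-1"] by simp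

lemma vanishing_zero: "vanishing (\<lambda>\<epsilon> f \<tau> x. 0)"
  unfolding vanishing_def using op_bound_zero tendsto_const[of 0] by blast

lemma vanishing_sum: "(\<And>i. i \<in> I \<Longrightarrow> vanishing (G i)) \<Longrightarrow> vanishing (\<lambda>\<epsilon> f \<tau> x. \<Sum>i\<in>I. G i \<epsilon> f \<tau> x)"
  by (induction I rule: infinite_finite_induct) (auto intro: vanishing_add vanishing_zero)

lemma vanishing_small:
  assumes "op_bound (\<lambda>_. C) G" "(c \<longlongrightarrow> 0) (at_right 0)" shows "vanishing (\<lambda>\<epsilon> f \<tau> x. c \<epsilon> * G \<epsilon> f \<tau> x)"
proof -
  have "((\<lambda>\<epsilon>. \<bar>c \<epsilon>\<bar> * C) \<longlongrightarrow> 0) (at_right 0)" by (rule tendsto_mult_left_zero[OF tendsto_rabs_zero[OF assms(2)]])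
  then show ?thesis unfolding vanishing_def using op_bound_scale[OF assms(1), of c] by blast
qed

lemma vanishing_cong:
  assumes "vanishing G" "\<And>\<epsilon> f \<tau> x. \<epsilon> > 0 \<Longrightarrow> f \<in> bL2 \<Longrightarrow> H \<epsilon> f \<tau> x = G \<epsilon> f \<tau> x" shows "vanishing H"
proof -
  have "H \<epsilon> f \<tau> = G \<epsilon> f \<tau>" if "\<epsilon> > 0" "f \<in> bL2" for \<epsilon> f \<tau> using assms(2)[OF that] by auto
  then have "op_bound R G \<Longrightarrow> op_bound R H" for R unfolding op_bound_def by simp
  then show ?thesis using assms(1) unfolding vanishing_def by blast
qed

lemma op_bound_conv:
  fixes \<psi> :: "real ^ 'n \<Rightarrow> real"
  assumes \<psi>: "test_function \<psi>" shows "\<exists>C. op_bound (\<lambda>_. C) (\<lambda>\<epsilon> f \<tau> x. conv f \<psi> (x - \<tau>))"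
proof -
  obtain C where C: "C > 0" "(\<integral>\<^sup>+s. ennreal \<bar>\<psi> s\<bar> \<partial>lborel) \<le> ennreal C" by (rule test_function_L1[OF \<psi>]) blast
  have m: "\<psi> \<in> borel_measurable borel" by (rule test_function_borel[OF \<psi>])
  have "(\<lambda>x. conv f \<psi> (x - \<tau>)) \<in> bL2 \<and> nL2 (\<lambda>x. conv f \<psi> (x - \<tau>)) \<le> C * nL2 f" if f: "f \<in> bL2" for f and \<tau> :: "real ^ 'n"
    using conv_bL2[OF f m C(2)] C(1) bL2_shift(1,2)[of "conv f \<psi>" \<tau>] by simp
  then show ?thesis unfolding op_bound_def by blast
qed

context periodic_kernel
begin

lemma op_bound_corrector:
  fixes G :: "real \<Rightarrow> (real ^ 'n \<Rightarrow> real) \<Rightarrow> 'b \<Rightarrow> real ^ 'n \<Rightarrow> real"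
  assumes g: "g \<in> BP" and G: "\<exists>C. op_bound (\<lambda>_. C) G" shows "\<exists>C. op_bound (\<lambda>_. C) (\<lambda>\<epsilon> f \<tau> x. g (x /\<^sub>R \<epsilon>) * G \<epsilon> f \<tau> x)"
proof -
  obtain C where C: "C > 0" "\<And>x. \<bar>g x\<bar> \<le> C" by (rule BP_bounded[OF g]) blast
  have gm: "(\<lambda>x. g (x /\<^sub>R \<epsilon>)) \<in> borel_measurable borel" for \<epsilon> by (rule measurable_compose[OF _ BP_measurable[OF g]]) measurable
  obtain D where D: "op_bound (\<lambda>_. D) G" using G by blast
  have "op_bound (\<lambda>_. C * D) (\<lambda>\<epsilon> f \<tau> x. g (x /\<^sub>R \<epsilon>) * G \<epsilon> f \<tau> x)"
    unfolding op_bound_def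
  proof (intro allI impI ballI conjI)
    fix \<epsilon> :: real and f :: "real ^ 'n \<Rightarrow> real" and \<tau> assume *: "\<epsilon> > 0" "f \<in> bL2"
    note G = op_boundD[OF D *, of \<tau>]
    note b = bL2_bounded_mult[OF G(1) gm[of \<epsilon>] C(2)]
    show "(\<lambda>x. g (x /\<^sub>R \<epsilon>) * G \<epsilon> f \<tau> x) \<in> bL2" by (rule b(1))
    show "nL2 (\<lambda>x. g (x /\<^sub>R \<epsilon>) * G \<epsilon> f \<tau> x) \<le> C * D * nL2 f"
      using order_trans[OF b(2) mult_left_mono[OF G(2), of C]] C(1) by (simp add: mult.assoc)
  qed
  then show ?thesis by blast
qed

text \<open>Reduces every Taylor residual to a moment of \<open>a\<close>: the superposition bound
  with the kernel majorised by \<open>\<alpha>\<^sub>2 * a z\<close> and the corrector g by its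
  supremum leaves only the integral of \<open>a\<close> against the L1 norm of the
  remainder.\<close>

lemma op_bound_superposition:
  assumes T [measurable]: "(\<lambda>(h, s). T h s) \<in> borel_measurable (borel \<Otimes>\<^sub>M borel)"
    and N [measurable]: "N \<in> borel_measurable borel" and N0: "\<And>h. N h \<ge> 0"
    and TN: "\<And>h. (\<integral>\<^sup>+s. ennreal \<bar>T h s\<bar> \<partial>lborel) \<le> ennreal (N h)"
    and int: "\<And>\<epsilon>. \<epsilon> > 0 \<Longrightarrow> integrable lborel (\<lambda>z. a z * N (\<epsilon> *\<^sub>R z))"
    and g: "g \<in> BP" and C: "\<And>x. \<bar>g x\<bar> \<le> C" "C > 0"
  shows "op_bound (\<lambda>\<epsilon>. \<alpha>\<^sub>2 * C * (LINT z|lborel. a z * N (\<epsilon> *\<^sub>R z)))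
    (\<lambda>\<epsilon> f \<tau> x. LINT z|lborel. K (x /\<^sub>R \<epsilon>) z * (g (x /\<^sub>R \<epsilon> - z) * conv f (T (\<epsilon> *\<^sub>R z)) (x - \<tau>)))"
  unfolding op_bound_def
proof (intro allI impI ballI)
  fix \<epsilon> :: real and f :: "real ^ 'n \<Rightarrow> real" and \<tau> :: "real ^ 'n" assume \<epsilon>: "\<epsilon> > 0" and f: "f \<in> bL2"
  have [measurable]: "g \<in> borel_measurable borel" by (rule BP_measurable[OF g])
  let ?\<Psi> = "\<lambda>z s. T (\<epsilon> *\<^sub>R z) (s - \<tau>)" and ?m = "\<lambda>x z. K (x /\<^sub>R \<epsilon>) z * g (x /\<^sub>R \<epsilon> - z)" and ?w = "\<lambda>z. (\<alpha>\<^sub>2 * a z) * C"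
  let ?B = "\<alpha>\<^sub>2 * C * (LINT z|lborel. a z * N (\<epsilon> *\<^sub>R z))"
  have 1: "(\<lambda>(z, s). ?\<Psi> z s) \<in> borel_measurable (borel \<Otimes>\<^sub>M borel)" by measurable
  have 2: "(\<lambda>(x, z). ?m x z) \<in> borel_measurable (borel \<Otimes>\<^sub>M borel)" by measurable
  have 3: "?w \<in> borel_measurable borel" by measurable
  have 4: "\<bar>?m x z\<bar> \<le> ?w z" for x z
    unfolding abs_mult abs_of_nonneg[OF K_nonneg] using a_nonneg \<alpha>2_pos by (intro mult_mono K_le C) auto
  have 5: "(\<integral>\<^sup>+z. ennreal (?w z) * (\<integral>\<^sup>+s. ennreal \<bar>?\<Psi> z s\<bar> \<partial>lborel) \<partial>lborel) \<le> ennreal ?B"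
  proof -
    have [measurable]: "T h \<in> borel_measurable borel" for h by measurable
    have "(\<integral>\<^sup>+s. ennreal \<bar>?\<Psi> z s\<bar> \<partial>lborel) \<le> ennreal (N (\<epsilon> *\<^sub>R z))" for z
      by (subst nn_integral_abs_shift) (measurable, rule TN)
    then have "(\<integral>\<^sup>+z. ennreal (?w z) * (\<integral>\<^sup>+s. ennreal \<bar>?\<Psi> z s\<bar> \<partial>lborel) \<partial>lborel) \<le> (\<integral>\<^sup>+z. ennreal (?w z) * ennreal (N (\<epsilon> *\<^sub>R z)) \<partial>lborel)"
      by (intro nn_integral_mono mult_left_mono) auto
    also have "\<dots> = (\<integral>\<^sup>+z. ennreal (\<alpha>\<^sub>2 * C * (a z * N (\<epsilon> *\<^sub>R z))) \<partial>lborel)"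
      using a_nonneg \<alpha>2_pos C(2) N0 by (intro nn_integral_cong) (simp add: ennreal_mult[symmetric] mult_ac)
    also have "\<dots> = ennreal (LINT z|lborel. \<alpha>\<^sub>2 * C * (a z * N (\<epsilon> *\<^sub>R z)))"
      using a_nonneg \<alpha>2_pos C(2) N0 by (intro nn_integral_eq_integral integrable_mult_right int \<epsilon> AE_I2) simp
    finally show ?thesis by simp
  qed
  have 6: "?B \<ge> 0" using a_nonneg \<alpha>2_pos C(2) N0 by simp
  have e: "(\<lambda>x. LINT z|lborel. K (x /\<^sub>R \<epsilon>) z * (g (x /\<^sub>R \<epsilon> - z) * conv f (T (\<epsilon> *\<^sub>R z)) (x - \<tau>)))
    = (\<lambda>x. LINT z|lborel. ?m x z * conv f (?\<Psi> z) x)"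
    by (simp add: conv_shift mult.assoc)
  show "(\<lambda>x. LINT z|lborel. K (x /\<^sub>R \<epsilon>) z * (g (x /\<^sub>R \<epsilon> - z) * conv f (T (\<epsilon> *\<^sub>R z)) (x - \<tau>))) \<in> bL2 \<and>
    nL2 (\<lambda>x. LINT z|lborel. K (x /\<^sub>R \<epsilon>) z * (g (x /\<^sub>R \<epsilon> - z) * conv f (T (\<epsilon> *\<^sub>R z)) (x - \<tau>))) \<le> ?B * nL2 f"
    unfolding e using conv_superposition[OF f 1 2 3 4 5 6] by blast
qed

lemma first_abs_integrable: "integrable lborel (\<lambda>z. a z * norm z)"
proof (rule Bochner_Integration.integrable_bound[OF weight_integrable])
  show "AE z in lborel. norm (a z * norm z) \<le> norm (a z * (1 + (norm z)\<^sup>2))"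
    using norm_le_weight a_nonneg by (intro AE_I2) (auto simp: abs_mult intro!: mult_left_mono)
qed measurable

lemma vanishing_res1:
  assumes \<rho>: "test_function \<rho>" shows "vanishing (\<lambda>\<epsilon> f \<tau> x. res1 \<rho> \<epsilon> f \<tau> i j x)"
proof -
  have \<psi>: "test_function (D2 \<rho> i j)" using \<rho> by (intro test_function_partial)
  obtain C where C: "C > 0" "\<And>h. (\<integral>\<^sup>+s. ennreal \<bar>taylor1 (D2 \<rho> i j) h s\<bar> \<partial>lborel) \<le> ennreal (C * norm h ^ 1)"
    by (rule taylor_L1[OF \<psi>, of taylor1 1]) (use taylor1_bound[OF \<psi>] in auto)
  obtain D where D: "D > 0" "\<And>x. \<bar>corr2 i j x\<bar> \<le> D" by (rule BP_bounded[OF corr2(1)]) blast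
  have int: "integrable lborel (\<lambda>z. a z * (C * norm (\<epsilon> *\<^sub>R z) ^ 1))" if "\<epsilon> > 0" for \<epsilon>
    using integrable_mult_right[OF first_abs_integrable, of "C * \<epsilon>"] that by (simp add: mult_ac)
  have b: "op_bound (\<lambda>\<epsilon>. \<alpha>\<^sub>2 * D * (LINT z|lborel. a z * (C * norm (\<epsilon> *\<^sub>R z) ^ 1))) (\<lambda>\<epsilon> f \<tau> x. res1 \<rho> \<epsilon> f \<tau> i j x)"
    unfolding res1_def
    by (rule op_bound_superposition[OF taylor_measurable(1)[OF \<psi>] _ _ C(2) int corr2(1) D(2,1)]) (use C(1) in auto)
  have e: "(LINT z|lborel. a z * (C * norm (\<epsilon> *\<^sub>R z) ^ 1)) = \<bar>\<epsilon>\<bar> * (C * (LINT z|lborel. a z * norm z))" for \<epsilon>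
    unfolding integral_mult_right_zero[symmetric] by (simp add: mult_ac)
  have "((\<lambda>\<epsilon>. \<alpha>\<^sub>2 * D * (LINT z|lborel. a z * (C * norm (\<epsilon> *\<^sub>R z) ^ 1))) \<longlongrightarrow> 0) (at_right 0)"
    unfolding e by (intro tendsto_mult_right_zero tendsto_mult_left_zero tendsto_rabs_zero tendsto_ident_at)
  then show ?thesis unfolding vanishing_def using b by blast
qed

lemma vanishing_res2:
  assumes \<rho>: "test_function \<rho>" shows "vanishing (\<lambda>\<epsilon> f \<tau> x. (1 / \<epsilon>) * res2 \<rho> \<epsilon> f \<tau> i x)"
proof -
  have \<psi>: "test_function (D1 \<rho> i)" using \<rho> by (intro test_function_partial)
  obtain C where C: "C > 0" "\<And>h. (\<integral>\<^sup>+s. ennreal \<bar>taylor2 (D1 \<rho> i) h s\<bar> \<partial>lborel) \<le> ennreal (C * norm h ^ 2)"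
    by (rule taylor_L1[OF \<psi>, of taylor2 2]) (use taylor2_bound[OF \<psi>] in auto)
  obtain D where D: "D > 0" "\<And>x. \<bar>corr i x\<bar> \<le> D" by (rule BP_bounded[OF corr(1)]) blast
  have int: "integrable lborel (\<lambda>z. a z * (C * norm (\<epsilon> *\<^sub>R z) ^ 2))" for \<epsilon>
    using integrable_mult_right[OF a_second, of "C * \<epsilon>\<^sup>2"] by (simp add: mult_ac power_mult_distrib)
  have b: "op_bound (\<lambda>\<epsilon>. \<alpha>\<^sub>2 * D * (LINT z|lborel. a z * (C * norm (\<epsilon> *\<^sub>R z) ^ 2))) (\<lambda>\<epsilon> f \<tau> x. res2 \<rho> \<epsilon> f \<tau> i x)"
    unfolding res2_def
    by (rule op_bound_superposition[OF taylor_measurable(2)[OF \<psi>] _ _ C(2) int corr(1) D(2,1)]) (use C(1) in auto)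
  let ?R = "\<lambda>\<epsilon>. \<bar>1 / \<epsilon>\<bar> * (\<alpha>\<^sub>2 * D * (LINT z|lborel. a z * (C * norm (\<epsilon> *\<^sub>R z) ^ 2)))"
  have e: "(LINT z|lborel. a z * (C * norm (\<epsilon> *\<^sub>R z) ^ 2)) = C * \<epsilon>\<^sup>2 * (LINT z|lborel. (norm z)\<^sup>2 * a z)" for \<epsilon>
    unfolding integral_mult_right_zero[symmetric] by (simp add: mult_ac power_mult_distrib)
  have e': "?R \<epsilon> = \<bar>\<epsilon>\<bar> * (\<alpha>\<^sub>2 * D * (C * (LINT z|lborel. (norm z)\<^sup>2 * a z)))" for \<epsilon>
    unfolding e by (cases "\<epsilon> = 0") (simp_all add: power2_eq_square field_simps)
  have "(?R \<longlongrightarrow> 0) (at_right 0)" unfolding e' by (intro tendsto_mult_left_zero tendsto_rabs_zero tendsto_ident_at)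
  then show ?thesis unfolding vanishing_def using op_bound_scale[OF b, of "\<lambda>\<epsilon>. 1 / \<epsilon>"] by blast
qed

text \<open>After division by \<epsilon>^2 the cubic bound still gains a factor \<epsilon> for each
  fixed z, but its integral against \<open>a\<close> would require a third moment. The minimum with
  the quadratic bound has an integrable majorant, so dominated convergence applies; it supplies no
  rate.\<close>

lemma vanishing_res3:
  assumes \<rho>: "test_function \<rho>" shows "vanishing (\<lambda>\<epsilon> f \<tau> x. (1 / \<epsilon>\<^sup>2) * res3 \<rho> \<epsilon> f \<tau> x)"
proof -
  obtain C where C: "C > 0" "\<And>h. (\<integral>\<^sup>+s. ennreal \<bar>taylor3 \<rho> h s\<bar> \<partial>lborel) \<le> ennreal (C * norm h ^ 3)"
    by (rule taylor_L1[OF \<rho>, of taylor3 3]) (use taylor3_bound[OF \<rho>] in auto)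
  obtain D where D: "D > 0" "\<And>h. (\<integral>\<^sup>+s. ennreal \<bar>taylor3 \<rho> h s\<bar> \<partial>lborel) \<le> ennreal (D * norm h ^ 2)"
    by (rule taylor_L1[OF \<rho>, of taylor3 2]) (use taylor3_bound2[OF \<rho>] in auto)
  define N where "N h = min (C * norm h ^ 3) (D * norm h ^ 2)" for h :: "real ^ 'n"
  have [measurable]: "N \<in> borel_measurable borel" unfolding N_def[abs_def] by measurable
  have N0: "N h \<ge> 0" for h using C(1) D(1) by (simp add: N_def)
  have TN: "(\<integral>\<^sup>+s. ennreal \<bar>taylor3 \<rho> h s\<bar> \<partial>lborel) \<le> ennreal (N h)" for h
    unfolding N_def min_def using C(2) D(2) by auto
  have int2: "integrable lborel (\<lambda>z. D * ((norm z)\<^sup>2 * a z))" by (intro integrable_mult_right a_second)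
  have int: "integrable lborel (\<lambda>z. a z * N (\<epsilon> *\<^sub>R z))" for \<epsilon>
  proof (rule Bochner_Integration.integrable_bound)
    show "integrable lborel (\<lambda>z. D * \<epsilon>\<^sup>2 * ((norm z)\<^sup>2 * a z))" by (intro integrable_mult_right a_second)
    have "a z * N (\<epsilon> *\<^sub>R z) \<le> a z * (D * \<epsilon>\<^sup>2 * (norm z)\<^sup>2)" for z
      using a_nonneg by (intro mult_left_mono) (auto simp: N_def power_mult_distrib)
    then show "AE z in lborel. norm (a z * N (\<epsilon> *\<^sub>R z)) \<le> norm (D * \<epsilon>\<^sup>2 * ((norm z)\<^sup>2 * a z))"
      using a_nonneg N0 D(1) by (intro AE_I2) (auto simp: mult_ac)
  qed measurable
  have b: "op_bound (\<lambda>\<epsilon>. \<alpha>\<^sub>2 * 1 * (LINT z|lborel. a z * N (\<epsilon> *\<^sub>R z))) (\<lambda>\<epsilon> f \<tau> x. res3 \<rho> \<epsilon> f \<tau> x)"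
    using op_bound_superposition[OF taylor_measurable(3)[OF \<rho>] _ N0 TN int BP_const[of 1], of 1]
    by (simp add: res3_def)
  \<comment> \<open>The remainder bound at \<epsilon> z with \<epsilon>^2 taken out: of the two
    expressions only the cubic one keeps a factor \<epsilon>.\<close>
  let ?M = "\<lambda>\<epsilon> z. a z * min (C * \<bar>\<epsilon>\<bar> * norm z ^ 3) (D * norm z ^ 2)"
  have e: "\<bar>1 / \<epsilon>\<^sup>2\<bar> * (\<alpha>\<^sub>2 * 1 * (LINT z|lborel. a z * N (\<epsilon> *\<^sub>R z))) = \<alpha>\<^sub>2 * (LINT z|lborel. ?M \<epsilon> z)" if "\<epsilon> > 0" for \<epsilon>
  proof -
    have "N (\<epsilon> *\<^sub>R z) = \<epsilon>\<^sup>2 * min (C * \<bar>\<epsilon>\<bar> * norm z ^ 3) (D * norm z ^ 2)" for z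
      unfolding N_def using that
      by (subst min_mult_distrib_left) (auto simp: power_mult_distrib power2_eq_square power3_eq_cube mult_ac)
    then have "(LINT z|lborel. a z * N (\<epsilon> *\<^sub>R z)) = \<epsilon>\<^sup>2 * (LINT z|lborel. ?M \<epsilon> z)"
      unfolding integral_mult_right_zero[symmetric] by (simp add: mult_ac)
    then show ?thesis using that by simp
  qed
  have "((\<lambda>\<epsilon>. LINT z|lborel. ?M \<epsilon> z) \<longlongrightarrow> (LINT (z::real^'n)|lborel. 0)) (at_right 0)"
    unfolding tendsto_at_iff_sequentially
  proof (intro allI impI)
    fix X :: "nat \<Rightarrow> real" assume "\<forall>i. X i \<in> {0<..} - {0}" and X: "X \<longlonglongrightarrow> 0"
    show "((\<lambda>\<epsilon>. LINT z|lborel. ?M \<epsilon> z) \<circ> X) \<longlonglongrightarrow> (LINT (z::real^'n)|lborel. 0)"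
      unfolding o_def
    proof (rule integral_dominated_convergence[OF _ _ int2])
      show "AE z in lborel. (\<lambda>i. ?M (X i) z) \<longlonglongrightarrow> 0"
      proof (rule AE_I2)
        fix z :: "real ^ 'n"
        have "(\<lambda>i. ?M (X i) z) \<longlonglongrightarrow> a z * min (C * \<bar>0\<bar> * norm z ^ 3) (D * norm z ^ 2)" by (intro tendsto_intros X)
        moreover have "min 0 (D * norm z ^ 2) = 0" using D(1) by simp
        ultimately show "(\<lambda>i. ?M (X i) z) \<longlonglongrightarrow> 0" by simp
      qed
      show "AE z in lborel. norm (?M (X i) z) \<le> D * ((norm z)\<^sup>2 * a z)" for i
      proof (rule AE_I2)
        fix z :: "real ^ 'n"
        have "0 \<le> min (C * \<bar>X i\<bar> * norm z ^ 3) (D * norm z ^ 2)" using C(1) D(1) by simp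
        then have "norm (?M (X i) z) = ?M (X i) z" using a_nonneg by simp
        also have "\<dots> \<le> a z * (D * norm z ^ 2)" using a_nonneg by (intro mult_left_mono) auto
        finally show "norm (?M (X i) z) \<le> D * ((norm z)\<^sup>2 * a z)" by (simp add: mult_ac)
      qed
    qed measurable
  qed
  then have "((\<lambda>\<epsilon>. \<alpha>\<^sub>2 * (LINT z|lborel. ?M \<epsilon> z)) \<longlongrightarrow> 0) (at_right 0)" by (intro tendsto_mult_right_zero) simp
  then have "((\<lambda>\<epsilon>. \<bar>1 / \<epsilon>\<^sup>2\<bar> * (\<alpha>\<^sub>2 * 1 * (LINT z|lborel. a z * N (\<epsilon> *\<^sub>R z)))) \<longlongrightarrow> 0) (at_right 0)"
    by (rule Lim_transform_eventually) (use e in \<open>auto simp: eventually_at_filter\<close>)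
  then show ?thesis unfolding vanishing_def using op_bound_scale[OF b, of "\<lambda>\<epsilon>. 1 / \<epsilon>\<^sup>2"] by blast
qed

lemma op_bound_heat:
  assumes \<psi>: "test_function \<psi>" shows "\<exists>C. op_bound (\<lambda>_. C) (\<lambda>\<epsilon> f \<tau> x. conv f (heat \<psi>) (x - \<tau>))"
proof -
  have "\<exists>C. op_bound (\<lambda>_. C) (\<lambda>\<epsilon> f \<tau> x. conv f (D2 \<psi> i j) (x - \<tau>))" for i j
    by (intro op_bound_conv test_function_partial \<psi>)
  then obtain C where C: "\<And>i j. op_bound (\<lambda>_. C i j) (\<lambda>\<epsilon> f \<tau> x. conv f (D2 \<psi> i j) (x - \<tau>))" by metis
  let ?C = "\<Sum>i\<in>UNIV. \<Sum>j\<in>UNIV. \<bar>Theta $ i $ j\<bar> * C i j"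
  have "op_bound (\<lambda>_. ?C) (\<lambda>\<epsilon> f \<tau> x. \<Sum>i\<in>UNIV. \<Sum>j\<in>UNIV. Theta $ i $ j * conv f (D2 \<psi> i j) (x - \<tau>))"
    by (intro op_bound_sum op_bound_scale[where c="\<lambda>_. Theta $ _ $ _"] C)
  then have "op_bound (\<lambda>_. ?C) (\<lambda>\<epsilon> f \<tau> x. conv f (heat \<psi>) (x - \<tau>))"
    unfolding op_bound_def by (simp add: conv_heat[OF \<psi>])
  then show ?thesis by blast
qed

lemma vanishing_eps:
  fixes G :: "real \<Rightarrow> (real ^ 'n \<Rightarrow> real) \<Rightarrow> 'b \<Rightarrow> real ^ 'n \<Rightarrow> real"
  assumes "g \<in> BP" "\<exists>C. op_bound (\<lambda>_. C) G" "(c \<longlongrightarrow> 0) (at_right 0)"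
  shows "vanishing (\<lambda>\<epsilon> f \<tau> x. c \<epsilon> * (g (x /\<^sub>R \<epsilon>) * G \<epsilon> f \<tau> x))"
  using op_bound_corrector[OF assms(1,2)] vanishing_small[OF _ assms(3)] by blast

text \<open>The transport part of the flow has size 1/\<epsilon>, of which the factor \<epsilon>^2
  leaves one power of \<epsilon>.\<close>

lemma vanishing_flow:
  assumes \<psi>: "test_function \<psi>" and g: "g \<in> BP" shows "vanishing (\<lambda>\<epsilon> f \<tau> x. \<epsilon>\<^sup>2 * g (x /\<^sub>R \<epsilon>) * flow \<psi> \<epsilon> f \<tau> x)"
proof (rule vanishing_cong)
  have 1: "((\<lambda>\<epsilon>. \<epsilon>\<^sup>2) \<longlongrightarrow> 0) (at_right (0::real))" by (auto intro!: tendsto_eq_intros)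
  have 2: "((\<lambda>\<epsilon>. \<epsilon> * drift $ k) \<longlongrightarrow> 0) (at_right (0::real))" for k by (auto intro!: tendsto_eq_intros)
  show "vanishing (\<lambda>\<epsilon> f \<tau> x. \<epsilon>\<^sup>2 * (g (x /\<^sub>R \<epsilon>) * conv f (heat \<psi>) (x - \<tau>))
    - (\<Sum>k\<in>UNIV. (\<epsilon> * drift $ k) * (g (x /\<^sub>R \<epsilon>) * conv f (D1 \<psi> k) (x - \<tau>))))"
    by (intro vanishing_diff vanishing_sum vanishing_eps[OF g _ 1] vanishing_eps[OF g _ 2] op_bound_heat op_bound_conv test_function_partial \<psi>)
  fix \<epsilon> :: real and f :: "real ^ 'n \<Rightarrow> real" and \<tau> x assume \<epsilon>: "\<epsilon> > 0"
  have "\<epsilon>\<^sup>2 * (d / \<epsilon>) = \<epsilon> * d" for d using \<epsilon> by (simp add: power2_eq_square)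
  then have s: "(\<Sum>k\<in>UNIV. (\<epsilon> * drift $ k) * (g (x /\<^sub>R \<epsilon>) * conv f (D1 \<psi> k) (x - \<tau>)))
    = (\<Sum>k\<in>UNIV. (\<epsilon>\<^sup>2 * (drift $ k / \<epsilon>)) * (g (x /\<^sub>R \<epsilon>) * conv f (D1 \<psi> k) (x - \<tau>)))" by simp
  show "\<epsilon>\<^sup>2 * g (x /\<^sub>R \<epsilon>) * flow \<psi> \<epsilon> f \<tau> x = \<epsilon>\<^sup>2 * (g (x /\<^sub>R \<epsilon>) * conv f (heat \<psi>) (x - \<tau>))
    - (\<Sum>k\<in>UNIV. (\<epsilon> * drift $ k) * (g (x /\<^sub>R \<epsilon>) * conv f (D1 \<psi> k) (x - \<tau>)))"
    unfolding s flow_def right_diff_distrib sum_distrib_left by (simp only: mult_ac)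
qed

lemma tendsto_eps: "((\<lambda>\<epsilon>. \<epsilon>) \<longlongrightarrow> 0) (at_right (0::real))" by (rule tendsto_ident_at)

lemma vanishing_residual:
  assumes \<rho>: "test_function \<rho>" shows "vanishing (residual \<rho>)"
proof -
  have H: "vanishing (\<lambda>\<epsilon> f \<tau> x. \<epsilon> * (corr i (x /\<^sub>R \<epsilon>) * conv f (heat (D1 \<rho> i)) (x - \<tau>)))" for i
    by (intro vanishing_eps corr(1) op_bound_heat test_function_partial \<rho> tendsto_eps)
  have F: "vanishing (\<lambda>\<epsilon> f \<tau> x. \<epsilon>\<^sup>2 * corr2 i j (x /\<^sub>R \<epsilon>) * flow (D2 \<rho> i j) \<epsilon> f \<tau> x)" for i j
    by (intro vanishing_flow test_function_partial \<rho> corr2(1))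
  have "vanishing (\<lambda>\<epsilon> f \<tau> x. residual \<rho> \<epsilon> f \<tau> x)"
    unfolding residual_def mult.assoc[of _ "corr _ _"]
    by (intro vanishing_add vanishing_diff vanishing_sum vanishing_res1 vanishing_res2 vanishing_res3 H F \<rho>)
  then show ?thesis .
qed

lemma vanishing_ansatz:
  assumes \<rho>: "test_function \<rho>" shows "vanishing (\<lambda>\<epsilon> f \<tau> x. ansatz \<rho> \<epsilon> f \<tau> x - conv f \<rho> (x - \<tau>))"
proof (rule vanishing_cong)
  have 1: "((\<lambda>\<epsilon>. \<epsilon>\<^sup>2) \<longlongrightarrow> 0) (at_right (0::real))" by (auto intro!: tendsto_eq_intros)
  show "vanishing (\<lambda>\<epsilon> f \<tau> x. (\<Sum>i\<in>UNIV. \<epsilon> * (corr i (x /\<^sub>R \<epsilon>) * conv f (D1 \<rho> i) (x - \<tau>)))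
     + (\<Sum>i\<in>UNIV. \<Sum>j\<in>UNIV. \<epsilon>\<^sup>2 * (corr2 i j (x /\<^sub>R \<epsilon>) * conv f (D2 \<rho> i j) (x - \<tau>))))"
    by (intro vanishing_add vanishing_sum vanishing_eps[OF _ _ 1] vanishing_eps[OF _ _ tendsto_eps] corr(1) corr2(1) op_bound_conv test_function_partial \<rho>)
qed (simp add: ansatz_def mult.assoc)

end

subsection \<open>Comparison with the limit equation\<close>

lemma cont_L2_norm:
  assumes "cont_L2 z" shows "continuous_on {0..} (\<lambda>t. nL2 (z t))"
  unfolding continuous_on_def
proof
  fix t :: real assume t: "t \<in> {0..}"
  have "((\<lambda>s. \<bar>nL2 (z s) - nL2 (z t)\<bar>) \<longlongrightarrow> 0) (at t within {0..})"
  proof (rule tendsto_0_dominated)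
    show "((\<lambda>s. nL2 (\<lambda>x. z s x - z t x)) \<longlongrightarrow> 0) (at t within {0..})" using cont_L2D(2)[OF assms] t by simp
    show "\<forall>\<^sub>F s in at t within {0..}. \<bar>nL2 (z s) - nL2 (z t)\<bar> \<le> nL2 (\<lambda>x. z s x - z t x)"
      unfolding eventually_at_filter using t by (intro always_eventually) (auto intro!: nL2_diff_le cont_L2D(1)[OF assms])
  qed simp
  then show "((\<lambda>t. nL2 (z t)) \<longlongrightarrow> nL2 (z t)) (at t within {0..})"
    by (simp add: tendsto_rabs_zero_iff LIM_zero_iff)
qed

text \<open>For a path without spatial regularity the moving frame costs differentiability but not
  continuity: translations are continuous in L2 at each fixed time, and this adds to continuity in
  time. It makes the error in the final statement a continuous function of time.\<close>

lemma cont_L2_shift: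
  fixes c :: "'a::euclidean_space"
  assumes z: "cont_L2 z" shows "cont_L2 (\<lambda>t x. z t (x + t *\<^sub>R c))"
  unfolding cont_L2_def
proof (intro conjI allI impI)
  fix t :: real assume t: "t \<ge> 0"
  show b: "(\<lambda>x. z s (x + s *\<^sub>R c)) \<in> bL2" if "s \<ge> 0" for s by (rule bL2_shift(3)[OF cont_L2D(1)[OF z that]])
  note zt = cont_L2D(1)[OF z t]
  let ?s = "\<lambda>s. nL2 (\<lambda>x. z t (x - (t - s) *\<^sub>R c) - z t x)"
  show "((\<lambda>s. nL2 (\<lambda>x. z s (x + s *\<^sub>R c) - z t (x + t *\<^sub>R c))) \<longlongrightarrow> 0) (at t within {0..})"
  proof (rule tendsto_0_dominated)
    let ?h = "\<lambda>h. nL2 (\<lambda>x. z t (x - h) - z t x)"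
    have "isCont ?h 0" using L2_translation_continuous[OF zt] by (simp add: isCont_def nL2_def)
    moreover have "((\<lambda>s. (t - s) *\<^sub>R c) \<longlongrightarrow> (t - t) *\<^sub>R c) (at t within {0..})" by (intro tendsto_intros)
    ultimately have "(?s \<longlongrightarrow> ?h 0) (at t within {0..})" using isCont_tendsto_compose[of 0 ?h] by simp
    then have "(?s \<longlongrightarrow> 0) (at t within {0..})" by (simp add: nL2_def)
    then show "((\<lambda>s. nL2 (\<lambda>x. z s x - z t x) + ?s s) \<longlongrightarrow> 0) (at t within {0..})"
      using tendsto_add[OF cont_L2D(2)[OF z t]] by simp
    show "\<forall>\<^sub>F s in at t within {0..}. nL2 (\<lambda>x. z s (x + s *\<^sub>R c) - z t (x + t *\<^sub>R c)) \<le> nL2 (\<lambda>x. z s x - z t x) + ?s s"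
      unfolding eventually_at_filter
    proof (intro always_eventually allI impI)
      fix s :: real assume "s \<in> {0..}"
      then have zs: "z s \<in> bL2" using cont_L2D(1)[OF z] by simp
      let ?f = "\<lambda>x. z s x - z t x" and ?g = "\<lambda>x. z t x - z t (x + (t - s) *\<^sub>R c)"
      have f: "?f \<in> bL2" "?g \<in> bL2" by (intro bL2_diff zs zt bL2_shift)+
      have "nL2 (\<lambda>x. z s (x + s *\<^sub>R c) - z t (x + t *\<^sub>R c)) = nL2 (\<lambda>x. (?f (x + s *\<^sub>R c) + ?g (x + s *\<^sub>R c)))"
        by (simp add: algebra_simps)
      also have "\<dots> = nL2 (\<lambda>x. ?f x + ?g x)" by (rule bL2_shift(4)[OF bL2_add[OF f]])
      also have "\<dots> \<le> nL2 ?f + nL2 ?g" by (rule nL2_triangle[OF f])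
      also have "nL2 ?g = nL2 (\<lambda>x. ?g (x - (t - s) *\<^sub>R c))" by (rule bL2_shift(2)[OF f(2), symmetric])
      finally show "nL2 (\<lambda>x. z s (x + s *\<^sub>R c) - z t (x + t *\<^sub>R c)) \<le> nL2 ?f + ?s s" by simp
    qed
  qed simp
qed

text \<open>A continuous path over a compact time interval is covered by finitely many small L2
  balls around its own values; translation continuity at their finitely many centres then serves all
  times, with a third of \<eta> for each of the three errors.\<close>

lemma cont_L2_equicontinuous:
  fixes z :: "real \<Rightarrow> 'a::euclidean_space \<Rightarrow> real"
  assumes z: "cont_L2 z" and \<eta>: "\<eta> > 0"
  obtains \<delta> where "\<delta> > 0" "\<And>t h. 0 \<le> t \<Longrightarrow> t \<le> T \<Longrightarrow> norm h \<le> \<delta> \<Longrightarrow> nL2 (\<lambda>x. z t (x - h) - z t x) \<le> \<eta>"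
proof -
  have "\<exists>r>0. \<forall>s\<ge>0. \<bar>s - t\<bar> < r \<longrightarrow> nL2 (\<lambda>x. z s x - z t x) < \<eta> / 3" if t: "t \<ge> 0" for t
  proof -
    have "\<forall>\<^sub>F s in at t within {0..}. nL2 (\<lambda>x. z s x - z t x) < \<eta> / 3"
      using order_tendstoD(2)[OF cont_L2D(2)[OF z t], of "\<eta> / 3"] \<eta> by simp
    then obtain r where r: "r > 0" "\<And>s. s \<in> {0..} \<Longrightarrow> s \<noteq> t \<Longrightarrow> dist s t < r \<Longrightarrow> nL2 (\<lambda>x. z s x - z t x) < \<eta> / 3"
      unfolding eventually_at by blast
    have "nL2 (\<lambda>x. z s x - z t x) < \<eta> / 3" if "s \<ge> 0" "\<bar>s - t\<bar> < r" for s
    proof (cases "s = t")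
      case True then show ?thesis using \<eta> by (simp add: nL2_def)
    next
      case False then show ?thesis using r(2)[of s] that by (simp add: dist_real_def)
    qed
    then show ?thesis using r(1) by blast
  qed
  then obtain r where r: "\<And>t. t \<ge> 0 \<Longrightarrow> r t > 0" "\<And>t s. t \<ge> 0 \<Longrightarrow> s \<ge> 0 \<Longrightarrow> \<bar>s - t\<bar> < r t \<Longrightarrow> nL2 (\<lambda>x. z s x - z t x) < \<eta> / 3"
    by metis
  have "\<exists>d>0. \<forall>h. norm h \<le> d \<longrightarrow> nL2 (\<lambda>x. z t (x - h) - z t x) < \<eta> / 3" if t: "t \<ge> 0" for t
  proof -
    have "\<forall>\<^sub>F h in at 0. nL2 (\<lambda>x. z t (x - h) - z t x) < \<eta> / 3"
      using order_tendstoD(2)[OF L2_translation_continuous[OF cont_L2D(1)[OF z t]], of "\<eta> / 3"] \<eta> by simp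
    then obtain d where d: "d > 0" "\<And>h. h \<noteq> 0 \<Longrightarrow> dist h 0 < d \<Longrightarrow> nL2 (\<lambda>x. z t (x - h) - z t x) < \<eta> / 3"
      unfolding eventually_at by blast
    have "nL2 (\<lambda>x. z t (x - h) - z t x) < \<eta> / 3" if "norm h \<le> d / 2" for h
    proof (cases "h = 0")
      case True then show ?thesis using \<eta> by (simp add: nL2_def)
    next
      case False then show ?thesis using d that by simp
    qed
    then show ?thesis using d(1) by (intro exI[of _ "d / 2"]) auto
  qed
  then obtain d where d: "\<And>t. t \<ge> 0 \<Longrightarrow> d t > 0" "\<And>t h. t \<ge> 0 \<Longrightarrow> norm h \<le> d t \<Longrightarrow> nL2 (\<lambda>x. z t (x - h) - z t x) < \<eta> / 3"
    by metis
  have "{0..T} \<subseteq> (\<Union>t\<in>{0..T}. ball t (r t))" using r(1) by auto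
  then obtain S where S: "S \<subseteq> {0..T}" "finite S" "{0..T} \<subseteq> (\<Union>t\<in>S. ball t (r t))"
    by (rule compactE_image[OF compact_Icc, of "{0..T}" "\<lambda>t. ball t (r t)", rotated]) auto
  show thesis
  \<comment> \<open>Inserting 1 keeps the minimum meaningful when no time is selected, as for T <
    0.\<close>
  proof (rule that[of "Min (insert 1 (d ` S))"])
    show "Min (insert 1 (d ` S)) > 0" using S(1,2) d(1) by auto
    fix t :: real and h :: 'a assume t: "0 \<le> t" "t \<le> T" and h: "norm h \<le> Min (insert 1 (d ` S))"
    then obtain s where s: "s \<in> S" "\<bar>t - s\<bar> < r s" using S(3) by (auto simp: dist_real_def abs_minus_commute subset_iff)
    have s0: "s \<ge> 0" using s(1) S(1) by auto
    have hd: "norm h \<le> d s" using h s(1) S(2) by simp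
    note zt = cont_L2D(1)[OF z t(1)] and zs = cont_L2D(1)[OF z s0]
    have 1: "nL2 (\<lambda>x. z t x - z s x) < \<eta> / 3" by (rule r(2)[OF s0 t(1) s(2)])
    have 2: "nL2 (\<lambda>x. z s (x - h) - z s x) < \<eta> / 3" by (rule d(2)[OF s0 hd])
    have 3: "nL2 (\<lambda>x. z t (x - h) - z s (x - h)) = nL2 (\<lambda>x. z t x - z s x)"
      by (rule bL2_shift(2)[OF bL2_diff[OF zt zs]])
    note zth = bL2_shift(1)[OF zt, of h] and zsh = bL2_shift(1)[OF zs, of h]
    have "nL2 (\<lambda>x. z t (x - h) - z t x) \<le> nL2 (\<lambda>x. z t (x - h) - z s (x - h)) + nL2 (\<lambda>x. z s (x - h) - z t x)"
      by (rule nL2_triangle_diff[OF zth zsh zt])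
    moreover have "nL2 (\<lambda>x. z s (x - h) - z t x) \<le> nL2 (\<lambda>x. z s (x - h) - z s x) + nL2 (\<lambda>x. z s x - z t x)"
      by (rule nL2_triangle_diff[OF zsh zs zt])
    ultimately show "nL2 (\<lambda>x. z t (x - h) - z t x) \<le> \<eta>"
      using 1 2 3 nL2_diff_commute[of "z s" "z t"] by linarith
  qed
qed

context periodic_kernel
begin

text \<open>The limit equation is recorded in mollified form, with both derivatives on the test
  function; this is how every later step consults it.\<close>

definition heat_path :: "(real \<Rightarrow> real ^ 'n \<Rightarrow> real) \<Rightarrow> bool" where
  "heat_path u \<longleftrightarrow> cont_L2 u \<and> (\<forall>t>0. \<exists>v. deriv_L2 u v t \<and> (\<forall>\<psi> x. test_function \<psi> \<longrightarrow> conv v \<psi> x = conv (u t) (heat \<psi>) x))"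

definition jump_path :: "real \<Rightarrow> (real \<Rightarrow> real ^ 'n \<Rightarrow> real) \<Rightarrow> bool" where
  "jump_path \<epsilon> u \<longleftrightarrow> cont_L2 u \<and> (\<forall>t>0. \<exists>v. deriv_L2 u v t \<and> (AE x in lborel. v x = Lop \<epsilon> (u t) x))"

lemma flow_path:
  assumes u: "heat_path u" and \<psi>: "test_function \<psi>" and t: "t > 0"
  shows "deriv_L2 (\<lambda>s x. conv (u s) \<psi> (x - s *\<^sub>R (drift /\<^sub>R \<epsilon>))) (flow \<psi> \<epsilon> (u t) (t *\<^sub>R (drift /\<^sub>R \<epsilon>))) t"
proof -
  obtain v where v: "deriv_L2 u v t" "\<And>\<psi> x. test_function \<psi> \<Longrightarrow> conv v \<psi> x = conv (u t) (heat \<psi>) x"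
    using u t unfolding heat_path_def by blast
  have "(\<lambda>x. conv v \<psi> (x - t *\<^sub>R (drift /\<^sub>R \<epsilon>)) - (\<Sum>i\<in>UNIV. (drift /\<^sub>R \<epsilon>) $ i * conv (u t) (partial_deriv i \<psi>) (x - t *\<^sub>R (drift /\<^sub>R \<epsilon>))))
    = flow \<psi> \<epsilon> (u t) (t *\<^sub>R (drift /\<^sub>R \<epsilon>))"
    by (simp add: fun_eq_iff flow_def v(2)[OF \<psi>] divide_inverse mult.commute)
  then show ?thesis using conv_path(2)[OF \<psi> v(1), of "drift /\<^sub>R \<epsilon>"] by simp
qed

lemma ansatz_path:
  assumes u: "heat_path u" and \<rho>: "test_function \<rho>"
  shows "cont_L2 (\<lambda>s. ansatz \<rho> \<epsilon> (u s) (s *\<^sub>R (drift /\<^sub>R \<epsilon>)))"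
    and "t > 0 \<Longrightarrow> deriv_L2 (\<lambda>s. ansatz \<rho> \<epsilon> (u s) (s *\<^sub>R (drift /\<^sub>R \<epsilon>))) (ansatz_dt \<rho> \<epsilon> (u t) (t *\<^sub>R (drift /\<^sub>R \<epsilon>))) t"
proof -
  have uc: "cont_L2 u" using u by (simp add: heat_path_def)
  have sc: "\<exists>C. \<forall>x. \<bar>c * g (x /\<^sub>R \<epsilon>)\<bar> \<le> C" "(\<lambda>x. c * g (x /\<^sub>R \<epsilon>)) \<in> borel_measurable borel" if g: "g \<in> BP" for g and c :: real
  proof -
    obtain C where C: "C > 0" "\<And>x. \<bar>g x\<bar> \<le> C" by (rule BP_bounded[OF g]) blast
    have "\<bar>c * g (x /\<^sub>R \<epsilon>)\<bar> \<le> \<bar>c\<bar> * C" for x unfolding abs_mult by (intro mult_left_mono C) simp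
    then show "\<exists>C. \<forall>x. \<bar>c * g (x /\<^sub>R \<epsilon>)\<bar> \<le> C" by blast
    have "(\<lambda>x. g (x /\<^sub>R \<epsilon>)) \<in> borel_measurable borel" by (rule measurable_compose[OF _ BP_measurable[OF g]]) measurable
    then show "(\<lambda>x. c * g (x /\<^sub>R \<epsilon>)) \<in> borel_measurable borel" by measurable
  qed
  let ?c = "drift /\<^sub>R \<epsilon>"
  have C: "cont_L2 (\<lambda>s x. c * g (x /\<^sub>R \<epsilon>) * conv (u s) \<psi> (x - s *\<^sub>R ?c))" if g: "g \<in> BP" and psi: "test_function \<psi>" for g c \<psi>
  proof -
    obtain B where "\<And>x. \<bar>c * g (x /\<^sub>R \<epsilon>)\<bar> \<le> B" using sc(1)[OF g, of c] by blast
    then show ?thesis by (rule cont_L2_mult[OF conv_path(1)[OF psi uc] sc(2)[OF g]])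
  qed
  have D: "deriv_L2 (\<lambda>s x. c * g (x /\<^sub>R \<epsilon>) * conv (u s) \<psi> (x - s *\<^sub>R ?c)) (\<lambda>x. c * g (x /\<^sub>R \<epsilon>) * flow \<psi> \<epsilon> (u t) (t *\<^sub>R ?c) x) t"
    if g: "g \<in> BP" and psi: "test_function \<psi>" and t: "t > 0" for g c \<psi> t
  proof -
    obtain B where "\<And>x. \<bar>c * g (x /\<^sub>R \<epsilon>)\<bar> \<le> B" using sc(1)[OF g, of c] by blast
    then show ?thesis by (rule deriv_L2_mult[OF flow_path[OF u psi t] sc(2)[OF g]])
  qed
  show "cont_L2 (\<lambda>s. ansatz \<rho> \<epsilon> (u s) (s *\<^sub>R ?c))"
    unfolding ansatz_def[abs_def]
    by (intro cont_L2_add cont_L2_sum C corr(1) corr2(1) test_function_partial \<rho> conv_path(1)[OF _ uc])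
  show "deriv_L2 (\<lambda>s. ansatz \<rho> \<epsilon> (u s) (s *\<^sub>R ?c)) (ansatz_dt \<rho> \<epsilon> (u t) (t *\<^sub>R ?c)) t" if t: "t > 0"
    unfolding ansatz_def[abs_def] ansatz_dt_def[abs_def]
    by (intro deriv_L2_add deriv_L2_sum D corr(1) corr2(1) test_function_partial \<rho> flow_path[OF u] t finite_UNIV finite)
qed

lemma Lop_measurable: assumes [measurable]: "f \<in> borel_measurable borel" shows "Lop \<epsilon> f \<in> borel_measurable borel"
  unfolding Lop_def[abs_def] by measurable

text \<open>The constants do not depend on \<epsilon>, since rescaling the argument leaves the
  pointwise bounds of \<open>p0\<close> unchanged; weighted and plain norms are thus equivalent
  uniformly in \<epsilon>.\<close>

lemma p0_weight: obtains c1 c2 where "\<And>\<epsilon>. weight (\<lambda>x. p0 (x /\<^sub>R \<epsilon>)) c1 c2"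
proof -
  obtain c1 where c1: "c1 > 0" "\<And>x. p0 x \<ge> c1" by (rule p0_lower) blast
  obtain c2 where c2: "c2 > 0" "\<And>x. \<bar>p0 x\<bar> \<le> c2" by (rule BP_bounded[OF p0_BP]) blast
  have "weight (\<lambda>x. p0 (x /\<^sub>R \<epsilon>)) c1 c2" for \<epsilon>
  proof
    show "(\<lambda>x. p0 (x /\<^sub>R \<epsilon>)) \<in> borel_measurable borel" by (rule measurable_compose[OF _ BP_measurable[OF p0_BP]]) measurable
    show "p0 (x /\<^sub>R \<epsilon>) \<le> c2" for x using c2(2)[of "x /\<^sub>R \<epsilon>"] by simp
  qed (use c1 in auto)
  then show thesis by (rule that)
qed

text \<open>The difference z of solution and expansion satisfies z' = L z + r, where r is the
  residual. Dissipativity discards L z, and 2 z r \<le> z^2 + r^2 leaves the energy itself plus a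
  source, which is the hypothesis of the energy estimate.\<close>

lemma energy_comparison:
  assumes W: "weight (\<lambda>x. p0 (x /\<^sub>R \<epsilon>)) c1 c2" and \<epsilon>: "\<epsilon> > 0" and \<rho>: "test_function \<rho>"
    and R: "op_bound R (residual \<rho>)" and u0: "heat_path u0" and u: "jump_path \<epsilon> u"
    and M: "\<And>t. 0 \<le> t \<Longrightarrow> t \<le> T \<Longrightarrow> nL2 (u0 t) \<le> M" and t: "0 \<le> t" "t \<le> T"
  defines "w \<equiv> \<lambda>s. ansatz \<rho> \<epsilon> (u0 s) (s *\<^sub>R (drift /\<^sub>R \<epsilon>))"
  shows "c1 * (nL2 (\<lambda>x. u t x - w t x))\<^sup>2 \<le> exp T * (c2 * (nL2 (\<lambda>x. u 0 x - w 0 x))\<^sup>2 + c2 * (R \<epsilon> * M)\<^sup>2 * T)"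
proof -
  let ?p = "\<lambda>x. p0 (x /\<^sub>R \<epsilon>)" and ?c = "drift /\<^sub>R \<epsilon>"
  interpret weight ?p c1 c2 by (rule W)
  have uc: "cont_L2 u" using u by (simp add: jump_path_def)
  have "\<forall>s>0. \<exists>v. deriv_L2 u v s \<and> (AE x in lborel. v x = Lop \<epsilon> (u s) x)" using u unfolding jump_path_def by blast
  then obtain v where v: "\<And>s. s > 0 \<Longrightarrow> deriv_L2 u (v s) s" "\<And>s. s > 0 \<Longrightarrow> AE x in lborel. v s x = Lop \<epsilon> (u s) x"
    by metis
  note wc = ansatz_path(1)[OF u0 \<rho>, of \<epsilon>, folded w_def] and wd = ansatz_path(2)[OF u0 \<rho>, of _ \<epsilon>, folded w_def]
  define w' where "w' s = ansatz_dt \<rho> \<epsilon> (u0 s) (s *\<^sub>R ?c)" for s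
  define z where "z s x = u s x - w s x" for s x
  define z' where "z' s x = v s x - w' s x" for s x
  have zc: "cont_L2 z" unfolding z_def[abs_def] by (rule cont_L2_diff[OF uc wc])
  have zd: "deriv_L2 z (z' s) s" if "s > 0" for s
    unfolding z_def[abs_def] z'_def[abs_def] w'_def by (rule deriv_L2_diff[OF v(1)[OF that] wd[OF that]])
  let ?B = "c2 * (R \<epsilon> * M)\<^sup>2"
  have ineq: "2 * (LINT x|lborel. ?p x * (z s x * z' s x)) \<le> energy ?p (z s) + ?B" if s: "0 < s" "s < T" for s
  proof -
    define r where "r = residual \<rho> \<epsilon> (u0 s) (s *\<^sub>R ?c)"
    have u0s: "u0 s \<in> bL2" using u0 s by (simp add: heat_path_def cont_L2D(1))
    have us: "u s \<in> bL2" and ws: "w s \<in> bL2" and zs: "z s \<in> bL2" using s uc wc zc by (simp_all add: cont_L2D(1))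
    have z's: "z' s \<in> bL2" by (rule deriv_L2D(3)[OF zd[OF s(1)]])
    have rb: "r \<in> bL2" "nL2 r \<le> R \<epsilon> * nL2 (u0 s)" unfolding r_def by (rule op_boundD[OF R \<epsilon> u0s])+
    have rx: "Lop \<epsilon> (w s) x - w' s x = r x" for x
      unfolding w_def w'_def r_def by (rule Lop_ansatz[OF \<rho> u0s \<epsilon>])
    have "AE x in lborel. Lop \<epsilon> (z s) x = z' s x - r x"
      using v(2)[OF s(1)] Lop_diff[OF us ws \<epsilon>]
    proof eventually_elim
      case (elim x)
      then show ?case unfolding z'_def z_def[abs_def] using rx[of x] by linarith
    qed
    then have "(LINT x|lborel. ?p x * (z s x * Lop \<epsilon> (z s) x)) = (LINT x|lborel. ?p x * (z s x * z' s x) - ?p x * (z s x * r x))"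
      using bL2_measurable[OF zs] bL2_measurable[OF z's] bL2_measurable[OF rb(1)] Lop_measurable[of "z s" \<epsilon>]
      by (intro integral_cong_AE) (auto simp: right_diff_distrib)
    also have "\<dots> = (LINT x|lborel. ?p x * (z s x * z' s x)) - (LINT x|lborel. ?p x * (z s x * r x))"
      by (intro Bochner_Integration.integral_diff weighted_integrable zs z's rb)
    finally have "(LINT x|lborel. ?p x * (z s x * z' s x)) \<le> (LINT x|lborel. ?p x * (z s x * r x))"
      using Lop_dissipative[OF zs \<epsilon>] by linarith
    moreover have "2 * (LINT x|lborel. ?p x * (z s x * r x)) \<le> energy ?p (z s) + energy ?p r"
    proof -
      have "(LINT x|lborel. 2 * (?p x * (z s x * r x))) \<le> (LINT x|lborel. ?p x * (z s x * z s x) + ?p x * (r x * r x))"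
      proof (intro integral_mono Bochner_Integration.integrable_add integrable_mult_right weighted_integrable zs rb)
        fix x
        have "2 * (z s x * r x) \<le> z s x * z s x + r x * r x"
          using zero_le_square[of "z s x - r x"] by (simp add: algebra_simps)
        from mult_left_mono[OF this p_nonneg[of x]]
        show "2 * (?p x * (z s x * r x)) \<le> ?p x * (z s x * z s x) + ?p x * (r x * r x)" by (simp add: distrib_left mult.left_commute[of _ 2])
      qed
      also have "\<dots> = energy ?p (z s) + energy ?p r"
        unfolding energy_def power2_eq_square by (intro Bochner_Integration.integral_add weighted_integrable zs rb)
      finally show ?thesis by simp
    qed
    moreover have "energy ?p r \<le> ?B"
    \<comment> \<open>R may be negative at individual \<epsilon>; there the operator bound forces
      the residual to have norm 0, so its energy is still dominated.\<close>
    proof (cases "R \<epsilon> \<ge> 0")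
      case True
      have "nL2 r \<le> R \<epsilon> * M" using rb(2) mult_left_mono[OF M[of s] True] s by simp
      then have "(nL2 r)\<^sup>2 \<le> (R \<epsilon> * M)\<^sup>2" by (intro power_mono) auto
      then have "c2 * (nL2 r)\<^sup>2 \<le> ?B" using c2 by (intro mult_left_mono) auto
      then show ?thesis using energy_bounds(2)[OF rb(1)] by linarith
    next
      case False
      then have "R \<epsilon> * nL2 (u0 s) \<le> 0" by (intro mult_nonpos_nonneg) auto
      then have "nL2 r = 0" using rb(2) nL2_nonneg[of r] by linarith
      then have "energy ?p r \<le> 0" using energy_bounds(2)[OF rb(1)] by simp
      moreover have "?B \<ge> 0" using c2 by simp
      ultimately show ?thesis by linarith
    qed
    ultimately show ?thesis by linarith
  qed
  have B0: "?B \<ge> 0" using c2 by simp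
  have "energy ?p (z t) \<le> exp T * (energy ?p (z 0) + ?B * T)"
    by (rule energy_estimate[OF zc zd ineq t B0])
  moreover have "c1 * (nL2 (z t))\<^sup>2 \<le> energy ?p (z t)" by (rule energy_bounds(1)[OF cont_L2D(1)[OF zc t(1)]])
  moreover have "energy ?p (z 0) \<le> c2 * (nL2 (z 0))\<^sup>2" by (rule energy_bounds(2)[OF cont_L2D(1)[OF zc]]) simp
  then have "exp T * (energy ?p (z 0) + ?B * T) \<le> exp T * (c2 * (nL2 (z 0))\<^sup>2 + ?B * T)" by (intro mult_left_mono) auto
  ultimately have "c1 * (nL2 (z t))\<^sup>2 \<le> exp T * (c2 * (nL2 (z 0))\<^sup>2 + ?B * T)" by linarith
  then show ?thesis unfolding z_def .
qed

text \<open>The order of choices matters: \<eta> fixes the width \<delta> by equicontinuity,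
  \<delta> fixes the mollifier, and only then does \<epsilon> tend to 0, because the residual bounds
  depend on the derivatives of \<rho>. The expansion starts from mollified data, so an initial error
  that does not vanish with \<epsilon> has to be carried through the energy estimate.\<close>

theorem homogenization_borel:
  assumes u0: "heat_path u0" and u: "\<And>\<epsilon>. \<epsilon> > 0 \<Longrightarrow> jump_path \<epsilon> (u \<epsilon>)"
    and init: "\<And>\<epsilon>. \<epsilon> > 0 \<Longrightarrow> nL2 (\<lambda>x. u \<epsilon> 0 x - u0 0 x) = 0" and T: "T > 0" and \<eta>: "\<eta> > 0"
  shows "\<forall>\<^sub>F \<epsilon> in at_right 0. \<forall>t. 0 \<le> t \<longrightarrow> t \<le> T \<longrightarrow> nL2 (\<lambda>x. u \<epsilon> t (x + t *\<^sub>R (drift /\<^sub>R \<epsilon>)) - u0 t x) \<le> \<eta>"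
proof -
  obtain c1 c2 where W: "\<And>\<epsilon>. weight (\<lambda>x. p0 (x /\<^sub>R \<epsilon>)) c1 c2" by (rule p0_weight) blast
  have c: "c1 > 0" "c2 > 0" using weight.c1[OF W] weight.c2[OF W] by auto
  have u0c: "cont_L2 u0" using u0 by (simp add: heat_path_def)
  have u0b: "u0 t \<in> bL2" if "t \<ge> 0" for t by (rule cont_L2D(1)[OF u0c that])
  have "bounded ((\<lambda>t. nL2 (u0 t)) ` {0..T})"
    by (intro compact_imp_bounded compact_continuous_image continuous_on_subset[OF cont_L2_norm[OF u0c]]) auto
  then obtain M where "\<forall>t\<in>{0..T}. nL2 (u0 t) \<le> M" by (auto simp: bounded_iff)
  then have M: "nL2 (u0 t) \<le> M" if "0 \<le> t" "t \<le> T" for t using that by simp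
  \<comment> \<open>The amplification factor of an initial error: exp T from the Gronwall argument,
    c2 / c1 from the passage between weighted and plain norms, and the root because energies are
    quadratic.\<close>
  define \<kappa> where "\<kappa> = sqrt (exp T * c2 / c1)"
  have \<kappa>: "\<kappa> \<ge> 0" using c by (simp add: \<kappa>_def)
  \<comment> \<open>The mollification error counts once at the initial time, multiplied by \<kappa>,
    and once at time t. Together this is (\<kappa> + 1) \<eta>' = \<eta> / 2, and the other half of
    \<eta> absorbs the terms that vanish with \<epsilon>.\<close>
  define \<eta>' where "\<eta>' = \<eta> / (2 * (\<kappa> + 1))"
  have \<eta>': "\<eta>' > 0" using \<eta> \<kappa> by (simp add: \<eta>'_def)
  obtain \<delta> where \<delta>: "\<delta> > 0" "\<And>t h. 0 \<le> t \<Longrightarrow> t \<le> T \<Longrightarrow> norm h \<le> \<delta> \<Longrightarrow> nL2 (\<lambda>x. u0 t (x - h) - u0 t x) \<le> \<eta>'"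
    by (rule cont_L2_equicontinuous[OF u0c \<eta>', of T]) blast
  obtain \<rho> :: "real ^ 'n \<Rightarrow> real" where \<rho>: "test_function \<rho>" "\<And>s. \<rho> s \<ge> 0" "(LINT s|lborel. \<rho> s) = 1" "\<And>s. norm s > \<delta> \<Longrightarrow> \<rho> s = 0"
    by (rule mollifier_exists[OF \<delta>(1)]) blast
  have mol: "nL2 (\<lambda>x. conv (u0 t) \<rho> x - u0 t x) \<le> \<eta>'" if t: "0 \<le> t" "t \<le> T" for t
    using mollification_error[OF u0b[OF t(1)] test_function_bL2[OF \<rho>(1)] \<rho>(2) test_function_integrable[OF \<rho>(1)] \<rho>(3,4) \<delta>(2)[OF t]] \<eta>' by simp
  obtain R where R: "(R \<longlongrightarrow> 0) (at_right 0)" "op_bound R (residual \<rho>)" using vanishing_residual[OF \<rho>(1)] by (auto simp: vanishing_def)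
  obtain A where A: "(A \<longlongrightarrow> 0) (at_right 0)" "op_bound A (\<lambda>\<epsilon> f \<tau> x. ansatz \<rho> \<epsilon> f \<tau> x - conv f \<rho> (x - \<tau>))"
    using vanishing_ansatz[OF \<rho>(1)] by (auto simp: vanishing_def)
  \<comment> \<open>The absolute value allows \<open>nL2 (u0 t)\<close> to be replaced by its bound
    M, as \<open>A\<close> carries no sign.\<close>
  let ?A = "\<lambda>\<epsilon>. \<bar>A \<epsilon>\<bar> * M"
  define bd where "bd \<epsilon> = \<kappa> * sqrt ((\<eta>' + ?A \<epsilon>)\<^sup>2 + (R \<epsilon> * M)\<^sup>2 * T) + ?A \<epsilon> + \<eta>'" for \<epsilon>
  have "(bd \<longlongrightarrow> \<kappa> * sqrt ((\<eta>' + \<bar>0\<bar> * M)\<^sup>2 + (0 * M)\<^sup>2 * T) + \<bar>0\<bar> * M + \<eta>') (at_right 0)"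
    unfolding bd_def[abs_def] by (intro tendsto_intros A R)
  moreover have "\<kappa> * sqrt ((\<eta>' + \<bar>0\<bar> * M)\<^sup>2 + (0 * M)\<^sup>2 * T) + \<bar>0\<bar> * M + \<eta>' = \<eta> / 2"
  proof -
    have "\<kappa> * sqrt ((\<eta>' + \<bar>0\<bar> * M)\<^sup>2 + (0 * M)\<^sup>2 * T) + \<bar>0\<bar> * M + \<eta>' = (\<kappa> + 1) * \<eta>'" using \<eta>' by (simp add: distrib_right)
    also have "\<dots> = \<eta> / 2" using \<kappa> unfolding \<eta>'_def by (simp add: field_simps)
    finally show ?thesis .
  qed
  ultimately have "(bd \<longlongrightarrow> \<eta> / 2) (at_right 0)" by (simp only:)
  then have "\<forall>\<^sub>F \<epsilon> in at_right 0. bd \<epsilon> < \<eta>" by (rule order_tendstoD(2)) (use \<eta> in simp)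
  then show ?thesis
    using eventually_at_right_less[of 0]
  proof eventually_elim
    case (elim \<epsilon>)
    then have \<epsilon>: "\<epsilon> > 0" by simp
    define w where "w s = ansatz \<rho> \<epsilon> (u0 s) (s *\<^sub>R (drift /\<^sub>R \<epsilon>))" for s
    have uc: "cont_L2 (u \<epsilon>)" using u[OF \<epsilon>] by (simp add: jump_path_def)
    have wc: "cont_L2 w" unfolding w_def[abs_def] by (rule ansatz_path(1)[OF u0 \<rho>(1)])
    have corrector: "nL2 (\<lambda>x. w t x - u0 t (x - t *\<^sub>R (drift /\<^sub>R \<epsilon>))) \<le> ?A \<epsilon> + \<eta>'" if t: "0 \<le> t" "t \<le> T" for t
    proof -
      let ?\<tau> = "t *\<^sub>R (drift /\<^sub>R \<epsilon>)"
      note ut = u0b[OF t(1)]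
      have cb: "conv (u0 t) \<rho> \<in> bL2"
      proof -
        obtain C where C: "C > 0" "(\<integral>\<^sup>+s. ennreal \<bar>\<rho> s\<bar> \<partial>lborel) \<le> ennreal C" by (rule test_function_L1[OF \<rho>(1)]) blast
        then show ?thesis by (intro conv_bL2(1)[OF ut test_function_borel[OF \<rho>(1)] C(2)]) simp
      qed
      have "nL2 (\<lambda>x. w t x - conv (u0 t) \<rho> (x - ?\<tau>)) \<le> A \<epsilon> * nL2 (u0 t)"
        unfolding w_def by (rule op_boundD(2)[OF A(2) \<epsilon> ut])
      also have "\<dots> \<le> ?A \<epsilon>" by (intro mult_mono M t) auto
      finally have 1: "nL2 (\<lambda>x. w t x - conv (u0 t) \<rho> (x - ?\<tau>)) \<le> ?A \<epsilon>" .
      have 2: "nL2 (\<lambda>x. conv (u0 t) \<rho> (x - ?\<tau>) - u0 t (x - ?\<tau>)) \<le> \<eta>'"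
        using bL2_shift(2)[OF bL2_diff[OF cb ut], of ?\<tau>] mol[OF t] by simp
      show ?thesis
        using nL2_triangle_diff[OF cont_L2D(1)[OF wc t(1)] bL2_shift(1)[OF cb, of ?\<tau>] bL2_shift(1)[OF ut, of ?\<tau>]] 1 2 by linarith
    qed
    show ?case
    proof (intro allI impI)
      fix t assume t: "0 \<le> t" "t \<le> T"
      let ?\<tau> = "t *\<^sub>R (drift /\<^sub>R \<epsilon>)"
      note utb = cont_L2D(1)[OF uc t(1)] and wtb = cont_L2D(1)[OF wc t(1)] and u0tb = bL2_shift(1)[OF u0b[OF t(1)], of ?\<tau>]
      have zero: "u \<epsilon> 0 \<in> bL2" "w 0 \<in> bL2" "u0 0 \<in> bL2" using uc wc u0c by (simp_all add: cont_L2D(1))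
      have "nL2 (\<lambda>x. u \<epsilon> 0 x - w 0 x) \<le> nL2 (\<lambda>x. u \<epsilon> 0 x - u0 0 x) + nL2 (\<lambda>x. u0 0 x - w 0 x)"
        by (rule nL2_triangle_diff[OF zero(1,3,2)])
      then have z0: "nL2 (\<lambda>x. u \<epsilon> 0 x - w 0 x) \<le> \<eta>' + ?A \<epsilon>"
        using init[OF \<epsilon>] corrector[of 0] T nL2_diff_commute[of "u0 0" "w 0"] by simp
      have "c1 * (nL2 (\<lambda>x. u \<epsilon> t x - w t x))\<^sup>2 \<le> exp T * (c2 * (nL2 (\<lambda>x. u \<epsilon> 0 x - w 0 x))\<^sup>2 + c2 * (R \<epsilon> * M)\<^sup>2 * T)"
        unfolding w_def by (rule energy_comparison[OF W \<epsilon> \<rho>(1) R(2) u0 u[OF \<epsilon>] M t])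
      also have "\<dots> \<le> exp T * (c2 * (\<eta>' + ?A \<epsilon>)\<^sup>2 + c2 * (R \<epsilon> * M)\<^sup>2 * T)"
        using c z0 by (intro mult_left_mono add_right_mono power_mono) auto
      also have "\<dots> = exp T * c2 * ((\<eta>' + ?A \<epsilon>)\<^sup>2 + (R \<epsilon> * M)\<^sup>2 * T)" by (simp add: algebra_simps)
      finally have "(nL2 (\<lambda>x. u \<epsilon> t x - w t x))\<^sup>2 \<le> exp T * c2 / c1 * ((\<eta>' + ?A \<epsilon>)\<^sup>2 + (R \<epsilon> * M)\<^sup>2 * T)"
        using c by (simp add: field_simps)
      then have "nL2 (\<lambda>x. u \<epsilon> t x - w t x) \<le> \<kappa> * sqrt ((\<eta>' + ?A \<epsilon>)\<^sup>2 + (R \<epsilon> * M)\<^sup>2 * T)"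
        unfolding \<kappa>_def real_sqrt_mult[symmetric] by (rule real_le_rsqrt)
      then have "nL2 (\<lambda>x. u \<epsilon> t x - u0 t (x - ?\<tau>)) \<le> bd \<epsilon>"
        unfolding bd_def using nL2_triangle_diff[OF utb wtb u0tb] corrector[OF t] by linarith
      also have "nL2 (\<lambda>x. u \<epsilon> t x - u0 t (x - ?\<tau>)) = nL2 (\<lambda>x. u \<epsilon> t (x + ?\<tau>) - u0 t x)"
        using bL2_shift(4)[OF bL2_diff[OF utb u0tb], of ?\<tau>] by simp
      finally show "nL2 (\<lambda>x. u \<epsilon> t (x + ?\<tau>) - u0 t x) \<le> \<eta>" using elim(1) by linarith
    qed
  qed
qed

end

subsection \<open>Borel representatives\<close>

lemma AE_lebesgue_iff: "(AE x in lebesgue. P x) \<longleftrightarrow> (AE x in lborel. P x)"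
  by (rule AE_completion_iff)

lemma measurable_lebesgue_AE:
  fixes f f' :: "'a::euclidean_space \<Rightarrow> real"
  assumes "f' \<in> borel_measurable borel" "AE x in lborel. f x = f' x" shows "f \<in> borel_measurable lebesgue"
proof (rule borel_measurable_AE)
  show "f' \<in> borel_measurable lebesgue" using assms(1) by (intro measurable_completion) simp
  show "AE x in lebesgue. f' x = f x" using assms(2) unfolding AE_lebesgue_iff by eventually_elim simp
qed

lemma integral_lebesgue_AE:
  fixes f f' :: "'a::euclidean_space \<Rightarrow> real"
  assumes f': "f' \<in> borel_measurable borel" and ae: "AE x in lborel. f x = f' x"
  shows "(LINT x|lebesgue. f x) = (LINT x|lborel. f' x)"
proof -
  have "(LINT x|lebesgue. f x) = (LINT x|lebesgue. f' x)"
    using measurable_lebesgue_AE[OF f' ae] measurable_completion[of f' lborel borel] f' ae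
    by (intro integral_cong_AE) (simp_all add: AE_lebesgue_iff)
  also have "\<dots> = (LINT x|lborel. f' x)" by (rule integral_completion) (use f' in simp)
  finally show ?thesis .
qed

lemma integrable_lebesgue_AE:
  fixes f f' :: "'a::euclidean_space \<Rightarrow> real"
  assumes f': "f' \<in> borel_measurable borel" and ae: "AE x in lborel. f x = f' x"
  shows "integrable lebesgue f \<longleftrightarrow> integrable lborel f'"
proof -
  have "integrable lebesgue f \<longleftrightarrow> integrable lebesgue f'"
    using measurable_lebesgue_AE[OF f' ae] measurable_completion[of f' lborel borel] f' ae
    by (intro integrable_cong_AE) (simp_all add: AE_lebesgue_iff)
  also have "\<dots> \<longleftrightarrow> integrable lborel f'" by (rule integrable_completion) (use f' in simp)
  finally show ?thesis .
qed

lemma borel_representative: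
  fixes f :: "'a::euclidean_space \<Rightarrow> real"
  assumes "f \<in> borel_measurable lebesgue" obtains f' where "f' \<in> borel_measurable borel" "AE x in lborel. f x = f' x"
proof -
  obtain g where "g \<in> borel_measurable lborel" "AE x in lborel. f x = g x"
    using completion_ex_borel_measurable_real[OF assms] by blast
  then show thesis by (intro that[of g]) auto
qed

lemma L2_representative:
  assumes f: "f \<in> L2_space" obtains f' where "f' \<in> bL2" "AE x in lborel. f x = f' x"
proof -
  obtain f' where f': "f' \<in> borel_measurable borel" "AE x in lborel. f x = f' x"
    by (rule borel_representative[of f]) (use f in \<open>auto simp: L2_space_def\<close>)
  have "integrable lborel (\<lambda>x. (f' x)\<^sup>2)"
  proof (subst integrable_lebesgue_AE[of "\<lambda>x. (f' x)\<^sup>2" "\<lambda>x. (f x)\<^sup>2", symmetric])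
    show "AE x in lborel. (f x)\<^sup>2 = (f' x)\<^sup>2" using f'(2) by eventually_elim simp
  qed (use f f' in \<open>auto simp: L2_space_def\<close>)
  then show thesis using f' by (intro that[of f']) (auto simp: bL2_def)
qed

lemma L2_norm_representative:
  assumes f': "f' \<in> borel_measurable borel" and ae: "AE x in lborel. f x = f' x" shows "L2_norm f = nL2 f'"
proof -
  have "(LINT x|lebesgue. (f x)\<^sup>2) = (LINT x|lborel. (f' x)\<^sup>2)"
  proof (rule integral_lebesgue_AE)
    show "AE x in lborel. (f x)\<^sup>2 = (f' x)\<^sup>2" using ae by eventually_elim simp
  qed (use f' in measurable)
  then show ?thesis by (simp add: L2_norm_def nL2_def)
qed

text \<open>Representatives are chosen separately for each time. Continuity and differentiability in
  L2 compare only two times and one derivative in each norm, so just finitely many null sets occur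
  at once and no choice has to be coherent in time.\<close>

lemma path_representative:
  fixes u :: "real \<Rightarrow> real ^ 'n \<Rightarrow> real"
  assumes u: "solves_cauchy_problem A \<phi> u"
  obtains u' where "cont_L2 u'" "\<And>t. t \<ge> 0 \<Longrightarrow> AE x in lborel. u t x = u' t x" "AE x in lborel. \<phi> x = u' 0 x"
    "\<And>t. t > 0 \<Longrightarrow> \<exists>v v'. A (u t) v \<and> v \<in> L2_space \<and> (AE x in lborel. v x = v' x) \<and> deriv_L2 u' v' t"
proof -
  have "\<exists>f'. f' \<in> bL2 \<and> (AE x in lborel. u t x = f' x)" if "t \<ge> 0" for t
    using L2_representative[of "u t"] u that unfolding solves_cauchy_problem_def by metis
  then obtain u' where u': "\<And>t. t \<ge> 0 \<Longrightarrow> u' t \<in> bL2" "\<And>t. t \<ge> 0 \<Longrightarrow> AE x in lborel. u t x = u' t x"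
    by metis
  note um = bL2_measurable[OF u'(1)]
  show thesis
  proof (rule that[OF _ u'(2)])
    show "cont_L2 u'"
      unfolding cont_L2_def
    proof (intro conjI allI impI u'(1))
      fix t :: real assume t: "t \<ge> 0"
      have "((\<lambda>s. L2_norm (\<lambda>x. u s x - u t x)) \<longlongrightarrow> 0) (at t within {0..})"
        using u t by (simp add: solves_cauchy_problem_def)
      moreover
      have "L2_norm (\<lambda>x. u s x - u t x) = nL2 (\<lambda>x. u' s x - u' t x)" if "s \<ge> 0" for s
      proof (rule L2_norm_representative)
        show "AE x in lborel. u s x - u t x = u' s x - u' t x"
          using u'(2)[OF that] u'(2)[OF t] by eventually_elim simp
      qed (intro borel_measurable_diff um that t)
      then have "\<forall>\<^sub>F s in at t within {0..}. L2_norm (\<lambda>x. u s x - u t x) = nL2 (\<lambda>x. u' s x - u' t x)"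
        by (simp add: eventually_at_filter)
      ultimately show "((\<lambda>s. nL2 (\<lambda>x. u' s x - u' t x)) \<longlongrightarrow> 0) (at t within {0..})"
        by (rule Lim_transform_eventually)
    qed
    have "AE x in lborel. u 0 x = \<phi> x" using u by (simp add: solves_cauchy_problem_def AE_lebesgue_iff)
    then show "AE x in lborel. \<phi> x = u' 0 x" using u'(2)[OF order_refl] by eventually_elim simp
    fix t :: real assume t: "t > 0"
    obtain v where v: "A (u t) v" "v \<in> L2_space" "((\<lambda>s. L2_norm (\<lambda>x. (u s x - u t x) / (s - t) - v x)) \<longlongrightarrow> 0) (at t)"
      using u t by (auto simp: solves_cauchy_problem_def has_L2_derivative_def)
    obtain v' where v': "v' \<in> bL2" "AE x in lborel. v x = v' x" by (rule L2_representative[OF v(2)]) blast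
    have t0: "t \<ge> 0" using t by simp
    have eq: "L2_norm (\<lambda>x. (u s x - u t x) / (s - t) - v x) = nL2 (\<lambda>x. (u' s x - u' t x) / (s - t) - v' x)" if "s \<ge> 0" for s
    proof (rule L2_norm_representative)
      show "AE x in lborel. (u s x - u t x) / (s - t) - v x = (u' s x - u' t x) / (s - t) - v' x"
        using u'(2)[OF that] u'(2)[OF t0] v'(2) by eventually_elim simp
    qed (rule bL2_measurable[OF bL2_quotient[OF u'(1)[OF that] u'(1)[OF t0] v'(1)]])
    have "\<forall>\<^sub>F s in at t. L2_norm (\<lambda>x. (u s x - u t x) / (s - t) - v x) = nL2 (\<lambda>x. (u' s x - u' t x) / (s - t) - v' x)"
      by (rule eventually_mono[OF eventually_at_nonneg[OF t]]) (rule eq)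
    then have "((\<lambda>s. nL2 (\<lambda>x. (u' s x - u' t x) / (s - t) - v' x)) \<longlongrightarrow> 0) (at t)"
      by (rule Lim_transform_eventually[OF v(3)])
    then have d: "deriv_L2 u' v' t" using u'(1) t v'(1) by (simp add: deriv_L2_def)
    then show "\<exists>v v'. A (u t) v \<and> v \<in> L2_space \<and> (AE x in lborel. v x = v' x) \<and> deriv_L2 u' v' t"
      by (intro exI[of _ v] exI[of _ v'] conjI v(1,2) v'(2) d)
  qed
qed

lemma lattice_part_add: "k \<in> integer_lattice \<Longrightarrow> lattice_part (x + k) = lattice_part x + k"
proof (rule lattice_part_unique[symmetric])
  assume k: "k \<in> integer_lattice"
  show "lattice_part x + k \<in> integer_lattice" using k lattice_part(1)[of x] by (simp add: integer_lattice_def)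
  show "x + k - (lattice_part x + k) \<in> unit_cell" using lattice_part(2)[of x] by simp
qed

text \<open>A Borel function equal to \<mu> almost everywhere is periodic and bounded only almost
  everywhere. Taking its values on the cell through \<open>lattice_part\<close> restores periodicity
  at every point, and clipping restores the bounds. Agreement with \<mu> survives because only
  countably many lattice translates of the exceptional null set are involved.\<close>

lemma periodic_representative:
  fixes \<mu> :: "real ^ 'n \<Rightarrow> real ^ 'n \<Rightarrow> real"
  assumes \<mu>: "(\<lambda>(x, y). \<mu> x y) \<in> borel_measurable lebesgue"
    and per: "\<And>x y k. k \<in> integer_lattice \<Longrightarrow> \<mu> (x + k) y = \<mu> x y" "\<And>x y k. k \<in> integer_lattice \<Longrightarrow> \<mu> x (y + k) = \<mu> x y"
    and bounds: "\<And>x y. \<alpha>\<^sub>1 \<le> \<mu> x y" "\<And>x y. \<mu> x y \<le> \<alpha>\<^sub>2"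
  obtains \<mu>' where "(\<lambda>(x, y). \<mu>' x y) \<in> borel_measurable (borel \<Otimes>\<^sub>M borel)"
    "\<And>x y k. k \<in> integer_lattice \<Longrightarrow> \<mu>' (x + k) y = \<mu>' x y" "\<And>x y k. k \<in> integer_lattice \<Longrightarrow> \<mu>' x (y + k) = \<mu>' x y"
    "\<And>x y. \<alpha>\<^sub>1 \<le> \<mu>' x y" "\<And>x y. \<mu>' x y \<le> \<alpha>\<^sub>2" "AE x in lborel. AE y in lborel. \<mu> x y = \<mu>' x y"
proof -
  obtain m where m: "m \<in> borel_measurable borel" "AE p in lborel. (case p of (x, y) \<Rightarrow> \<mu> x y) = m p"
    by (rule borel_representative[OF \<mu>]) blast
  have [measurable]: "m \<in> borel_measurable (borel \<Otimes>\<^sub>M borel)" using m(1) by (simp add: borel_prod)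
  define \<mu>' where "\<mu>' x y = max \<alpha>\<^sub>1 (min \<alpha>\<^sub>2 (m (x - lattice_part x, y - lattice_part y)))" for x y
  obtain e :: "nat \<Rightarrow> real ^ 'n" where e: "bij_betw e UNIV integer_lattice" by (rule integer_lattice_enumeration)
  have "AE p in lborel. \<forall>i j. (case p + (e i, e j) of (x, y) \<Rightarrow> \<mu> x y) = m (p + (e i, e j))"
    unfolding AE_all_countable
  proof (intro allI)
    fix i j
    show "AE p in lborel. (case p + (e i, e j) of (x, y) \<Rightarrow> \<mu> x y) = m (p + (e i, e j))"
      using AE_lborel_affine[OF m(2), of 1 "(e i, e j)"] by (simp add: add.commute)
  qed
  then have "AE p in lborel. \<mu> (fst p) (snd p) = \<mu>' (fst p) (snd p)"
  proof eventually_elim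
    case (elim p)
    obtain x y where p: "p = (x, y)" by (cases p)
    have "- lattice_part x \<in> integer_lattice" "- lattice_part y \<in> integer_lattice"
      by (intro integer_lattice_uminus lattice_part)+
    then obtain i j where ij: "e i = - lattice_part x" "e j = - lattice_part y"
      using e by (metis bij_betw_imp_surj_on imageE)
    have "\<mu> (x + - lattice_part x) (y + - lattice_part y) = m (x + - lattice_part x, y + - lattice_part y)"
      using elim[rule_format, of i j] by (simp add: p ij)
    moreover have "\<mu> (x + - lattice_part x) (y + - lattice_part y) = \<mu> x y"
      by (simp only: per integer_lattice_uminus lattice_part)
    ultimately have "m (x - lattice_part x, y - lattice_part y) = \<mu> x y" by simp
    then show ?case using bounds[of x y] by (simp add: p \<mu>'_def)
  qed
  then have "AE p in lborel \<Otimes>\<^sub>M lborel. \<mu> (fst p) (snd p) = \<mu>' (fst p) (snd p)" unfolding lborel_prod .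
  from lborel_pair.AE_pair[OF this] have ae: "AE x in lborel. AE y in lborel. \<mu> x y = \<mu>' x y" by simp
  show thesis
  proof (rule that[OF _ _ _ _ _ ae])
    have "(\<lambda>p. \<mu>' (fst p) (snd p)) \<in> borel_measurable (borel \<Otimes>\<^sub>M borel)" unfolding \<mu>'_def by measurable
    then show "(\<lambda>(x, y). \<mu>' x y) \<in> borel_measurable (borel \<Otimes>\<^sub>M borel)" by (simp add: case_prod_beta')
    have "\<alpha>\<^sub>1 \<le> \<alpha>\<^sub>2" using bounds[of undefined undefined] by linarith
    then show "\<alpha>\<^sub>1 \<le> \<mu>' x y" "\<mu>' x y \<le> \<alpha>\<^sub>2" for x y by (simp_all add: \<mu>'_def)
  qed (simp_all add: \<mu>'_def lattice_part_add)
qed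

lemma periodization_AE:
  fixes a a' :: "real ^ 'n \<Rightarrow> real"
  assumes "AE z in lborel. a z = a' z" shows "AE \<eta> in lborel. periodization a \<eta> = periodization a' \<eta>"
proof -
  obtain e :: "nat \<Rightarrow> real ^ 'n" where e: "bij_betw e UNIV integer_lattice" by (rule integer_lattice_enumeration)
  have "AE \<eta> in lborel. \<forall>i. a (\<eta> + e i) = a' (\<eta> + e i)"
    unfolding AE_all_countable
  proof
    fix i
    show "AE \<eta> in lborel. a (\<eta> + e i) = a' (\<eta> + e i)"
      using AE_lborel_affine[OF assms, of 1 "e i"] by (simp add: add.commute)
  qed
  then show ?thesis by eventually_elim (simp add: periodization_eq_suminf[OF e])
qed

lemma kernel_representative:
  fixes a :: "real ^ 'n \<Rightarrow> real" and \<mu> :: "real ^ 'n \<Rightarrow> real ^ 'n \<Rightarrow> real"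
  assumes a: "integrable lebesgue a" "\<And>z. a z \<ge> 0" "(\<integral>\<^sup>+\<eta>\<in>unit_cell. (periodization a \<eta>)\<^sup>2 \<partial>lebesgue) < \<infinity>"
    "(LINT z|lebesgue. a z) > 0" "integrable lebesgue (\<lambda>z. (norm z)\<^sup>2 * a z)"
    and \<mu>: "(\<lambda>(x, y). \<mu> x y) \<in> borel_measurable lebesgue"
      "\<And>x y k. k \<in> integer_lattice \<Longrightarrow> \<mu> (x + k) y = \<mu> x y" "\<And>x y k. k \<in> integer_lattice \<Longrightarrow> \<mu> x (y + k) = \<mu> x y"
      "0 < \<alpha>\<^sub>1" "\<And>x y. \<alpha>\<^sub>1 \<le> \<mu> x y" "\<And>x y. \<mu> x y \<le> \<alpha>\<^sub>2"
  obtains a' \<mu>' where "periodic_kernel a' \<mu>' \<alpha>\<^sub>1 \<alpha>\<^sub>2" "AE z in lborel. a z = a' z" "AE x in lborel. AE y in lborel. \<mu> x y = \<mu>' x y"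
proof -
  show thesis
  proof (rule periodic_representative[OF \<mu>(1-3,5,6)])
    fix \<mu>' assume \<mu>': "(\<lambda>(x, y). \<mu>' x y) \<in> borel_measurable (borel \<Otimes>\<^sub>M borel)"
    "\<And>x y k. k \<in> integer_lattice \<Longrightarrow> \<mu>' (x + k) y = \<mu>' x y" "\<And>x y k. k \<in> integer_lattice \<Longrightarrow> \<mu>' x (y + k) = \<mu>' x y"
    "\<And>x y. \<alpha>\<^sub>1 \<le> \<mu>' x y" "\<And>x y. \<mu>' x y \<le> \<alpha>\<^sub>2" "AE x in lborel. AE y in lborel. \<mu> x y = \<mu>' x y"
    obtain b where b: "b \<in> borel_measurable borel" "AE z in lborel. a z = b z"
      by (rule borel_representative[OF borel_measurable_integrable[OF a(1)]]) blast
    define a' where "a' z = max 0 (b z)" for z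
    have [measurable]: "a' \<in> borel_measurable borel" using b(1) unfolding a'_def by measurable
    have ae: "AE z in lborel. a z = a' z" using b(2)
    proof eventually_elim
      case (elim z) then show ?case using a(2)[of z] by (simp add: a'_def)
    qed
    have "periodic_kernel a' \<mu>' \<alpha>\<^sub>1 \<alpha>\<^sub>2"
    proof
      show "integrable lborel a'" using integrable_lebesgue_AE[OF _ ae] a(1) by simp
      show "a' z \<ge> 0" for z by (simp add: a'_def)
      show "(LINT z|lborel. a' z) > 0" using integral_lebesgue_AE[OF _ ae] a(4) by simp
      have "AE z in lborel. (norm z)\<^sup>2 * a z = (norm z)\<^sup>2 * a' z" using ae by eventually_elim simp
      then show "integrable lborel (\<lambda>z. (norm z)\<^sup>2 * a' z)" using integrable_lebesgue_AE[of "\<lambda>z. (norm z)\<^sup>2 * a' z" "\<lambda>z. (norm z)\<^sup>2 * a z"] a(5) by simp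
      have "(\<integral>\<^sup>+\<eta>\<in>unit_cell. (periodization a' \<eta>)\<^sup>2 \<partial>lborel) = (\<integral>\<^sup>+\<eta>\<in>unit_cell. (periodization a \<eta>)\<^sup>2 \<partial>lborel)"
        using periodization_AE[OF ae] by (intro nn_integral_cong_AE) (auto elim!: eventually_mono)
      then show "(\<integral>\<^sup>+\<eta>\<in>unit_cell. (periodization a' \<eta>)\<^sup>2 \<partial>lborel) < \<infinity>" using a(3) by (simp add: nn_integral_completion)
    qed (fact \<mu>' \<mu>(4))+
    then show ?thesis by (rule that[OF _ ae \<mu>'(6)])
  qed
qed

lemma nonlocal_operator_AE:
  fixes a a' :: "real ^ 'n \<Rightarrow> real"
  assumes a: "AE z in lborel. a z = a' z" and \<mu>: "AE x in lborel. AE y in lborel. \<mu> x y = \<mu>' x y"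
    and f: "AE x in lborel. f x = f' x" and \<epsilon>: "\<epsilon> > 0"
    and [measurable]: "a' \<in> borel_measurable borel" "(\<lambda>(x, y). \<mu>' x y) \<in> borel_measurable (borel \<Otimes>\<^sub>M borel)" "f' \<in> borel_measurable borel"
  shows "AE x in lborel. nonlocal_operator a \<mu> \<epsilon> f x = nonlocal_operator a' \<mu>' \<epsilon> f' x"
proof -
  have \<mu>2: "AE x in lborel. AE y in lborel. \<mu> (x /\<^sub>R \<epsilon>) (y /\<^sub>R \<epsilon>) = \<mu>' (x /\<^sub>R \<epsilon>) (y /\<^sub>R \<epsilon>)"
  proof -
    have "AE x in lborel. AE y in lborel. \<mu> (0 + x /\<^sub>R \<epsilon>) y = \<mu>' (0 + x /\<^sub>R \<epsilon>) y"
      by (rule AE_lborel_affine[OF \<mu>]) (use \<epsilon> in simp)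
    then show ?thesis
    proof eventually_elim
      case (elim x)
      then show ?case using AE_lborel_affine[of "\<lambda>y. \<mu> (x /\<^sub>R \<epsilon>) y = \<mu>' (x /\<^sub>R \<epsilon>) y" "inverse \<epsilon>" 0] \<epsilon> by simp
    qed
  qed
  show ?thesis using \<mu>2 f
  proof eventually_elim
    case (elim x)
    then have fx: "f x = f' x" by simp
    have "AE y in lborel. a (x /\<^sub>R \<epsilon> + (- inverse \<epsilon>) *\<^sub>R y) = a' (x /\<^sub>R \<epsilon> + (- inverse \<epsilon>) *\<^sub>R y)"
      by (rule AE_lborel_affine[OF a]) (use \<epsilon> in simp)
    then have ay: "AE y in lborel. a ((x - y) /\<^sub>R \<epsilon>) = a' ((x - y) /\<^sub>R \<epsilon>)" by (simp add: scaleR_diff_right)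
    let ?h = "\<lambda>y. a' ((x - y) /\<^sub>R \<epsilon>) * \<mu>' (x /\<^sub>R \<epsilon>) (y /\<^sub>R \<epsilon>) * (f' y - f' x)"
    have "(\<lambda>y. \<mu>' (x /\<^sub>R \<epsilon>) (y /\<^sub>R \<epsilon>)) \<in> borel_measurable borel" by measurable
    then have m: "?h \<in> borel_measurable borel" by measurable
    have "AE y in lborel. a ((x - y) /\<^sub>R \<epsilon>) * \<mu> (x /\<^sub>R \<epsilon>) (y /\<^sub>R \<epsilon>) * (f y - f x) = ?h y"
      using ay elim(1) f
    proof eventually_elim
      case (elim y) then show ?case using fx by simp
    qed
    from integral_lebesgue_AE[OF m this]
    have "(LINT y|lebesgue. a ((x - y) /\<^sub>R \<epsilon>) * \<mu> (x /\<^sub>R \<epsilon>) (y /\<^sub>R \<epsilon>) * (f y - f x)) = (LINT y|lebesgue. ?h y)"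
      using integral_completion[of ?h lborel] m by simp
    then show ?case by (simp add: nonlocal_operator_def)
  qed
qed

text \<open>The two weak derivatives are moved onto \<psi> one at a time, direction i first, as
  \<open>D i j\<close> is a derivative of \<open>G j\<close>. The convolutions do not see null sets,
  so the identity holds at every x.\<close>

lemma diffusion_graph_conv:
  fixes f v :: "real ^ 'n \<Rightarrow> real"
  assumes g: "diffusion_graph \<Theta> f v" and f': "f' \<in> bL2" "AE x in lborel. f x = f' x"
    and v': "v' \<in> bL2" "AE x in lborel. v x = v' x" and \<psi>: "test_function \<psi>"
  shows "conv v' \<psi> x = (\<Sum>i\<in>UNIV. \<Sum>j\<in>UNIV. \<Theta> $ i $ j * conv f' (partial_deriv j (partial_deriv i \<psi>)) x)"
proof -
  obtain G D where f: "f \<in> L2_space" and G: "\<And>j. G j \<in> L2_space" "\<And>j. weak_partial_deriv j f (G j)"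
    and D: "\<And>i j. D i j \<in> L2_space" "\<And>i j. weak_partial_deriv i (G j) (D i j)"
    and v: "v = (\<lambda>x. \<Sum>i\<in>UNIV. \<Sum>j\<in>UNIV. \<Theta> $ i $ j * D i j x)"
    using g unfolding diffusion_graph_def by blast
  have "\<exists>g. g \<in> bL2 \<and> (AE x in lborel. G j x = g x)" for j by (rule L2_representative[OF G(1)[of j]]) blast
  then obtain G' where G': "\<And>j. G' j \<in> bL2" "\<And>j. AE x in lborel. G j x = G' j x" by metis
  have "\<exists>g. g \<in> bL2 \<and> (AE x in lborel. D i j x = g x)" for i j by (rule L2_representative[OF D(1)[of i j]]) blast
  then obtain D' where D': "\<And>i j. D' i j \<in> bL2" "\<And>i j. AE x in lborel. D i j x = D' i j x" by metis
  have m: "g \<in> L2_space \<Longrightarrow> g \<in> borel_measurable lebesgue" for g :: "real ^ 'n \<Rightarrow> real" by (simp add: L2_space_def)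
  have c: "conv (D' i j) \<psi> x = conv f' (partial_deriv j (partial_deriv i \<psi>)) x" for i j
  proof -
    have "conv (D' i j) \<psi> x = conv (G' j) (partial_deriv i \<psi>) x"
      using G' D' m[OF G(1)] m[OF D(1)] by (intro weak_partial_deriv_conv[OF D(2)[of i j] \<psi>]) (simp_all add: AE_lebesgue_iff bL2_measurable)
    also have "\<dots> = conv f' (partial_deriv j (partial_deriv i \<psi>)) x"
      using G' f' m[OF G(1)] m[OF f] by (intro weak_partial_deriv_conv[OF G(2)[of j] test_function_partial[OF \<psi>]]) (simp_all add: AE_lebesgue_iff bL2_measurable)
    finally show ?thesis .
  qed
  let ?V = "\<lambda>x. \<Sum>i\<in>UNIV. \<Sum>j\<in>UNIV. \<Theta> $ i $ j * D' i j x"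
  have "AE x in lborel. \<forall>i j. D i j x = D' i j x" unfolding AE_all_countable using D'(2) by blast
  then have ae: "AE x in lborel. v' x = ?V x" using v'(2) by eventually_elim (simp add: v)
  have \<psi>b: "\<psi> \<in> bL2" by (rule test_function_bL2[OF \<psi>])
  have bb: "(\<lambda>y. \<psi> (x - y)) \<in> bL2" by (rule bL2_reflect[OF \<psi>b])
  have i: "integrable lborel (\<lambda>y. D' i j y * \<psi> (x - y))" for i j by (rule bL2_mult_integrable[OF D'(1) bb])
  have "conv v' \<psi> x = conv ?V \<psi> x"
    unfolding conv_def using bL2_measurable[OF v'(1)] bL2_measurable[OF D'(1)] bL2_measurable[OF bb] ae
    by (intro integral_cong_AE) (auto elim!: eventually_mono)
  also have "\<dots> = (LINT y|lborel. (\<Sum>i\<in>UNIV. \<Sum>j\<in>UNIV. \<Theta> $ i $ j * (D' i j y * \<psi> (x - y))))"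
    by (simp add: conv_def sum_distrib_right mult.assoc)
  also have "\<dots> = (\<Sum>i\<in>UNIV. \<Sum>j\<in>UNIV. \<Theta> $ i $ j * conv (D' i j) \<psi> x)"
    using i by (simp add: conv_def)
  finally show ?thesis by (simp add: c)
qed

section \<open>The essential supremum in time\<close>

text \<open>A pointwise bound controls the essential supremum only of a measurable function, and
  continuity in time provides that measurability. Positive length of the time interval gives the
  lower bound 0, since on a null space the essential supremum would be the least element.\<close>

lemma tendsto_0_Linf_L2_norm:
  fixes w :: "real \<Rightarrow> real \<Rightarrow> real ^ 'n \<Rightarrow> real"
  assumes cont: "\<And>\<epsilon>. \<epsilon> > 0 \<Longrightarrow> continuous_on {0<..<T} (\<lambda>t. L2_norm (w \<epsilon> t))" and T: "T > 0"
    and small: "\<And>\<eta>. \<eta> > 0 \<Longrightarrow> \<forall>\<^sub>F \<epsilon> in at_right 0. \<forall>t. 0 < t \<longrightarrow> t < T \<longrightarrow> L2_norm (w \<epsilon> t) \<le> \<eta>"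
  shows "((\<lambda>\<epsilon>. Linf_L2_norm T (w \<epsilon>)) \<longlongrightarrow> 0) (at_right 0)"
proof -
  let ?M = "restrict_space lebesgue {0<..<T}"
  have m: "(\<lambda>t. ereal (L2_norm (w \<epsilon> t))) \<in> borel_measurable ?M" if "\<epsilon> > 0" for \<epsilon>
  proof -
    have "(\<lambda>t. L2_norm (w \<epsilon> t)) \<in> borel_measurable (restrict_space borel {0<..<T})"
      by (rule borel_measurable_continuous_on_restrict[OF cont[OF that]])
    then have "(\<lambda>t. L2_norm (w \<epsilon> t)) \<in> borel_measurable ?M"
      by (auto simp: measurable_def space_restrict_space sets_restrict_space intro!: sets_completionI_sets)
    then show ?thesis by measurable
  qed
  have "emeasure ?M (space ?M) = ennreal T"
    using T by (simp add: space_restrict_space emeasure_restrict_space)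
  then have M0: "emeasure ?M (space ?M) \<noteq> 0" using T by simp
  have pos: "Linf_L2_norm T (w \<epsilon>) \<ge> 0" for \<epsilon>
  proof -
    have "esssup ?M (\<lambda>t. 0 :: ereal) \<le> Linf_L2_norm T (w \<epsilon>)"
      unfolding Linf_L2_norm_def by (rule esssup_mono) (simp_all add: L2_norm_def)
    then show ?thesis using esssup_const[OF M0, of "0 :: ereal"] by simp
  qed
  show ?thesis
  proof (rule order_tendstoI)
    fix b :: ereal assume "b < 0"
    then show "\<forall>\<^sub>F \<epsilon> in at_right 0. b < Linf_L2_norm T (w \<epsilon>)" using pos by (intro always_eventually) (auto intro: less_le_trans)
  next
    fix b :: ereal assume "0 < b"
    then obtain \<eta> where \<eta>: "0 < ereal \<eta>" "ereal \<eta> < b" using ereal_dense2 by blast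
    then have "\<eta> > 0" by simp
    from small[OF this] eventually_at_right_less[of 0]
    show "\<forall>\<^sub>F \<epsilon> in at_right 0. Linf_L2_norm T (w \<epsilon>) < b"
    proof eventually_elim
      case (elim \<epsilon>)
      have "Linf_L2_norm T (w \<epsilon>) \<le> ereal \<eta>"
        unfolding Linf_L2_norm_def
      proof (rule esssup_I[OF m[OF elim(2)]])
        show "AE t in ?M. ereal (L2_norm (w \<epsilon> t)) \<le> ereal \<eta>" using elim(1) by (intro AE_I2) (simp add: space_restrict_space)
      qed
      then show ?case using \<eta>(2) by (rule le_less_trans)
    qed
  qed
qed

lemma choice_positive:
  fixes P :: "real \<Rightarrow> 'a \<Rightarrow> bool"
  assumes "\<And>\<epsilon>. \<epsilon> > 0 \<Longrightarrow> \<exists>U. P \<epsilon> U" shows "\<exists>U. \<forall>\<epsilon>>0. P \<epsilon> (U \<epsilon>)"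
  using assms by metis

theorem theorem2p1:
  fixes a :: "real ^ 'n \<Rightarrow> real"
    and \<mu> :: "real ^ 'n \<Rightarrow> real ^ 'n \<Rightarrow> real"
    and a\<^sub>1 \<alpha>\<^sub>1 \<alpha>\<^sub>2 :: real
  assumes a_L1: "integrable lebesgue a"
    and a_nonneg: "\<And>z. a z \<ge> 0"
    and a_periodization_L2: "(\<integral>\<^sup>+\<eta>\<in>unit_cell. (periodization a \<eta>)\<^sup>2 \<partial>lebesgue) < \<infinity>"
    and a_mass: "(LINT z|lebesgue. a z) = a\<^sub>1" "a\<^sub>1 > 0"
    and a_second_moment: "integrable lebesgue (\<lambda>z. (norm z)\<^sup>2 * a z)"
    and \<mu>_measurable: "(\<lambda>(x, y). \<mu> x y) \<in> borel_measurable lebesgue"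
    and \<mu>_periodic:
      "\<And>x y k. k \<in> integer_lattice \<Longrightarrow> \<mu> (x + k) y = \<mu> x y"
      "\<And>x y k. k \<in> integer_lattice \<Longrightarrow> \<mu> x (y + k) = \<mu> x y"
    and \<mu>_bounds: "0 < \<alpha>\<^sub>1" "\<And>x y. \<alpha>\<^sub>1 \<le> \<mu> x y" "\<And>x y. \<mu> x y \<le> \<alpha>\<^sub>2"
  shows "\<exists>(b :: real ^ 'n) (\<Theta> :: real ^ 'n ^ 'n). positive_definite \<Theta> \<and>
    (\<forall>\<phi> \<in> L2_space. \<forall>u\<^sub>\<epsilon> u\<^sub>0.
       (\<forall>\<epsilon>>0. solves_cauchy_problem (\<lambda>f g. g = nonlocal_operator a \<mu> \<epsilon> f) \<phi> (u\<^sub>\<epsilon> \<epsilon>)) \<longrightarrow>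
       solves_cauchy_problem (diffusion_graph \<Theta>) \<phi> u\<^sub>0 \<longrightarrow>
       (\<forall>T>0. ((\<lambda>\<epsilon>. Linf_L2_norm T (\<lambda>t x. u\<^sub>\<epsilon> \<epsilon> t (x + (t / \<epsilon>) *\<^sub>R b) - u\<^sub>0 t x)) \<longlongrightarrow> 0)
                (at_right 0)))"
proof -
  obtain a' \<mu>' where kernel: "periodic_kernel a' \<mu>' \<alpha>\<^sub>1 \<alpha>\<^sub>2" and a': "AE z in lborel. a z = a' z"
    and \<mu>': "AE x in lborel. AE y in lborel. \<mu> x y = \<mu>' x y"
    by (rule kernel_representative[OF a_L1 a_nonneg a_periodization_L2 _ a_second_moment \<mu>_measurable \<mu>_periodic \<mu>_bounds])
      (use a_mass in simp)
  \<comment> \<open>From here on \<open>drift\<close> and \<open>Theta\<close> are determined by the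
    kernel alone, so the same pair serves every initial function and every family of
    solutions.\<close>
  interpret periodic_kernel a' \<mu>' \<alpha>\<^sub>1 \<alpha>\<^sub>2 by (rule kernel)
  have "((\<lambda>\<epsilon>. Linf_L2_norm T (\<lambda>t x. u \<epsilon> t (x + (t / \<epsilon>) *\<^sub>R drift) - u0 t x)) \<longlongrightarrow> 0) (at_right 0)"
    if u: "\<forall>\<epsilon>>0. solves_cauchy_problem (\<lambda>f g. g = nonlocal_operator a \<mu> \<epsilon> f) \<phi> (u \<epsilon>)"
      and u0: "solves_cauchy_problem (diffusion_graph Theta) \<phi> u0" and T: "T > 0" for u u0 \<phi> T
  proof -
    obtain U0 where U0: "cont_L2 U0" "\<And>t. t \<ge> 0 \<Longrightarrow> AE x in lborel. u0 t x = U0 t x" "AE x in lborel. \<phi> x = U0 0 x"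
      "\<And>t. t > 0 \<Longrightarrow> \<exists>v v'. diffusion_graph Theta (u0 t) v \<and> v \<in> L2_space \<and> (AE x in lborel. v x = v' x) \<and> deriv_L2 U0 v' t"
      by (rule path_representative[OF u0]) blast
    have heat: "heat_path U0"
      unfolding heat_path_def
    proof (intro conjI allI impI U0(1))
      fix t :: real assume t: "t > 0"
      obtain v v' where v: "diffusion_graph Theta (u0 t) v" "AE x in lborel. v x = v' x" "deriv_L2 U0 v' t" using U0(4)[OF t] by blast
      have U0t: "U0 t \<in> bL2" by (rule cont_L2D(1)[OF U0(1)]) (use t in simp)
      have ae: "AE x in lborel. u0 t x = U0 t x" by (rule U0(2)) (use t in simp)
      have "conv v' \<psi> x = conv (U0 t) (heat \<psi>) x" if "test_function \<psi>" for \<psi> x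
        unfolding conv_heat[OF that U0t] by (rule diffusion_graph_conv[OF v(1) U0t ae deriv_L2D(3)[OF v(3)] v(2) that])
      then show "\<exists>v. deriv_L2 U0 v t \<and> (\<forall>\<psi> x. test_function \<psi> \<longrightarrow> conv v \<psi> x = conv (U0 t) (heat \<psi>) x)" using v(3) by blast
    qed
    have "\<exists>U. jump_path \<epsilon> U \<and> (\<forall>t\<ge>0. AE x in lborel. u \<epsilon> t x = U t x) \<and> (AE x in lborel. \<phi> x = U 0 x)" if \<epsilon>: "\<epsilon> > 0" for \<epsilon>
    proof -
      have "solves_cauchy_problem (\<lambda>f g. g = nonlocal_operator a \<mu> \<epsilon> f) \<phi> (u \<epsilon>)" using u \<epsilon> by blast
      then obtain U where U: "cont_L2 U" "\<And>t. t \<ge> 0 \<Longrightarrow> AE x in lborel. u \<epsilon> t x = U t x" "AE x in lborel. \<phi> x = U 0 x"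
        "\<And>t. t > 0 \<Longrightarrow> \<exists>v v'. v = nonlocal_operator a \<mu> \<epsilon> (u \<epsilon> t) \<and> v \<in> L2_space \<and> (AE x in lborel. v x = v' x) \<and> deriv_L2 U v' t"
        by (rule path_representative) blast
      have "jump_path \<epsilon> U"
        unfolding jump_path_def
      proof (intro conjI allI impI U(1))
        fix t :: real assume t: "t > 0"
        obtain v' where v: "AE x in lborel. nonlocal_operator a \<mu> \<epsilon> (u \<epsilon> t) x = v' x" "deriv_L2 U v' t" using U(4)[OF t] by blast
        have m: "U t \<in> borel_measurable borel" by (rule bL2_measurable[OF cont_L2D(1)[OF U(1)]]) (use t in simp)
        have "AE x in lborel. nonlocal_operator a \<mu> \<epsilon> (u \<epsilon> t) x = nonlocal_operator a' \<mu>' \<epsilon> (U t) x"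
          by (rule nonlocal_operator_AE[OF a' \<mu>' U(2) \<epsilon> a_borel \<mu>_borel m]) (use t in simp)
        then have "AE x in lborel. v' x = Lop \<epsilon> (U t) x"
          using v(1) by eventually_elim (simp add: nonlocal_operator_eq[OF \<epsilon> m])
        then show "\<exists>v. deriv_L2 U v t \<and> (AE x in lborel. v x = Lop \<epsilon> (U t) x)" using v(2) by blast
      qed
      then show ?thesis using U(2,3) by blast
    qed
    \<comment> \<open>The values of the chosen family at nonpositive \<epsilon> are arbitrary; the
      limit from the right never sees them.\<close>
    then have "\<exists>U. \<forall>\<epsilon>>0. jump_path \<epsilon> (U \<epsilon>) \<and> (\<forall>t\<ge>0. AE x in lborel. u \<epsilon> t x = U \<epsilon> t x) \<and> (AE x in lborel. \<phi> x = U \<epsilon> 0 x)"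
      by (rule choice_positive)
    then obtain U where U: "\<And>\<epsilon>. \<epsilon> > 0 \<Longrightarrow> jump_path \<epsilon> (U \<epsilon>)" "\<And>\<epsilon> t. \<epsilon> > 0 \<Longrightarrow> t \<ge> 0 \<Longrightarrow> AE x in lborel. u \<epsilon> t x = U \<epsilon> t x"
      "\<And>\<epsilon>. \<epsilon> > 0 \<Longrightarrow> AE x in lborel. \<phi> x = U \<epsilon> 0 x"
      by auto
    have Uc: "cont_L2 (U \<epsilon>)" if "\<epsilon> > 0" for \<epsilon> using U(1)[OF that] by (simp add: jump_path_def)
    have diff: "cont_L2 (\<lambda>t x. U \<epsilon> t (x + t *\<^sub>R (drift /\<^sub>R \<epsilon>)) - U0 t x)" if "\<epsilon> > 0" for \<epsilon>
      by (intro cont_L2_diff cont_L2_shift Uc that U0(1))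
    have init: "nL2 (\<lambda>x. U \<epsilon> 0 x - U0 0 x) = 0" if \<epsilon>: "\<epsilon> > 0" for \<epsilon>
    proof -
      have "AE x in lborel. (U \<epsilon> 0 x - U0 0 x)\<^sup>2 = 0" using U(3)[OF \<epsilon>] U0(3) by eventually_elim simp
      from integral_eq_zero_AE[OF this] show ?thesis by (simp add: nL2_def)
    qed
    \<comment> \<open>Passing to the moving frame is a translation at each fixed time and preserves
      null sets, so the norms of the given solutions and of their Borel representatives agree at
      every time, not just at almost every one.\<close>
    have norm: "L2_norm (\<lambda>x. u \<epsilon> t (x + (t / \<epsilon>) *\<^sub>R drift) - u0 t x) = nL2 (\<lambda>x. U \<epsilon> t (x + t *\<^sub>R (drift /\<^sub>R \<epsilon>)) - U0 t x)"
      if \<epsilon>: "\<epsilon> > 0" and t: "t \<ge> 0" for \<epsilon> t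
    proof (rule L2_norm_representative[OF bL2_measurable[OF cont_L2D(1)[OF diff[OF \<epsilon>] t]]])
      have "AE x in lborel. u \<epsilon> t ((t / \<epsilon>) *\<^sub>R drift + 1 *\<^sub>R x) = U \<epsilon> t ((t / \<epsilon>) *\<^sub>R drift + 1 *\<^sub>R x)"
        by (rule AE_lborel_affine[OF U(2)[OF \<epsilon> t]]) simp
      then show "AE x in lborel. u \<epsilon> t (x + (t / \<epsilon>) *\<^sub>R drift) - u0 t x = U \<epsilon> t (x + t *\<^sub>R (drift /\<^sub>R \<epsilon>)) - U0 t x"
        using U0(2)[OF t] by eventually_elim (simp add: add.commute divide_inverse)
    qed
    show ?thesis
    proof (rule tendsto_0_Linf_L2_norm[OF _ T])
      fix \<epsilon> :: real assume \<epsilon>: "\<epsilon> > 0"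
      have "continuous_on {0<..<T} (\<lambda>t. nL2 (\<lambda>x. U \<epsilon> t (x + t *\<^sub>R (drift /\<^sub>R \<epsilon>)) - U0 t x))"
        by (rule continuous_on_subset[OF cont_L2_norm[OF diff[OF \<epsilon>]]]) auto
      then show "continuous_on {0<..<T} (\<lambda>t. L2_norm (\<lambda>x. u \<epsilon> t (x + (t / \<epsilon>) *\<^sub>R drift) - u0 t x))"
        by (rule continuous_on_eq) (simp add: norm[OF \<epsilon>])
    next
      fix \<eta> :: real assume \<eta>: "\<eta> > 0"
      show "\<forall>\<^sub>F \<epsilon> in at_right 0. \<forall>t. 0 < t \<longrightarrow> t < T \<longrightarrow> L2_norm (\<lambda>x. u \<epsilon> t (x + (t / \<epsilon>) *\<^sub>R drift) - u0 t x) \<le> \<eta>"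
      proof -
        have "\<forall>\<^sub>F \<epsilon> in at_right 0. \<forall>t. 0 \<le> t \<longrightarrow> t \<le> T \<longrightarrow> nL2 (\<lambda>x. U \<epsilon> t (x + t *\<^sub>R (drift /\<^sub>R \<epsilon>)) - U0 t x) \<le> \<eta>"
          by (rule homogenization_borel[OF heat U(1) init T \<eta>])
        then show ?thesis using eventually_at_right_less[of 0] by eventually_elim (simp add: norm)
      qed
    qed
  qed
  then show ?thesis using positive_definite_Theta by blast
qed

end
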